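(* Let $a$ be a weak composition of length $n$ and $\lambda$ a partition. Then \[\mathfrak{Q}_a\cdot s_\lambda(x_1,\ldots,x_n)=\sum_b C^b_{a,\lambda}\mathfrak{Q}_b,\] where $b$ ranges over weak compositions of length $n$ and $C^b_{a,\lambda}$ is the number of elements of $\mathrm{HLRS}(a,b)$ with content $\lambda^\ast$.
   Context: Weak compositions of length $n$: sequences of $n$ nonnegative integers; $\mathrm{flat}(a)$ deletes zero parts; $b\ge a$ means $b_1+\cdots+b_i\ge a_1+\cdots+a_i$ for all $i$. $D(a)$: $a_i$ left-justified boxes in row $i$, row 1 lowest. Quasi-key tableau of shape $a$: filling of $D(a)$ with positive integers such that (1) entries weakly decrease along rows and no entry of row $i$ exceeds $i$; (2) column entries are distinct and increase going up the first column; (3) if $i$ is above $k$ in a column with $i<k$, there is an entry $j>i$ immediately right of $k$; (4) for two rows with the higher strictly longer, an entry $i$ in column $c$ of the lower row and $j$ in column $c+1$ of the higher row satisfy $i<j$. $\mathfrak{Q}_a=\sum_T\prod_i x_i^{\#\{\text{entries } i \text{ in } T\}}$ over quasi-key tableaux $T$ of shape $a$. Triples of $D(b)$ (rows $r<s$): Type A: boxes $\gamma=(r,c),\alpha=(r,c+1),\beta=(s,c+1)$ with $b_r\ge b_s$; Type B: $\gamma=(s,c),\alpha=(s,c+1),\beta=(r,c)$ with $b_s>b_r$; here a basement column $0$ is adjoined to every row and triples may involve it. Inversion triple: $\beta>\gamma\ge\alpha$ or $\gamma\ge\alpha>\beta$. LRS: for weak compositions $c,b$ of length $n$ with $c_i\le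 b_i$ for all $i$, a Littlewood–Richardson skew skyline tableau of shape $b/c$ is a filling of $D(b)$ together with its basement in which the basement and the boxes of $D(c)\subseteq D(b)$ contain the symbol $\ast$ and the other boxes contain positive integers, such that rows weakly decrease left to right, no column repeats an integer entry, all triples are inversion triples (with conventions: $\ast=\infty$, $\ast$'s in the same row are equal, $\ast$'s in the same column increase from top to bottom), and the column word is contre-lattice. The column word reads integer entries bottom to top in each column, columns from right to left. A word with largest letter $k$ is contre-lattice if every prefix has at least as many $k$'s as $(k-1)$'s, at least as many $(k-1)$'s as $(k-2)$'s, etc. The content is the multiset of integer entries. For $\lambda=(\lambda_1\ge\cdots\ge\lambda_\ell>0)$, $\lambda^\ast$ is the multiset $1^{\lambda_\ell}2^{\lambda_{\ell-1}}\cdots\ell^{\lambda_1}$. $\mathrm{LRS}(a,b)$ is the set of LRS of shape $b/c$ over all weak compositions $c$ of length $n$ with $c\ge a$ and $\mathrm{flat}(c)=\mathrm{flat}(a)$. For an LRS $L$ with row $i$ nonempty and row $i+1$ empty ($i+1\le n$), $\mathrm{swap}_{i,i+1}(L)$ moves all boxes and entries of row $i$ (not the basement) up to row $i+1$. $L\in\mathrm{LRS}(a,b)$ is highest-weight if for every such $i$, $\mathrm{swap}_{i,i+1}(L)$ is not in $\bigcup_d\mathrm{LRS}(a,d)$ ($d$ ranging over weak compositions of length $n$). $\mathrm{HLRS}(a,b)$ is the set of highest-weight elements of $\mathrm{LRS}(a,b)$. *)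

theory Defs
  imports Main "HOL-Library.Poly_Mapping" "HOL-Library.Multiset"
begin

(* Conventions: a weak composition of length n is a nat list a of length n;
   rows are numbered 1..n (row 1 lowest) and a_i = a!(i-1);
   columns are numbered 1,2,...; column 0 is the basement (LRS only).
   A cell is a pair (row, column).
   Polynomials in x_1..x_n are elements of (nat \<Rightarrow>\<^sub>0 nat) \<Rightarrow>\<^sub>0 int
   (exponent vector \<mapsto> coefficient), variable x_i having index i. *)

type_synonym poly = "(nat \<Rightarrow>\<^sub>0 nat) \<Rightarrow>\<^sub>0 int"
type_synonym filling = "nat \<times> nat \<Rightarrow> nat"

definition cells :: "nat list \<Rightarrow> (nat \<times> nat) set" where
  "cells a = {(i, j). 1 \<le> i \<and> i \<le> length a \<and> 1 \<le> j \<and> j \<le> a ! (i - 1)}"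

definition is_partition :: "nat list \<Rightarrow> bool" where
  "is_partition lam \<longleftrightarrow> sorted_wrt (\<ge>) lam \<and> (\<forall>x\<in>set lam. 0 < x)"

definition flat :: "nat list \<Rightarrow> nat list" where
  "flat a = filter (\<lambda>x. x \<noteq> 0) a"

definition dominates :: "nat list \<Rightarrow> nat list \<Rightarrow> bool" where
  "dominates b a \<longleftrightarrow> (\<forall>i. sum_list (take i a) \<le> sum_list (take i b))"

definition wt :: "(nat \<times> nat) set \<Rightarrow> filling \<Rightarrow> (nat \<Rightarrow>\<^sub>0 nat)" where
  "wt S T = (\<Sum>p\<in>S. Poly_Mapping.single (T p) 1)"

definition qkt :: "nat list \<Rightarrow> filling set" where
  "qkt a = {T.
     (\<forall>p. p \<notin> cells a \<longrightarrow> T p = 0) \<and> (\<forall>p\<in>cells a. 1 \<le> T p) \<and>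
     (\<forall>i j. (i, j) \<in> cells a \<and> (i, j + 1) \<in> cells a \<longrightarrow> T (i, j + 1) \<le> T (i, j)) \<and>
     (\<forall>i j. (i, j) \<in> cells a \<longrightarrow> T (i, j) \<le> i) \<and>
     (\<forall>i k j. (i, j) \<in> cells a \<and> (k, j) \<in> cells a \<and> i \<noteq> k \<longrightarrow> T (i, j) \<noteq> T (k, j)) \<and>
     (\<forall>i k. (i, 1) \<in> cells a \<and> (k, 1) \<in> cells a \<and> i < k \<longrightarrow> T (i, 1) < T (k, 1)) \<and>
     (\<forall>r s j. r < s \<and> (r, j) \<in> cells a \<and> (s, j) \<in> cells a \<and> T (s, j) < T (r, j) \<longrightarrow>
         (r, j + 1) \<in> cells a \<and> T (s, j) < T (r, j + 1)) \<and>
     (\<forall>r s j. r < s \<and> a ! (r - 1) < a ! (s - 1) \<and> (r, j) \<in> cells a \<and> (s, j + 1) \<in> cells a \<longrightarrow>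
         T (r, j) < T (s, j + 1))}"

definition qpoly :: "nat list \<Rightarrow> poly" where
  "qpoly a = (\<Sum>T\<in>qkt a. Poly_Mapping.single (wt (cells a) T) 1)"

(* semistandard Young tableaux of shape lam (English convention) with entries in 1..n *)
definition ssyt :: "nat \<Rightarrow> nat list \<Rightarrow> filling set" where
  "ssyt n lam = {T.
     (\<forall>p. p \<notin> cells lam \<longrightarrow> T p = 0) \<and> (\<forall>p\<in>cells lam. 1 \<le> T p \<and> T p \<le> n) \<and>
     (\<forall>i j. (i, j) \<in> cells lam \<and> (i, j + 1) \<in> cells lam \<longrightarrow> T (i, j) \<le> T (i, j + 1)) \<and>
     (\<forall>i j. (i, j) \<in> cells lam \<and> (i + 1, j) \<in> cells lam \<longrightarrow> T (i, j) < T (i + 1, j))}"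

definition schur :: "nat \<Rightarrow> nat list \<Rightarrow> poly" where
  "schur n lam = (\<Sum>T\<in>ssyt n lam. Poly_Mapping.single (wt (cells lam) T) 1)"

definition present :: "nat list \<Rightarrow> nat \<times> nat \<Rightarrow> bool" where
  "present b p \<longleftrightarrow> 1 \<le> fst p \<and> fst p \<le> length b \<and> (snd p = 0 \<or> snd p \<le> b ! (fst p - 1))"

(* cell carrying the symbol * (basement or D(c)) -- meaningful for present cells *)
definition isstar :: "nat list \<Rightarrow> nat \<times> nat \<Rightarrow> bool" where
  "isstar c p \<longleftrightarrow> snd p = 0 \<or> snd p \<le> c ! (fst p - 1)"

definition numcell :: "nat list \<Rightarrow> nat list \<Rightarrow> nat \<times> nat \<Rightarrow> bool" where
  "numcell b c p \<longleftrightarrow> present b p \<and> \<not> isstar c p"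

(* comparison of cell entries: * = infinity; *'s compared by row: equal in the same
   row, larger in lower rows (so they increase from top to bottom in a column) *)
definition lt_cell :: "nat list \<Rightarrow> filling \<Rightarrow> nat \<times> nat \<Rightarrow> nat \<times> nat \<Rightarrow> bool" where
  "lt_cell c L p q = (if isstar c p then isstar c q \<and> fst q < fst p
                      else isstar c q \<or> L p < L q)"

definition le_cell :: "nat list \<Rightarrow> filling \<Rightarrow> nat \<times> nat \<Rightarrow> nat \<times> nat \<Rightarrow> bool" where
  "le_cell c L p q = (if isstar c p then isstar c q \<and> fst q \<le> fst p
                      else isstar c q \<or> L p \<le> L q)"

definition inv_triple :: "nat list \<Rightarrow> filling \<Rightarrow> nat \<times> nat \<Rightarrow> nat \<times> nat \<Rightarrow> nat \<times> nat \<Rightarrow> bool" where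
  "inv_triple c L g al be \<longleftrightarrow>
     (lt_cell c L g be \<and> le_cell c L al g) \<or> (le_cell c L al g \<and> lt_cell c L be al)"

definition colword :: "nat list \<Rightarrow> nat list \<Rightarrow> filling \<Rightarrow> nat list" where
  "colword b c L = concat (map (\<lambda>j. map (\<lambda>i. L (i, j))
        (filter (\<lambda>i. numcell b c (i, j)) [1..<length b + 1])) (rev [1..<sum_list b + 1]))"

definition contre_lattice :: "nat list \<Rightarrow> bool" where
  "contre_lattice w \<longleftrightarrow>
     (let k = (if w = [] then 0 else Max (set w)) in
      \<forall>m \<le> length w. \<forall>j. 1 \<le> j \<and> j + 1 \<le> k \<longrightarrow>
         count_list (take m w) j \<le> count_list (take m w) (j + 1))"

definition is_lrs :: "nat list \<Rightarrow> nat list \<Rightarrow> filling \<Rightarrow> bool" where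
  "is_lrs b c L \<longleftrightarrow>
     length c = length b \<and> (\<forall>i < length b. c ! i \<le> b ! i) \<and>
     (\<forall>p. \<not> numcell b c p \<longrightarrow> L p = 0) \<and> (\<forall>p. numcell b c p \<longrightarrow> 1 \<le> L p) \<and>
     (\<forall>i j. present b (i, j + 1) \<longrightarrow> le_cell c L (i, j + 1) (i, j)) \<and>
     (\<forall>i k j. numcell b c (i, j) \<and> numcell b c (k, j) \<and> i \<noteq> k \<longrightarrow> L (i, j) \<noteq> L (k, j)) \<and>
     (\<forall>r s j. r < s \<and> b ! (s - 1) \<le> b ! (r - 1) \<and>
        present b (r, j) \<and> present b (r, j + 1) \<and> present b (s, j + 1) \<longrightarrow>
        inv_triple c L (r, j) (r, j + 1) (s, j + 1)) \<and>
     (\<forall>r s j. r < s \<and> b ! (r - 1) < b ! (s - 1) \<and>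
        present b (s, j) \<and> present b (s, j + 1) \<and> present b (r, j) \<longrightarrow>
        inv_triple c L (s, j) (s, j + 1) (r, j)) \<and>
     contre_lattice (colword b c L)"

(* an LRS is represented as (outer shape b, inner shape c, filling) *)
type_synonym lrs = "nat list \<times> nat list \<times> filling"

definition LRS :: "nat list \<Rightarrow> nat list \<Rightarrow> lrs set" where
  "LRS a b = {(b', c, L). b' = b \<and> length c = length a \<and> dominates c a \<and>
                 flat c = flat a \<and> is_lrs b c L}"

definition content :: "lrs \<Rightarrow> nat multiset" where
  "content x = (case x of (b, c, L) \<Rightarrow> image_mset L (mset_set {p. numcell b c p}))"

definition lamstar :: "nat list \<Rightarrow> nat multiset" where
  "lamstar lam = (\<Sum>j\<in>{1..length lam}. replicate_mset (lam ! (length lam - j)) j)"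

definition swap_rows :: "nat \<Rightarrow> lrs \<Rightarrow> lrs" where
  "swap_rows i x = (case x of (b, c, L) \<Rightarrow>
     (b[i - 1 := b ! i, i := b ! (i - 1)], c[i - 1 := c ! i, i := c ! (i - 1)],
      (\<lambda>(k, j). if k = i + 1 then L (i, j) else if k = i then 0 else L (k, j))))"

definition HLRS :: "nat list \<Rightarrow> nat list \<Rightarrow> lrs set" where
  "HLRS a b = {x \<in> LRS a b. \<forall>i. 1 \<le> i \<and> i + 1 \<le> length a \<and>
                  0 < fst x ! (i - 1) \<and> fst x ! i = 0 \<longrightarrow>
                  swap_rows i x \<notin> (\<Union>d. LRS a d)}"

definition lrcoeff :: "nat list \<Rightarrow> nat list \<Rightarrow> nat list \<Rightarrow> nat" where
  "lrcoeff a lam b = card {x \<in> HLRS a b. content x = lamstar lam}"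

end

theory Submission
  imports Defs "HOL-Computational_Algebra.Formal_Power_Series" "HOL-Combinatorics.Permutations"
begin

text \<open>
  Relocating every row of a quasi-key tableau to the row given by its first entry writes the quasi-key
  polynomial of \<open>a\<close> as the sum of the Demazure atoms of all \<open>c \<ge> a\<close> with \<open>flat c = flat a\<close>. That quasi-key tableaux
  with fixed first column and semi-skyline augmented fillings have the same generating function follows by
  comparing both with their column sets.

  An atom times a complete homogeneous polynomial is a sum of atoms over horizontal strips; this Pieri rule is
  proved one variable at a time from a growth rule for pairs of strips, itself a transfer-matrix computation
  on columns. Since atoms are linearly independent and complete homogeneous polynomials commute, two-step chains of
  strips are symmetric in their sizes, and the sign-reversing involution of Stembridge turns the Jacobi-Trudi
  expansion of the Schur polynomial into a count of lattice chains of strips. Reading off the levels of a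
  Littlewood-Richardson skew skyline tableau identifies it with such a chain.

  Both notions are invariant under moving nonempty rows past empty ones, and every class of tableaux under these moves has
  exactly one highest-weight element; the atoms of the shapes obtained from its shape \<open>b\<close> by moving rows down add up to
  the quasi-key polynomial of \<open>b\<close>. Grouping the atoms by classes gives the theorem.
\<close>

section \<open>Strips and their growth rule\<close>

text \<open>No insertion algorithm or jeu de taquin is used: the bijections one would expect are
  replaced by equalities of counts. Adding one variable multiplies the series of complete
  homogeneous polynomials by a geometric series, so the shapes above a given pair must be counted by
  1/(1-x) times those below it. Working from the last column to the left, this ratio holds literally
  only where the two given shapes differ; where they agree several states are possible, and the
  invariant has to be a family of linear relations between them. The basement column, together with
  a lowest row that is empty in one of the shapes, turns these relations back into the plain ratio.
  Comparing coefficients of independent atoms then stands in for a Bender-Knuth involution. As it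
  yields only equal cardinalities, the sign-reversing argument is carried out fibre by fibre:
  everything beyond the column of the violation is held fixed, and only the columns to its left are
  counted again.\<close>

text \<open>\<open>strip c b\<close> says that the cells of \<open>b\<close> outside \<open>c\<close>, all filled with the same letter, form a
 Littlewood-Richardson skew skyline tableau. \<open>ups m d c\<close> says that the cells of \<open>c\<close> outside \<open>d\<close> can be the
 ones with entry \<open>m + 1\<close> in a semi-skyline augmented filling of shape \<open>c\<close> with entries greater than \<open>m\<close>.\<close>

definition strip :: "(nat \<Rightarrow> nat) \<Rightarrow> (nat \<Rightarrow> nat) \<Rightarrow> bool" where
 "strip c b \<longleftrightarrow> (\<forall>r. c r \<le> b r) \<and> (\<forall>r s. r < s \<longrightarrow> b s \<le> c r \<or> b r < c s \<or> b r = c r)"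

definition ups :: "nat \<Rightarrow> (nat \<Rightarrow> nat) \<Rightarrow> (nat \<Rightarrow> nat) \<Rightarrow> bool" where
 "ups m d c \<longleftrightarrow> (\<forall>r. d r \<le> c r) \<and> (\<forall>r\<le>Suc m. d r = 0) \<and>
   (\<forall>r s. m < r \<and> r < s \<longrightarrow> c r < d s \<or> c s \<le> d r \<or> d s = c s)"

section \<open>Paths of column sets and their generating functions\<close>

definition paths :: "(nat \<Rightarrow> 'a set \<Rightarrow> 'a set \<Rightarrow> bool) \<Rightarrow> (nat \<Rightarrow> 'a set) \<Rightarrow> 'a set \<Rightarrow> nat \<Rightarrow> (nat \<Rightarrow> 'a set) set" where
 "paths T R X k = {D. D 0 = X \<and> (\<forall>j. T j (D j) (D (Suc j))) \<and> (\<exists>N. \<forall>j\<ge>N. D j = {}) \<and>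
   card {j. D j \<noteq> R j} = k}"

text \<open>\<open>R\<close> in \<open>paths\<close> is a reference sequence of column sets. A strip
  meets each column at most once, so the number of columns where a path departs from
  \<open>R\<close> will be the number of cells of a strip.\<close>

definition pathgf :: "(nat \<Rightarrow> 'a set \<Rightarrow> 'a set \<Rightarrow> bool) \<Rightarrow> (nat \<Rightarrow> 'a set) \<Rightarrow> 'a set \<Rightarrow> int fps" where
 "pathgf T R X = Abs_fps (\<lambda>k. int (card (paths T R X k)))"

lemma finite_eventually_neq:
 fixes D R :: "nat \<Rightarrow> 'a set"
 assumes "\<exists>N. \<forall>j\<ge>N. D j = {}" "\<exists>N. \<forall>j\<ge>N. R j = {}"
 shows "finite {j. D j \<noteq> R j}"
proof -
 obtain M N where "\<forall>j\<ge>M. D j = {}" "\<forall>j\<ge>N. R j = {}" using assms by blast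
 then have "{j. D j \<noteq> R j} \<subseteq> {..<max M N}"
  by (auto simp: not_less[symmetric])
 then show ?thesis by (rule finite_subset) simp
qed

lemma card_neq_case_nat:
 fixes D R :: "nat \<Rightarrow> 'a set"
 assumes "\<exists>N. \<forall>j\<ge>N. D j = {}" "\<exists>N. \<forall>j\<ge>N. R j = {}"
 shows "card {j. D j \<noteq> R j} = (if D 0 = R 0 then 0 else 1) + card {j. (D \<circ> Suc) j \<noteq> (R \<circ> Suc) j}"
proof -
 have eq: "{j. D j \<noteq> R j} = {j. j = 0 \<and> D 0 \<noteq> R 0} \<union> Suc ` {j. (D \<circ> Suc) j \<noteq> (R \<circ> Suc) j}"
  (is "?A = ?B \<union> Suc ` ?C")
 proof (rule set_eqI)
  fix j show "j \<in> ?A \<longleftrightarrow> j \<in> ?B \<union> Suc ` ?C" by (cases j) auto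
 qed
 have "finite ?A" by (rule finite_eventually_neq[OF assms])
 then have "finite (Suc ` ?C)" by (rule finite_subset[rotated]) (use eq in blast)
 then have fin: "finite ?C" by (simp add: finite_image_iff)
 have "card ?A = card ?B + card (Suc ` ?C)"
  unfolding eq by (rule card_Un_disjoint) (use fin in auto)
 moreover have "card ?B = (if D 0 = R 0 then 0 else 1)" by auto
 moreover have "card (Suc ` ?C) = card ?C" by (rule card_image) simp
 ultimately show ?thesis by simp
qed

text \<open>Peeling off column 0 leaves a path of the shifted system started at the next column set;
  the weight drops by one exactly when the first set departs from the reference.\<close>

lemma paths_rec:
 assumes R: "\<exists>N. \<forall>j\<ge>N. R j = {}"
 shows "paths T R X k = (\<Union>Y\<in>{Y. T 0 X Y}. case_nat X `
   {D. D \<in> paths (T \<circ> Suc) (R \<circ> Suc) Y (k - (if X = R 0 then 0 else 1)) \<and> (if X = R 0 then 0 else 1) \<le> k})"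
  (is "?A = ?B")
proof
 show "?A \<subseteq> ?B"
 proof
  fix D assume D: "D \<in> ?A"
  then have ev: "\<exists>N. \<forall>j\<ge>N. D j = {}" and [simp]: "D 0 = X" by (auto simp: paths_def)
  have c: "card {j. D j \<noteq> R j} = (if D 0 = R 0 then 0 else 1) + card {j. (D \<circ> Suc) j \<noteq> (R \<circ> Suc) j}"
   by (rule card_neq_case_nat[OF ev R])
  have ev': "\<exists>N. \<forall>j\<ge>N. (D \<circ> Suc) j = {}" using ev by (metis comp_apply le_SucI)
  have "D \<circ> Suc \<in> paths (T \<circ> Suc) (R \<circ> Suc) (D 1) (k - (if X = R 0 then 0 else 1))"
   using D c ev' by (cases "X = R 0") (simp_all add: paths_def, linarith)
  moreover have "(if X = R 0 then 0 else 1) \<le> k" using D c by (cases "X = R 0") (simp_all add: paths_def)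
  moreover have "T 0 X (D 1)" using D by (simp add: paths_def) (metis One_nat_def \<open>D 0 = X\<close>)
  moreover have "D = case_nat X (D \<circ> Suc)" by (rule ext) (auto split: nat.split)
  ultimately show "D \<in> ?B" by blast
 qed
 show "?B \<subseteq> ?A"
 proof
  fix D assume "D \<in> ?B"
  then obtain Y D' where Y: "T 0 X Y" and D: "D = case_nat X D'"
   and D': "D' \<in> paths (T \<circ> Suc) (R \<circ> Suc) Y (k - (if X = R 0 then 0 else 1))"
   and k: "(if X = R 0 then 0 else 1) \<le> k" by blast
  have ev: "\<exists>N. \<forall>j\<ge>N. D j = {}"
  proof -
   obtain N where "\<forall>j\<ge>N. D' j = {}" using D' by (auto simp: paths_def)
   then have "\<forall>j\<ge>Suc N. D j = {}" unfolding D by (auto split: nat.split)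
   then show ?thesis by blast
  qed
  have "card {j. D j \<noteq> R j} = (if D 0 = R 0 then 0 else 1) + card {j. (D \<circ> Suc) j \<noteq> (R \<circ> Suc) j}"
   by (rule card_neq_case_nat[OF ev R])
  moreover have "D \<circ> Suc = D'" unfolding D by auto
  ultimately have "card {j. D j \<noteq> R j} = k" using D' k by (cases "X = R 0") (simp_all add: paths_def D)
  moreover have "T j (D j) (D (Suc j))" for j
   using D' Y unfolding D paths_def by (cases j) auto
  ultimately show "D \<in> ?A" using ev by (auto simp: paths_def D)
 qed
qed

lemma finite_paths_case:
 assumes "finite U" and "\<And>D. D \<in> paths T R X k \<Longrightarrow> (\<forall>j. D j \<subseteq> U) \<and> (\<forall>j\<ge>M. D j = {})"
 shows "finite (paths T R X k)"
proof -
 have "paths T R X k \<subseteq> {f. \<forall>j. (j \<in> {..<M} \<longrightarrow> f j \<in> Pow U) \<and> (j \<notin> {..<M} \<longrightarrow> f j = {})}"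
  using assms(2) by (simp add: not_less subset_iff)
 moreover have "finite {f. \<forall>j. (j \<in> {..<M} \<longrightarrow> f j \<in> Pow U) \<and> (j \<notin> {..<M} \<longrightarrow> f j = {})}"
  by (rule finite_set_of_finite_funs) (use assms(1) in auto)
 ultimately show ?thesis by (rule finite_subset)
qed

text \<open>The set \<open>U\<close> makes the sum over the next state finite: by
  \<open>sub\<close>, every state from which a path can be continued lies in it.\<close>

lemma pathgf_rec:
 assumes R: "\<exists>N. \<forall>j\<ge>N. R j = {}" and U: "finite U"
  and fin: "\<And>Y k. finite (paths (T \<circ> Suc) (R \<circ> Suc) Y k)"
  and sub: "\<And>Y k. T 0 X Y \<Longrightarrow> paths (T \<circ> Suc) (R \<circ> Suc) Y k \<noteq> {} \<Longrightarrow> Y \<subseteq> U"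
 shows "pathgf T R X = (if X = R 0 then 1 else fps_X) *
   (\<Sum>Y\<in>Pow U. if T 0 X Y then pathgf (T \<circ> Suc) (R \<circ> Suc) Y else 0)"
proof (rule fps_ext)
 fix k
 let ?w = "if X = R 0 then 0 else 1 :: nat"
 let ?P = "\<lambda>Y k. paths (T \<circ> Suc) (R \<circ> Suc) Y k"
 let ?Q = "\<lambda>Y. case_nat X ` {D. D \<in> ?P Y (k - ?w) \<and> ?w \<le> k}"
 have inj: "inj (case_nat X :: _ \<Rightarrow> nat \<Rightarrow> 'a set)"
 proof (rule injI)
  fix f g :: "nat \<Rightarrow> 'a set" assume "case_nat X f = case_nat X g"
  then have "case_nat X f (Suc j) = case_nat X g (Suc j)" for j by simp
  then show "f = g" by auto
 qed
 have "paths T R X k = (\<Union>Y\<in>{Y. T 0 X Y}. ?Q Y)" by (rule paths_rec[OF R])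
 also have "\<dots> = (\<Union>Y\<in>{Y\<in>Pow U. T 0 X Y}. ?Q Y)" using sub by blast
 finally have e: "paths T R X k = (\<Union>Y\<in>{Y\<in>Pow U. T 0 X Y}. ?Q Y)" .
 have "card (paths T R X k) = (\<Sum>Y\<in>{Y\<in>Pow U. T 0 X Y}. card (?Q Y))"
  unfolding e
 proof (rule card_UN_disjoint)
  show "finite {Y \<in> Pow U. T 0 X Y}" using U by simp
  show "\<forall>Y\<in>{Y \<in> Pow U. T 0 X Y}. finite (?Q Y)" using fin by auto
  show "\<forall>i\<in>{Y \<in> Pow U. T 0 X Y}. \<forall>j\<in>{Y \<in> Pow U. T 0 X Y}. i \<noteq> j \<longrightarrow> ?Q i \<inter> ?Q j = {}"
  proof (intro ballI impI)
   fix Y Z :: "'a set" assume "Y \<noteq> Z"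
   then have "{D. D \<in> ?P Y (k - ?w) \<and> ?w \<le> k} \<inter> {D. D \<in> ?P Z (k - ?w) \<and> ?w \<le> k} = {}"
    by (auto simp: paths_def)
   then show "?Q Y \<inter> ?Q Z = {}" by (metis image_Int[OF inj] image_empty)
  qed
 qed
 also have "\<dots> = (\<Sum>Y\<in>{Y\<in>Pow U. T 0 X Y}. if ?w \<le> k then card (?P Y (k - ?w)) else 0)"
 proof (rule sum.cong[OF refl])
  fix Y
  have "card (?Q Y) = card {D. D \<in> ?P Y (k - ?w) \<and> ?w \<le> k}"
   by (rule card_image) (rule inj_on_subset[OF inj], simp)
  then show "card (?Q Y) = (if ?w \<le> k then card (?P Y (k - ?w)) else 0)" by simp
 qed
 finally have c: "int (card (paths T R X k)) =
   (\<Sum>Y\<in>Pow U. if T 0 X Y then if ?w \<le> k then int (card (?P Y (k - ?w))) else 0 else 0)"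
  using U by (simp add: sum.If_cases sum.inter_filter[symmetric] Int_def)
 show "fps_nth (pathgf T R X) k = fps_nth ((if X = R 0 then 1 else fps_X) *
   (\<Sum>Y\<in>Pow U. if T 0 X Y then pathgf (T \<circ> Suc) (R \<circ> Suc) Y else 0)) k"
  using c by (cases "X = R 0"; cases k)
   (simp_all add: pathgf_def fps_sum_nth if_distrib[of "\<lambda>f. fps_nth f _"] cong: if_cong)
qed

text \<open>In terms of the column sets \<open>E\<close>, \<open>C\<close> of two given shapes, a third shape is a path of
 column sets \<open>X\<close>, \<open>Y\<close> in consecutive columns. \<open>siteL\<close> is the local condition on a shape below both,
 \<open>siteR\<close> the one on a shape above both.\<close>

definition siteL :: "nat set \<Rightarrow> nat set \<Rightarrow> nat set \<Rightarrow> nat set \<Rightarrow> nat set \<Rightarrow> bool" where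
 "siteL E C C' X Y \<longleftrightarrow> (X = E \<or> (\<exists>m\<in>E - Y. X = E - {m} \<and> (\<forall>t\<in>E - Y. t \<le> m))) \<and>
   (C' = Y \<or> (\<exists>z\<in>C - Y. C' = insert z Y \<and> (\<forall>t\<in>C - Y. z \<le> t)))"

definition siteR :: "nat set \<Rightarrow> nat set \<Rightarrow> nat set \<Rightarrow> nat set \<Rightarrow> nat set \<Rightarrow> bool" where
 "siteR C E' C' X Y \<longleftrightarrow> (Y = E' \<or> (\<exists>z\<in>X - E'. Y = insert z E' \<and> (\<forall>t\<in>X - E'. z \<le> t))) \<and>
   (X = C \<or> (\<exists>m\<in>X - C'. C = X - {m} \<and> (\<forall>t\<in>X - C'. t \<le> m)))"

text \<open>Departures are measured from \<open>E\<close> because the strip below leads from the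
  path up to \<open>E\<close>. In \<open>rf\<close> they are measured from \<open>C\<close>, where
  the strip leading to the upper path starts.\<close>

definition lf :: "(nat \<Rightarrow> nat set) \<Rightarrow> (nat \<Rightarrow> nat set) \<Rightarrow> nat set \<Rightarrow> int fps" where
 "lf E C = pathgf (\<lambda>j. siteL (E j) (C j) (C (Suc j))) E"

definition rf :: "(nat \<Rightarrow> nat set) \<Rightarrow> (nat \<Rightarrow> nat set) \<Rightarrow> nat set \<Rightarrow> int fps" where
 "rf E C = pathgf (\<lambda>j. siteR (C j) (E (Suc j)) (C (Suc j))) C"

text \<open>The last conjunct is the order that a common lower or upper shape imposes on
  \<open>E\<close> and \<open>C\<close> (\<open>strip_ups_order\<close>,
  \<open>ups_strip_order\<close>). The column \<open>N\<close> after which both are empty is the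
  induction parameter of \<open>transfer\<close>.\<close>

definition cfg :: "nat set \<Rightarrow> nat \<Rightarrow> (nat \<Rightarrow> nat set) \<Rightarrow> (nat \<Rightarrow> nat set) \<Rightarrow> bool" where
 "cfg U N E C \<longleftrightarrow> finite U \<and> (\<forall>j. E (Suc j) \<subseteq> E j \<and> C (Suc j) \<subseteq> C j) \<and> E 0 \<subseteq> U \<and> C 0 \<subseteq> U \<and>
   (\<forall>j\<ge>N. E j = {} \<and> C j = {}) \<and> (\<forall>j. \<forall>m\<in>E j - C j. \<forall>x\<in>C j - E j. x < m)"

lemma cfg_Suc: "cfg U (Suc N) E C \<Longrightarrow> cfg U N (E \<circ> Suc) (C \<circ> Suc)"
 unfolding cfg_def by (simp, blast)

lemma cfg_empty:
 assumes "cfg U N E C" shows "\<exists>N. \<forall>j\<ge>N. E j = {}" "\<exists>N. \<forall>j\<ge>N. C j = {}"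
 by (rule exI[of _ N], use assms in \<open>simp add: cfg_def\<close>)+

lemma cfg_finite: "cfg U N E C \<Longrightarrow> finite U"
 by (simp add: cfg_def)

lemma cfg_subset:
 assumes "cfg U N E C" shows "E j \<subseteq> U" "C j \<subseteq> U"
proof -
 have "E j \<subseteq> U \<and> C j \<subseteq> U"
  using assms unfolding cfg_def by (induction j) (simp, blast)
 then show "E j \<subseteq> U" "C j \<subseteq> U" by auto
qed

lemma finite_paths_L:
 assumes "cfg U N E C"
 shows "finite (paths (\<lambda>j. siteL (E j) (C j) (C (Suc j))) E X k)"
proof (rule finite_paths_case)
 show "finite U" using assms by (simp add: cfg_def)
 fix D assume "D \<in> paths (\<lambda>j. siteL (E j) (C j) (C (Suc j))) E X k"
 then have "D j \<subseteq> E j" for j by (auto simp: paths_def siteL_def)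
 then show "(\<forall>j. D j \<subseteq> U) \<and> (\<forall>j\<ge>N. D j = {})"
  using cfg_subset[OF assms] assms by (fastforce simp: cfg_def)
qed

text \<open>An upper path may run on beyond column \<open>N\<close>, where both shapes are empty.
  From there on its sets decrease and each nonempty one costs a departure, so it ends by column
  \<open>N + k\<close>. An infinite \<open>X\<close> admits no first step at all, since
  \<open>C 0\<close> is finite.\<close>

lemma finite_paths_R:
 assumes "cfg U N E C"
 shows "finite (paths (\<lambda>j. siteR (C j) (E (Suc j)) (C (Suc j))) C X k)"
proof (cases "finite X")
 case True
 show ?thesis
 proof (rule finite_paths_case)
  show "finite (U \<union> X)" using assms True by (simp add: cfg_def)
  fix B assume B: "B \<in> paths (\<lambda>j. siteR (C j) (E (Suc j)) (C (Suc j))) C X k"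
  then have [simp]: "B 0 = X" and st: "\<And>j. siteR (C j) (E (Suc j)) (C (Suc j)) (B j) (B (Suc j))"
   and ev: "\<exists>N. \<forall>j\<ge>N. B j = {}" and k: "card {j. B j \<noteq> C j} = k"
   by (auto simp: paths_def)
  have sub: "B (Suc j) \<subseteq> E (Suc j) \<union> B j" for j using st[of j] by (auto simp: siteR_def)
  have 1: "B j \<subseteq> U \<union> X" for j
  proof (induction j)
   case (Suc j) then show ?case using sub[of j] cfg_subset(1)[OF assms, of "Suc j"] by blast
  qed simp
  have dec: "B (Suc j) \<subseteq> B j" if "N \<le> j" for j
   using sub[of j] assms that by (simp add: cfg_def)
  have anti: "B j \<subseteq> B i" if "N \<le> i" "i \<le> j" for i j
   using that(2,1) by (induction rule: dec_induct) (use dec in \<open>auto dest: order_trans\<close>)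
  have 2: "B j = {}" if j: "N + k \<le> j" for j
  proof (rule ccontr)
   assume "B j \<noteq> {}"
   then have "{N..j} \<subseteq> {j. B j \<noteq> C j}" using anti assms by (fastforce simp: cfg_def)
   moreover have "finite {j. B j \<noteq> C j}"
    by (rule finite_eventually_neq[OF ev cfg_empty(2)[OF assms]])
   ultimately have "card {N..j} \<le> k" using k card_mono by metis
   then show False using j by simp
  qed
  show "(\<forall>j. B j \<subseteq> U \<union> X) \<and> (\<forall>j\<ge>N + k. B j = {})" using 1 2 by blast
 qed
next
 case False
 have "finite (C 0)" using cfg_subset(2)[OF assms] cfg_finite[OF assms] by (rule finite_subset)
 then have "\<not> siteR (C 0) (E (Suc 0)) (C (Suc 0)) X Y" for Y
  using False by (auto simp: siteR_def)
 then have "paths (\<lambda>j. siteR (C j) (E (Suc j)) (C (Suc j))) C X k = {}"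
  by (auto simp: paths_def)
 then show ?thesis by simp
qed

lemma pathgf_nonzeroD: "pathgf T R X \<noteq> 0 \<Longrightarrow> \<exists>k. paths T R X k \<noteq> {}"
 unfolding pathgf_def fps_eq_iff by (auto simp: card_gt_0_iff)

lemma lf_support:
 assumes "lf E C X \<noteq> 0" shows "X = E 0 \<or> (\<exists>m\<in>E 0. X = E 0 - {m})"
proof -
 obtain D where "D 0 = X" "siteL (E 0) (C 0) (C (Suc 0)) (D 0) (D (Suc 0))"
  using pathgf_nonzeroD[OF assms[unfolded lf_def]] by (auto simp: paths_def)
 then show ?thesis by (auto simp: siteL_def)
qed

lemma rf_support:
 assumes "rf E C X \<noteq> 0" shows "X = C 0 \<or> (\<exists>m\<in>X. C 0 = X - {m})"
proof -
 obtain D where "D 0 = X" "siteR (C 0) (E (Suc 0)) (C (Suc 0)) (D 0) (D (Suc 0))"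
  using pathgf_nonzeroD[OF assms[unfolded rf_def]] by (auto simp: paths_def)
 then show ?thesis by (auto simp: siteR_def)
qed

lemma lf_rec:
 assumes c: "cfg U (Suc N) E C"
 shows "lf E C X = (if X = E 0 then 1 else fps_X) *
  (\<Sum>Y\<in>Pow U. if siteL (E 0) (C 0) (C 1) X Y then lf (E \<circ> Suc) (C \<circ> Suc) Y else 0)"
proof -
 let ?T = "\<lambda>j. siteL (E j) (C j) (C (Suc j))"
 have T: "?T \<circ> Suc = (\<lambda>j. siteL ((E \<circ> Suc) j) ((C \<circ> Suc) j) ((C \<circ> Suc) (Suc j)))" by (simp add: comp_def)
 have "pathgf ?T E X = (if X = E 0 then 1 else fps_X) *
   (\<Sum>Y\<in>Pow U. if ?T 0 X Y then pathgf (?T \<circ> Suc) (E \<circ> Suc) Y else 0)"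
 proof (rule pathgf_rec)
  show "\<exists>N. \<forall>j\<ge>N. E j = {}" "finite U" using cfg_empty[OF c] cfg_finite[OF c] by auto
  show "finite (paths (?T \<circ> Suc) (E \<circ> Suc) Y k)" for Y k
   unfolding T by (rule finite_paths_L[OF cfg_Suc[OF c]])
  show "Y \<subseteq> U" if "paths (?T \<circ> Suc) (E \<circ> Suc) Y k \<noteq> {}" for Y k
  proof -
   have "Y \<subseteq> E 1" using that by (auto simp: paths_def siteL_def)
   then show ?thesis using cfg_subset[OF c, of 1] by blast
  qed
 qed
 then show ?thesis unfolding lf_def T by simp
qed

lemma rf_rec:
 assumes c: "cfg U (Suc N) E C" and X: "X \<subseteq> U"
 shows "rf E C X = (if X = C 0 then 1 else fps_X) *
  (\<Sum>Y\<in>Pow U. if siteR (C 0) (E 1) (C 1) X Y then rf (E \<circ> Suc) (C \<circ> Suc) Y else 0)"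
proof -
 let ?T = "\<lambda>j. siteR (C j) (E (Suc j)) (C (Suc j))"
 have T: "?T \<circ> Suc = (\<lambda>j. siteR ((C \<circ> Suc) j) ((E \<circ> Suc) (Suc j)) ((C \<circ> Suc) (Suc j)))" by (simp add: comp_def)
 have "pathgf ?T C X = (if X = C 0 then 1 else fps_X) *
   (\<Sum>Y\<in>Pow U. if ?T 0 X Y then pathgf (?T \<circ> Suc) (C \<circ> Suc) Y else 0)"
 proof (rule pathgf_rec)
  show "\<exists>N. \<forall>j\<ge>N. C j = {}" "finite U" using cfg_empty[OF c] cfg_finite[OF c] by auto
  show "finite (paths (?T \<circ> Suc) (C \<circ> Suc) Y k)" for Y k
   unfolding T by (rule finite_paths_R[OF cfg_Suc[OF c]])
  show "Y \<subseteq> U" if "?T 0 X Y" for Y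
   using that X cfg_subset[OF c, of 1] by (auto simp: siteR_def)
 qed
 then show ?thesis unfolding rf_def T by simp
qed

lemma sum_Pow_remove:
 fixes f :: "nat set \<Rightarrow> int fps"
 assumes "finite U" "G \<subseteq> U" and "\<And>Y. f Y \<noteq> 0 \<Longrightarrow> Y = G \<or> (\<exists>y\<in>G. Y = G - {y})"
 shows "sum f (Pow U) = f G + (\<Sum>y\<in>G. f (G - {y}))"
proof -
 have fin: "finite G" using assms by (auto intro: finite_subset)
 have "sum f (Pow U) = sum f (insert G ((\<lambda>y. G - {y}) ` G))"
  by (rule sum.mono_neutral_right) (use assms in auto)
 also have "\<dots> = f G + sum f ((\<lambda>y. G - {y}) ` G)"
  by (rule sum.insert) (use fin in auto)
 also have "sum f ((\<lambda>y. G - {y}) ` G) = (\<Sum>y\<in>G. f (G - {y}))"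
  by (rule sum.reindex_cong[of "\<lambda>y. G - {y}" G]) (auto simp: inj_on_def)
 finally show ?thesis .
qed

lemma sum_Pow_insert:
 fixes f :: "nat set \<Rightarrow> int fps"
 assumes "finite U" "G \<subseteq> U" and "\<And>Y. Y \<subseteq> U \<Longrightarrow> f Y \<noteq> 0 \<Longrightarrow> Y = G \<or> (\<exists>y. y \<notin> G \<and> Y = insert y G)"
 shows "sum f (Pow U) = f G + (\<Sum>y\<in>U - G. f (insert y G))"
proof -
 have "sum f (Pow U) = sum f (insert G ((\<lambda>y. insert y G) ` (U - G)))"
  by (rule sum.mono_neutral_right) (use assms in auto)
 also have "\<dots> = f G + sum f ((\<lambda>y. insert y G) ` (U - G))"
  by (rule sum.insert) (use assms in auto)
 also have "sum f ((\<lambda>y. insert y G) ` (U - G)) = (\<Sum>y\<in>U - G. f (insert y G))"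
  by (rule sum.reindex_cong[of "\<lambda>y. insert y G" "U - G"]) (auto simp: inj_on_def)
 finally show ?thesis .
qed

lemma sum_Pow_single:
 fixes f :: "nat set \<Rightarrow> int fps"
 assumes "finite U" "Z \<subseteq> U" and "\<And>Y. f Y \<noteq> 0 \<Longrightarrow> Y = Z"
 shows "sum f (Pow U) = f Z"
proof -
 have "sum f (Pow U) = sum f {Z}"
  by (rule sum.mono_neutral_right) (use assms in auto)
 then show ?thesis by simp
qed

section \<open>Admissible steps between two columns, according to where the shapes agree\<close>

lemma siteL_Int_iff:
 assumes "Y = E' \<inter> C'" "C' \<subseteq> C" "E' \<subseteq> E"
 shows "siteL E C C' (E \<inter> C) Y \<longleftrightarrow> (\<forall>m\<in>E - C. \<forall>t\<in>E - Y. t \<le> m) \<and> (\<forall>z\<in>C' - E'. \<forall>t\<in>C - Y. z \<le> t)"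
proof -
 have "(E \<inter> C = E \<or> (\<exists>m\<in>E - Y. E \<inter> C = E - {m} \<and> (\<forall>t\<in>E - Y. t \<le> m))) \<longleftrightarrow> (\<forall>m\<in>E - C. \<forall>t\<in>E - Y. t \<le> m)"
  (is "?A \<longleftrightarrow> ?B")
 proof
  assume B: ?B
  show ?A
  proof (cases "E \<subseteq> C")
   case False
   then obtain m where m: "m \<in> E - C" by blast
   have "m' = m" if "m' \<in> E - C" for m'
   proof (rule antisym)
    show "m' \<le> m" using B m that assms by blast
    show "m \<le> m'" using B m that assms by blast
   qed
   then have "E \<inter> C = E - {m}" using m by blast
   then show ?thesis using B m assms by blast
  qed blast
 qed blast
 moreover have "(C' = Y \<or> (\<exists>z\<in>C - Y. C' = insert z Y \<and> (\<forall>t\<in>C - Y. z \<le> t))) \<longleftrightarrow> (\<forall>z\<in>C' - E'. \<forall>t\<in>C - Y. z \<le> t)"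
  (is "?A \<longleftrightarrow> ?B")
 proof
  assume B: ?B
  show ?A
  proof (cases "C' \<subseteq> E'")
   case False
   then obtain m where m: "m \<in> C' - E'" by blast
   have "m' = m" if "m' \<in> C' - E'" for m'
   proof (rule antisym)
    show "m' \<le> m" using B m that assms by blast
    show "m \<le> m'" using B m that assms by blast
   qed
   then have "C' = insert m Y" using m assms by blast
   then show ?thesis using B m assms by blast
  qed (use assms in blast)
 qed (use assms in blast)
 ultimately show ?thesis unfolding siteL_def by blast
qed

lemma siteR_Un_iff:
 assumes "X = E \<union> C" "C' \<subseteq> C" "E' \<subseteq> E"
 shows "siteR C E' C' X (E' \<union> C') \<longleftrightarrow> (\<forall>z\<in>C' - E'. \<forall>t\<in>X - E'. z \<le> t) \<and> (\<forall>m\<in>E - C. \<forall>t\<in>X - C'. t \<le> m)"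
proof -
 have "(X = C \<or> (\<exists>m\<in>X - C'. C = X - {m} \<and> (\<forall>t\<in>X - C'. t \<le> m))) \<longleftrightarrow> (\<forall>m\<in>E - C. \<forall>t\<in>X - C'. t \<le> m)"
  (is "?A \<longleftrightarrow> ?B")
 proof
  assume B: ?B
  show ?A
  proof (cases "E \<subseteq> C")
   case False
   then obtain m where m: "m \<in> E - C" by blast
   have "m' = m" if "m' \<in> E - C" for m'
   proof (rule antisym)
    show "m' \<le> m" using B m that assms by blast
    show "m \<le> m'" using B m that assms by blast
   qed
   then have "C = X - {m}" using m assms by blast
   then show ?thesis using B m assms by blast
  qed (use assms in blast)
 qed (use assms in blast)
 moreover have "(E' \<union> C' = E' \<or> (\<exists>z\<in>X - E'. E' \<union> C' = insert z E' \<and> (\<forall>t\<in>X - E'. z \<le> t))) \<longleftrightarrow>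
   (\<forall>z\<in>C' - E'. \<forall>t\<in>X - E'. z \<le> t)"
  (is "?A \<longleftrightarrow> ?B")
 proof
  assume B: ?B
  show ?A
  proof (cases "C' \<subseteq> E'")
   case False
   then obtain m where m: "m \<in> C' - E'" by blast
   have "m' = m" if "m' \<in> C' - E'" for m'
   proof (rule antisym)
    show "m' \<le> m" using B m that assms by blast
    show "m \<le> m'" using B m that assms by blast
   qed
   then have "E' \<union> C' = insert m E'" using m assms by blast
   then show ?thesis using B m assms by blast
  qed blast
 qed blast
 ultimately show ?thesis unfolding siteR_def by blast
qed

text \<open>Both sides say that rows of \<open>E - C\<close> lie above, and rows of
  \<open>C' - E'\<close> below, certain competitors. The two sets of competitors differ only by rows
  belonging to one shape and not to the other, and these are controlled by the order hypotheses or
  by the other half of the condition.\<close>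

lemma site_iff:
 assumes "C' \<subseteq> C" "E' \<subseteq> E" "\<forall>m\<in>E - C. \<forall>x\<in>C - E. x < m" "\<forall>m\<in>E' - C'. \<forall>x\<in>C' - E'. x < m"
 shows "siteL E C C' (E \<inter> C) (E' \<inter> C') \<longleftrightarrow> siteR C E' C' (E \<union> C) (E' \<union> C')"
 unfolding siteL_Int_iff[OF refl assms(1,2)] siteR_Un_iff[OF refl assms(1,2)]
proof (intro iffI conjI ballI; elim conjE)
 fix z t assume 1: "\<forall>m\<in>E - C. \<forall>t\<in>E - E' \<inter> C'. t \<le> m" "\<forall>z\<in>C' - E'. \<forall>t\<in>C - E' \<inter> C'. z \<le> t"
  "z \<in> C' - E'" "t \<in> E \<union> C - E'"
 show "z \<le> t"
 proof (cases "t \<in> C")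
  case False
  then have t: "t \<in> E - C" using 1 by blast
  show ?thesis
  proof (cases "z \<in> E")
   case True then show ?thesis using 1 t by blast
  next
   case False
   then have "z < t" using 1(3) t assms(1,3) by blast
   then show ?thesis by simp
  qed
 qed (use 1 in blast)
next
 fix m t assume 1: "\<forall>m\<in>E - C. \<forall>t\<in>E - E' \<inter> C'. t \<le> m" "\<forall>z\<in>C' - E'. \<forall>t\<in>C - E' \<inter> C'. z \<le> t"
  "m \<in> E - C" "t \<in> E \<union> C - C'"
 show "t \<le> m"
 proof (cases "t \<in> E")
  case True then show ?thesis using 1 by blast
 next
  case False
  then have "t < m" using 1(3,4) assms(3) by blast
  then show ?thesis by simp
 qed
next
 fix m t assume 1: "\<forall>z\<in>C' - E'. \<forall>t\<in>E \<union> C - E'. z \<le> t" "\<forall>m\<in>E - C. \<forall>t\<in>E \<union> C - C'. t \<le> m"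
  "m \<in> E - C" "t \<in> E - E' \<inter> C'"
 show "t \<le> m"
 proof (cases "t \<in> C'")
  case True
  then have t: "t \<in> C' - E'" using 1(4) by blast
  show ?thesis
  proof (cases "m \<in> E'")
   case True
   then have "t < m" using t 1(3) assms(1,4) by blast
   then show ?thesis by simp
  next
   case False then show ?thesis using 1 t by blast
  qed
 qed (use 1 in blast)
next
 fix z t assume 1: "\<forall>z\<in>C' - E'. \<forall>t\<in>E \<union> C - E'. z \<le> t" "\<forall>m\<in>E - C. \<forall>t\<in>E \<union> C - C'. t \<le> m"
  "z \<in> C' - E'" "t \<in> C - E' \<inter> C'"
 show "z \<le> t"
 proof (cases "t \<in> E'")
  case True
  then have "z < t" using 1(3,4) assms(4) by blast
  then show ?thesis by simp
 next
  case False then show ?thesis using 1 by blast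
 qed
qed

text \<open>If the shapes agree in one column and separate in the next, the row dropped by a lower
  path is forced to be \<open>hi\<close>, whereas an upper path may add any row above
  \<open>hi\<close>. This asymmetry is the origin of the sums over \<open>m < u\<close> in
  \<open>transfer\<close>.\<close>

lemma siteL_eq_noneq:
 assumes "C' \<subseteq> G" "E' \<subseteq> G" "m \<in> G" "hi \<in> G - E' \<inter> C'" "\<forall>t\<in>G - E' \<inter> C'. t \<le> hi"
 shows "siteL G G C' (G - {m}) (E' \<inter> C') \<longleftrightarrow> siteL G G C' G (E' \<inter> C') \<and> m = hi"
proof -
 have "(\<exists>m'\<in>G - E' \<inter> C'. G - {m} = G - {m'} \<and> (\<forall>t\<in>G - E' \<inter> C'. t \<le> m')) \<longleftrightarrow> m = hi"
 proof
  assume "\<exists>m'\<in>G - E' \<inter> C'. G - {m} = G - {m'} \<and> (\<forall>t\<in>G - E' \<inter> C'. t \<le> m')"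
  then obtain m' where m': "m' \<in> G - E' \<inter> C'" "G - {m} = G - {m'}" "\<forall>t\<in>G - E' \<inter> C'. t \<le> m'" by blast
  then have "m' = m" using assms(3) by blast
  moreover have "m' \<le> hi" "hi \<le> m'" using m' assms(4,5) by blast+
  ultimately show "m = hi" by simp
 qed (use assms in blast)
 moreover have "G - {m} \<noteq> G" using assms by blast
 ultimately show ?thesis unfolding siteL_def by simp blast
qed

lemma siteR_eq_noneq:
 assumes "C' \<subseteq> G" "E' \<subseteq> G" "u \<notin> G" "hi \<in> G - E' \<inter> C'" "\<forall>t\<in>G - E' \<inter> C'. t \<le> hi"
  "\<forall>m\<in>E' - C'. \<forall>x\<in>C' - E'. x < m"
 shows "siteR G E' C' (insert u G) (E' \<union> C') \<longleftrightarrow> siteR G E' C' G (E' \<union> C') \<and> hi < u"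
proof -
 have a: "siteR G E' C' G (E' \<union> C') \<longleftrightarrow> (\<forall>z\<in>C' - E'. \<forall>t\<in>G - E'. z \<le> t)"
  using siteR_Un_iff[of G G G C' E'] assms by auto
 have b: "siteR G E' C' (insert u G) (E' \<union> C') \<longleftrightarrow> (\<forall>z\<in>C' - E'. \<forall>t\<in>insert u G - E'. z \<le> t) \<and> (\<forall>t\<in>insert u G - C'. t \<le> u)"
 proof -
  have "siteR G E' C' (insert u G) (E' \<union> C') \<longleftrightarrow>
   (\<forall>z\<in>C' - E'. \<forall>t\<in>insert u G - E'. z \<le> t) \<and> (\<forall>m\<in>insert u G - G. \<forall>t\<in>insert u G - C'. t \<le> m)"
   by (rule siteR_Un_iff) (use assms in auto)
  then show ?thesis using assms by blast
 qed
 have "u \<notin> E'" "u \<notin> C'" "hi \<noteq> u" using assms by auto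
 show ?thesis unfolding a b
 proof (intro iffI conjI; elim conjE)
  assume 1: "\<forall>z\<in>C' - E'. \<forall>t\<in>insert u G - E'. z \<le> t" "\<forall>t\<in>insert u G - C'. t \<le> u"
  show "\<forall>z\<in>C' - E'. \<forall>t\<in>G - E'. z \<le> t" using 1 by blast
  have "hi \<le> u"
   using 1 assms \<open>u \<notin> E'\<close> by (cases "hi \<in> C'") (blast, blast)
  then show "hi < u" using \<open>hi \<noteq> u\<close> by simp
 next
  assume 1: "\<forall>z\<in>C' - E'. \<forall>t\<in>G - E'. z \<le> t" "hi < u"
  have lt: "t < u" if "t \<in> G - E' \<inter> C'" for t
  proof -
   have "t \<le> hi" using that assms(5) by blast
   then show ?thesis using 1(2) by simp
  qed
  show "\<forall>z\<in>C' - E'. \<forall>t\<in>insert u G - E'. z \<le> t"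
  proof (intro ballI)
   fix z t assume "z \<in> C' - E'" "t \<in> insert u G - E'"
   then show "z \<le> t" using 1 lt[of z] assms by auto
  qed
  show "\<forall>t\<in>insert u G - C'. t \<le> u" using lt less_imp_le by blast
 qed
qed

text \<open>The mirror situation: if the shapes differ in one column and agree in the next, a lower
  path may drop any row below \<open>lo\<close> there, while an upper path can only add
  \<open>lo\<close> itself.\<close>

lemma siteL_noneq_eq:
 assumes "G' \<subseteq> C" "G' \<subseteq> E" "y \<in> G'" "lo \<in> (E \<union> C) - G'" "\<forall>t\<in>(E \<union> C) - G'. lo \<le> t"
 shows "siteL E C G' (E \<inter> C) (G' - {y}) \<longleftrightarrow> siteL E C G' (E \<inter> C) G' \<and> y < lo"
proof -
 have a: "siteL E C G' (E \<inter> C) G' \<longleftrightarrow> (\<forall>m\<in>E - C. \<forall>t\<in>E - G'. t \<le> m)"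
  using siteL_Int_iff[of G' G' G' C E] assms by auto
 have b: "siteL E C G' (E \<inter> C) (G' - {y}) \<longleftrightarrow>
   (\<forall>m\<in>E - C. \<forall>t\<in>E - (G' - {y}). t \<le> m) \<and> (\<forall>z\<in>G' - (G' - {y}). \<forall>t\<in>C - (G' - {y}). z \<le> t)"
  by (rule siteL_Int_iff) (use assms in auto)
 have "lo \<noteq> y" using assms by auto
 show ?thesis unfolding a b
 proof (intro iffI conjI; elim conjE)
  assume 1: "\<forall>m\<in>E - C. \<forall>t\<in>E - (G' - {y}). t \<le> m" "\<forall>z\<in>G' - (G' - {y}). \<forall>t\<in>C - (G' - {y}). z \<le> t"
  show "\<forall>m\<in>E - C. \<forall>t\<in>E - G'. t \<le> m" using 1 by blast
  have "y \<le> lo" using 1 assms by (cases "lo \<in> C") (blast, blast)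
  then show "y < lo" using \<open>lo \<noteq> y\<close> by simp
 next
  assume 1: "\<forall>m\<in>E - C. \<forall>t\<in>E - G'. t \<le> m" "y < lo"
  have lt: "y \<le> t" if "t \<in> (E \<union> C) - G'" for t
  proof -
   have "lo \<le> t" using that assms(5) by blast
   then show ?thesis using 1(2) by simp
  qed
  show "\<forall>m\<in>E - C. \<forall>t\<in>E - (G' - {y}). t \<le> m" using 1 lt assms(1) by blast
  show "\<forall>z\<in>G' - (G' - {y}). \<forall>t\<in>C - (G' - {y}). z \<le> t" using lt by auto
 qed
qed

lemma siteR_noneq_eq:
 assumes "G' \<subseteq> C" "G' \<subseteq> E" "u \<notin> G'" "lo \<in> (E \<union> C) - G'" "\<forall>t\<in>(E \<union> C) - G'. lo \<le> t"
 shows "siteR C G' G' (E \<union> C) (insert u G') \<longleftrightarrow> siteR C G' G' (E \<union> C) G' \<and> u = lo"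
proof -
 have "(\<exists>z\<in>E \<union> C - G'. insert u G' = insert z G' \<and> (\<forall>t\<in>E \<union> C - G'. z \<le> t)) \<longleftrightarrow> u = lo"
 proof
  assume "\<exists>z\<in>E \<union> C - G'. insert u G' = insert z G' \<and> (\<forall>t\<in>E \<union> C - G'. z \<le> t)"
  then obtain z where z: "z \<in> E \<union> C - G'" "insert u G' = insert z G'" "\<forall>t\<in>E \<union> C - G'. z \<le> t" by blast
  then have "z = u" using assms(3) by blast
  moreover have "z \<le> lo" "lo \<le> z" using z assms(4,5) by blast+
  ultimately show "u = lo" by simp
 qed (use assms in blast)
 moreover have "insert u G' \<noteq> G'" using assms by blast
 ultimately show ?thesis unfolding siteR_def by (simp add: conj_commute)
qed

lemma siteL_eq_same:
 "siteL G G G G G" "y \<in> G \<Longrightarrow> siteL G G G G (G - {y})" "m \<in> G \<Longrightarrow> \<not> siteL G G G (G - {m}) G"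
 "m \<in> G \<Longrightarrow> y \<in> G \<Longrightarrow> siteL G G G (G - {m}) (G - {y}) \<longleftrightarrow> m = y"
proof -
 have d: "G - (G - {y}) = {y}" "insert y (G - {y}) = G" if "y \<in> G" for y using that by blast+
 have e: "G - {m} = G \<longleftrightarrow> False" "G = G - {m} \<longleftrightarrow> False" if "m \<in> G" for m using that by blast+
 have f: "G - {m} = G - {y} \<longleftrightarrow> m = y" if "m \<in> G" "y \<in> G" for m y using that by blast
 show "siteL G G G G G" by (simp add: siteL_def)
 show "siteL G G G G (G - {y})" if "y \<in> G" using that by (auto simp: siteL_def d(1))
 show "\<not> siteL G G G (G - {m}) G" if "m \<in> G" using that by (simp add: siteL_def e)
 show "siteL G G G (G - {m}) (G - {y}) \<longleftrightarrow> m = y" if "m \<in> G" "y \<in> G"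
  using that by (auto simp: siteL_def d(1) e f)
qed

lemma siteR_eq_same:
 "siteR G G G G G" "u \<notin> G \<Longrightarrow> \<not> siteR G G G G (insert u G)" "siteR G G G (insert u G) G"
 "u \<notin> G \<Longrightarrow> v \<notin> G \<Longrightarrow> siteR G G G (insert u G) (insert v G) \<longleftrightarrow> u = v"
proof -
 have d: "insert u G - G = {u}" "insert u G - {u} = G" if "u \<notin> G" for u using that by blast+
 have e: "insert u G = G \<longleftrightarrow> False" "G = insert u G \<longleftrightarrow> False" if "u \<notin> G" for u using that by blast+
 have f: "insert v G = insert u G \<longleftrightarrow> u = v" if "u \<notin> G" "v \<notin> G" for u v using that by blast
 show "siteR G G G G G" by (simp add: siteR_def)
 show "\<not> siteR G G G G (insert u G)" if "u \<notin> G" using that by (simp add: siteR_def e)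
 show "siteR G G G (insert u G) G"
  by (cases "u \<in> G") (simp_all add: siteR_def d insert_absorb)
 show "siteR G G G (insert u G) (insert v G) \<longleftrightarrow> u = v" if "u \<notin> G" "v \<notin> G"
  using that by (auto simp: siteR_def d e f)
qed

lemma siteL_eq_eq:
 assumes "G' \<subseteq> G" "m \<in> G" "y \<in> G'" "hi \<in> G - G'" "\<forall>t\<in>G - G'. t \<le> hi" "lo \<in> G - G'" "\<forall>t\<in>G - G'. lo \<le> t"
 shows "siteL G G G' (G - {m}) (G' - {y}) \<longleftrightarrow> m = hi \<and> y < lo"
proof -
 have d: "G - (G' - {y}) = insert y (G - G')" using assms by blast
 have lo: "lo \<le> hi" "y \<noteq> lo" "y \<noteq> hi" using assms by auto
 show ?thesis
 proof
  assume s: "siteL G G G' (G - {m}) (G' - {y})"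
  then obtain m' where m': "m' \<in> insert y (G - G')" "G - {m} = G - {m'}" "\<forall>t\<in>insert y (G - G'). t \<le> m'"
  proof -
   have "G - {m} \<noteq> G" using assms(2) by blast
   then show thesis using that conjunct1[OF s[unfolded siteL_def d]] by (elim disjE bexE conjE) simp_all
  qed
  obtain z where z: "z \<in> insert y (G - G')" "G' = insert z (G' - {y})" "\<forall>t\<in>insert y (G - G'). z \<le> t"
  proof -
   have "G' \<noteq> G' - {y}" using assms(3) by blast
   then show thesis using that conjunct2[OF s[unfolded siteL_def d]] by (elim disjE bexE conjE) simp_all
  qed
  have "m' \<in> G" using m'(1) assms(1,3) by blast
  then have "m' = m" using m'(2) assms(2) by blast
  have "z = y" using z(2) assms(3) z(1) by blast
  then have "y \<le> lo" using z(3) assms(6) by blast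
  then have y: "y < lo" using lo by simp
  have "hi \<le> m'" using m'(3) assms(4) by blast
  then have "m' \<noteq> y" using y lo by simp
  then have "m' \<in> G - G'" using m'(1) by blast
  then have "m' \<le> hi" using assms(5) by blast
  then have "m' = hi" using \<open>hi \<le> m'\<close> by simp
  then show "m = hi \<and> y < lo" using y \<open>m' = m\<close> by simp
 next
  assume a: "m = hi \<and> y < lo"
  have "\<forall>t\<in>insert y (G - G'). t \<le> hi" using assms(5) a lo by auto
  moreover have "\<forall>t\<in>insert y (G - G'). y \<le> t" using assms(7) a by (auto intro: le_trans less_imp_le)
  moreover have "G' = insert y (G' - {y})" using assms(3) by blast
  ultimately show "siteL G G G' (G - {m}) (G' - {y})"
   unfolding siteL_def d using a assms(4) by auto
 qed
qed

lemma siteR_eq_eq: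
 assumes "G' \<subseteq> G" "u \<notin> G" "v \<notin> G'" "hi \<in> G - G'" "\<forall>t\<in>G - G'. t \<le> hi" "lo \<in> G - G'" "\<forall>t\<in>G - G'. lo \<le> t"
 shows "siteR G G' G' (insert u G) (insert v G') \<longleftrightarrow> hi < u \<and> v = lo"
proof -
 have d: "insert u G - G' = insert u (G - G')" using assms by blast
 have lo: "lo \<le> hi" "u \<noteq> lo" "u \<noteq> hi" using assms by auto
 show ?thesis
 proof
  assume s: "siteR G G' G' (insert u G) (insert v G')"
  then obtain m' where m': "m' \<in> insert u (G - G')" "G = insert u G - {m'}" "\<forall>t\<in>insert u (G - G'). t \<le> m'"
  proof -
   have "insert u G \<noteq> G" using assms(2) by blast
   then show thesis using that conjunct2[OF s[unfolded siteR_def d]] by (elim disjE bexE conjE) simp_all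
  qed
  obtain z where z: "z \<in> insert u (G - G')" "insert v G' = insert z G'" "\<forall>t\<in>insert u (G - G'). z \<le> t"
  proof -
   have "insert v G' \<noteq> G'" using assms(3) by blast
   then show thesis using that conjunct1[OF s[unfolded siteR_def d]] by (elim disjE bexE conjE) simp_all
  qed
  have "m' = u" using m'(2) assms(2) by blast
  then have "hi \<le> u" using m'(3) assms(4) by blast
  then have y: "hi < u" using lo by simp
  have "v \<in> insert z G'" using insertI1[of v G'] unfolding z(2) .
  then have "z = v" using assms(3) by simp
  have "z \<le> lo" using z(3) assms(6) by blast
  then have "z \<noteq> u" using y lo by simp
  then have "lo \<le> z" using z(1) assms(7) by blast
  then show "hi < u \<and> v = lo" using y \<open>z = v\<close> \<open>z \<le> lo\<close> by simp
 next
  assume a: "hi < u \<and> v = lo"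
  have "\<forall>t\<in>insert u (G - G'). t \<le> u" using assms(5) a by (auto intro: le_trans less_imp_le)
  moreover have "\<forall>t\<in>insert u (G - G'). lo \<le> t" using assms(7) a lo by auto
  moreover have "G = insert u G - {u}" using assms(2) by blast
  ultimately show "siteR G G' G' (insert u G) (insert v G')"
   unfolding siteR_def d using a assms(6) by auto
 qed
qed

section \<open>The transfer identity between lower and upper paths\<close>

definition gz :: "int fps" where "gz = Abs_fps (\<lambda>_. 1)"

lemma gz_inverse: "(1 - fps_X) * gz = 1"
proof (rule fps_ext)
 fix n show "fps_nth ((1 - fps_X) * gz) n = fps_nth 1 n"
  by (cases n) (simp_all add: gz_def left_diff_distrib)
qed

lemma finite_has_Max: "finite S \<Longrightarrow> S \<noteq> {} \<Longrightarrow> \<exists>hi\<in>S. \<forall>t\<in>S. t \<le> (hi::nat)"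
 using Max_in Max_ge by blast

lemma finite_has_Min: "finite S \<Longrightarrow> S \<noteq> {} \<Longrightarrow> \<exists>lo\<in>S. \<forall>t\<in>S. (lo::nat) \<le> t"
 using Min_in Min_le by blast

context
 fixes U N E C
 assumes c: "cfg U (Suc N) E C"
begin

lemma fU: "finite U" using c by (rule cfg_finite)

lemma sub01: "E 1 \<subseteq> E 0" "C 1 \<subseteq> C 0" "E 0 \<subseteq> U" "C 0 \<subseteq> U"
 using c unfolding cfg_def by auto

lemma P01: "\<forall>m\<in>E 0 - C 0. \<forall>x\<in>C 0 - E 0. x < m" "\<forall>m\<in>E 1 - C 1. \<forall>x\<in>C 1 - E 1. x < m"
 using c unfolding cfg_def by blast+

text \<open>\<open>Y\<close> is \<open>E 1\<close> or misses one of its rows, and \<open>C 1\<close>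
  is \<open>Y\<close> or has one more row. When the two columns differ only the intersection fits
  both requirements; for upper paths only the union does.\<close>

lemma lf_rec_noneq:
 assumes "E 1 \<noteq> C 1"
 shows "lf E C X = (if X = E 0 then 1 else fps_X) *
   (if siteL (E 0) (C 0) (C 1) X (E 1 \<inter> C 1) then lf (E \<circ> Suc) (C \<circ> Suc) (E 1 \<inter> C 1) else 0)"
proof -
 have "(\<Sum>Y\<in>Pow U. if siteL (E 0) (C 0) (C 1) X Y then lf (E \<circ> Suc) (C \<circ> Suc) Y else 0) =
  (if siteL (E 0) (C 0) (C 1) X (E 1 \<inter> C 1) then lf (E \<circ> Suc) (C \<circ> Suc) (E 1 \<inter> C 1) else 0)"
 proof (rule sum_Pow_single[OF fU])
  show "E 1 \<inter> C 1 \<subseteq> U" using sub01 by blast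
  fix Y assume "(if siteL (E 0) (C 0) (C 1) X Y then lf (E \<circ> Suc) (C \<circ> Suc) Y else 0) \<noteq> 0"
  then have s: "siteL (E 0) (C 0) (C 1) X Y" and "lf (E \<circ> Suc) (C \<circ> Suc) Y \<noteq> 0" by (auto split: if_splits)
  from lf_support[OF this(2)] have Y: "Y = E 1 \<or> (\<exists>m\<in>E 1. Y = E 1 - {m})" by simp
  have C: "C 1 = Y \<or> (\<exists>z\<in>C 0 - Y. C 1 = insert z Y)" using s unfolding siteL_def by blast
  from Y C assms show "Y = E 1 \<inter> C 1" by auto
 qed
 then show ?thesis using lf_rec[OF c] by simp
qed

lemma rf_rec_noneq:
 assumes "E 1 \<noteq> C 1" "X \<subseteq> U"
 shows "rf E C X = (if X = C 0 then 1 else fps_X) *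
   (if siteR (C 0) (E 1) (C 1) X (E 1 \<union> C 1) then rf (E \<circ> Suc) (C \<circ> Suc) (E 1 \<union> C 1) else 0)"
proof -
 have "(\<Sum>Y\<in>Pow U. if siteR (C 0) (E 1) (C 1) X Y then rf (E \<circ> Suc) (C \<circ> Suc) Y else 0) =
  (if siteR (C 0) (E 1) (C 1) X (E 1 \<union> C 1) then rf (E \<circ> Suc) (C \<circ> Suc) (E 1 \<union> C 1) else 0)"
 proof (rule sum_Pow_single[OF fU])
  show "E 1 \<union> C 1 \<subseteq> U" using sub01 by blast
  fix Y assume "(if siteR (C 0) (E 1) (C 1) X Y then rf (E \<circ> Suc) (C \<circ> Suc) Y else 0) \<noteq> 0"
  then have s: "siteR (C 0) (E 1) (C 1) X Y" and "rf (E \<circ> Suc) (C \<circ> Suc) Y \<noteq> 0" by (auto split: if_splits)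
  from rf_support[OF this(2)] have Y: "Y = C 1 \<or> (\<exists>m\<in>Y. C 1 = Y - {m})" by simp
  have C: "Y = E 1 \<or> (\<exists>z\<in>X - E 1. Y = insert z (E 1))" using s unfolding siteR_def by blast
  from Y C assms show "Y = E 1 \<union> C 1" by auto
 qed
 then show ?thesis using rf_rec[OF c assms(2)] by simp
qed

lemma lf_rec_eq:
 assumes "E 1 = C 1" "G = E 1"
 shows "lf E C X = (if X = E 0 then 1 else fps_X) *
   ((if siteL (E 0) (C 0) G X G then lf (E \<circ> Suc) (C \<circ> Suc) G else 0) +
   (\<Sum>y\<in>G. if siteL (E 0) (C 0) G X (G - {y}) then lf (E \<circ> Suc) (C \<circ> Suc) (G - {y}) else 0))"
proof -
 have "(\<Sum>Y\<in>Pow U. if siteL (E 0) (C 0) (C 1) X Y then lf (E \<circ> Suc) (C \<circ> Suc) Y else 0) =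
   (if siteL (E 0) (C 0) (C 1) X G then lf (E \<circ> Suc) (C \<circ> Suc) G else 0) +
   (\<Sum>y\<in>G. if siteL (E 0) (C 0) (C 1) X (G - {y}) then lf (E \<circ> Suc) (C \<circ> Suc) (G - {y}) else 0)"
 proof (rule sum_Pow_remove[OF fU])
  show "G \<subseteq> U" using sub01 assms by blast
  fix Y assume "(if siteL (E 0) (C 0) (C 1) X Y then lf (E \<circ> Suc) (C \<circ> Suc) Y else 0) \<noteq> 0"
  then have "lf (E \<circ> Suc) (C \<circ> Suc) Y \<noteq> 0" by (auto split: if_splits)
  from lf_support[OF this] show "Y = G \<or> (\<exists>y\<in>G. Y = G - {y})" by (simp add: assms(2))
 qed
 then show ?thesis using lf_rec[OF c] assms by simp
qed

lemma rf_rec_eq: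
 assumes "E 1 = C 1" "G = E 1" "X \<subseteq> U"
 shows "rf E C X = (if X = C 0 then 1 else fps_X) *
   ((if siteR (C 0) G G X G then rf (E \<circ> Suc) (C \<circ> Suc) G else 0) +
   (\<Sum>y\<in>U - G. if siteR (C 0) G G X (insert y G) then rf (E \<circ> Suc) (C \<circ> Suc) (insert y G) else 0))"
proof -
 have "(\<Sum>Y\<in>Pow U. if siteR (C 0) G G X Y then rf (E \<circ> Suc) (C \<circ> Suc) Y else 0) =
   (if siteR (C 0) G G X G then rf (E \<circ> Suc) (C \<circ> Suc) G else 0) +
   (\<Sum>y\<in>U - G. if siteR (C 0) G G X (insert y G) then rf (E \<circ> Suc) (C \<circ> Suc) (insert y G) else 0)"
 proof (rule sum_Pow_insert[OF fU])
  show "G \<subseteq> U" using sub01 assms by blast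
  fix Y assume "(if siteR (C 0) G G X Y then rf (E \<circ> Suc) (C \<circ> Suc) Y else 0) \<noteq> 0"
  then have "siteR (C 0) G G X Y" by (auto split: if_splits)
  then show "Y = G \<or> (\<exists>y. y \<notin> G \<and> Y = insert y G)" unfolding siteR_def by blast
 qed
 then show ?thesis using rf_rec[OF c assms(3)] assms by simp
qed

end

lemma sum_if_less:
 fixes f :: "nat \<Rightarrow> 'a::comm_monoid_add"
 assumes "finite G"
 shows "(\<Sum>y\<in>G. if y < lo then f y else 0) = (\<Sum>y\<in>{y\<in>G. y < lo}. f y)"
 using assms by (simp add: sum.inter_filter[symmetric])

text \<open>Each side has a single successor state, and the weights match: the lower path departs
  from \<open>E\<close> exactly when the upper path departs from \<open>C\<close>.\<close>

lemma transfer_noneq_noneq: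
 assumes c: "cfg U (Suc N) E C" and "E 0 \<noteq> C 0" "E 1 \<noteq> C 1"
  and IH: "gz * lf (E \<circ> Suc) (C \<circ> Suc) (E 1 \<inter> C 1) = rf (E \<circ> Suc) (C \<circ> Suc) (E 1 \<union> C 1)"
 shows "gz * lf E C (E 0 \<inter> C 0) = rf E C (E 0 \<union> C 0)"
proof -
 have "E 0 \<inter> C 0 = E 0 \<longleftrightarrow> E 0 \<union> C 0 = C 0" by blast
 moreover have "siteL (E 0) (C 0) (C 1) (E 0 \<inter> C 0) (E 1 \<inter> C 1) \<longleftrightarrow> siteR (C 0) (E 1) (C 1) (E 0 \<union> C 0) (E 1 \<union> C 1)"
  by (rule site_iff) (use sub01[OF c] P01[OF c] in auto)
 moreover have "E 0 \<union> C 0 \<subseteq> U" using sub01[OF c] by blast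
 ultimately show ?thesis
  unfolding lf_rec_noneq[OF c assms(3)] rf_rec_noneq[OF c assms(3) \<open>E 0 \<union> C 0 \<subseteq> U\<close>] IH[symmetric]
  by (simp add: mult.left_commute)
qed

lemma transfer_eq_noneq:
 assumes c: "cfg U (Suc N) E C" and G: "E 0 = G" "C 0 = G" "E 1 \<noteq> C 1"
  and IH: "gz * lf (E \<circ> Suc) (C \<circ> Suc) (E 1 \<inter> C 1) = rf (E \<circ> Suc) (C \<circ> Suc) (E 1 \<union> C 1)"
 shows "rf E C G = (1 - fps_X) * (gz * lf E C G) + (\<Sum>m\<in>G. gz * lf E C (G - {m}))"
  and "u \<in> U - G \<Longrightarrow> rf E C G + rf E C (insert u G) = gz * lf E C G + (\<Sum>m\<in>{m\<in>G. m < u}. gz * lf E C (G - {m}))"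
proof -
 note sb = sub01[OF c, unfolded G]
 have fG: "finite G" using sb fU[OF c] by (meson finite_subset)
 have "G - E 1 \<inter> C 1 \<noteq> {}" using sb G(3) by blast
 with fG obtain hi where hi: "hi \<in> G - E 1 \<inter> C 1" "\<forall>t\<in>G - E 1 \<inter> C 1. t \<le> hi"
  using finite_has_Max[of "G - E 1 \<inter> C 1"] by auto
 define v where "v = rf (E \<circ> Suc) (C \<circ> Suc) (E 1 \<union> C 1)"
 define \<sigma> where "\<sigma> = siteL G G (C 1) G (E 1 \<inter> C 1)"
 have \<sigma>R: "\<sigma> \<longleftrightarrow> siteR G (E 1) (C 1) G (E 1 \<union> C 1)"
  using site_iff[of "C 1" G "E 1" G] sb P01[OF c] by (simp add: \<sigma>_def)
 have l0: "gz * lf E C G = (if \<sigma> then v else 0)"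
  unfolding lf_rec_noneq[OF c G(3)] G v_def IH[symmetric] \<sigma>_def by simp
 have lm: "gz * lf E C (G - {m}) = (if \<sigma> \<and> m = hi then fps_X * v else 0)" if "m \<in> G" for m
 proof -
  have "G - {m} \<noteq> G" using that by blast
  then show ?thesis
   unfolding lf_rec_noneq[OF c G(3)] G v_def IH[symmetric] \<sigma>_def
   using siteL_eq_noneq[OF sb(2,1) that hi] by (simp add: mult.left_commute)
 qed
 have r0: "rf E C G = (if \<sigma> then v else 0)"
  unfolding rf_rec_noneq[OF c G(3) sb(3)] G v_def \<sigma>R by simp
 have ru: "rf E C (insert u G) = (if \<sigma> \<and> hi < u then fps_X * v else 0)" if "u \<in> U - G" for u
 proof -
  have "insert u G \<noteq> G" "insert u G \<subseteq> U" "u \<notin> G" using that sb by blast+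
  then show ?thesis
   unfolding rf_rec_noneq[OF c G(3) \<open>insert u G \<subseteq> U\<close>] G v_def \<sigma>R
   using siteR_eq_noneq[OF sb(2,1) \<open>u \<notin> G\<close> hi P01(2)[OF c]] by simp
 qed
 have "(\<Sum>m\<in>G. gz * lf E C (G - {m})) = (\<Sum>m\<in>G. if m = hi then if \<sigma> then fps_X * v else 0 else 0)"
  by (rule sum.cong) (use lm in auto)
 also have "\<dots> = (if \<sigma> then fps_X * v else 0)" using fG hi by simp
 finally show "rf E C G = (1 - fps_X) * (gz * lf E C G) + (\<Sum>m\<in>G. gz * lf E C (G - {m}))"
  unfolding r0 l0 by (simp add: algebra_simps)
 assume u: "u \<in> U - G"
 have "(\<Sum>m\<in>{m\<in>G. m < u}. gz * lf E C (G - {m})) = (\<Sum>m\<in>{m\<in>G. m < u}. if m = hi then if \<sigma> then fps_X * v else 0 else 0)"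
  by (rule sum.cong) (use lm in auto)
 also have "\<dots> = (if \<sigma> \<and> hi < u then fps_X * v else 0)" using fG hi by auto
 finally show "rf E C G + rf E C (insert u G) = gz * lf E C G + (\<Sum>m\<in>{m\<in>G. m < u}. gz * lf E C (G - {m}))"
  unfolding r0 l0 ru[OF u] by simp
qed

text \<open>Below, every row under \<open>lo\<close> may be dropped in the next column; above, only
  \<open>lo\<close> may be added. The relation of the next column at \<open>u = lo\<close> compares
  exactly these two sums.\<close>

lemma transfer_noneq_eq:
 assumes c: "cfg U (Suc N) E C" and G: "E 0 \<noteq> C 0" "E 1 = G" "C 1 = G"
  and IH: "\<And>u. u \<in> U - G \<Longrightarrow> rf (E \<circ> Suc) (C \<circ> Suc) G + rf (E \<circ> Suc) (C \<circ> Suc) (insert u G) =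
    gz * lf (E \<circ> Suc) (C \<circ> Suc) G + (\<Sum>m\<in>{m\<in>G. m < u}. gz * lf (E \<circ> Suc) (C \<circ> Suc) (G - {m}))"
 shows "gz * lf E C (E 0 \<inter> C 0) = rf E C (E 0 \<union> C 0)"
proof -
 note sb = sub01[OF c, unfolded G]
 have fG: "finite G" "finite (E 0 \<union> C 0)" using sb fU[OF c] by (meson finite_subset le_sup_iff)+
 have "E 0 \<union> C 0 - G \<noteq> {}" using sb G(1) by blast
 with fG obtain lo where lo: "lo \<in> E 0 \<union> C 0 - G" "\<forall>t\<in>E 0 \<union> C 0 - G. lo \<le> t"
  using finite_has_Min[of "E 0 \<union> C 0 - G"] by auto
 have loU: "lo \<in> U - G" using lo sb by blast
 define \<tau> where "\<tau> = siteL (E 0) (C 0) G (E 0 \<inter> C 0) G"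
 have \<tau>R: "\<tau> \<longleftrightarrow> siteR (C 0) G G (E 0 \<union> C 0) G"
  using site_iff[of G "C 0" G "E 0"] sb P01[OF c] by (simp add: \<tau>_def)
 let ?l = "lf (E \<circ> Suc) (C \<circ> Suc)" and ?r = "rf (E \<circ> Suc) (C \<circ> Suc)"
 have "(\<Sum>y\<in>G. if siteL (E 0) (C 0) G (E 0 \<inter> C 0) (G - {y}) then ?l (G - {y}) else 0) =
  (\<Sum>y\<in>G. if y < lo then if \<tau> then ?l (G - {y}) else 0 else 0)"
  by (rule sum.cong) (use siteL_noneq_eq[OF sb(2,1) _ lo] in \<open>auto simp: \<tau>_def\<close>)
 also have "\<dots> = (if \<tau> then (\<Sum>y\<in>{y\<in>G. y < lo}. ?l (G - {y})) else 0)"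
  unfolding sum_if_less[OF fG(1)] by simp
 finally have L: "lf E C (E 0 \<inter> C 0) = (if E 0 \<inter> C 0 = E 0 then 1 else fps_X) *
   (if \<tau> then ?l G + (\<Sum>y\<in>{y\<in>G. y < lo}. ?l (G - {y})) else 0)"
  using lf_rec_eq[OF c _ G(2)[symmetric], of "E 0 \<inter> C 0"] G by (simp add: \<tau>_def)
 have "(\<Sum>y\<in>U - G. if siteR (C 0) G G (E 0 \<union> C 0) (insert y G) then ?r (insert y G) else 0) =
  (\<Sum>y\<in>U - G. if y = lo then if \<tau> then ?r (insert y G) else 0 else 0)"
  by (rule sum.cong) (use siteR_noneq_eq[OF sb(2,1) _ lo] in \<open>auto simp: \<tau>R\<close>)
 also have "\<dots> = (if \<tau> then ?r (insert lo G) else 0)" using loU fU[OF c] by simp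
 finally have R: "rf E C (E 0 \<union> C 0) = (if E 0 \<union> C 0 = C 0 then 1 else fps_X) *
   (if \<tau> then ?r G + ?r (insert lo G) else 0)"
  using rf_rec_eq[OF c _ G(2)[symmetric], of "E 0 \<union> C 0"] G sb by (simp add: \<tau>R)
 have "E 0 \<inter> C 0 = E 0 \<longleftrightarrow> E 0 \<union> C 0 = C 0" by blast
 then show ?thesis unfolding L R IH[OF loU] by (simp add: algebra_simps sum_distrib_left)
qed

text \<open>If the consecutive columns are equal, a departure keeps its row: a lower path can only
  begin one, an upper path can only end one. If they differ, all states with a nonzero series carry
  a multiple of one common series.\<close>

lemma transfer_eq_eq:
 assumes c: "cfg U (Suc N) E C" and G: "E 0 = G" "C 0 = G" "E 1 = G'" "C 1 = G'"
  and IH1: "rf (E \<circ> Suc) (C \<circ> Suc) G' = (1 - fps_X) * (gz * lf (E \<circ> Suc) (C \<circ> Suc) G') +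
    (\<Sum>m\<in>G'. gz * lf (E \<circ> Suc) (C \<circ> Suc) (G' - {m}))"
  and IH2: "\<And>u. u \<in> U - G' \<Longrightarrow> rf (E \<circ> Suc) (C \<circ> Suc) G' + rf (E \<circ> Suc) (C \<circ> Suc) (insert u G') =
    gz * lf (E \<circ> Suc) (C \<circ> Suc) G' + (\<Sum>m\<in>{m\<in>G'. m < u}. gz * lf (E \<circ> Suc) (C \<circ> Suc) (G' - {m}))"
 shows "rf E C G = (1 - fps_X) * (gz * lf E C G) + (\<Sum>m\<in>G. gz * lf E C (G - {m}))" (is ?A)
  and "\<And>u. u \<in> U - G \<Longrightarrow> rf E C G + rf E C (insert u G) = gz * lf E C G + (\<Sum>m\<in>{m\<in>G. m < u}. gz * lf E C (G - {m}))" (is "\<And>u. _ \<Longrightarrow> ?B u")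
proof -
 note sb = sub01[OF c, unfolded G]
 have fG: "finite G" "finite G'" using sb fU[OF c] by (meson finite_subset)+
 let ?l = "lf (E \<circ> Suc) (C \<circ> Suc)" and ?r = "rf (E \<circ> Suc) (C \<circ> Suc)"
 have lr: "lf E C X = (if X = G then 1 else fps_X) * ((if siteL G G G' X G' then ?l G' else 0) +
   (\<Sum>y\<in>G'. if siteL G G G' X (G' - {y}) then ?l (G' - {y}) else 0))" for X
  using lf_rec_eq[OF c _ G(3)[symmetric], of X] G by simp
 have rr: "rf E C X = (if X = G then 1 else fps_X) * ((if siteR G G' G' X G' then ?r G' else 0) +
   (\<Sum>y\<in>U - G'. if siteR G G' G' X (insert y G') then ?r (insert y G') else 0))" if "X \<subseteq> U" for X
  using rf_rec_eq[OF c _ G(3)[symmetric], of X] G that by simp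
 have "?A \<and> (\<forall>u\<in>U - G. ?B u)"
 proof (cases "G = G'")
  case True
  have l0: "lf E C G = ?l G + (\<Sum>y\<in>G. ?l (G - {y}))"
   unfolding lr True[symmetric] by (simp add: siteL_eq_same)
  have lm: "lf E C (G - {m}) = fps_X * ?l (G - {m})" if m: "m \<in> G" for m
  proof -
   have "(\<Sum>y\<in>G. if siteL G G G (G - {m}) (G - {y}) then ?l (G - {y}) else 0) = (\<Sum>y\<in>G. if y = m then ?l (G - {y}) else 0)"
    by (rule sum.cong) (use m siteL_eq_same(4) in auto)
   moreover have "G - {m} \<noteq> G" using m by blast
   ultimately show ?thesis unfolding lr True[symmetric] using m fG siteL_eq_same(3)[OF m] by simp
  qed
  have r0: "rf E C G = ?r G"
  proof -
   have "(\<Sum>y\<in>U - G. if siteR G G G G (insert y G) then ?r (insert y G) else 0) = 0"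
    by (rule sum.neutral) (use siteR_eq_same(2) in auto)
   then show ?thesis unfolding rr[OF sb(3)] True[symmetric] by (simp add: siteR_eq_same)
  qed
  have ru: "rf E C (insert u G) = fps_X * (?r G + ?r (insert u G))" if u: "u \<in> U - G" for u
  proof -
   have "(\<Sum>y\<in>U - G. if siteR G G G (insert u G) (insert y G) then ?r (insert y G) else 0) = (\<Sum>y\<in>U - G. if y = u then ?r (insert y G) else 0)"
    by (rule sum.cong) (use u siteR_eq_same(4) in auto)
   moreover have "insert u G \<noteq> G" "insert u G \<subseteq> U" using u sb by blast+
   ultimately show ?thesis unfolding rr[OF \<open>insert u G \<subseteq> U\<close>] True[symmetric] using u fU[OF c] siteR_eq_same(3) by simp
  qed
  have s: "(\<Sum>m\<in>A. gz * lf E C (G - {m})) = fps_X * (\<Sum>m\<in>A. gz * ?l (G - {m}))" if "A \<subseteq> G" for A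
   unfolding sum_distrib_left by (rule sum.cong) (use lm that in \<open>auto simp: algebra_simps\<close>)
  note I1 = IH1[folded True] and I2 = IH2[folded True]
  have ?A unfolding r0 l0 I1 s[OF subset_refl]
   by (simp add: algebra_simps flip: sum_distrib_left)
  moreover have "?B u" if u: "u \<in> U - G" for u
  proof -
   have "rf E C G + rf E C (insert u G) = ?r G + fps_X * (?r G + ?r (insert u G))" unfolding r0 ru[OF u] ..
   also have "\<dots> = (1 - fps_X) * (gz * ?l G) + (\<Sum>m\<in>G. gz * ?l (G - {m})) +
     fps_X * (gz * ?l G + (\<Sum>m\<in>{m\<in>G. m < u}. gz * ?l (G - {m})))" unfolding I2[OF u] unfolding I1 ..
   also have "\<dots> = gz * lf E C G + fps_X * (\<Sum>m\<in>{m\<in>G. m < u}. gz * ?l (G - {m}))"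
    unfolding l0 by (simp add: algebra_simps sum_distrib_left)
   also have "fps_X * (\<Sum>m\<in>{m\<in>G. m < u}. gz * ?l (G - {m})) = (\<Sum>m\<in>{m\<in>G. m < u}. gz * lf E C (G - {m}))"
    by (rule s[symmetric]) auto
   finally show ?thesis .
  qed
  ultimately show ?thesis by blast
 next
  case False
  then have ne: "G - G' \<noteq> {}" using sb by blast
  obtain hi where hi: "hi \<in> G - G'" "\<forall>t\<in>G - G'. t \<le> hi" using finite_has_Max[OF _ ne] fG by auto
  obtain lo where lo: "lo \<in> G - G'" "\<forall>t\<in>G - G'. lo \<le> t" using finite_has_Min[OF _ ne] fG by auto
  have loU: "lo \<in> U - G'" using lo sb by blast
  have t: "siteL G G G' G G'" "siteR G G' G' G G'" by (auto simp: siteL_def siteR_def)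
  \<comment> \<open>The common series of all states: by the inductive relation at the lowest row of
    \<open>G - G'\<close> it has a description through upper paths as well.\<close>
  define q where "q = gz * ?l G' + (\<Sum>m\<in>{m\<in>G'. m < lo}. gz * ?l (G' - {m}))"
  have q: "?r G' + ?r (insert lo G') = q" unfolding q_def by (rule IH2[OF loU])
  have l0: "gz * lf E C G = q"
  proof -
   have "(\<Sum>y\<in>G'. if siteL G G G' G (G' - {y}) then ?l (G' - {y}) else 0) = (\<Sum>y\<in>G'. if y < lo then ?l (G' - {y}) else 0)"
    by (rule sum.cong) (use siteL_noneq_eq[of G' G G _ lo] sb lo t in auto)
   then show ?thesis unfolding lr q_def sum_if_less[OF fG(2), symmetric]
    using t by (simp add: distrib_left sum_distrib_left if_distrib cong: if_cong)
  qed
  have lm: "gz * lf E C (G - {m}) = (if m = hi then fps_X * q else 0)" if m: "m \<in> G" for m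
  proof -
   have "(\<Sum>y\<in>G'. if siteL G G G' (G - {m}) (G' - {y}) then ?l (G' - {y}) else 0) = (if m = hi then (\<Sum>y\<in>G'. if y < lo then ?l (G' - {y}) else 0) else 0)"
    using siteL_eq_eq[OF sb(1) m _ hi lo] by (auto intro!: sum.cong sum.neutral)
   moreover have "G - {m} \<noteq> G" using m by blast
   moreover have "siteL G G G' (G - {m}) G' \<longleftrightarrow> m = hi" using siteL_eq_noneq[of G' G G' m hi] sb m hi t by simp
   ultimately show ?thesis unfolding lr q_def sum_if_less[OF fG(2), symmetric]
    by (simp add: algebra_simps sum_distrib_left if_distrib cong: if_cong)
  qed
  have r0: "rf E C G = q"
  proof -
   have "(\<Sum>y\<in>U - G'. if siteR G G' G' G (insert y G') then ?r (insert y G') else 0) = (\<Sum>y\<in>U - G'. if y = lo then ?r (insert y G') else 0)"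
    by (rule sum.cong) (use siteR_noneq_eq[of G' G G _ lo] sb lo t in auto)
   then show ?thesis unfolding rr[OF sb(3)] q[symmetric] using t loU fU[OF c] by simp
  qed
  have ru: "rf E C (insert u G) = (if hi < u then fps_X * q else 0)" if u: "u \<in> U - G" for u
  proof -
   have ug: "u \<notin> G" using u by blast
   have "(\<Sum>y\<in>U - G'. if siteR G G' G' (insert u G) (insert y G') then ?r (insert y G') else 0) =
     (if hi < u then (\<Sum>y\<in>U - G'. if y = lo then ?r (insert y G') else 0) else 0)"
    using siteR_eq_eq[OF sb(1) ug _ hi lo] by (auto intro!: sum.cong sum.neutral)
   moreover have "insert u G \<noteq> G" "insert u G \<subseteq> U" using u sb by blast+
   moreover have "siteR G G' G' (insert u G) G' \<longleftrightarrow> hi < u" using siteR_eq_noneq[of G' G G' u hi] sb ug hi t by simp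
   ultimately show ?thesis unfolding rr[OF \<open>insert u G \<subseteq> U\<close>] q[symmetric] using loU fU[OF c] by simp
  qed
  have s: "(\<Sum>m\<in>A. gz * lf E C (G - {m})) = (if hi \<in> A then fps_X * q else 0)" if "A \<subseteq> G" for A
  proof -
   have "(\<Sum>m\<in>A. gz * lf E C (G - {m})) = (\<Sum>m\<in>A. if m = hi then fps_X * q else 0)"
   proof (rule sum.cong[OF refl])
    fix x assume "x \<in> A"
    then show "gz * lf E C (G - {x}) = (if x = hi then fps_X * q else 0)" using lm that by blast
   qed
   then show ?thesis using finite_subset[OF that fG(1)] by simp
  qed
  have ?A unfolding r0 l0 s[OF subset_refl] using hi by (simp add: algebra_simps)
  moreover have "?B u" if u: "u \<in> U - G" for u
   unfolding r0 l0 ru[OF u] using s[of "{m\<in>G. m < u}"] hi by auto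
  ultimately show ?thesis by blast
 qed
 then show ?A "\<And>u. u \<in> U - G \<Longrightarrow> ?B u" by blast+
qed

text \<open>Where the columns differ there is one state on each side and the ratio \<open>gz\<close>
  is literal. Where they agree there is one state per row, so one relation is carried for the
  undisturbed state and one for each row \<open>u\<close> that could be added. This family is closed
  under the four kinds of one-column step.\<close>

lemma transfer:
 assumes "cfg U N E C"
 shows "(E 0 = C 0 \<longrightarrow> rf E C (E 0) = (1 - fps_X) * (gz * lf E C (E 0)) + (\<Sum>m\<in>E 0. gz * lf E C (E 0 - {m})) \<and>
   (\<forall>u\<in>U - E 0. rf E C (E 0) + rf E C (insert u (E 0)) =
    gz * lf E C (E 0) + (\<Sum>m\<in>{m\<in>E 0. m < u}. gz * lf E C (E 0 - {m})))) \<and>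
   (E 0 \<noteq> C 0 \<longrightarrow> gz * lf E C (E 0 \<inter> C 0) = rf E C (E 0 \<union> C 0))"
 using assms
proof (induction N arbitrary: E C)
 case 0
 have e [simp]: "E j = {}" "C j = {}" for j using 0 by (auto simp: cfg_def)
 have [simp]: "E \<circ> Suc = E" "C \<circ> Suc = C" by (auto simp: comp_def)
 have c: "cfg U (Suc 0) E C" using 0 by (simp add: cfg_def)
 have fU: "finite U" by (rule fU[OF c])
 have L: "lf E C {} = 1"
 proof (rule fps_ext)
  fix n
  have "D \<in> paths (\<lambda>j. siteL (E j) (C j) (C (Suc j))) E {} n \<longleftrightarrow> n = 0 \<and> D = (\<lambda>_. {})" for D
  proof
   assume D: "D \<in> paths (\<lambda>j. siteL (E j) (C j) (C (Suc j))) E {} n"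
   then have "siteL {} {} {} (D j) (D (Suc j))" for j by (simp add: paths_def)
   then have "D j = {}" for j by (simp add: siteL_def)
   then show "n = 0 \<and> D = (\<lambda>_. {})" using D by (auto simp: paths_def)
  qed (auto simp: paths_def siteL_def)
  then have "paths (\<lambda>j. siteL (E j) (C j) (C (Suc j))) E {} n = (if n = 0 then {\<lambda>_. {}} else {})"
   by auto
  then show "fps_nth (lf E C {}) n = fps_nth 1 n" by (simp add: lf_def pathgf_def)
 qed
 have R: "rf E C X = (if X = {} then 1 else fps_X) *
   ((if siteR {} {} {} X {} then rf E C {} else 0) +
   (\<Sum>y\<in>U. if siteR {} {} {} X {y} then rf E C {y} else 0))" if "X \<subseteq> U" for X
  using rf_rec_eq[OF c _ refl that] by (simp cong: if_cong)
 have R0: "rf E C {} = 1"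
 proof (rule fps_ext)
  fix n
  have "B \<in> paths (\<lambda>j. siteR (C j) (E (Suc j)) (C (Suc j))) C {} n \<longleftrightarrow> n = 0 \<and> B = (\<lambda>_. {})" for B
  proof
   assume B: "B \<in> paths (\<lambda>j. siteR (C j) (E (Suc j)) (C (Suc j))) C {} n"
   then have st: "siteR {} {} {} (B j) (B (Suc j))" for j by (simp add: paths_def)
   have "B j = {}" for j
   proof (induction j)
    case (Suc j) then show ?case using st[of j] by (simp add: siteR_def)
   qed (use B in \<open>simp add: paths_def\<close>)
   then show "n = 0 \<and> B = (\<lambda>_. {})" using B by (auto simp: paths_def)
  qed (auto simp: paths_def siteR_def)
  then have "paths (\<lambda>j. siteR (C j) (E (Suc j)) (C (Suc j))) C {} n = (if n = 0 then {\<lambda>_. {}} else {})"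
   by auto
  then show "fps_nth (rf E C {}) n = fps_nth 1 n" by (simp add: rf_def pathgf_def)
 qed
 \<comment> \<open>Beyond the last column an upper path may carry one row \<open>u\<close> through
   any number of further columns. This geometric series is the source of the factor
   \<open>gz\<close>.\<close>
 have ru: "rf E C {u} = fps_X * (1 + rf E C {u})" if "u \<in> U" for u
 proof -
  have "(\<Sum>y\<in>U. if siteR {} {} {} {u} {y} then rf E C {y} else 0) = (\<Sum>y\<in>U. if y = u then rf E C {y} else 0)"
   by (rule sum.cong) (auto simp: siteR_def)
  moreover have "siteR {} {} {} {u} {}" by (auto simp: siteR_def)
  ultimately show ?thesis using R[of "{u}"] that R0 fU by simp
 qed
 have "1 + rf E C {u} = gz" if "u \<in> U" for u
 proof -
  define v where "v = rf E C {u}"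
  have v: "(1 - fps_X) * (1 + v) = 1" using ru[OF that, folded v_def] by (simp add: algebra_simps)
  have "1 + v = ((1 - fps_X) * gz) * (1 + v)" by (simp add: gz_inverse)
  also have "\<dots> = gz * ((1 - fps_X) * (1 + v))" by (simp only: mult.assoc mult.commute mult.left_commute)
  also have "\<dots> = gz" by (simp only: v mult_1_right)
  finally show ?thesis unfolding v_def .
 qed
 note one = this
 have e0: "E 0 = {}" "C 0 = {}" by simp_all
 note e [simp del]
 show ?case unfolding e0 using L R0 gz_inverse one by simp
next
 case (Suc N)
 note c = Suc.prems
 have z: "(E \<circ> Suc) 0 = E 1" "(C \<circ> Suc) 0 = C 1" by simp_all
 note IH = Suc.IH[OF cfg_Suc[OF c], unfolded z]
 show ?case
 proof (cases "E 0 = C 0"; cases "E 1 = C 1")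
  assume 0: "E 0 = C 0" and 1: "E 1 = C 1"
  note I = mp[OF conjunct1[OF IH] 1]
  note T = transfer_eq_eq[OF c refl 0[symmetric] refl 1[symmetric] conjunct1[OF I] bspec[OF conjunct2[OF I]]]
  show ?thesis by (intro conjI impI ballI T) (use 0 in simp_all)
 next
  assume 0: "E 0 = C 0" and 1: "E 1 \<noteq> C 1"
  note T = transfer_eq_noneq[OF c refl 0[symmetric] 1 mp[OF conjunct2[OF IH] 1]]
  show ?thesis by (intro conjI impI ballI T) (use 0 in simp_all)
 next
  assume 0: "E 0 \<noteq> C 0" and 1: "E 1 = C 1"
  note I = mp[OF conjunct1[OF IH] 1]
  note T = transfer_noneq_eq[OF c 0 refl 1[symmetric] bspec[OF conjunct2[OF I]]]
  show ?thesis using 0 T by blast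
 next
  assume 0: "E 0 \<noteq> C 0" and 1: "E 1 \<noteq> C 1"
  note T = transfer_noneq_noneq[OF c 0 1 mp[OF conjunct2[OF IH] 1]]
  show ?thesis using 0 T by blast
 qed
qed

text \<open>The smallest label of the universe sits at position 0 of \<open>E\<close>, so nothing can be moved below it.\<close>

lemma lf_rf_wall:
 assumes c: "cfg U (Suc N) E C" and U: "E 0 = U" "C 0 = U" and w: "w \<in> U" "w \<notin> E 1" "\<forall>u\<in>U. w \<le> u"
 shows "gz * lf E C U = rf E C U"
proof -
 have z: "(E \<circ> Suc) 0 = E 1" "(C \<circ> Suc) 0 = C 1" by simp_all
 note IH = transfer[OF cfg_Suc[OF c], unfolded z]
 note sb = sub01[OF c, unfolded U]
 show ?thesis
 proof (cases "E 1 = C 1")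
  case False
  have "siteL U U (C 1) U (E 1 \<inter> C 1) \<longleftrightarrow> siteR U (E 1) (C 1) U (E 1 \<union> C 1)"
   using site_iff[of "C 1" U "E 1" U] sb P01[OF c] by simp
  then show ?thesis unfolding lf_rec_noneq[OF c False] rf_rec_noneq[OF c False sb(3)] U
   using mp[OF conjunct2[OF IH] False] by simp
 next
  case True
  define G where "G = E 1"
  have lo: "w \<in> U - G" "\<forall>t\<in>U - G. w \<le> t" using w by (auto simp: G_def)
  have fU: "finite U" by (rule fU[OF c])
  have fG: "finite G" using sb fU finite_subset unfolding G_def by blast
  let ?l = "lf (E \<circ> Suc) (C \<circ> Suc)" and ?r = "rf (E \<circ> Suc) (C \<circ> Suc)"
  have GU: "G \<subseteq> U" using sb unfolding G_def by blast
  have t: "siteL U U G U G" "siteR U G G U G" by (auto simp: siteL_def siteR_def)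
  have lt: "\<not> y < w" if "y \<in> G" for y using w(3) that GU by (auto simp: not_less)
  have "(\<Sum>y\<in>G. if siteL U U G U (G - {y}) then ?l (G - {y}) else 0) = 0"
   by (rule sum.neutral) (use siteL_noneq_eq[of G U U _ w] GU lo lt in auto)
  then have L: "lf E C U = ?l G"
   using lf_rec_eq[OF c True G_def, of U] U t by simp
  have "(\<Sum>y\<in>U - G. if siteR U G G U (insert y G) then ?r (insert y G) else 0) = (\<Sum>y\<in>U - G. if y = w then ?r (insert y G) else 0)"
   by (rule sum.cong) (use siteR_noneq_eq[of G U U _ w] GU lo t in auto)
  then have R: "rf E C U = ?r G + ?r (insert w G)"
   using rf_rec_eq[OF c True G_def, of U] U t lo fU by simp
  have "(\<Sum>m\<in>{m\<in>G. m < w}. gz * ?l (G - {m})) = 0" by (rule sum.neutral) (use lt in auto)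
  moreover have "?r G + ?r (insert w G) = gz * ?l G + (\<Sum>m\<in>{m\<in>G. m < w}. gz * ?l (G - {m}))"
   using bspec[OF conjunct2[OF mp[OF conjunct1[OF IH] True]], of w] lo unfolding G_def by blast
  ultimately show ?thesis unfolding L R by simp
 qed
qed

section \<open>From column sets back to shapes\<close>

definition cols :: "nat set \<Rightarrow> (nat \<Rightarrow> nat) \<Rightarrow> nat \<Rightarrow> nat set" where
 "cols U c j = {r \<in> U. j \<le> c r}"

definition on :: "nat set \<Rightarrow> (nat \<Rightarrow> nat) \<Rightarrow> bool" where
 "on U c \<longleftrightarrow> (\<forall>r. r \<notin> U \<longrightarrow> c r = 0)"

lemma onD: "on U c \<Longrightarrow> c r \<noteq> 0 \<Longrightarrow> r \<in> U"
 by (auto simp: on_def)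

lemma cols_0 [simp]: "cols U c 0 = U" by (auto simp: cols_def)

lemma cols_Suc_subset: "cols U c (Suc j) \<subseteq> cols U c j" by (auto simp: cols_def)

lemma cols_empty: assumes "finite U" shows "\<exists>N. \<forall>j\<ge>N. cols U c j = {}"
proof -
 have "\<forall>j\<ge>Suc (Max (insert 0 (c ` U))). cols U c j = {}"
 proof (intro allI impI)
  fix j assume j: "Suc (Max (insert 0 (c ` U))) \<le> j"
  have "c r \<le> Max (insert 0 (c ` U))" if "r \<in> U" for r using assms that by simp
  then show "cols U c j = {}" using j by (fastforce simp: cols_def)
 qed
 then show ?thesis by blast
qed

lemma cols_inj: assumes "on U c" "on U d" "cols U c = cols U d" shows "c = d"
proof
 fix r
 have "(r \<in> U \<and> j \<le> c r) \<longleftrightarrow> (r \<in> U \<and> j \<le> d r)" for j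
  using fun_cong[OF assms(3), of j] by (auto simp: cols_def)
 then have "r \<in> U \<Longrightarrow> c r = d r" by (metis antisym order_refl)
 then show "c r = d r" using assms by (cases "r \<in> U") (auto simp: on_def)
qed

lemma cols_surj:
 assumes "finite U" "D 0 = U" "\<And>j. D (Suc j) \<subseteq> D j" "\<exists>N. \<forall>j\<ge>N. D j = {}"
 obtains d where "on U d" "D = cols U d"
proof
 obtain N where N: "\<forall>j\<ge>N. D j = {}" using assms by blast
 \<comment> \<open>Column 0 is the basement and contains all of \<open>U\<close>, so a row length
   counts only the columns \<open>Suc j\<close>.\<close>
 define d where "d = (\<lambda>r. card {j. r \<in> D (Suc j)})"
 have anti: "D j \<subseteq> D i" if "i \<le> j" for i j
  using that by (induction rule: dec_induct) (use assms in auto)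
 have mem: "r \<in> D j \<longleftrightarrow> j \<le> d r" if r: "r \<in> U" for r j
 proof -
  have fin: "finite {j. r \<in> D (Suc j)}"
   by (rule finite_subset[of _ "{..N}"], rule subsetI, rule ccontr) (use N in auto)
  have down: "i \<in> {j. r \<in> D (Suc j)}" if "j \<in> {j. r \<in> D (Suc j)}" "i \<le> j" for i j
   using that anti[of "Suc i" "Suc j"] by auto
  show ?thesis
  proof (cases j)
   case (Suc i)
   show ?thesis
   proof
    assume "r \<in> D j"
    then have "{..i} \<subseteq> {j. r \<in> D (Suc j)}" using down Suc by auto
    then have "card {..i} \<le> d r" unfolding d_def by (rule card_mono[OF fin])
    then show "j \<le> d r" using Suc by simp
   next
    assume j: "j \<le> d r"
    show "r \<in> D j"
    proof (rule ccontr)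
     assume "r \<notin> D j"
     then have "{j. r \<in> D (Suc j)} \<subseteq> {..<i}" using down[of _ i] Suc by (auto intro: leI ccontr)
     then have "d r \<le> card {..<i}" unfolding d_def by (rule card_mono[rotated]) simp
     then show False using j Suc by simp
    qed
   qed
  qed (use assms r in simp)
 qed
 have sub: "D j \<subseteq> U" for j using anti[of 0 j] assms by simp
 have "d r = 0" if "r \<notin> U" for r
 proof -
  have "{j. r \<in> D (Suc j)} = {}" using sub that by blast
  then show ?thesis unfolding d_def by simp
 qed
 then show "on U d" by (simp add: on_def)
 show "D = cols U d"
 proof
  fix j show "D j = cols U d j" using mem[of _ j] sub[of j] by (auto simp: cols_def)
 qed
qed

lemma sum_cols:
 assumes "finite U" "\<And>r. r \<in> U \<Longrightarrow> c r \<le> N"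
 shows "sum c U = (\<Sum>j\<in>{1..N}. card (cols U c j))"
proof -
 have "sum c U = (\<Sum>r\<in>U. \<Sum>j\<in>{1..N}. if j \<le> c r then 1 else 0)"
 proof (rule sum.cong[OF refl])
  fix r assume "r \<in> U"
  then have "{1..N} \<inter> {j. j \<le> c r} = {1..c r}" using assms(2)[of r] by auto
  then show "c r = (\<Sum>j\<in>{1..N}. if j \<le> c r then 1 else 0)" by (simp add: sum.If_cases)
 qed
 also have "\<dots> = (\<Sum>j\<in>{1..N}. \<Sum>r\<in>U. if j \<le> c r then 1 else 0)" by (rule sum.swap)
 also have "\<dots> = (\<Sum>j\<in>{1..N}. card (cols U c j))"
  by (rule sum.cong) (use assms(1) in \<open>auto simp: sum.If_cases cols_def Int_def\<close>)
 finally show ?thesis .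
qed

text \<open>Each column loses at most one cell, so lost cells and changed columns are equally
  many.\<close>

lemma card_cols_neq:
 assumes U: "finite U" and le: "\<And>r. c r \<le> d r"
  and one: "\<And>j. cols U c j = cols U d j \<or> (\<exists>m\<in>cols U d j. cols U c j = cols U d j - {m})"
 shows "sum d U = sum c U + card {j. cols U c j \<noteq> cols U d j}"
proof -
 define N where "N = Max (insert 0 (d ` U))"
 have N: "d r \<le> N" if "r \<in> U" for r using U that by (simp add: N_def)
 have Nc: "c r \<le> N" if "r \<in> U" for r using N le that le_trans by blast
 have sub: "{j. cols U c j \<noteq> cols U d j} \<subseteq> {1..N}"
 proof
  fix j assume j: "j \<in> {j. cols U c j \<noteq> cols U d j}"
  have "j \<noteq> 0" using j by (auto intro: ccontr)
  moreover have "j \<le> N"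
  proof (rule ccontr)
   assume "\<not> j \<le> N"
   then have "cols U c j = {}" "cols U d j = {}" using N Nc by (fastforce simp: cols_def)+
   then show False using j by simp
  qed
  ultimately show "j \<in> {1..N}" by simp
 qed
 have "card (cols U d j) = card (cols U c j) + (if cols U c j \<noteq> cols U d j then 1 else 0)" for j
 proof (cases "cols U c j = cols U d j")
  case False
  then obtain m where m: "m \<in> cols U d j" "cols U c j = cols U d j - {m}" using one by blast
  have "finite (cols U d j)" using U by (simp add: cols_def)
  then show ?thesis using card_Suc_Diff1[OF _ m(1)] m(2) False by simp
 qed simp
 then have "(\<Sum>j\<in>{1..N}. card (cols U d j)) = (\<Sum>j\<in>{1..N}. card (cols U c j)) + (\<Sum>j\<in>{1..N}. if cols U c j \<noteq> cols U d j then 1 else 0)"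
  by (simp add: sum.distrib)
 also have "(\<Sum>j\<in>{1..N}. if cols U c j \<noteq> cols U d j then 1 else 0) = card {j. cols U c j \<noteq> cols U d j}"
 proof -
  have "{1..N} \<inter> {j. cols U c j \<noteq> cols U d j} = {j. cols U c j \<noteq> cols U d j}" using sub by blast
  then show ?thesis by (simp add: sum.If_cases)
 qed
 finally show ?thesis using sum_cols[OF U N] sum_cols[OF U Nc] by simp
qed

lemma cols_le: assumes "on U c" "on U d" "\<And>j. cols U c j \<subseteq> cols U d j" shows "c r \<le> d r"
proof (cases "r \<in> U")
 case True
 then have "r \<in> cols U c (c r)" by (simp add: cols_def)
 then have "r \<in> cols U d (c r)" using assms(3) by blast
 then show ?thesis by (simp add: cols_def)
qed (use assms(1) in \<open>simp add: on_def\<close>)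

text \<open>If row \<open>m\<close> loses a cell in column \<open>j\<close>, the pair condition
  forces every higher row of \<open>e\<close> that reaches column \<open>j\<close> to go beyond it
  already in \<open>d\<close>. Hence only the highest candidate can lose a cell, and only one row
  does.\<close>

lemma strip_cols:
 assumes "on U d" "on U e"
 shows "strip d e \<longleftrightarrow> (\<forall>r. d r \<le> e r) \<and> (\<forall>j. cols U d j = cols U e j \<or>
  (\<exists>m\<in>cols U e j - cols U d (Suc j). cols U d j = cols U e j - {m} \<and> (\<forall>t\<in>cols U e j - cols U d (Suc j). t \<le> m)))"
proof (intro iffI conjI allI)
 assume s: "strip d e"
 show le: "d r \<le> e r" for r using s by (simp add: strip_def)
 fix j
 have sub: "cols U d j \<subseteq> cols U e j" using le by (auto simp: cols_def intro: le_trans)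
 show "cols U d j = cols U e j \<or>
  (\<exists>m\<in>cols U e j - cols U d (Suc j). cols U d j = cols U e j - {m} \<and> (\<forall>t\<in>cols U e j - cols U d (Suc j). t \<le> m))"
 proof (cases "cols U d j = cols U e j")
  case False
  then obtain m where m: "m \<in> U" "j \<le> e m" "d m < j"
  proof -
   obtain m where "m \<in> cols U e j" "m \<notin> cols U d j" using False sub by blast
   then show thesis using that by (auto simp: cols_def not_le)
  qed
  have mx: "t \<le> m" if "t \<in> cols U e j - cols U d (Suc j)" for t
  proof (rule ccontr)
   assume "\<not> t \<le> m"
   then have "e t \<le> d m \<or> e m < d t \<or> e m = d m" using s by (auto simp: strip_def)
   then show False using m that by (auto simp: cols_def)
  qed
  have uniq: "r = m" if "r \<in> U" "j \<le> e r" "d r < j" for r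
  proof (rule ccontr)
   assume "r \<noteq> m"
   moreover have "r \<le> m" using mx[of r] that by (auto simp: cols_def)
   ultimately have "e m \<le> d r \<or> e r < d m \<or> e r = d r" using s by (auto simp: strip_def)
   then show False using m that by auto
  qed
  have "cols U d j = cols U e j - {m}"
  proof (rule set_eqI)
   fix r show "r \<in> cols U d j \<longleftrightarrow> r \<in> cols U e j - {m}"
    using uniq[of r] m le[of r] by (cases "j \<le> d r") (auto simp: cols_def)
  qed
  moreover have "m \<in> cols U e j - cols U d (Suc j)" using m by (simp add: cols_def)
  ultimately show ?thesis using mx by blast
 qed simp
next
 assume a: "(\<forall>r. d r \<le> e r) \<and> (\<forall>j. cols U d j = cols U e j \<or>
  (\<exists>m\<in>cols U e j - cols U d (Suc j). cols U d j = cols U e j - {m} \<and> (\<forall>t\<in>cols U e j - cols U d (Suc j). t \<le> m)))"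
 show "strip d e" unfolding strip_def
 proof (intro conjI allI impI)
  show "d r \<le> e r" for r using conjunct1[OF a] by simp
  fix r s :: nat assume rs: "r < s"
  show "e s \<le> d r \<or> e r < d s \<or> e r = d r"
  proof (rule ccontr)
   assume n: "\<not> ?thesis"
   \<comment> \<open>In this column row \<open>r\<close> has lost its cell, while row
     \<open>s\<close> is present in \<open>e\<close> and does not continue in \<open>d\<close>. The
     highest candidate is then at least \<open>s\<close>, yet it would have to be
     \<open>r\<close>.\<close>
   define j where "j = max (Suc (d r)) (d s)"
   have le: "d r \<le> e r" "d s \<le> e s" using conjunct1[OF a] by simp_all
   have j: "d r < j" "j \<le> e r" "j \<le> e s" "d s \<le> j" using n le by (auto simp: j_def)
   have "e r \<noteq> 0" "e s \<noteq> 0" using j by simp_all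
   then have U: "r \<in> U" "s \<in> U" using onD[OF assms(2)] by simp_all
   have r: "r \<in> cols U e j" "r \<notin> cols U d j" using U j by (simp_all add: cols_def)
   then have "cols U d j \<noteq> cols U e j" by blast
   then obtain m where m: "cols U d j = cols U e j - {m}" "\<forall>t\<in>cols U e j - cols U d (Suc j). t \<le> m"
    using spec[OF conjunct2[OF a], of j] by blast
   have "m = r" using m(1) r by blast
   moreover have "s \<le> m" using m(2) U j by (auto simp: cols_def)
   ultimately show False using rs by simp
  qed
 qed
qed

text \<open>If a row gains a cell in column \<open>Suc j\<close>, each lower row of \<open>c\<close>
  that reaches column \<open>j\<close> must reach column \<open>Suc j\<close> already in
  \<open>d\<close>. Hence only the lowest candidate can grow.\<close>

lemma ups_cols:
 assumes "on {m<..n} d" "on {m<..n} c" "\<forall>r\<le>Suc m. d r = 0"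
 defines "U \<equiv> {m<..n}"
 shows "ups m d c \<longleftrightarrow> (\<forall>r. d r \<le> c r) \<and> (\<forall>j. cols U c (Suc j) = cols U d (Suc j) \<or>
  (\<exists>z\<in>cols U c j - cols U d (Suc j). cols U c (Suc j) = insert z (cols U d (Suc j)) \<and>
    (\<forall>t\<in>cols U c j - cols U d (Suc j). z \<le> t)))"
proof (intro iffI conjI allI)
 assume s: "ups m d c"
 show le: "d r \<le> c r" for r using s by (simp add: ups_def)
 fix j
 have sub: "cols U d (Suc j) \<subseteq> cols U c (Suc j)" using le by (auto simp: cols_def intro: le_trans)
 show "cols U c (Suc j) = cols U d (Suc j) \<or>
  (\<exists>z\<in>cols U c j - cols U d (Suc j). cols U c (Suc j) = insert z (cols U d (Suc j)) \<and>
    (\<forall>t\<in>cols U c j - cols U d (Suc j). z \<le> t))"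
 proof (cases "cols U c (Suc j) = cols U d (Suc j)")
  case False
  then obtain z where z: "z \<in> U" "Suc j \<le> c z" "d z \<le> j"
  proof -
   obtain z where "z \<in> cols U c (Suc j)" "z \<notin> cols U d (Suc j)" using False sub by blast
   then show thesis using that by (auto simp: cols_def not_le)
  qed
  have mn: "z \<le> t" if "t \<in> cols U c j - cols U d (Suc j)" for t
  proof (rule ccontr)
   assume "\<not> z \<le> t"
   then have "c t < d z \<or> c z \<le> d t \<or> d z = c z" using s that by (auto simp: ups_def cols_def U_def)
   then show False using z that by (auto simp: cols_def)
  qed
  have uniq: "r = z" if "r \<in> U" "Suc j \<le> c r" "d r \<le> j" for r
  proof (rule ccontr)
   assume "r \<noteq> z"
   moreover have "z \<le> r" using mn[of r] that by (auto simp: cols_def)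
   ultimately have "c z < d r \<or> c r \<le> d z \<or> d r = c r" using s z by (auto simp: ups_def U_def)
   then show False using z that by auto
  qed
  have "cols U c (Suc j) = insert z (cols U d (Suc j))"
  proof (rule set_eqI)
   fix r show "r \<in> cols U c (Suc j) \<longleftrightarrow> r \<in> insert z (cols U d (Suc j))"
    using uniq[of r] z le[of r] by (cases "Suc j \<le> d r") (auto simp: cols_def)
  qed
  moreover have "z \<in> cols U c j - cols U d (Suc j)" using z by (auto simp: cols_def)
  ultimately show ?thesis using mn by blast
 qed simp
next
 assume a: "(\<forall>r. d r \<le> c r) \<and> (\<forall>j. cols U c (Suc j) = cols U d (Suc j) \<or>
  (\<exists>z\<in>cols U c j - cols U d (Suc j). cols U c (Suc j) = insert z (cols U d (Suc j)) \<and>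
    (\<forall>t\<in>cols U c j - cols U d (Suc j). z \<le> t)))"
 show "ups m d c" unfolding ups_def
 proof (intro conjI allI impI)
  show "d r \<le> c r" for r using conjunct1[OF a] by simp
  show "d r = 0" if "r \<le> Suc m" for r using assms(3) that by blast
  fix r s :: nat assume rs: "m < r \<and> r < s"
  show "c r < d s \<or> c s \<le> d r \<or> d s = c s"
  proof (rule ccontr)
   assume n: "\<not> ?thesis"
   define j where "j = max (d r) (d s)"
   have le: "d r \<le> c r" "d s \<le> c s" using conjunct1[OF a] by simp_all
   have j: "d r \<le> j" "j \<le> c r" "Suc j \<le> c s" "d s \<le> j" using n le by (auto simp: j_def)
   have "c s \<noteq> 0" using j by simp
   then have U: "s \<in> U" using onD[OF assms(2)] by (simp add: U_def)
   then have U': "r \<in> U" using rs by (auto simp: U_def)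
   have s: "s \<in> cols U c (Suc j)" "s \<notin> cols U d (Suc j)" using U j by (simp_all add: cols_def)
   then have "cols U c (Suc j) \<noteq> cols U d (Suc j)" by blast
   then obtain z where z: "cols U c (Suc j) = insert z (cols U d (Suc j))" "\<forall>t\<in>cols U c j - cols U d (Suc j). z \<le> t"
    using spec[OF conjunct2[OF a], of j] by blast
   have "z = s" using s(1)[unfolded z(1)] s(2) by simp
   moreover have "z \<le> r" using z(2) U' j by (auto simp: cols_def)
   ultimately show False using rs by simp
  qed
 qed
qed

text \<open>This lemma and the next show that the order condition of \<open>cfg\<close> is necessary
  for a common lower, respectively upper, shape to exist.\<close>

lemma strip_ups_order:
 assumes "ups m0 d c" "strip d e" "m0 < m" "c m < j" "j \<le> e m" "e x < j" "j \<le> c x"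
 shows "x < m"
proof (rule ccontr)
 assume "\<not> x < m"
 moreover have "x \<noteq> m" using assms by auto
 ultimately have mx: "m < x" by simp
 have le: "d x \<le> e x" "d m \<le> c m" "d m \<le> e m" "d x \<le> c x" using assms by (auto simp: ups_def strip_def)
 have "c m < d x \<or> c x \<le> d m \<or> d x = c x" using assms(1,3) mx unfolding ups_def by blast
 moreover have "e x \<le> d m \<or> e m < d x \<or> e m = d m" using assms(2) mx unfolding strip_def by blast
 ultimately show False using le assms(4-7) by linarith
qed

lemma ups_strip_order:
 assumes "strip c b" "ups m0 e b" "m0 < m" "c m < j" "j \<le> e m" "e x < j" "j \<le> c x"
 shows "x < m"
proof (rule ccontr)
 assume "\<not> x < m"
 moreover have "x \<noteq> m" using assms by auto
 ultimately have mx: "m < x" by simp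
 have le: "c x \<le> b x" "c m \<le> b m" "e m \<le> b m" "e x \<le> b x" using assms by (auto simp: ups_def strip_def)
 have "b x \<le> c m \<or> b m < c x \<or> b m = c m" using assms(1) mx unfolding strip_def by blast
 moreover have "b m < e x \<or> b x \<le> e m \<or> e x = b x" using assms(2,3) mx unfolding ups_def by blast
 ultimately show False using le assms(4-7) by linarith
qed

lemma bij_paths_L:
 assumes c: "on {m<..n} c" and e: "on {m<..n} e" and e0: "\<forall>r\<le>Suc m. e r = 0"
 defines "U \<equiv> {m<..n}"
 defines "T \<equiv> (\<lambda>j. siteL (cols U e j) (cols U c j) (cols U c (Suc j)))"
 shows "bij_betw (cols U) {d. on U d \<and> ups m d c \<and> strip d e \<and> sum e U = sum d U + k}
   (paths T (cols U e) U k)"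
 unfolding bij_betw_def
proof
 have fU: "finite U" by (simp add: U_def)
 show "inj_on (cols U) {d. on U d \<and> ups m d c \<and> strip d e \<and> sum e U = sum d U + k}"
  by (rule inj_onI) (auto intro: cols_inj)
 show "cols U ` {d. on U d \<and> ups m d c \<and> strip d e \<and> sum e U = sum d U + k} = paths T (cols U e) U k"
 proof (intro set_eqI iffI)
  fix D assume "D \<in> cols U ` {d. on U d \<and> ups m d c \<and> strip d e \<and> sum e U = sum d U + k}"
  then obtain d where D: "D = cols U d" and d: "on U d" "ups m d c" "strip d e" "sum e U = sum d U + k" by blast
  have d0: "\<forall>r\<le>Suc m. d r = 0" using d(2) by (simp add: ups_def)
  note s = d(3)[unfolded strip_cols[OF d(1) e[folded U_def]]]
  note u = d(2)[unfolded ups_cols[OF d(1)[unfolded U_def] c d0], folded U_def]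
  have "T j (D j) (D (Suc j))" for j
   unfolding T_def siteL_def D using spec[OF conjunct2[OF s], of j] spec[OF conjunct2[OF u], of j] by blast
  moreover have "card {j. D j \<noteq> cols U e j} = k"
  proof -
   have "sum e U = sum d U + card {j. cols U d j \<noteq> cols U e j}"
    by (rule card_cols_neq[OF fU]) (use s in blast)+
   then show ?thesis using d(4) D by simp
  qed
  ultimately show "D \<in> paths T (cols U e) U k"
   unfolding paths_def using cols_empty[OF fU] D by auto
 next
  fix D assume D: "D \<in> paths T (cols U e) U k"
  then have T: "T j (D j) (D (Suc j))" for j by (simp add: paths_def)
  have De: "D j = cols U e j \<or> (\<exists>m\<in>cols U e j - D (Suc j). D j = cols U e j - {m} \<and> (\<forall>t\<in>cols U e j - D (Suc j). t \<le> m))" for j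
   using T[of j] unfolding T_def siteL_def by blast
  have Dc: "cols U c (Suc j) = D (Suc j) \<or>
    (\<exists>z\<in>cols U c j - D (Suc j). cols U c (Suc j) = insert z (D (Suc j)) \<and> (\<forall>t\<in>cols U c j - D (Suc j). z \<le> t))" for j
   using T[of j] unfolding T_def siteL_def by blast
  have sub: "D j \<subseteq> cols U e j" for j using De[of j] by blast
  have "D (Suc j) \<subseteq> D j" for j using De[of j] sub[of "Suc j"] cols_Suc_subset[of U e j] by blast
  then obtain d where d: "on U d" "D = cols U d"
   using cols_surj[OF fU, of D] D by (auto simp: paths_def)
  have le: "d r \<le> e r" for r using cols_le[OF d(1) e[folded U_def]] sub d(2) by blast
  have d0: "\<forall>r\<le>Suc m. d r = 0" using le e0 by (metis le_zero_eq)
  have s: "strip d e" unfolding strip_cols[OF d(1) e[folded U_def]] using De le unfolding d(2) by blast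
  have "cols U d j \<subseteq> cols U c j" for j
  proof (cases j)
   case (Suc i) then show ?thesis using Dc[of i] d(2) by blast
  qed simp
  then have lec: "d r \<le> c r" for r using cols_le[OF d(1) c[folded U_def]] by blast
  have u: "ups m d c" unfolding ups_cols[OF d(1)[unfolded U_def] c d0, folded U_def]
   using Dc lec unfolding d(2) by blast
  have "sum e U = sum d U + card {j. cols U d j \<noteq> cols U e j}"
   by (rule card_cols_neq[OF fU le]) (use De d(2) in blast)
  then have "sum e U = sum d U + k" using D d(2) by (simp add: paths_def)
  then show "D \<in> cols U ` {d. on U d \<and> ups m d c \<and> strip d e \<and> sum e U = sum d U + k}"
   using d s u by blast
 qed
qed

lemma bij_paths_R:
 assumes c: "on {m<..n} c" and e: "on {m<..n} e" and e0: "\<forall>r\<le>Suc m. e r = 0"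
 defines "U \<equiv> {m<..n}"
 defines "T \<equiv> (\<lambda>j. siteR (cols U c j) (cols U e (Suc j)) (cols U c (Suc j)))"
 shows "bij_betw (cols U) {b. on U b \<and> strip c b \<and> ups m e b \<and> sum b U = sum c U + k}
   (paths T (cols U c) U k)"
 unfolding bij_betw_def
proof
 have fU: "finite U" by (simp add: U_def)
 show "inj_on (cols U) {b. on U b \<and> strip c b \<and> ups m e b \<and> sum b U = sum c U + k}"
  by (rule inj_onI) (auto intro: cols_inj)
 show "cols U ` {b. on U b \<and> strip c b \<and> ups m e b \<and> sum b U = sum c U + k} = paths T (cols U c) U k"
 proof (intro set_eqI iffI)
  fix D assume "D \<in> cols U ` {b. on U b \<and> strip c b \<and> ups m e b \<and> sum b U = sum c U + k}"
  then obtain d where D: "D = cols U d" and d: "on U d" "strip c d" "ups m e d" "sum d U = sum c U + k" by blast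
  note s = d(2)[unfolded strip_cols[OF c[folded U_def] d(1)]]
  note u = d(3)[unfolded ups_cols[OF e d(1)[unfolded U_def] e0], folded U_def]
  have "cols U d j = cols U c j \<or> (\<exists>m\<in>cols U d j - cols U c (Suc j). cols U c j = cols U d j - {m} \<and> (\<forall>t\<in>cols U d j - cols U c (Suc j). t \<le> m))" for j
   using spec[OF conjunct2[OF s], of j] by (elim disjE) simp_all
  then have "T j (D j) (D (Suc j))" for j
   unfolding T_def siteR_def D using spec[OF conjunct2[OF u], of j] by blast
  moreover have "card {j. D j \<noteq> cols U c j} = k"
  proof -
   have "sum d U = sum c U + card {j. cols U c j \<noteq> cols U d j}"
    by (rule card_cols_neq[OF fU]) (use s in blast)+
   then show ?thesis using d(4) D by (simp add: eq_commute)
  qed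
  ultimately show "D \<in> paths T (cols U c) U k"
   unfolding paths_def using cols_empty[OF fU] D by auto
 next
  fix D assume D: "D \<in> paths T (cols U c) U k"
  then have T: "T j (D j) (D (Suc j))" for j by (simp add: paths_def)
  have Dc: "cols U c j = D j \<or> (\<exists>m\<in>D j - cols U c (Suc j). cols U c j = D j - {m} \<and> (\<forall>t\<in>D j - cols U c (Suc j). t \<le> m))" for j
   using T[of j] unfolding T_def siteR_def by (elim conjE disjE) simp_all
  have De: "D (Suc j) = cols U e (Suc j) \<or>
    (\<exists>z\<in>D j - cols U e (Suc j). D (Suc j) = insert z (cols U e (Suc j)) \<and> (\<forall>t\<in>D j - cols U e (Suc j). z \<le> t))" for j
   using T[of j] unfolding T_def siteR_def by blast
  have D0: "D 0 = U" using D by (simp add: paths_def)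
  have sub: "cols U e j \<subseteq> D j" for j
  proof (cases j)
   case (Suc i) then show ?thesis using De[of i] by blast
  qed (use D0 in simp)
  have "D (Suc j) \<subseteq> D j" for j
  proof -
   have "cols U e (Suc j) \<subseteq> D j" using cols_Suc_subset sub by (rule order_trans)
   then show ?thesis using De[of j] by (elim disjE bexE conjE) simp_all
  qed
  then obtain d where d: "on U d" "D = cols U d"
   using cols_surj[OF fU, of D] D by (auto simp: paths_def)
  have le: "e r \<le> d r" for r using cols_le[OF e[folded U_def] d(1)] sub d(2) by blast
  have "cols U c j \<subseteq> cols U d j" for j using Dc[of j] unfolding d(2) by (elim disjE bexE conjE) auto
  then have lec: "c r \<le> d r" for r using cols_le[OF c[folded U_def] d(1)] by blast
  have s: "strip c d" unfolding strip_cols[OF c[folded U_def] d(1)] using Dc lec unfolding d(2) by blast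
  have u: "ups m e d" unfolding ups_cols[OF e d(1)[unfolded U_def] e0, folded U_def]
   using De le unfolding d(2) by blast
  have "sum d U = sum c U + card {j. cols U c j \<noteq> cols U d j}"
   by (rule card_cols_neq[OF fU lec]) (use Dc d(2) in blast)
  then have "sum d U = sum c U + k" using D d(2) by (simp add: paths_def eq_commute)
  then show "D \<in> cols U ` {b. on U b \<and> strip c b \<and> ups m e b \<and> sum b U = sum c U + k}"
   using d s u by blast
 qed
qed

text \<open>The factor \<open>gz\<close> becomes the partial sum over \<open>i\<close>, and row
  \<open>Suc m\<close>, empty in \<open>e\<close>, is the lowest label that
  \<open>lf_rf_wall\<close> asks for. If the order condition of \<open>cfg\<close> fails, both
  families are empty.\<close>

lemma growth_count:
 assumes c: "on {m<..n} c" and e: "on {m<..n} e" and e0: "\<forall>r\<le>Suc m. e r = 0" and mn: "m < n"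
 defines "U \<equiv> {m<..n}"
 shows "card {b. on U b \<and> strip c b \<and> ups m e b \<and> sum b U = sum c U + k} =
  (\<Sum>i\<le>k. card {d. on U d \<and> ups m d c \<and> strip d e \<and> sum e U = sum d U + i})"
proof (cases "\<forall>j. \<forall>a\<in>cols U e j - cols U c j. \<forall>x\<in>cols U c j - cols U e j. x < a")
 case True
 have fU: "finite U" by (simp add: U_def)
 obtain N1 N2 where "\<forall>j\<ge>N1. cols U e j = {}" "\<forall>j\<ge>N2. cols U c j = {}" using cols_empty[OF fU] by metis
 then have "cfg U (Suc (N1 + N2)) (cols U e) (cols U c)"
  unfolding cfg_def using True fU cols_Suc_subset by simp
 then have "gz * lf (cols U e) (cols U c) U = rf (cols U e) (cols U c) U"
  by (rule lf_rf_wall[where w = "Suc m"]) (use mn e0 in \<open>auto simp: U_def cols_def\<close>)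
 then have "fps_nth (gz * lf (cols U e) (cols U c) U) k = fps_nth (rf (cols U e) (cols U c) U) k" by simp
 moreover have "fps_nth (rf (cols U e) (cols U c) U) k = int (card {b. on U b \<and> strip c b \<and> ups m e b \<and> sum b U = sum c U + k})"
  using bij_betw_same_card[OF bij_paths_R[OF c e e0, of k]] by (simp add: rf_def pathgf_def U_def)
 moreover have "fps_nth (lf (cols U e) (cols U c) U) i = int (card {d. on U d \<and> ups m d c \<and> strip d e \<and> sum e U = sum d U + i})" for i
  using bij_betw_same_card[OF bij_paths_L[OF c e e0, of i]] by (simp add: lf_def pathgf_def U_def)
 moreover have "fps_nth (gz * f) k = (\<Sum>i\<le>k. fps_nth f i)" for f
  by (subst mult.commute) (simp add: fps_mult_nth gz_def atMost_atLeast0)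
 ultimately have "(\<Sum>i\<le>k. int (card {d. on U d \<and> ups m d c \<and> strip d e \<and> sum e U = sum d U + i})) =
   int (card {b. on U b \<and> strip c b \<and> ups m e b \<and> sum b U = sum c U + k})" by simp
 then show ?thesis by (simp flip: of_nat_sum)
next
 case False
 then obtain j a x where a: "a \<in> U" "j \<le> e a" "c a < j" "x \<in> U" "j \<le> c x" "e x < j" "\<not> x < a"
 proof -
  from False obtain j a x where "a \<in> cols U e j - cols U c j" "x \<in> cols U c j - cols U e j" "\<not> x < a" by blast
  then show thesis using that[of a j x] by (auto simp: cols_def not_le)
 qed
 have "m < a" using a(1) by (simp add: U_def)
 have "\<not> (strip c b \<and> ups m e b)" for b using ups_strip_order[of c b m e a j x] a \<open>m < a\<close> by blast
 moreover have "\<not> (ups m d c \<and> strip d e)" for d using strip_ups_order[of m d c e a j x] a \<open>m < a\<close> by blast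
 ultimately have "{b. on U b \<and> strip c b \<and> ups m e b \<and> sum b U = sum c U + k} = {}"
  "{d. on U d \<and> ups m d c \<and> strip d e \<and> sum e U = sum d U + i} = {}" for i by blast+
 then show ?thesis by (simp only: card.empty sum.neutral_const)
qed

section \<open>Demazure atoms and the Pieri rule\<close>

definition dg :: "(nat \<Rightarrow> nat) \<Rightarrow> (nat \<times> nat) set" where
 "dg c = {(r, j). 1 \<le> j \<and> j \<le> c r}"

text \<open>Semi-skyline augmented fillings with entries greater than \<open>m\<close>; their generating function is the
 Demazure atom of \<open>c\<close> in the variables \<open>x\<close> with index greater than \<open>m\<close>.\<close>

definition ssaf :: "nat \<Rightarrow> (nat \<Rightarrow> nat) \<Rightarrow> filling set" where
 "ssaf m c = {T. (\<forall>r j. 0 < T (r, j) \<longleftrightarrow> 1 \<le> j \<and> j \<le> c r) \<and>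
   (\<forall>r j. 1 \<le> j \<longrightarrow> T (r, Suc j) \<le> T (r, j)) \<and>
   (\<forall>r. 0 < c r \<longrightarrow> T (r, 1) = r) \<and>
   (\<forall>r j. 0 < T (r, j) \<longrightarrow> m < T (r, j)) \<and>
   (\<forall>r s j. r < s \<and> 1 \<le> j \<and> Suc j \<le> c s \<longrightarrow> T (r, j) < T (s, Suc j) \<or> T (s, Suc j) < T (r, Suc j))}"

definition atom :: "nat \<Rightarrow> (nat \<Rightarrow> nat) \<Rightarrow> Defs.poly" where
 "atom m c = (\<Sum>T\<in>ssaf m c. Poly_Mapping.single (wt (dg c) T) 1)"

definition vX :: "nat \<Rightarrow> Defs.poly" where
 "vX i = Poly_Mapping.single (Poly_Mapping.single i 1) 1"

definition sz :: "nat \<Rightarrow> (nat \<Rightarrow> nat) \<Rightarrow> nat" where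
 "sz n c = sum c {1..n}"

lemma sum_on: "on {m<..n} c \<Longrightarrow> sum c {m<..n} = sz n c"
 unfolding sz_def by (rule sum.mono_neutral_left) (auto simp: on_def)

lemma vX_power: "vX i ^ k = Poly_Mapping.single (Poly_Mapping.single i k) 1"
proof (induction k)
 case (Suc k)
 have "vX i ^ Suc k = vX i * Poly_Mapping.single (Poly_Mapping.single i k) 1" using Suc by simp
 also have "\<dots> = Poly_Mapping.single (Poly_Mapping.single i 1 + Poly_Mapping.single i k) (1 * 1)"
  unfolding vX_def mult_single ..
 finally show ?case by (simp flip: single_add)
qed simp

lemma finite_dg:
 assumes "on {m<..n} c" shows "finite (dg c)"
proof -
 have "dg c \<subseteq> Sigma {m<..n} (\<lambda>r. {1..c r})"
  using onD[OF assms] by (auto simp: dg_def)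
 then show ?thesis by (rule finite_subset) simp
qed

lemma sum_dg:
 fixes f :: "nat \<times> nat \<Rightarrow> 'a::comm_monoid_add"
 assumes "on {m<..n} c"
 shows "sum f (dg c) = (\<Sum>r\<in>{m<..n}. \<Sum>j\<in>{1..c r}. f (r, j))"
proof -
 have "dg c = Sigma {m<..n} (\<lambda>r. {1..c r})"
  using onD[OF assms] by (auto simp: dg_def)
 then show ?thesis by (simp add: sum.Sigma)
qed

lemma card_dg: "on {m<..n} c \<Longrightarrow> card (dg c) = sz n c"
 using sum_dg[of m n c "\<lambda>_. 1::nat"] sum_on[of m n c] by simp

lemma ssaf_le:
 assumes "T \<in> ssaf m c" shows "T (r, j) \<le> r"
proof (cases "1 \<le> j \<and> j \<le> c r")
 case True
 then have "1 \<le> j" by simp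
 then have "T (r, j) \<le> T (r, 1)"
 proof (induction j rule: nat_induct_at_least)
  case (Suc j)
  then have "T (r, Suc j) \<le> T (r, j)" using assms by (simp add: ssaf_def)
  then show ?case using Suc by simp
 qed simp
 also have "\<dots> = r" using assms True by (auto simp: ssaf_def)
 finally show ?thesis .
next
 case False
 then have "\<not> 0 < T (r, j)" using assms by (auto simp: ssaf_def)
 then show ?thesis by simp
qed

lemma finite_ssaf: assumes "on {m<..n} c" shows "finite (ssaf m c)"
proof (rule finite_subset)
 show "ssaf m c \<subseteq> {T. \<forall>p. (p \<in> dg c \<longrightarrow> T p \<in> {..n}) \<and> (p \<notin> dg c \<longrightarrow> T p = 0)}"
 proof
  fix T assume T: "T \<in> ssaf m c"
  have "T p \<le> n" if "p \<in> dg c" for p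
  proof -
   obtain r j where p: "p = (r, j)" by force
   have "r \<in> {m<..n}" using that p onD[OF assms, of r] by (auto simp: dg_def)
   then show ?thesis using ssaf_le[OF T, of r j] p by simp
  qed
  moreover have "T p = 0" if "p \<notin> dg c" for p
  proof -
   obtain r j where p: "p = (r, j)" by force
   have "\<not> 0 < T p" using T that unfolding p ssaf_def dg_def by simp
   then show ?thesis by simp
  qed
  ultimately show "T \<in> {T. \<forall>p. (p \<in> dg c \<longrightarrow> T p \<in> {..n}) \<and> (p \<notin> dg c \<longrightarrow> T p = 0)}" by simp
 qed
 show "finite {T. \<forall>p. (p \<in> dg c \<longrightarrow> T p \<in> {..n}) \<and> (p \<notin> dg c \<longrightarrow> T p = 0)}"
  by (rule finite_set_of_finite_funs[OF finite_dg[OF assms]]) simp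
qed

lemma finite_on_sz: "finite {c. on {m<..n} c \<and> sz n c \<le> k}"
proof (rule finite_subset)
 show "{c. on {m<..n} c \<and> sz n c \<le> k} \<subseteq> {c. \<forall>r. (r \<in> {m<..n} \<longrightarrow> c r \<in> {..k}) \<and> (r \<notin> {m<..n} \<longrightarrow> c r = 0)}"
 proof
  fix c assume c: "c \<in> {c. on {m<..n} c \<and> sz n c \<le> k}"
  have "c r \<le> k" if "r \<in> {m<..n}" for r
  proof -
   have "c r \<le> sum c {1..n}" by (rule member_le_sum) (use that in auto)
   then show ?thesis using c by (simp add: sz_def)
  qed
  then show "c \<in> {c. \<forall>r. (r \<in> {m<..n} \<longrightarrow> c r \<in> {..k}) \<and> (r \<notin> {m<..n} \<longrightarrow> c r = 0)}"
   using c by (auto simp: on_def)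
 qed
 show "finite {c. \<forall>r. (r \<in> {m<..n} \<longrightarrow> c r \<in> {..k}) \<and> (r \<notin> {m<..n} \<longrightarrow> c r = 0)}"
  by (rule finite_set_of_finite_funs) auto
qed

lemma sz_mono: "(\<And>r. d r \<le> c r) \<Longrightarrow> sz n d \<le> sz n c"
 unfolding sz_def by (rule sum_mono)

lemma finite_ups: assumes "on {m<..n} c" shows "finite {d. ups m d c}"
proof (rule finite_subset[OF _ finite_on_sz[of m n "sz n c"]])
 show "{d. ups m d c} \<subseteq> {d. on {m<..n} d \<and> sz n d \<le> sz n c}"
 proof safe
  fix d assume u: "ups m d c"
  then have le: "d r \<le> c r" for r by (simp add: ups_def)
  show "on {m<..n} d" unfolding on_def
  proof (intro allI impI)
   fix r assume "r \<notin> {m<..n}"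
   then have "c r = 0" using assms by (simp add: on_def)
   then show "d r = 0" using le[of r] by simp
  qed
  show "sz n d \<le> sz n c" by (rule sz_mono[OF le])
 qed
qed

lemma ups_on: assumes "ups m d c" "on {m<..n} c" shows "on {Suc m<..n} d"
 unfolding on_def
proof (intro allI impI)
 fix r assume r: "r \<notin> {Suc m<..n}"
 show "d r = 0"
 proof (cases "r \<le> Suc m")
  case True then show ?thesis using assms by (simp add: ups_def)
 next
  case False
  then have "c r = 0" using assms(2) r by (simp add: on_def)
  moreover have "d r \<le> c r" using assms(1) by (simp add: ups_def)
  ultimately show ?thesis by simp
 qed
qed

section \<open>Branching of atoms: splitting off the smallest entry\<close>

definition thr :: "nat \<Rightarrow> filling \<Rightarrow> nat \<Rightarrow> nat" where
 "thr m T r = card {j. m < T (r, j)}"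

lemma thr_iff:
 assumes "\<And>j. 1 \<le> j \<Longrightarrow> T (r, Suc j) \<le> T (r, j)" "T (r, 0) = 0" "T (r, Suc N) = 0"
 shows "m < T (r, j) \<longleftrightarrow> 1 \<le> j \<and> j \<le> thr m T r"
proof -
 have dec: "T (r, k) \<le> T (r, j)" if "j \<le> k" "1 \<le> j" for j k
  using that
 proof (induction k rule: dec_induct)
  case (step k) then show ?case using assms(1)[of k] by simp
 qed simp
 let ?S = "{j. m < T (r, j)}"
 have S0: "0 \<notin> ?S" using assms by simp
 have SN: "j \<le> N" if "j \<in> ?S" for j
 proof (rule ccontr)
  assume "\<not> j \<le> N"
  then show False using dec[of "Suc N" j] that assms(3) by simp
 qed
 have fin: "finite ?S" using SN by (meson atMost_iff finite_atMost finite_subset subsetI)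
 have down: "i \<in> ?S" if "j \<in> ?S" "i \<le> j" "1 \<le> i" for i j using that dec[of i j] by simp
 show ?thesis
 proof
  assume j: "m < T (r, j)"
  then have "{1..j} \<subseteq> ?S" using down[of j] by auto
  then have "card {1..j} \<le> thr m T r" unfolding thr_def by (rule card_mono[OF fin])
  moreover have "j \<noteq> 0" using S0 j by (auto intro: ccontr)
  ultimately show "1 \<le> j \<and> j \<le> thr m T r" by simp
 next
  assume j: "1 \<le> j \<and> j \<le> thr m T r"
  show "m < T (r, j)"
  proof (rule ccontr)
   assume n: "\<not> m < T (r, j)"
   have "?S \<subseteq> {1..<j}"
   proof
    fix i assume i: "i \<in> ?S"
    have "i \<noteq> 0" using S0 i by (auto intro: ccontr)
    moreover have "i < j" using down[of i j] i n j by (cases "j \<le> i") simp_all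
    ultimately show "i \<in> {1..<j}" by simp
   qed
   then have "thr m T r \<le> card {1..<j}" unfolding thr_def by (rule card_mono[rotated]) simp
   then have "thr m T r \<le> j - 1" by simp
   then show False using j by linarith
  qed
 qed
qed

lemma ssaf_thr_iff:
 assumes "T \<in> ssaf m c" shows "k < T (r, j) \<longleftrightarrow> 1 \<le> j \<and> j \<le> thr k T r"
proof (rule thr_iff)
 show "T (r, Suc j) \<le> T (r, j)" if "1 \<le> j" for j using assms that by (simp add: ssaf_def)
 have a: "0 < T (r, j) \<longleftrightarrow> 1 \<le> j \<and> j \<le> c r" for j using assms by (simp add: ssaf_def)
 show "T (r, 0) = 0" using a[of 0] by simp
 show "T (r, Suc (c r)) = 0" using a[of "Suc (c r)"] by simp
qed

text \<open>The entries \<open>m + 1\<close> occupy the end of row \<open>s\<close>. If a lower row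
  is present in the column before they start, the triple rule makes its next entry larger than
  \<open>m + 1\<close>, and then does so again column after column up to the end of row
  \<open>s\<close>.\<close>

lemma ssaf_ups:
 assumes T: "T \<in> ssaf m c"
 shows "ups m (thr (Suc m) T) c"
proof -
 note t = ssaf_thr_iff[OF T]
 have pos: "0 < T (r, j) \<longleftrightarrow> 1 \<le> j \<and> j \<le> c r" for r j using T by (simp add: ssaf_def)
 have gt: "0 < T (r, j) \<Longrightarrow> m < T (r, j)" for r j using T by (simp add: ssaf_def)
 have rule': "r < s \<Longrightarrow> 1 \<le> j \<Longrightarrow> Suc j \<le> c s \<Longrightarrow> T (r, j) < T (s, Suc j) \<or> T (s, Suc j) < T (r, Suc j)" for r s j
  using T by (simp add: ssaf_def)
 let ?d = "thr (Suc m) T"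
 have le: "?d r \<le> c r" for r
 proof (cases "?d r = 0")
  case False
  then have "Suc m < T (r, ?d r)" using t[of "Suc m" r "?d r"] by simp
  then show ?thesis using pos[of r "?d r"] by simp
 qed simp
 show ?thesis unfolding ups_def
 proof (intro conjI allI impI le)
  fix r assume r: "r \<le> Suc m"
  show "?d r = 0"
  proof (rule ccontr)
   assume "?d r \<noteq> 0"
   then have "Suc m < T (r, 1)" using t[of "Suc m" r 1] by simp
   then show False using ssaf_le[OF T, of r 1] r by simp
  qed
 next
  fix r s assume rs: "m < r \<and> r < s"
  show "c r < ?d s \<or> c s \<le> ?d r \<or> ?d s = c s"
  proof (cases "?d s = c s")
   case False
   then have lt: "?d s < c s" using le[of s] by simp
   have one: "T (s, j) = Suc m" if "?d s < j" "j \<le> c s" for j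
   proof -
    have "m < T (s, j)" using gt[of s j] pos[of s j] that by simp
    moreover have "\<not> Suc m < T (s, j)" using t[of "Suc m" s j] that by simp
    ultimately show ?thesis by simp
   qed
   \<comment> \<open>Row \<open>s\<close> starts with \<open>s\<close>, which exceeds
     \<open>m + 1\<close>; so the entries \<open>m + 1\<close> start after column 1 and the rule can
     be applied to the column before them.\<close>
   have d1: "1 \<le> ?d s"
   proof (rule ccontr)
    assume "\<not> 1 \<le> ?d s"
    then have "T (s, 1) = Suc m" using one[of 1] lt by simp
    moreover have "T (s, 1) = s" using T lt by (auto simp: ssaf_def)
    ultimately show False using rs by simp
   qed
   have c: "T (r, ?d s) < Suc m \<or> Suc m < T (r, Suc (?d s))"
    using rule'[of r s "?d s"] rs d1 lt one[of "Suc (?d s)"] by simp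
   then show ?thesis
   proof
    assume "T (r, ?d s) < Suc m"
    then have "\<not> 0 < T (r, ?d s)" using gt[of r "?d s"] by auto
    then show ?thesis using pos[of r "?d s"] d1 by simp
   next
    assume a: "Suc m < T (r, Suc (?d s))"
    have "Suc m < T (r, j)" if "Suc (?d s) \<le> j" "j \<le> c s" for j
     using that
    proof (induction j rule: dec_induct)
     case (step j)
     then have "Suc m < T (r, j)" by simp
     then show ?case using rule'[of r s j] rs step one[of "Suc j"] by simp
    qed (use a in simp)
    then have "Suc m < T (r, c s)" using lt by simp
    then show ?thesis using t[of "Suc m" r "c s"] by simp
   qed
  qed simp
 qed
qed

lemma ssaf_cut:
 assumes T: "T \<in> ssaf m c"
 shows "(\<lambda>p. if T p = Suc m then 0 else T p) \<in> ssaf (Suc m) (thr (Suc m) T)" (is "?T \<in> _")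
proof -
 note t = ssaf_thr_iff[OF T]
 have gt: "0 < T (r, j) \<Longrightarrow> m < T (r, j)" for r j using T by (simp add: ssaf_def)
 have eq: "?T (r, j) = (if Suc m < T (r, j) then T (r, j) else 0)" for r j
  using gt[of r j] by (cases "T (r, j) = 0") auto
 have pos: "0 < T (r, j) \<longleftrightarrow> 1 \<le> j \<and> j \<le> c r" for r j using T by (simp add: ssaf_def)
 have dec: "T (r, Suc j) \<le> T (r, j)" if "1 \<le> j" for r j using T that by (simp add: ssaf_def)
 have rule': "r < s \<Longrightarrow> 1 \<le> j \<Longrightarrow> Suc j \<le> c s \<Longrightarrow> T (r, j) < T (s, Suc j) \<or> T (s, Suc j) < T (r, Suc j)" for r s j
  using T by (simp add: ssaf_def)
 show ?thesis unfolding ssaf_def mem_Collect_eq eq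
 proof (intro conjI allI impI)
  fix r j
  show "0 < (if Suc m < T (r, j) then T (r, j) else 0) \<longleftrightarrow> 1 \<le> j \<and> j \<le> thr (Suc m) T r"
   using t[of "Suc m" r j] by auto
  show "(if Suc m < T (r, Suc j) then T (r, Suc j) else 0) \<le> (if Suc m < T (r, j) then T (r, j) else 0)" if "1 \<le> j"
   using dec[OF that, of r] by auto
  show "Suc m < (if Suc m < T (r, j) then T (r, j) else 0)" if "0 < (if Suc m < T (r, j) then T (r, j) else 0)"
   using that by (simp split: if_splits)
 next
  fix r assume "0 < thr (Suc m) T r"
  then have a: "Suc m < T (r, 1)" using t[of "Suc m" r 1] by simp
  then have "0 < c r" using pos[of r 1] by simp
  then have "T (r, 1) = r" using T by (simp add: ssaf_def)
  then show "(if Suc m < T (r, 1) then T (r, 1) else 0) = r" using a by simp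
 next
  fix r s j assume a: "r < s \<and> 1 \<le> j \<and> Suc j \<le> thr (Suc m) T s"
  then have b: "Suc m < T (s, Suc j)" using t[of "Suc m" s "Suc j"] by simp
  then have "Suc j \<le> c s" using pos[of s "Suc j"] by simp
  then have "T (r, j) < T (s, Suc j) \<or> T (s, Suc j) < T (r, Suc j)" using rule' a by blast
  then show "(if Suc m < T (r, j) then T (r, j) else 0) < (if Suc m < T (s, Suc j) then T (s, Suc j) else 0) \<or>
    (if Suc m < T (s, Suc j) then T (s, Suc j) else 0) < (if Suc m < T (r, Suc j) then T (r, Suc j) else 0)"
   using b by auto
 qed
qed

lemma ssaf_fill:
 assumes T: "T \<in> ssaf (Suc m) d" and u: "ups m d c" and c0: "on {m<..n} c"
 shows "(\<lambda>p. if p \<in> dg c \<and> T p = 0 then Suc m else T p) \<in> ssaf m c" (is "?T \<in> _")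
  and "thr (Suc m) (\<lambda>p. if p \<in> dg c \<and> T p = 0 then Suc m else T p) = d"
proof -
 have pos: "0 < T (r, j) \<longleftrightarrow> 1 \<le> j \<and> j \<le> d r" for r j using T by (simp add: ssaf_def)
 have gt: "0 < T (r, j) \<Longrightarrow> Suc m < T (r, j)" for r j using T by (simp add: ssaf_def)
 have le: "d r \<le> c r" for r using u by (simp add: ups_def)
 have eq: "?T (r, j) = (if 1 \<le> j \<and> j \<le> d r then T (r, j) else if 1 \<le> j \<and> j \<le> c r then Suc m else 0)" for r j
  using pos[of r j] le[of r] by (auto simp: dg_def)
 have dec: "T (r, Suc j) \<le> T (r, j)" if "1 \<le> j" for r j using T that by (simp add: ssaf_def)
 have rule': "r < s \<Longrightarrow> 1 \<le> j \<Longrightarrow> Suc j \<le> d s \<Longrightarrow> T (r, j) < T (s, Suc j) \<or> T (s, Suc j) < T (r, Suc j)" for r s j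
  using T by (simp add: ssaf_def)
 have up: "c r < d s \<or> c s \<le> d r \<or> d s = c s" if "m < r" "r < s" for r s using u that by (simp add: ups_def)
 have d0: "d r = 0" if "r \<le> Suc m" for r using u that by (simp add: ups_def)
 have cm: "m < r" if "0 < c r" for r using onD[OF c0, of r] that by simp
 show th: "?T \<in> ssaf m c" unfolding ssaf_def mem_Collect_eq eq
 proof (intro conjI allI impI)
  fix r j
  show "0 < (if 1 \<le> j \<and> j \<le> d r then T (r, j) else if 1 \<le> j \<and> j \<le> c r then Suc m else 0) \<longleftrightarrow> 1 \<le> j \<and> j \<le> c r"
   using pos[of r j] le[of r] by auto
  show "(if 1 \<le> Suc j \<and> Suc j \<le> d r then T (r, Suc j) else if 1 \<le> Suc j \<and> Suc j \<le> c r then Suc m else 0)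
   \<le> (if 1 \<le> j \<and> j \<le> d r then T (r, j) else if 1 \<le> j \<and> j \<le> c r then Suc m else 0)" if "1 \<le> j"
   using dec[OF that, of r] that pos[of r j] gt[of r j] by auto
  show "m < (if 1 \<le> j \<and> j \<le> d r then T (r, j) else if 1 \<le> j \<and> j \<le> c r then Suc m else 0)"
   if "0 < (if 1 \<le> j \<and> j \<le> d r then T (r, j) else if 1 \<le> j \<and> j \<le> c r then Suc m else 0)"
   using that gt[of r j] by (auto split: if_splits)
 next
  fix r assume c: "0 < c r"
  show "(if 1 \<le> (1::nat) \<and> 1 \<le> d r then T (r, 1) else if 1 \<le> (1::nat) \<and> 1 \<le> c r then Suc m else 0) = r"
  proof (cases "r = Suc m")
   case True then show ?thesis using d0[of r] c by simp
  next
   case False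
   then have "Suc m < r" using cm[OF c] by simp
   \<comment> \<open>Row \<open>Suc m\<close> is empty in \<open>d\<close>, so the pair condition
     with it forces every nonempty higher row to start in \<open>d\<close>. Its first entry is
     therefore not overwritten by \<open>m + 1\<close>.\<close>
   then have "0 < d r" using up[of "Suc m" r] d0[of "Suc m"] c by auto
   then show ?thesis using T by (simp add: ssaf_def)
  qed
 next
  fix r s j assume a: "r < s \<and> 1 \<le> j \<and> Suc j \<le> c s"
  show "(if 1 \<le> j \<and> j \<le> d r then T (r, j) else if 1 \<le> j \<and> j \<le> c r then Suc m else 0) <
    (if 1 \<le> Suc j \<and> Suc j \<le> d s then T (s, Suc j) else if 1 \<le> Suc j \<and> Suc j \<le> c s then Suc m else 0) \<or>
    (if 1 \<le> Suc j \<and> Suc j \<le> d s then T (s, Suc j) else if 1 \<le> Suc j \<and> Suc j \<le> c s then Suc m else 0) <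
    (if 1 \<le> Suc j \<and> Suc j \<le> d r then T (r, Suc j) else if 1 \<le> Suc j \<and> Suc j \<le> c r then Suc m else 0)"
  proof (cases "Suc j \<le> d s")
   case True
   then have "T (r, j) < T (s, Suc j) \<or> T (s, Suc j) < T (r, Suc j)" using rule' a by blast
   moreover have "Suc m < T (s, Suc j)" using gt[of s "Suc j"] pos[of s "Suc j"] True by simp
   moreover have "T (s, Suc j) < T (r, Suc j) \<Longrightarrow> Suc j \<le> d r" using pos[of r "Suc j"] by simp
   ultimately show ?thesis using True by auto
  next
   case False
   show ?thesis
   proof (cases "m < r")
    case True
    then consider "c r < d s" | "c s \<le> d r" | "d s = c s" using up[of r s] a by blast
    then show ?thesis
    proof cases
     case 1 then show ?thesis using False a le[of r] by simp
    next
     case 2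
     then have "Suc j \<le> d r" using a by simp
     then show ?thesis using gt[of r "Suc j"] pos[of r "Suc j"] False a by simp
    next
     case 3 then show ?thesis using False a by simp
    qed
   next
    case f: False
    then have "c r = 0" using cm[of r] by auto
    then show ?thesis using le[of r] False a by simp
   qed
  qed
 qed
 show "thr (Suc m) ?T = d"
 proof
  fix r
  have "Suc m < ?T (r, j) \<longleftrightarrow> 1 \<le> j \<and> j \<le> d r" for j
   unfolding eq using gt[of r j] pos[of r j] by auto
  then have "thr (Suc m) ?T r = card {1..d r}" unfolding thr_def by (simp add: atLeastAtMost_def atLeast_def atMost_def Int_def)
  then show "thr (Suc m) ?T r = d r" by simp
 qed
qed

lemma wt_split:
 assumes fin: "finite A" and sub: "B \<subseteq> A" and "\<And>p. p \<in> B \<Longrightarrow> T p = T' p" "\<And>p. p \<in> A - B \<Longrightarrow> T p = i"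
 shows "wt A T = Poly_Mapping.single i (card (A - B)) + wt B T'"
proof -
 have "wt A T = (\<Sum>p\<in>A - B. Poly_Mapping.single (T p) 1) + (\<Sum>p\<in>B. Poly_Mapping.single (T p) 1)"
  unfolding wt_def by (rule sum.subset_diff[OF sub fin])
 also have "(\<Sum>p\<in>B. Poly_Mapping.single (T p) 1) = wt B T'"
  unfolding wt_def by (rule sum.cong) (use assms in auto)
 also have "(\<Sum>p\<in>A - B. Poly_Mapping.single (T p) (1::nat)) = (\<Sum>p\<in>A - B. Poly_Mapping.single i 1)"
  by (rule sum.cong) (use assms in auto)
 also have "\<dots> = Poly_Mapping.single i (card (A - B))"
 proof -
  have "(\<Sum>p\<in>S. Poly_Mapping.single i (1::nat)) = Poly_Mapping.single i (card S)" if "finite S" for S :: "(nat \<times> nat) set"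
   using that
  proof (induction S)
   case (insert x F)
   show ?case unfolding sum.insert[OF insert.hyps] insert.IH card_insert_disjoint[OF insert.hyps]
    by (simp flip: single_add)
  qed simp
  then show ?thesis using fin by simp
 qed
 finally show ?thesis .
qed

lemma wt_branch:
 assumes c: "on {m<..n} c" and le: "\<And>r. d r \<le> c r"
  and T: "\<And>p. p \<in> dg d \<Longrightarrow> T p = T' p" "\<And>p. p \<in> dg c - dg d \<Longrightarrow> T p = i"
 shows "wt (dg c) T = Poly_Mapping.single i (sz n c - sz n d) + wt (dg d) T'"
proof -
 have d: "on {m<..n} d" unfolding on_def
 proof (intro allI impI)
  fix r assume "r \<notin> {m<..n}"
  then have "c r = 0" using c by (simp add: on_def)
  then show "d r = 0" using le[of r] by simp
 qed
 have fin: "finite (dg c)" "finite (dg d)" using finite_dg[OF c] finite_dg[OF d] by auto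
 have sub: "dg d \<subseteq> dg c" using le by (auto simp: dg_def intro: le_trans)
 have "wt (dg c) T = Poly_Mapping.single i (card (dg c - dg d)) + wt (dg d) T'"
  by (rule wt_split[OF fin(1) sub]) (use T in auto)
 also have "card (dg c - dg d) = sz n c - sz n d"
  using card_Diff_subset[OF fin(2) sub] card_dg[OF c] card_dg[OF d] by simp
 finally show ?thesis .
qed

lemma atom_branch:
 assumes c: "on {m<..n} c"
 shows "atom m c = (\<Sum>d\<in>{d. ups m d c}. vX (Suc m) ^ (sz n c - sz n d) * atom (Suc m) d)"
proof -
 let ?f = "\<lambda>T. (thr (Suc m) T, \<lambda>p. if T p = Suc m then 0 else T p)"
 let ?g = "\<lambda>(d::nat \<Rightarrow> nat, T). (\<lambda>p. if p \<in> dg c \<and> T p = 0 then Suc m else T p)"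
 let ?w = "\<lambda>(d, T). Poly_Mapping.single (Poly_Mapping.single (Suc m) (sz n c - sz n d) + wt (dg d) T) (1::int)"
 have "atom m c = sum ?w (Sigma {d. ups m d c} (ssaf (Suc m)))"
  unfolding atom_def
 proof (rule sum.reindex_bij_witness[where i = ?g and j = ?f])
  fix T assume T: "T \<in> ssaf m c"
  have pos: "0 < T (r, j) \<longleftrightarrow> 1 \<le> j \<and> j \<le> c r" for r j using T by (simp add: ssaf_def)
  have gt: "0 < T (r, j) \<Longrightarrow> m < T (r, j)" for r j using T by (simp add: ssaf_def)
  have dgp: "p \<in> dg c \<longleftrightarrow> 0 < T p" for p using pos[of "fst p" "snd p"] by (cases p) (auto simp: dg_def)
  show "?g (?f T) = T" using dgp by auto
  show "?f T \<in> Sigma {d. ups m d c} (ssaf (Suc m))" using ssaf_ups[OF T] ssaf_cut[OF T] by simp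
  have dgd: "p \<in> dg (thr (Suc m) T) \<longleftrightarrow> Suc m < T p" for p
   using ssaf_thr_iff[OF T, of "Suc m" "fst p" "snd p"] by (cases p) (auto simp: dg_def)
  have "wt (dg c) T = Poly_Mapping.single (Suc m) (sz n c - sz n (thr (Suc m) T)) +
    wt (dg (thr (Suc m) T)) (\<lambda>p. if T p = Suc m then 0 else T p)"
  proof (rule wt_branch[OF c])
   show "thr (Suc m) T r \<le> c r" for r using ssaf_ups[OF T] by (simp add: ups_def)
   show "T p = (if T p = Suc m then 0 else T p)" if "p \<in> dg (thr (Suc m) T)" for p
    using that by (simp add: dgd)
   show "T p = Suc m" if "p \<in> dg c - dg (thr (Suc m) T)" for p
    using that dgp[of p] dgd[of p] gt[of "fst p" "snd p"] by (cases p) auto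
  qed
  then show "?w (?f T) = Poly_Mapping.single (wt (dg c) T) 1" by simp
 next
  fix q assume "q \<in> Sigma {d. ups m d c} (ssaf (Suc m))"
  then obtain d T where q: "q = (d, T)" and u: "ups m d c" and T: "T \<in> ssaf (Suc m) d" by auto
  note F = ssaf_fill[OF T u c]
  have gt: "0 < T (r, j) \<Longrightarrow> Suc m < T (r, j)" for r j using T by (simp add: ssaf_def)
  have ne: "T p \<noteq> Suc m" for p using gt[of "fst p" "snd p"] by (cases p) auto
  show "?g q \<in> ssaf m c" using F q by simp
  show "?f (?g q) = q" using F(2) ne q by (auto simp: fun_eq_iff)
 qed
 also have "\<dots> = (\<Sum>d\<in>{d. ups m d c}. \<Sum>T\<in>ssaf (Suc m) d. ?w (d, T))"
  unfolding prod.case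
  by (rule sum.Sigma[symmetric]) (use finite_ups[OF c] finite_ssaf[OF ups_on[OF _ c]] in auto)
 also have "\<dots> = (\<Sum>d\<in>{d. ups m d c}. vX (Suc m) ^ (sz n c - sz n d) * atom (Suc m) d)"
  by (rule sum.cong) (simp_all add: atom_def vX_power sum_distrib_left mult_single)
 finally show ?thesis .
qed

section \<open>Complete homogeneous polynomials and the Pieri rule\<close>

definition hfps :: "nat set \<Rightarrow> Defs.poly fps" where
 "hfps S = (\<Prod>i\<in>S. Abs_fps (\<lambda>k. vX i ^ k))"

definition hp :: "nat set \<Rightarrow> nat \<Rightarrow> Defs.poly" where
 "hp S k = fps_nth (hfps S) k"

lemma hp_insert:
 assumes "finite S" "i \<notin> S"
 shows "hp (insert i S) k = (\<Sum>j\<le>k. vX i ^ j * hp S (k - j))"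
 using assms by (simp add: hp_def hfps_def fps_mult_nth atMost_atLeast0)

lemma hp_empty: "hp {} k = (if k = 0 then 1 else 0)"
 by (simp add: hp_def hfps_def)

lemma finite_strip: "finite {b. on {m<..n} b \<and> strip c b \<and> sz n b = k}"
 by (rule finite_subset[OF _ finite_on_sz[of m n k]]) auto

lemma sum_swap_card:
 fixes f :: "'b \<Rightarrow> 'c::comm_ring_1"
 assumes "finite A" "finite B"
 shows "(\<Sum>a\<in>A. \<Sum>b\<in>{b\<in>B. P a b}. f b) = (\<Sum>b\<in>B. of_nat (card {a\<in>A. P a b}) * f b)"
proof -
 have "(\<Sum>a\<in>A. \<Sum>b\<in>{b\<in>B. P a b}. f b) = (\<Sum>a\<in>A. \<Sum>b\<in>B. if P a b then f b else 0)"
  by (rule sum.cong[OF refl], rule sum.inter_filter) (rule assms)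
 also have "\<dots> = (\<Sum>b\<in>B. \<Sum>a\<in>A. if P a b then f b else 0)" by (rule sum.swap)
 also have "\<dots> = (\<Sum>b\<in>B. of_nat (card {a\<in>A. P a b}) * f b)"
 proof (rule sum.cong[OF refl])
  fix b
  have "(\<Sum>a\<in>A. if P a b then f b else 0) = (\<Sum>a\<in>{a\<in>A. P a b}. f b)"
   by (rule sum.inter_filter[symmetric]) (rule assms)
  then show "(\<Sum>a\<in>A. if P a b then f b else 0) = of_nat (card {a\<in>A. P a b}) * f b" by simp
 qed
 finally show ?thesis .
qed

text \<open>Downward induction on \<open>m\<close>, adding the variable \<open>vX (Suc m)\<close>.
  Both sides are expanded in the atoms \<open>atom (Suc m) e\<close>. For fixed \<open>e\<close> the
  exponent of the new variable is determined by the total degree \<open>M\<close>, so only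
  multiplicities have to be compared, and they agree by \<open>growth_count\<close>.\<close>

lemma pieri:
 assumes "on {m<..n} c" "m \<le> n"
 shows "atom m c * hp {m<..n} k = (\<Sum>b\<in>{b. on {m<..n} b \<and> strip c b \<and> sz n b = sz n c + k}. atom m b)"
 using assms(2,1)
proof (induction m arbitrary: c k rule: inc_induct)
 case base
 have e: "{n<..n} = {}" by simp
 have c: "c = (\<lambda>_. 0)" using base by (auto simp: on_def)
 have on: "on {n<..n} b \<longleftrightarrow> b = (\<lambda>_. 0)" for b :: "nat \<Rightarrow> nat" by (auto simp: on_def)
 have "{b. on {n<..n} b \<and> strip c b \<and> sz n b = sz n c + k} = (if k = 0 then {\<lambda>_. 0} else {})"
  unfolding on c by (auto simp: strip_def)
 then show ?case unfolding e hp_empty c by simp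
next
 case (step m)
 let ?U = "{m<..n}" and ?V = "{Suc m<..n}" and ?x = "vX (Suc m)"
 note c = step.prems
 have ins: "?U = insert (Suc m) ?V" "Suc m \<notin> ?V" using step by auto
 define M where "M = sz n c + k"
 let ?E = "{e. on ?V e \<and> sz n e \<le> M}"
 have fE: "finite ?E" by (rule finite_on_sz)
 define F where "F = (\<lambda>e. ?x ^ (M - sz n e) * atom (Suc m) e)"
 have upE: "on ?V d" "sz n d \<le> sz n c" "d r \<le> c r" if "ups m d c" for d r
 proof -
  show "on ?V d" by (rule ups_on[OF that c])
  have "d r \<le> c r" for r using that by (simp add: ups_def)
  then show "sz n d \<le> sz n c" "d r \<le> c r" by (auto intro: sz_mono)
 qed
 have "atom m c * hp ?U k = (\<Sum>d\<in>{d. ups m d c}. \<Sum>j\<le>k. ?x ^ (j + (sz n c - sz n d)) * (atom (Suc m) d * hp ?V (k - j)))"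
  unfolding ins(1) hp_insert[OF _ ins(2), simplified] atom_branch[OF c] sum_product
  by (simp add: power_add mult_ac)
 also have "\<dots> = (\<Sum>j\<le>k. \<Sum>d\<in>{d. ups m d c}. ?x ^ (j + (sz n c - sz n d)) * (atom (Suc m) d * hp ?V (k - j)))"
  by (rule sum.swap)
 also have "\<dots> = (\<Sum>j\<le>k. \<Sum>d\<in>{d. ups m d c}. \<Sum>e\<in>{e\<in>?E. strip d e \<and> sz n e = sz n d + (k - j)}. F e)"
 proof (intro sum.cong refl)
  fix j d assume j: "j \<in> {..k}" and d: "d \<in> {d. ups m d c}"
  have u: "ups m d c" using d by simp
  have "?x ^ (j + (sz n c - sz n d)) * (atom (Suc m) d * hp ?V (k - j)) =
    (\<Sum>e\<in>{e. on ?V e \<and> strip d e \<and> sz n e = sz n d + (k - j)}. ?x ^ (j + (sz n c - sz n d)) * atom (Suc m) e)"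
   unfolding step.IH[OF upE(1)[OF u]] sum_distrib_left ..
  also have "\<dots> = (\<Sum>e\<in>{e\<in>?E. strip d e \<and> sz n e = sz n d + (k - j)}. F e)"
  proof (rule sum.cong)
   show "{e. on ?V e \<and> strip d e \<and> sz n e = sz n d + (k - j)} = {e\<in>?E. strip d e \<and> sz n e = sz n d + (k - j)}"
    using upE(2)[OF u] by (auto simp: M_def)
   fix e assume "e \<in> {e\<in>?E. strip d e \<and> sz n e = sz n d + (k - j)}"
   then have "M - sz n e = j + (sz n c - sz n d)" using upE(2)[OF u] j by (simp add: M_def)
   then show "?x ^ (j + (sz n c - sz n d)) * atom (Suc m) e = F e" by (simp add: F_def)
  qed
  finally show "?x ^ (j + (sz n c - sz n d)) * (atom (Suc m) d * hp ?V (k - j)) =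
    (\<Sum>e\<in>{e\<in>?E. strip d e \<and> sz n e = sz n d + (k - j)}. F e)" .
 qed
 also have "\<dots> = (\<Sum>j\<le>k. \<Sum>e\<in>?E. of_nat (card {d\<in>{d. ups m d c}. strip d e \<and> sz n e = sz n d + (k - j)}) * F e)"
  by (intro sum.cong refl sum_swap_card finite_ups[OF c] fE)
 also have "\<dots> = (\<Sum>e\<in>?E. \<Sum>j\<le>k. of_nat (card {d\<in>{d. ups m d c}. strip d e \<and> sz n e = sz n d + (k - j)}) * F e)"
  by (rule sum.swap)
 also have "\<dots> = (\<Sum>e\<in>?E. of_nat (card {b\<in>{b. on ?U b \<and> strip c b \<and> sz n b = sz n c + k}. ups m e b}) * F e)"
 proof (rule sum.cong[OF refl])
  fix e assume e: "e \<in> ?E"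
  have eU: "on ?U e" and e0: "\<forall>r\<le>Suc m. e r = 0" using e by (auto simp: on_def)
  let ?A = "\<lambda>i. card {d. on ?U d \<and> ups m d c \<and> strip d e \<and> sum e ?U = sum d ?U + i}"
  have A: "card {d\<in>{d. ups m d c}. strip d e \<and> sz n e = sz n d + i} = ?A i" for i
  proof -
   have "{d\<in>{d. ups m d c}. strip d e \<and> sz n e = sz n d + i} = {d. on ?U d \<and> ups m d c \<and> strip d e \<and> sum e ?U = sum d ?U + i}"
   proof (rule set_eqI)
    fix d
    have "on ?U d" if "ups m d c" using upE(1)[OF that] by (auto simp: on_def)
    then show "d \<in> {d\<in>{d. ups m d c}. strip d e \<and> sz n e = sz n d + i} \<longleftrightarrow>
      d \<in> {d. on ?U d \<and> ups m d c \<and> strip d e \<and> sum e ?U = sum d ?U + i}"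
     using sum_on[OF eU] sum_on[of m n d] by auto
   qed
   then show ?thesis by simp
  qed
  have B: "{b\<in>{b. on ?U b \<and> strip c b \<and> sz n b = sz n c + k}. ups m e b} =
    {b. on ?U b \<and> strip c b \<and> ups m e b \<and> sum b ?U = sum c ?U + k}"
   using sum_on[OF c] sum_on[of m n] by auto
  have "(\<Sum>j\<le>k. of_nat (card {d\<in>{d. ups m d c}. strip d e \<and> sz n e = sz n d + (k - j)}) * F e) =
    of_nat (\<Sum>j\<le>k. ?A (k - j)) * F e"
   unfolding A by (simp add: sum_distrib_right)
  also have "(\<Sum>j\<le>k. ?A (k - j)) = (\<Sum>i\<le>k. ?A i)"
   by (rule sum.reindex_bij_witness[of _ "\<lambda>i. k - i" "\<lambda>i. k - i"]) auto
  also have "\<dots> = card {b. on ?U b \<and> strip c b \<and> ups m e b \<and> sum b ?U = sum c ?U + k}"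
   using growth_count[OF c eU e0, of k] step.hyps by simp
  finally show "(\<Sum>j\<le>k. of_nat (card {d\<in>{d. ups m d c}. strip d e \<and> sz n e = sz n d + (k - j)}) * F e) =
    of_nat (card {b\<in>{b. on ?U b \<and> strip c b \<and> sz n b = sz n c + k}. ups m e b}) * F e"
   unfolding B .
 qed
 also have "\<dots> = (\<Sum>b\<in>{b. on ?U b \<and> strip c b \<and> sz n b = sz n c + k}. \<Sum>e\<in>{e\<in>?E. ups m e b}. F e)"
  by (rule sum_swap_card[symmetric, OF finite_strip fE])
 also have "\<dots> = (\<Sum>b\<in>{b. on ?U b \<and> strip c b \<and> sz n b = sz n c + k}. atom m b)"
 proof (rule sum.cong[OF refl])
  fix b assume b: "b \<in> {b. on ?U b \<and> strip c b \<and> sz n b = sz n c + k}"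
  then have bU: "on ?U b" by simp
  have "{e\<in>?E. ups m e b} = {e. ups m e b}"
  proof (intro set_eqI iffI)
   fix e assume "e \<in> {e. ups m e b}"
   then have u: "ups m e b" by simp
   then have "sz n e \<le> sz n b" by (intro sz_mono) (simp add: ups_def)
   then show "e \<in> {e\<in>?E. ups m e b}" using ups_on[OF u bU] u b by (simp add: M_def)
  qed simp
  then show "(\<Sum>e\<in>{e\<in>?E. ups m e b}. F e) = atom m b"
   unfolding atom_branch[OF bU] F_def using b by (simp add: M_def)
 qed
 finally show ?case .
qed

section \<open>Linear independence of atoms and the symmetry of two-step chains\<close>

definition mon :: "nat \<Rightarrow> (nat \<Rightarrow> nat) \<Rightarrow> (nat \<Rightarrow>\<^sub>0 nat)" where
 "mon n c = (\<Sum>r\<in>{1..n}. Poly_Mapping.single r (c r))"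

lemma lookup_mon: "Poly_Mapping.lookup (mon n c) r = (if r \<in> {1..n} then c r else 0)"
 unfolding mon_def lookup_sum lookup_single when_def by (simp add: sum.delta cong: if_cong)

lemma lookup_sum_single:
 assumes "finite A"
 shows "Poly_Mapping.lookup (\<Sum>a\<in>A. Poly_Mapping.single (w a) (1::int)) f = int (card {a\<in>A. w a = f})"
 unfolding lookup_sum lookup_single when_def
 using sum.inter_filter[OF assms, of "\<lambda>_. 1::int" "\<lambda>a. w a = f"] by simp

text \<open>Entries of row \<open>r\<close> are at most \<open>r\<close>, so the sum of all entries
  is at most the sum of \<open>r * c r\<close>, with equality only for the filling whose rows are
  constant. Sorted by this statistic, the matrix of coefficients is unitriangular.\<close>

lemma lookup_atom_mon:
 assumes c: "on {0<..n} c" and b: "on {0<..n} b"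
  and "(\<Sum>r\<in>{1..n}. r * c r) \<le> (\<Sum>r\<in>{1..n}. r * b r)"
 shows "Poly_Mapping.lookup (atom 0 c) (mon n b) = (if c = b then 1 else 0)"
proof -
 let ?\<phi> = "\<lambda>f. \<Sum>i\<in>{1..n}. i * Poly_Mapping.lookup f i"
 have lw: "Poly_Mapping.lookup (wt (dg c) T) i = card {p\<in>dg c. T p = i}" for T i
  unfolding wt_def lookup_sum lookup_single when_def
  using sum.inter_filter[OF finite_dg[OF c], of "\<lambda>_. 1::nat" "\<lambda>p. T p = i"] by simp
 let ?T = "\<lambda>(r, j). if 1 \<le> j \<and> j \<le> c r then r else 0"
 have rpos: "0 < r" if "0 < c r" for r using onD[OF c, of r] that by simp
 have mem: "?T \<in> ssaf 0 c" using rpos by (auto simp: ssaf_def)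
 have wT: "wt (dg c) ?T = mon n c"
 proof (rule poly_mapping_eqI)
  fix i
  have "{p\<in>dg c. ?T p = i} = (\<lambda>j. (i, j)) ` {1..c i}" by (auto simp: dg_def split: if_splits)
  then have "card {p\<in>dg c. ?T p = i} = c i" by (simp add: card_image inj_on_def)
  then show "Poly_Mapping.lookup (wt (dg c) ?T) i = Poly_Mapping.lookup (mon n c) i"
   unfolding lw lookup_mon using onD[OF c, of i] by (cases "c i = 0") auto
 qed
 have key: "c = b \<and> T = ?T" if T: "T \<in> ssaf 0 c" and w: "wt (dg c) T = mon n b" for T
 proof -
  have Tn: "T p \<in> {1..n}" if "p \<in> dg c" for p
  proof -
   obtain r j where p: "p = (r, j)" by force
   have "r \<in> {0<..n}" using that p onD[OF c, of r] by (auto simp: dg_def)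
   moreover have "0 < T (r, j)" using T that p by (simp add: ssaf_def dg_def)
   ultimately show ?thesis using ssaf_le[OF T, of r j] p by simp
  qed
  have "(\<Sum>r\<in>{1..n}. r * b r) = ?\<phi> (mon n b)" by (rule sum.cong) (auto simp: lookup_mon)
  also have "\<dots> = (\<Sum>i\<in>{1..n}. \<Sum>p\<in>{p\<in>dg c. T p = i}. T p)" unfolding w[symmetric] lw by (simp add: mult.commute)
  also have "\<dots> = (\<Sum>p\<in>dg c. T p)" by (rule sum.group) (use finite_dg[OF c] Tn in auto)
  finally have e1: "(\<Sum>r\<in>{1..n}. r * b r) = (\<Sum>p\<in>dg c. T p)" .
  have e2: "(\<Sum>p\<in>dg c. fst p) = (\<Sum>r\<in>{1..n}. r * c r)"
  proof -
   have "{0<..n} = {1..n}" by auto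
   then show ?thesis unfolding sum_dg[OF c] by (simp add: mult.commute)
  qed
  have le: "T p \<le> fst p" for p using ssaf_le[OF T, of "fst p" "snd p"] by simp
  have "T p = fst p" if "p \<in> dg c" for p
  proof (rule ccontr)
   assume "T p \<noteq> fst p"
   then have "T p < fst p" using le[of p] by simp
   then have "(\<Sum>p\<in>dg c. T p) < (\<Sum>p\<in>dg c. fst p)"
    by (intro sum_strict_mono_ex1[OF finite_dg[OF c]]) (use le that in auto)
   then show False using e1 e2 assms(3) by simp
  qed
  moreover have "T p = 0" if "p \<notin> dg c" for p
  proof -
   have "\<not> 0 < T (fst p, snd p)" using T that unfolding ssaf_def dg_def by (cases p) simp
   then show ?thesis by simp
  qed
  ultimately have "T p = ?T p" for p by (cases p) (auto simp: dg_def)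
  then have TT: "T = ?T" by blast
  then have "mon n c = mon n b" using w wT by simp
  then have l: "Poly_Mapping.lookup (mon n c) r = Poly_Mapping.lookup (mon n b) r" for r by simp
  have "c r = b r" if "r \<in> {1..n}" for r using that l[of r] unfolding lookup_mon by simp
  moreover have "c r = b r" if "r \<notin> {1..n}" for r
  proof -
   have "r \<notin> {0<..n}" using that by auto
   then have "b r = 0" "c r = 0" using b c unfolding on_def by blast+
   then show ?thesis by simp
  qed
  ultimately show ?thesis using TT by blast
 qed
 have "{T \<in> ssaf 0 c. wt (dg c) T = mon n b} = (if c = b then {?T} else {})"
  using key mem wT by auto
 then show ?thesis unfolding atom_def lookup_sum_single[OF finite_ssaf[OF c]] by simp
qed

lemma atoms_independent:
 assumes B: "finite B" "\<And>b. b \<in> B \<Longrightarrow> on {0<..n} b" and z: "(\<Sum>b\<in>B. of_int (a b) * atom 0 b) = 0" and b: "b \<in> B"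
 shows "a b = 0"
proof (rule ccontr)
 assume ab: "a b \<noteq> 0"
 let ?\<phi> = "\<lambda>c. \<Sum>r\<in>{1..n}. r * c r"
 let ?S = "{b\<in>B. a b \<noteq> 0}"
 have fin: "finite (?\<phi> ` ?S)" "?\<phi> ` ?S \<noteq> {}" using B ab b by auto
 \<comment> \<open>A shape of maximal statistic among those with nonzero coefficient: in the
   coefficient of its monomial no other atom of the relation survives.\<close>
 obtain x where x: "x \<in> ?S" and xM: "Max (?\<phi> ` ?S) = ?\<phi> x" using Max_in[OF fin] by (rule imageE)
 have x2: "?\<phi> c \<le> ?\<phi> x" if "c \<in> ?S" for c
  unfolding xM[symmetric] by (rule Max_ge[OF fin(1)]) (use that in blast)
 have lk: "Poly_Mapping.lookup (of_int i * p) f = i * Poly_Mapping.lookup p f" for i and p :: Defs.poly and f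
 proof -
  have "(Poly_Mapping.single 0 (of_int i :: int) :: Defs.poly) = of_int i" by (rule single_of_int)
  then have "of_int i * p = Poly_Mapping.map ((*) i) p"
   unfolding mult_map_scale_conv_mult by (simp only: of_int_eq_id id_apply)
  then show ?thesis by (simp add: Poly_Mapping.map.rep_eq when_def)
 qed
 have "0 = Poly_Mapping.lookup (\<Sum>b\<in>B. of_int (a b) * atom 0 b) (mon n x)" unfolding z by simp
 also have "\<dots> = (\<Sum>b\<in>B. a b * Poly_Mapping.lookup (atom 0 b) (mon n x))" by (simp add: lookup_sum lk)
 also have "\<dots> = (\<Sum>b\<in>B. if b = x then a b else 0)"
 proof (rule sum.cong[OF refl])
  fix b assume b: "b \<in> B"
  show "a b * Poly_Mapping.lookup (atom 0 b) (mon n x) = (if b = x then a b else 0)"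
  proof (cases "a b = 0")
   case False
   then have "?\<phi> b \<le> ?\<phi> x" using x2[of b] b by simp
   then show ?thesis using lookup_atom_mon[OF B(2)[OF b] B(2), of x] x by simp
  qed auto
 qed
 also have "\<dots> = a x" using x B(1) by simp
 finally show False using x by simp
qed

lemma two_strips_expand:
 assumes c: "on {0<..n} c"
 shows "atom 0 c * hp {0<..n} p * hp {0<..n} q =
  (\<Sum>b\<in>{b. on {0<..n} b \<and> sz n b = sz n c + p + q}.
   of_nat (card {d. on {0<..n} d \<and> strip c d \<and> strip d b \<and> sz n d = sz n c + p}) * atom 0 b)"
proof -
 let ?D = "{d. on {0<..n} d \<and> strip c d \<and> sz n d = sz n c + p}"
 let ?B = "{b. on {0<..n} b \<and> sz n b = sz n c + p + q}"
 have fB: "finite ?B" by (rule finite_subset[OF _ finite_on_sz[of 0 n "sz n c + p + q"]]) auto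
 have "atom 0 c * hp {0<..n} p * hp {0<..n} q = (\<Sum>d\<in>?D. atom 0 d * hp {0<..n} q)"
  using pieri[OF c, of p] by (simp add: sum_distrib_right)
 also have "\<dots> = (\<Sum>d\<in>?D. \<Sum>b\<in>{b\<in>?B. strip d b}. atom 0 b)"
 proof (rule sum.cong[OF refl])
  fix d assume d: "d \<in> ?D"
  then have "{b. on {0<..n} b \<and> strip d b \<and> sz n b = sz n d + q} = {b\<in>?B. strip d b}" by auto
  then show "atom 0 d * hp {0<..n} q = (\<Sum>b\<in>{b\<in>?B. strip d b}. atom 0 b)"
   using pieri[of 0 n d q] d by simp
 qed
 also have "\<dots> = (\<Sum>b\<in>?B. of_nat (card {d\<in>?D. strip d b}) * atom 0 b)"
  by (rule sum_swap_card[OF finite_strip fB])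
 also have "\<dots> = (\<Sum>b\<in>?B. of_nat (card {d. on {0<..n} d \<and> strip c d \<and> strip d b \<and> sz n d = sz n c + p}) * atom 0 b)"
 proof (rule sum.cong[OF refl])
  fix b
  have "{d\<in>?D. strip d b} = {d. on {0<..n} d \<and> strip c d \<and> strip d b \<and> sz n d = sz n c + p}" by blast
  then show "of_nat (card {d\<in>?D. strip d b}) * atom 0 b =
   of_nat (card {d. on {0<..n} d \<and> strip c d \<and> strip d b \<and> sz n d = sz n c + p}) * atom 0 b" by simp
 qed
 finally show ?thesis .
qed

text \<open>Multiplication by \<open>hp {0<..n} p\<close> and by \<open>hp {0<..n} q\<close>
  commute; comparing the coefficients of independent atoms gives the symmetry without a bijection
  between the chains.\<close>

lemma two_strips_symmetric:
 assumes c: "on {0<..n} c" and b: "on {0<..n} b" "sz n b = sz n c + p + q"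
 shows "card {d. on {0<..n} d \<and> strip c d \<and> strip d b \<and> sz n d = sz n c + p} =
  card {d. on {0<..n} d \<and> strip c d \<and> strip d b \<and> sz n d = sz n c + q}"
proof -
 let ?B = "{b. on {0<..n} b \<and> sz n b = sz n c + p + q}"
 let ?N = "\<lambda>p b. card {d. on {0<..n} d \<and> strip c d \<and> strip d b \<and> sz n d = sz n c + p}"
 have fB: "finite ?B" by (rule finite_subset[OF _ finite_on_sz[of 0 n "sz n c + p + q"]]) auto
 have B2: "{b. on {0<..n} b \<and> sz n b = sz n c + q + p} = ?B" by auto
 have "atom 0 c * hp {0<..n} p * hp {0<..n} q = atom 0 c * hp {0<..n} q * hp {0<..n} p" by (simp add: mult_ac)
 then have eq: "(\<Sum>b\<in>?B. of_nat (?N p b) * atom 0 b) = (\<Sum>b\<in>?B. of_nat (?N q b) * atom 0 b)"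
  unfolding two_strips_expand[OF c] B2 .
 have "(\<Sum>b\<in>?B. of_int (int (?N p b) - int (?N q b)) * atom 0 b) =
   (\<Sum>b\<in>?B. of_nat (?N p b) * atom 0 b) - (\<Sum>b\<in>?B. of_nat (?N q b) * atom 0 b)"
  by (simp add: sum_subtractf left_diff_distrib)
 then have "(\<Sum>b\<in>?B. of_int (int (?N p b) - int (?N q b)) * atom 0 b) = 0" unfolding eq by simp
 then have "int (?N p b) - int (?N q b) = 0"
  by (rule atoms_independent[OF fB, rotated 1, where a = "\<lambda>b. int (?N p b) - int (?N q b)"]) (use b in auto)
 then show ?thesis by simp
qed

section \<open>Counting lattice chains\<close>

text \<open>Truncated subtraction makes this the number of cells in the columns beyond
  \<open>k\<close>; it is an integer because differences are compared later.\<close>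

definition tl_sz :: "nat \<Rightarrow> nat \<Rightarrow> (nat \<Rightarrow> nat) \<Rightarrow> int" where
 "tl_sz n k d = (\<Sum>r\<in>{1..n}. int (d r - k))"

lemma tl_sz_0: "tl_sz n 0 d = int (sz n d)"
 by (simp add: tl_sz_def sz_def)

lemma tl_sz_max: "k \<le> k' \<Longrightarrow> tl_sz n k' (\<lambda>r. max (d r) k) = tl_sz n k' d"
 unfolding tl_sz_def by (rule sum.cong) auto

lemma tl_sz_Suc: "tl_sz n k d = tl_sz n (Suc k) d + int (card {r\<in>{1..n}. k < d r})"
proof -
 have "tl_sz n k d = (\<Sum>r\<in>{1..n}. int (d r - Suc k) + (if k < d r then 1 else 0))"
  unfolding tl_sz_def by (rule sum.cong) auto
 also have "\<dots> = tl_sz n (Suc k) d + (\<Sum>r\<in>{1..n}. if k < d r then 1 else 0)"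
  unfolding tl_sz_def by (rule sum.distrib)
 also have "(\<Sum>r\<in>{1..n}. if k < d r then 1 else 0) = int (card {r\<in>{1..n}. k < d r})"
  using sum.inter_filter[of "{1..n}" "\<lambda>_. 1::int" "\<lambda>r. k < d r"] by simp
 finally show ?thesis .
qed

lemma strip_le: "strip c d \<Longrightarrow> c r \<le> d r"
 by (simp add: strip_def)

lemma strip_pair: "strip c b \<Longrightarrow> r < s \<Longrightarrow> b s \<le> c r \<or> b r < c s \<or> b r = c r"
 by (simp add: strip_def)

lemma stripI: "(\<And>r. c r \<le> b r) \<Longrightarrow> (\<And>r s. r < s \<Longrightarrow> b s \<le> c r \<or> b r < c s \<or> b r = c r) \<Longrightarrow> strip c b"
 by (simp add: strip_def)

lemma strip_column_unique:
 assumes "strip d b" "d r \<le> k" "k < b r" "d s \<le> k" "k < b s"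
 shows "r = s"
 using strip_pair[OF assms(1), of r s] strip_pair[OF assms(1), of s r] assms(2-) by linarith

lemma strip_column_card:
 assumes "strip d b"
 shows "card {r\<in>{1..n}. k < d r} \<le> card {r\<in>{1..n}. k < b r}"
  and "card {r\<in>{1..n}. k < b r} \<le> Suc (card {r\<in>{1..n}. k < d r})"
proof -
 show "card {r\<in>{1..n}. k < d r} \<le> card {r\<in>{1..n}. k < b r}"
 proof (rule card_mono)
  show "{r\<in>{1..n}. k < d r} \<subseteq> {r\<in>{1..n}. k < b r}"
   using strip_le[OF assms] by (auto intro: less_le_trans)
 qed simp
 have "card {r\<in>{1..n}. k < b r} \<le> card ({r\<in>{1..n}. k < d r} \<union> {r\<in>{1..n}. d r \<le> k \<and> k < b r})"
  by (rule card_mono) auto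
 also have "\<dots> \<le> card {r\<in>{1..n}. k < d r} + card {r\<in>{1..n}. d r \<le> k \<and> k < b r}"
  by (rule card_Un_le)
 also have "card {r\<in>{1..n}. d r \<le> k \<and> k < b r} \<le> 1"
  using strip_column_unique[OF assms] by (auto simp: card_le_Suc0_iff_eq)
 finally show "card {r\<in>{1..n}. k < b r} \<le> Suc (card {r\<in>{1..n}. k < d r})" by simp
qed

text \<open>The boxes of the middle shape in the columns up to \<open>k\<close> are decoupled from those further right:
 they are exactly the two-step chains between the truncations of \<open>c\<close> and \<open>b\<close>.\<close>

lemma strip_truncate:
 assumes d: "strip c d" "strip d b" and L: "\<And>r. c r \<le> k \<Longrightarrow> d r \<le> k"
 defines "c' \<equiv> \<lambda>r. min (c r) (Suc k)" and "b' \<equiv> \<lambda>r. if k < c r then Suc k else min (b r) k"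
  and "d' \<equiv> \<lambda>r. if k < c r then Suc k else d r"
 shows "strip c' d'" "strip d' b'"
proof -
 note le = strip_le[OF d(1)] strip_le[OF d(2)]
 show "strip c' d'"
 proof (rule stripI)
  show "c' r \<le> d' r" for r using le(1)[of r] by (simp add: c'_def d'_def)
  fix r s :: nat assume "r < s"
  then have "d s \<le> c r \<or> d r < c s \<or> d r = c r" by (rule strip_pair[OF d(1)])
  then show "d' s \<le> c' r \<or> d' r < c' s \<or> d' r = c' r"
   using L[of r] L[of s] unfolding c'_def d'_def
   by (cases "k < c r"; cases "k < c s") auto
 qed
 show "strip d' b'"
 proof (rule stripI)
  show "d' r \<le> b' r" for r using le(2)[of r] L[of r] by (simp add: b'_def d'_def)
  fix r s :: nat assume "r < s"
  then have "b s \<le> d r \<or> b r < d s \<or> b r = d r" by (rule strip_pair[OF d(2)])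
  then show "b' s \<le> d' r \<or> b' r < d' s \<or> b' r = d' r"
   using L[of r] L[of s] le(2)[of r] le(2)[of s] unfolding b'_def d'_def
   by (cases "k < c r"; cases "k < c s") auto
 qed
qed

text \<open>Rows with \<open>k < c r\<close> were frozen at length \<open>Suc k\<close>, longer than
  any row stopping within \<open>k\<close> columns; here they take back their values from
  \<open>d0\<close>. In mixed pairs the short row of the middle shape drops out of the condition
  inherited from \<open>d0\<close>.\<close>

lemma strip_untruncate:
 assumes d0: "strip c d0" "strip d0 b" and L: "\<And>r. c r \<le> k \<Longrightarrow> d0 r \<le> k"
 defines "c' \<equiv> \<lambda>r. min (c r) (Suc k)" and "b' \<equiv> \<lambda>r. if k < c r then Suc k else min (b r) k"
 assumes d': "strip c' d'" "strip d' b'"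
 defines "d \<equiv> \<lambda>r. if k < c r then d0 r else d' r"
 shows "strip c d" "strip d b"
proof -
 note le = strip_le[OF d0(1)] strip_le[OF d0(2)]
 have le': "c r \<le> d' r" "d' r \<le> b r" "d' r \<le> k" if "c r \<le> k" for r
  using strip_le[OF d'(1), of r] strip_le[OF d'(2), of r] that by (simp_all add: c'_def b'_def min_def split: if_splits)
 show "strip c d"
 proof (rule stripI)
  show "c r \<le> d r" for r using le(1)[of r] le'(1)[of r] by (simp add: d_def)
  fix r s :: nat assume rs: "r < s"
  show "d s \<le> c r \<or> d r < c s \<or> d r = c r"
  proof (cases "k < c r"; cases "k < c s")
   assume "k < c r" "k < c s" then show ?thesis using strip_pair[OF d0(1) rs] by (simp add: d_def)
  next
   assume "k < c r" "\<not> k < c s" then show ?thesis using le'(3)[of s] by (simp add: d_def)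
  next
   assume "\<not> k < c r" "k < c s" then show ?thesis using le'(3)[of r] by (simp add: d_def)
  next
   assume a: "\<not> k < c r" "\<not> k < c s"
   then have "c' r = c r" "c' s = c s" by (auto simp: c'_def)
   then show ?thesis using a strip_pair[OF d'(1) rs] by (simp add: d_def)
  qed
 qed
 show "strip d b"
 proof (rule stripI)
  show "d r \<le> b r" for r using le(2)[of r] le'(2)[of r] by (simp add: d_def)
  fix r s :: nat assume rs: "r < s"
  note p0 = strip_pair[OF d0(2) rs]
  show "b s \<le> d r \<or> b r < d s \<or> b r = d r"
  proof (cases "k < c r"; cases "k < c s")
   assume "k < c r" "k < c s" then show ?thesis using p0 by (simp add: d_def)
  next
   assume a: "k < c r" "\<not> k < c s"
   then have "k < b r" "d0 s \<le> k" using le[of r] L[of s] by simp_all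
   then show ?thesis using p0 a by (auto simp: d_def)
  next
   assume a: "\<not> k < c r" "k < c s"
   then have "k < b s" "d0 r \<le> k" "k < d0 s" using le[of s] L[of r] by simp_all
   then show ?thesis using p0 a by (auto simp: d_def)
  next
   assume a: "\<not> k < c r" "\<not> k < c s"
   \<comment> \<open>Cutting \<open>b\<close> at \<open>k\<close> would lose the comparison of two
     rows that both go beyond column \<open>k\<close>; but a strip adds at most one cell to column
     \<open>Suc k\<close>.\<close>
   then have one: "\<not> (k < b r \<and> k < b s)" using strip_column_unique[OF d0(2), of r k s] L[of r] L[of s] rs by auto
   have "b' r = min (b r) k" "b' s = min (b s) k" using a by (auto simp: b'_def)
   then show ?thesis using a strip_pair[OF d'(2) rs] le'[of r] le'[of s] one
    by (simp add: d_def min_def split: if_splits; linarith)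
  qed
 qed
qed

lemma strip_on: "strip c b \<Longrightarrow> on U b \<Longrightarrow> on U c"
 using strip_le[of c b] unfolding on_def by (metis le_zero_eq)

text \<open>The two hypotheses on the tails force column \<open>Suc k\<close> to gain no cell in the
  first step and one cell in the second. The columns up to \<open>k\<close> are thereby decoupled,
  and there \<open>two_strips_symmetric\<close> exchanges the two strip sizes. The one extra cell in
  column \<open>Suc k\<close> accounts for the -1 in \<open>ss\<close>.\<close>

lemma reflect_card:
 assumes bn: "on {0<..n} b"
  and viol: "tl_sz n k b - tl_sz n k \<rho> > tl_sz n k \<rho> - tl_sz n k c"
  and nviol: "tl_sz n (Suc k) b - tl_sz n (Suc k) \<rho> \<le> tl_sz n (Suc k) \<rho> - tl_sz n (Suc k) c"
  and ss: "int s + int s' = int (sz n b) + int (sz n c) - 1"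
 shows "card {d. strip c d \<and> strip d b \<and> (\<lambda>r. max (d r) k) = \<rho> \<and> sz n d = s} \<le>
  card {d. strip c d \<and> strip d b \<and> (\<lambda>r. max (d r) k) = \<rho> \<and> sz n d = s'}" (is "card (?S s) \<le> card (?S s')")
proof (cases "?S s = {}")
 case False
 then obtain d0 where d0: "strip c d0" "strip d0 b" "(\<lambda>r. max (d0 r) k) = \<rho>" and sz0: "sz n d0 = s" by blast
 have t: "tl_sz n k \<rho> = tl_sz n k d0" "tl_sz n (Suc k) \<rho> = tl_sz n (Suc k) d0"
  unfolding d0(3)[symmetric] by (simp_all add: tl_sz_max)
 let ?cc = "\<lambda>d. card {r\<in>{1..n}. k < d r}"
 have cc: "?cc c \<le> ?cc d0" "?cc b \<le> Suc (?cc d0)"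
  using strip_column_card[OF d0(1)] strip_column_card[OF d0(2)] by auto
 have A1: "tl_sz n k b - 2 * tl_sz n k \<rho> + tl_sz n k c = 1" and x0: "?cc c = ?cc d0"
  using viol nviol cc tl_sz_Suc[of n k b] tl_sz_Suc[of n k c] tl_sz_Suc[of n k d0] unfolding t by linarith+
 have d0n: "on {0<..n} d0" by (rule strip_on[OF d0(2) bn])
 have cn: "on {0<..n} c" by (rule strip_on[OF d0(1) d0n])
 \<comment> \<open>Column \<open>Suc k\<close> has equally many cells in \<open>c\<close> and in
   \<open>d0\<close>, hence the same ones; so a row of \<open>d0\<close> passes column
   \<open>k\<close> only if it does so in \<open>c\<close>.\<close>
 have L: "d0 r \<le> k" if "c r \<le> k" for r
 proof (rule ccontr)
  assume a: "\<not> d0 r \<le> k"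
  then have r: "r \<in> {1..n}" using onD[OF d0n, of r] by auto
  have "{r\<in>{1..n}. k < c r} \<subset> {r\<in>{1..n}. k < d0 r}"
  proof (rule psubsetI)
   show "{r\<in>{1..n}. k < c r} \<subseteq> {r\<in>{1..n}. k < d0 r}" using strip_le[OF d0(1)] by (auto intro: less_le_trans)
   have "r \<in> {r\<in>{1..n}. k < d0 r}" "r \<notin> {r\<in>{1..n}. k < c r}" using a that r by auto
   then show "{r\<in>{1..n}. k < c r} \<noteq> {r\<in>{1..n}. k < d0 r}" by blast
  qed
  then have "?cc c < ?cc d0" by (rule psubset_card_mono[rotated]) simp
  then show False using x0 by simp
 qed
 define c' where "c' = (\<lambda>r. min (c r) (Suc k))"
 define b' where "b' = (\<lambda>r. if k < c r then Suc k else min (b r) k)"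
 let ?f = "\<lambda>d r. if k < c r then Suc k else d r"
 let ?g = "\<lambda>d r. if k < c r then d0 r else d r"
 \<comment> \<open>\<open>K1\<close>, \<open>K2\<close> and \<open>K3\<close> are the numbers of
   cells cut off from the middle shape, from \<open>c\<close> and from \<open>b\<close>. All middle
   shapes of the fibre lose the same \<open>K1\<close>, and \<open>A1\<close> becomes a relation
   between the three numbers.\<close>
 define K1 where "K1 = (\<Sum>r\<in>{1..n}. if k < c r then int (d0 r) - int (Suc k) else 0)"
 define K2 where "K2 = (\<Sum>r\<in>{1..n}. if k < c r then int (c r) - int (Suc k) else 0)"
 define K3 where "K3 = (\<Sum>r\<in>{1..n}. if k < c r then int (b r) - int (Suc k) else int (b r) - int (min (b r) k))"
 have le0: "c r \<le> d0 r" "d0 r \<le> b r" for r using strip_le[OF d0(1)] strip_le[OF d0(2)] by auto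
 have c'n: "on {0<..n} c'" using cn by (simp add: on_def c'_def)
 have b'n: "on {0<..n} b'" using cn bn by (simp add: on_def b'_def)
 have szc: "int (sz n c') = int (sz n c) - K2"
  unfolding sz_def K2_def of_nat_sum sum_subtractf[symmetric] by (rule sum.cong) (auto simp: c'_def)
 have szb: "int (sz n b') = int (sz n b) - K3"
  unfolding sz_def K3_def of_nat_sum sum_subtractf[symmetric] by (rule sum.cong) (auto simp: b'_def)
 have K: "K3 + K2 - 2 * K1 = 1"
 proof -
  have "K3 + K2 - 2 * K1 = (\<Sum>r\<in>{1..n}. int (b r - k) - 2 * int (d0 r - k) + int (c r - k))"
   unfolding K1_def K2_def K3_def sum_distrib_left sum.distrib[symmetric] sum_subtractf[symmetric]
  proof (rule sum.cong[OF refl])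
   fix r
   show "(if k < c r then int (b r) - int (Suc k) else int (b r) - int (min (b r) k)) +
     (if k < c r then int (c r) - int (Suc k) else 0) - 2 * (if k < c r then int (d0 r) - int (Suc k) else 0) =
     int (b r - k) - 2 * int (d0 r - k) + int (c r - k)"
    using L[of r] le0[of r] by (cases "k < c r") (auto simp: of_nat_diff)
  qed
  also have "\<dots> = 1"
   using A1[unfolded t] unfolding tl_sz_def by (simp add: sum.distrib sum_subtractf sum_distrib_left)
  finally show ?thesis .
 qed
 have S: "d r = d0 r" if "(\<lambda>r. max (d r) k) = \<rho>" "k < c r" "c r \<le> d r" for d r
 proof -
  have "max (d r) k = max (d0 r) k" using that(1) d0(3) by metis
  then show ?thesis using that(2,3) le0[of r] by simp
 qed
 have Lk: "d r \<le> k" if "(\<lambda>r. max (d r) k) = \<rho>" "c r \<le> k" for d r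
 proof -
  have "max (d r) k = max (d0 r) k" using that(1) d0(3) by metis
  then show ?thesis using L[OF that(2)] by simp
 qed
 have szd: "int (sz n (?f d)) = int (sz n d) - K1" if "\<And>r. k < c r \<Longrightarrow> d r = d0 r" for d
  unfolding sz_def K1_def of_nat_sum sum_subtractf[symmetric] by (rule sum.cong) (use that in auto)
 let ?T = "\<lambda>p. {d'. on {0<..n} d' \<and> strip c' d' \<and> strip d' b' \<and> sz n d' = sz n c' + p}"
 have bij: "bij_betw ?f (?S u) (?T p)" if up: "int p = int u - K1 - int (sz n c')" for u p
 proof (rule bij_betw_byWitness[where f' = ?g])
  show "\<forall>d\<in>?S u. ?g (?f d) = d"
  proof
   fix d assume d: "d \<in> ?S u"
   have "d0 r = d r" if "k < c r" for r using S[of d r] strip_le[of c d r] that d by auto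
   then show "?g (?f d) = d" by auto
  qed
  show "\<forall>d'\<in>?T p. ?f (?g d') = d'"
  proof
   fix d' assume d': "d' \<in> ?T p"
   have "d' r = Suc k" if "k < c r" for r
    using strip_le[of c' d' r] strip_le[of d' b' r] d' that by (auto simp: c'_def b'_def)
   then show "?f (?g d') = d'" by auto
  qed
  show "?f ` ?S u \<subseteq> ?T p"
  proof
   fix e assume "e \<in> ?f ` ?S u"
   then obtain d where e: "e = ?f d" and d: "strip c d" "strip d b" "(\<lambda>r. max (d r) k) = \<rho>" "sz n d = u" by auto
   have "strip c' e" "strip e b'" unfolding e c'_def b'_def using strip_truncate[OF d(1,2) Lk[OF d(3)]] by auto
   moreover have "int (sz n e) = int (sz n c' + p)"
    unfolding e using szd[OF S[OF d(3) _ strip_le[OF d(1)]]] d(4) up by simp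
   ultimately show "e \<in> ?T p" using strip_on[OF _ b'n] by simp
  qed
  show "?g ` ?T p \<subseteq> ?S u"
  proof
   fix d assume "d \<in> ?g ` ?T p"
   then obtain d' where e: "d = ?g d'" and d': "strip c' d'" "strip d' b'" "sz n d' = sz n c' + p" by auto
   have st: "strip c d" "strip d b" unfolding e
    using strip_untruncate[OF d0(1,2) L d'(1)[unfolded c'_def] d'(2)[unfolded b'_def]] by auto
   have d'k: "d' r \<le> k" if "c r \<le> k" for r using strip_le[OF d'(2), of r] that by (simp add: b'_def)
   have "max (d r) k = \<rho> r" for r
    using d'k[of r] L[of r] unfolding e d0(3)[symmetric] by (cases "k < c r") auto
   then have "(\<lambda>r. max (d r) k) = \<rho>" by blast
   moreover have "sz n d = u"
   proof -
    have "?f d = d'"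
    proof
     fix r show "?f d r = d' r"
      using strip_le[OF d'(1), of r] strip_le[OF d'(2), of r] by (auto simp: e c'_def b'_def)
    qed
    then have "int (sz n d') = int (sz n d) - K1" using szd[of d] e by simp
    then show ?thesis using d'(3) up by simp
   qed
   ultimately show "d \<in> ?S u" using st by blast
  qed
 qed
 define p where "p = nat (int s - K1 - int (sz n c'))"
 have "int (sz n c') \<le> int (sz n (?f d0))"
  using strip_truncate(1)[OF d0(1,2) L] unfolding c'_def by (auto intro: sz_mono strip_le)
 then have p: "int p = int s - K1 - int (sz n c')" using szd[of d0] sz0 by (simp add: p_def)
 have "int (sz n (?f d0)) \<le> int (sz n b')"
  using strip_truncate(2)[OF d0(1,2) L] unfolding b'_def by (auto intro: sz_mono strip_le)
 then have "0 \<le> int s' - K1 - int (sz n c')" using szd[of d0] sz0 ss K szc szb by simp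
 then obtain q where q: "int q = int s' - K1 - int (sz n c')" using nonneg_int_cases by metis
 have "sz n b' = sz n c' + p + q" using p q ss K szc szb by linarith
 then have "card (?T p) = card (?T q)" by (rule two_strips_symmetric[OF c'n b'n])
 then show ?thesis using bij_betw_same_card[OF bij[OF p]] bij_betw_same_card[OF bij[OF q]] by simp
next
 case True
 then show ?thesis by (simp only: card.empty)
qed

section \<open>Chains of strips and products with complete homogeneous polynomials\<close>

definition chains :: "(nat \<Rightarrow> nat) \<Rightarrow> (nat \<Rightarrow> nat) \<Rightarrow> nat \<Rightarrow> (nat \<Rightarrow> nat \<Rightarrow> nat) set" where
 "chains c b l = {D. D 0 = c \<and> (\<forall>i\<ge>l. D i = b) \<and> (\<forall>i<l. strip (D i) (D (Suc i)))}"

text \<open>The step sizes are integers because the dotted action of permutations produces negative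
  ones, for which there is no chain.\<close>

definition chs :: "nat \<Rightarrow> (nat \<Rightarrow> nat) \<Rightarrow> (nat \<Rightarrow> nat) \<Rightarrow> nat \<Rightarrow> (nat \<Rightarrow> int) \<Rightarrow> (nat \<Rightarrow> nat \<Rightarrow> nat) set" where
 "chs n c b l al = {D\<in>chains c b l. \<forall>i<l. int (sz n (D (Suc i))) - int (sz n (D i)) = al i}"

definition hz :: "nat \<Rightarrow> int \<Rightarrow> Defs.poly" where
 "hz n k = (if k < 0 then 0 else hp {0<..n} (nat k))"

lemma chains_le: assumes "D \<in> chains c b l" shows "D i r \<le> b r"
proof (cases "i \<le> l")
 case True
 then show ?thesis
 proof (induction i rule: inc_induct)
  case (step i)
  have "D i r \<le> D (Suc i) r" using assms step by (auto simp: chains_def intro: strip_le)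
  then show ?case using step by simp
 qed (use assms in \<open>simp add: chains_def\<close>)
qed (use assms in \<open>simp add: chains_def\<close>)

lemma chains_on: assumes "D \<in> chains c b l" "on U b" shows "on U (D i)"
 using chains_le[OF assms(1)] assms(2) unfolding on_def by (metis le_zero_eq)

lemma finite_chains: assumes "on {0<..n} b" shows "finite (chains c b l)"
proof -
 let ?S = "{d. on {0<..n} d \<and> sz n d \<le> sz n b}"
 have "finite ?S" by (rule finite_on_sz)
 have "chains c b l \<subseteq> {D. \<forall>i. (i \<in> {..<l} \<longrightarrow> D i \<in> ?S) \<and> (i \<notin> {..<l} \<longrightarrow> D i = b)}"
 proof
  fix D assume D: "D \<in> chains c b l"
  have "D i \<in> ?S" for i using chains_on[OF D assms] chains_le[OF D] by (auto intro: sz_mono)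
  then show "D \<in> {D. \<forall>i. (i \<in> {..<l} \<longrightarrow> D i \<in> ?S) \<and> (i \<notin> {..<l} \<longrightarrow> D i = b)}"
   using D by (auto simp: chains_def)
 qed
 moreover have "finite {D. \<forall>i. (i \<in> {..<l} \<longrightarrow> D i \<in> ?S) \<and> (i \<notin> {..<l} \<longrightarrow> D i = b)}"
  by (rule finite_set_of_finite_funs) (use \<open>finite ?S\<close> in auto)
 ultimately show ?thesis by (rule finite_subset)
qed

lemma finite_chs: "on {0<..n} b \<Longrightarrow> finite (chs n c b l al)"
 unfolding chs_def using finite_chains by simp

lemma finite_size: "finite {b. on {0<..n} b \<and> int (sz n b) = s}"
 by (rule finite_subset[OF _ finite_on_sz[of 0 n "nat s"]]) auto

lemma card_chs_Suc:
 assumes b: "on {0<..n} b"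
 shows "card (chs n c b (Suc l) al) =
  (\<Sum>d\<in>{d. on {0<..n} d \<and> strip d b \<and> int (sz n b) = int (sz n d) + al l}. card (chs n c d l al))"
proof -
 let ?I = "{d. on {0<..n} d \<and> strip d b \<and> int (sz n b) = int (sz n d) + al l}"
 let ?f = "\<lambda>(d::nat \<Rightarrow> nat, D) i. if i \<le> l then D i else b"
 have fI: "finite ?I" by (rule finite_subset[OF _ finite_size[of n "int (sz n b) - al l"]]) auto
 have "bij_betw ?f (Sigma ?I (\<lambda>d. chs n c d l al)) (chs n c b (Suc l) al)"
 proof (rule bij_betw_byWitness[where f' = "\<lambda>D. (D l, \<lambda>i. D (min i l))"])
  show "\<forall>a\<in>Sigma ?I (\<lambda>d. chs n c d l al). ((?f a) l, \<lambda>i. (?f a) (min i l)) = a"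
  proof
   fix a assume "a \<in> Sigma ?I (\<lambda>d. chs n c d l al)"
   then obtain d D where a: "a = (d, D)" and D: "\<forall>i\<ge>l. D i = d" by (auto simp: chs_def chains_def)
   have "D (min i l) = D i" for i using D by (cases "i \<le> l") (auto simp: min_def)
   then show "((?f a) l, \<lambda>i. (?f a) (min i l)) = a" using D a by auto
  qed
  show "\<forall>D\<in>chs n c b (Suc l) al. ?f (D l, \<lambda>i. D (min i l)) = D"
  proof
   fix D assume "D \<in> chs n c b (Suc l) al"
   then have "\<forall>i\<ge>Suc l. D i = b" by (simp add: chs_def chains_def)
   then show "?f (D l, \<lambda>i. D (min i l)) = D" by (auto simp: fun_eq_iff not_le Suc_le_eq)
  qed
  show "?f ` Sigma ?I (\<lambda>d. chs n c d l al) \<subseteq> chs n c b (Suc l) al"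
  proof
   fix E assume "E \<in> ?f ` Sigma ?I (\<lambda>d. chs n c d l al)"
   then obtain d D where E: "E = (\<lambda>i. if i \<le> l then D i else b)" and d: "strip d b" "int (sz n b) = int (sz n d) + al l"
    and D: "D 0 = c" "\<forall>i\<ge>l. D i = d" "\<forall>i<l. strip (D i) (D (Suc i))"
    "\<forall>i<l. int (sz n (D (Suc i))) - int (sz n (D i)) = al i" by (auto simp: chs_def chains_def)
   have "strip (E i) (E (Suc i)) \<and> int (sz n (E (Suc i))) - int (sz n (E i)) = al i" if "i < Suc l" for i
    using D d that by (cases "i = l") (auto simp: E)
   then show "E \<in> chs n c b (Suc l) al" using D by (auto simp: chs_def chains_def E)
  qed
  show "(\<lambda>D. (D l, \<lambda>i. D (min i l))) ` chs n c b (Suc l) al \<subseteq> Sigma ?I (\<lambda>d. chs n c d l al)"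
  proof
   fix a assume "a \<in> (\<lambda>D. (D l, \<lambda>i. D (min i l))) ` chs n c b (Suc l) al"
   then obtain D where a: "a = (D l, \<lambda>i. D (min i l))" and D: "D \<in> chs n c b (Suc l) al" by auto
   then have DC: "D \<in> chains c b (Suc l)" and sz: "\<forall>i<Suc l. int (sz n (D (Suc i))) - int (sz n (D i)) = al i"
    by (auto simp: chs_def)
   have "on {0<..n} (D l)" by (rule chains_on[OF DC b])
   moreover have "strip (D l) b" "int (sz n b) = int (sz n (D l)) + al l"
    using DC sz[rule_format, of l] by (auto simp: chains_def)
   moreover have "(\<lambda>i. D (min i l)) \<in> chs n c (D l) l al"
    using DC sz by (auto simp: chs_def chains_def min_def)
   ultimately show "a \<in> Sigma ?I (\<lambda>d. chs n c d l al)" using a by simp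
  qed
 qed
 then have "card (chs n c b (Suc l) al) = card (Sigma ?I (\<lambda>d. chs n c d l al))"
  by (simp add: bij_betw_same_card)
 also have "\<dots> = (\<Sum>d\<in>?I. card (chs n c d l al))"
  by (rule card_SigmaI[OF fI]) (auto intro: finite_chs)
 finally show ?thesis .
qed

lemma atom_times_hs:
 assumes c: "on {0<..n} c"
 shows "atom 0 c * (\<Prod>i<l. hz n (al i)) =
  (\<Sum>b\<in>{b. on {0<..n} b \<and> int (sz n b) = int (sz n c) + (\<Sum>i<l. al i)}. of_nat (card (chs n c b l al)) * atom 0 b)"
proof (induction l)
 case 0
 have ch: "chs n c b 0 al = (if b = c then {\<lambda>_. c} else {})" for b by (auto simp: chs_def chains_def)
 have fin: "finite {b. on {0<..n} b \<and> int (sz n b) = int (sz n c)}" by (rule finite_size)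
 have "(\<Sum>b\<in>{b. on {0<..n} b \<and> int (sz n b) = int (sz n c)}. of_nat (card (chs n c b 0 al)) * atom 0 b) =
  (\<Sum>b\<in>{b. on {0<..n} b \<and> int (sz n b) = int (sz n c)}. if b = c then atom 0 b else 0)"
  by (rule sum.cong) (auto simp: ch)
 also have "\<dots> = atom 0 c" unfolding sum.delta[OF fin] using c by simp
 finally show ?case by simp
next
 case (Suc l)
 let ?D = "{d. on {0<..n} d \<and> int (sz n d) = int (sz n c) + (\<Sum>i<l. al i)}"
 let ?B = "{b. on {0<..n} b \<and> int (sz n b) = int (sz n c) + (\<Sum>i<Suc l. al i)}"
 let ?N = "\<lambda>d. of_nat (card (chs n c d l al)) :: Defs.poly"
 have "atom 0 c * (\<Prod>i<Suc l. hz n (al i)) = (\<Sum>d\<in>?D. ?N d * (atom 0 d * hz n (al l)))"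
  using Suc by (simp add: mult.assoc[symmetric] sum_distrib_right)
 also have "\<dots> = (\<Sum>d\<in>?D. \<Sum>b\<in>?B. if strip d b then ?N d * atom 0 b else 0)"
 proof (rule sum.cong[OF refl])
  fix d assume d: "d \<in> ?D"
  have "atom 0 d * hz n (al l) = (\<Sum>b\<in>{b\<in>?B. strip d b}. atom 0 b)"
  proof (cases "al l < 0")
   case True
   have "\<not> strip d b" if "b \<in> ?B" for b
   proof
    assume "strip d b"
    then have "sz n d \<le> sz n b" by (intro sz_mono strip_le)
    then show False using that d True by simp
   qed
   then have e: "{b\<in>?B. strip d b} = {}" by blast
   show ?thesis unfolding e using True by (simp add: hz_def)
  next
   case False
   have "{b. on {0<..n} b \<and> strip d b \<and> sz n b = sz n d + nat (al l)} = {b\<in>?B. strip d b}" using d False by auto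
   then show ?thesis using pieri[of 0 n d "nat (al l)"] d False by (simp add: hz_def)
  qed
  then have "?N d * (atom 0 d * hz n (al l)) = (\<Sum>b\<in>{b\<in>?B. strip d b}. ?N d * atom 0 b)"
   by (simp add: sum_distrib_left)
  also have "\<dots> = (\<Sum>b\<in>?B. if strip d b then ?N d * atom 0 b else 0)"
   by (rule sum.inter_filter[OF finite_size])
  finally show "?N d * (atom 0 d * hz n (al l)) = (\<Sum>b\<in>?B. if strip d b then ?N d * atom 0 b else 0)" .
 qed
 also have "\<dots> = (\<Sum>b\<in>?B. \<Sum>d\<in>?D. if strip d b then ?N d * atom 0 b else 0)" by (rule sum.swap)
 also have "\<dots> = (\<Sum>b\<in>?B. of_nat (card (chs n c b (Suc l) al)) * atom 0 b)"
 proof (rule sum.cong[OF refl])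
  fix b assume b: "b \<in> ?B"
  have "(\<Sum>d\<in>?D. if strip d b then ?N d * atom 0 b else 0) = (\<Sum>d\<in>{d\<in>?D. strip d b}. ?N d * atom 0 b)"
   by (rule sum.inter_filter[symmetric, OF finite_size])
  also have "{d\<in>?D. strip d b} = {d. on {0<..n} d \<and> strip d b \<and> int (sz n b) = int (sz n d) + al l}"
   using b by auto
  also have "(\<Sum>d\<in>{d. on {0<..n} d \<and> strip d b \<and> int (sz n b) = int (sz n d) + al l}. ?N d * atom 0 b) =
    of_nat (card (chs n c b (Suc l) al)) * atom 0 b"
   using card_chs_Suc[of n b c l al] b by (simp add: sum_distrib_right)
  finally show "(\<Sum>d\<in>?D. if strip d b then ?N d * atom 0 b else 0) = of_nat (card (chs n c b (Suc l) al)) * atom 0 b" .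
 qed
 finally show ?case .
qed

text \<open>The letter added at step \<open>i\<close> of a chain of length \<open>l\<close> is \<open>l - i\<close>; \<open>cn\<close> counts it in the columns beyond \<open>k\<close>.\<close>

definition cn :: "nat \<Rightarrow> (nat \<Rightarrow> nat \<Rightarrow> nat) \<Rightarrow> nat \<Rightarrow> nat \<Rightarrow> int" where
 "cn n D k i = tl_sz n k (D (Suc i)) - tl_sz n k (D i)"

text \<open>For the letters of the chain: the columns beyond \<open>k\<close> contain more copies of
  \<open>l - Suc i\<close> than of \<open>l - i\<close>.\<close>

definition viol :: "nat \<Rightarrow> nat \<Rightarrow> (nat \<Rightarrow> nat \<Rightarrow> nat) \<Rightarrow> nat \<Rightarrow> nat \<Rightarrow> bool" where
 "viol n l D k i \<longleftrightarrow> Suc i < l \<and> cn n D k i < cn n D k (Suc i)"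

definition lattice :: "nat \<Rightarrow> nat \<Rightarrow> (nat \<Rightarrow> nat \<Rightarrow> nat) \<Rightarrow> bool" where
 "lattice n l D \<longleftrightarrow> (\<forall>k i. \<not> viol n l D k i)"

text \<open>The violation with the largest \<open>k\<close>, and among these the smallest step, is
  singled out. Which one this is depends only on the columns beyond \<open>k\<close>, so it is
  unchanged when the middle shape varies in the first \<open>k\<close> columns.\<close>

definition bad :: "nat \<Rightarrow> (nat \<Rightarrow> nat) \<Rightarrow> (nat \<Rightarrow> nat) \<Rightarrow> nat \<Rightarrow> (nat \<Rightarrow> int) \<Rightarrow> nat \<Rightarrow> nat \<Rightarrow> (nat \<Rightarrow> nat \<Rightarrow> nat) set" where
 "bad n c b l al k i = {D\<in>chs n c b l al. viol n l D k i \<and> (\<forall>k'>k. \<forall>i'. \<not> viol n l D k' i') \<and> (\<forall>i'<i. \<not> viol n l D k i')}"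

lemma tl_sz_mono: "(\<And>r. d r \<le> b r) \<Longrightarrow> tl_sz n k d \<le> tl_sz n k b"
 unfolding tl_sz_def by (rule sum_mono) (simp add: diff_le_mono)

lemma tl_sz_diff_le:
 assumes "\<And>r. d r \<le> b r"
 shows "tl_sz n k b - tl_sz n k d \<le> int (sz n b) - int (sz n d)"
 unfolding tl_sz_def sz_def of_nat_sum sum_subtractf[symmetric]
proof (rule sum_mono)
 fix r show "int (b r - k) - int (d r - k) \<le> int (b r) - int (d r)" using assms[of r] by linarith
qed

lemma card_le_fibres:
 assumes "finite A" "finite B" and "\<And>x. x \<in> A \<Longrightarrow> card {a\<in>A. f a = f x} \<le> card {b\<in>B. g b = f x}"
 shows "card A \<le> card B"
proof -
 have "card A = (\<Sum>q\<in>f ` A. card {a\<in>A. f a = q})" using card_eq_sum sum.image_gen[OF assms(1), of "\<lambda>_. 1::nat" f] by simp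
 also have "\<dots> \<le> (\<Sum>q\<in>f ` A. card {b\<in>B. g b = q})" by (rule sum_mono) (use assms(3) in auto)
 also have "\<dots> = card (\<Union>q\<in>f ` A. {b\<in>B. g b = q})"
  by (rule card_UN_disjoint[symmetric]) (use assms in auto)
 also have "\<dots> \<le> card B" by (rule card_mono) (use assms in auto)
 finally show ?thesis .
qed

text \<open>The map \<open>?\<pi>\<close> forgets the first \<open>k\<close> columns of
  \<open>D (Suc i)\<close>. Inside a fibre the violations beyond \<open>k\<close> do not change and
  \<open>reflect_card\<close> applies. The new step sizes are those of the dotted action of the
  transposition of \<open>i\<close> and \<open>Suc i\<close>.\<close>

lemma card_bad_le:
 assumes b: "on {0<..n} b"
 shows "card (bad n c b l al k i) \<le> card (bad n c b l (al(i := al (Suc i) - 1, Suc i := al i + 1)) k i)"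
  (is "card ?A \<le> card ?B")
proof (rule card_le_fibres)
 let ?\<pi> = "\<lambda>D::nat \<Rightarrow> nat \<Rightarrow> nat. D(Suc i := (\<lambda>r. max (D (Suc i) r) k))"
 let ?al = "al(i := al (Suc i) - 1, Suc i := al i + 1)"
 show "finite ?A" "finite ?B" unfolding bad_def using finite_chs[OF b] by auto
 fix D0 assume D0: "D0 \<in> ?A"
 have ch: "D0 0 = c" "\<And>j. l \<le> j \<Longrightarrow> D0 j = b" "\<And>j. j < l \<Longrightarrow> strip (D0 j) (D0 (Suc j))"
  and sz0: "\<And>j. j < l \<Longrightarrow> int (sz n (D0 (Suc j))) - int (sz n (D0 j)) = al j"
  and v0: "viol n l D0 k i" "\<And>k' i'. k < k' \<Longrightarrow> \<not> viol n l D0 k' i'" "\<And>i'. i' < i \<Longrightarrow> \<not> viol n l D0 k i'"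
  and DC: "D0 \<in> chains c b l"
  using D0 by (auto simp: bad_def chs_def chains_def)
 have il: "Suc i < l" using v0(1) by (simp add: viol_def)
 define c1 where "c1 = D0 i"
 define d1 where "d1 = D0 (Suc i)"
 define b1 where "b1 = D0 (Suc (Suc i))"
 define \<rho> where "\<rho> = (\<lambda>r. max (d1 r) k)"
 let ?S = "\<lambda>s. {d. strip c1 d \<and> strip d b1 \<and> (\<lambda>r. max (d r) k) = \<rho> \<and> sz n d = s}"
 have st: "strip c1 d1" "strip d1 b1" using ch(3)[of i] ch(3)[of "Suc i"] il by (simp_all add: c1_def d1_def b1_def)
 have b1: "on {0<..n} b1" unfolding b1_def by (rule chains_on[OF DC b])
 have szs: "int (sz n d1) - int (sz n c1) = al i" "int (sz n b1) - int (sz n d1) = al (Suc i)"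
  using sz0[of i] sz0[of "Suc i"] il by (simp_all add: c1_def d1_def b1_def)
 have tl\<rho>: "tl_sz n k' \<rho> = tl_sz n k' d1" if "k \<le> k'" for k' unfolding \<rho>_def by (rule tl_sz_max[OF that])
 have viol: "tl_sz n k b1 - tl_sz n k \<rho> > tl_sz n k \<rho> - tl_sz n k c1"
  using v0(1) unfolding viol_def cn_def tl\<rho>[OF order_refl] c1_def d1_def b1_def by simp
 have nviol: "tl_sz n (Suc k) b1 - tl_sz n (Suc k) \<rho> \<le> tl_sz n (Suc k) \<rho> - tl_sz n (Suc k) c1"
  using v0(2)[of "Suc k" i] il unfolding viol_def cn_def tl\<rho>[OF le_SucI[OF order_refl]] c1_def d1_def b1_def by simp
 have "tl_sz n k c1 \<le> tl_sz n k d1" by (rule tl_sz_mono) (rule strip_le[OF st(1)])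
 then have "0 < tl_sz n k b1 - tl_sz n k d1" using viol unfolding tl\<rho>[OF order_refl] by simp
 also have "\<dots> \<le> int (sz n b1) - int (sz n d1)" by (rule tl_sz_diff_le) (rule strip_le[OF st(2)])
 finally have "0 \<le> int (sz n b1) + int (sz n c1) - 1 - int (sz n d1)" by simp
 then obtain s' where s': "int s' = int (sz n b1) + int (sz n c1) - 1 - int (sz n d1)" using nonneg_int_cases by metis
 have "card {D\<in>?A. ?\<pi> D = ?\<pi> D0} \<le> card (?S (sz n d1))"
 proof (rule card_inj_on_le[where f = "\<lambda>D. D (Suc i)"])
  have fS: "finite (?S s)" for s
  proof (rule finite_subset[OF _ finite_on_sz[of 0 n s]])
   show "?S s \<subseteq> {d. on {0<..n} d \<and> sz n d \<le> s}" using strip_on[OF _ b1] by auto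
  qed
  then show "finite (?S (sz n d1))" .
  show "inj_on (\<lambda>D. D (Suc i)) {D\<in>?A. ?\<pi> D = ?\<pi> D0}"
  proof (rule inj_onI)
   fix D E assume D: "D \<in> {D\<in>?A. ?\<pi> D = ?\<pi> D0}" and E: "E \<in> {D\<in>?A. ?\<pi> D = ?\<pi> D0}" and e: "D (Suc i) = E (Suc i)"
   show "D = E"
   proof
    fix j
    have "?\<pi> D j = ?\<pi> E j" using D E by simp
    then show "D j = E j" using e by (cases "j = Suc i") auto
   qed
  qed
  show "(\<lambda>D. D (Suc i)) ` {D\<in>?A. ?\<pi> D = ?\<pi> D0} \<subseteq> ?S (sz n d1)"
  proof
   fix d assume "d \<in> (\<lambda>D. D (Suc i)) ` {D\<in>?A. ?\<pi> D = ?\<pi> D0}"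
   then obtain D where d: "d = D (Suc i)" and D: "D \<in> ?A" and e: "?\<pi> D = ?\<pi> D0" by auto
   have ej: "D j = D0 j" if "j \<noteq> Suc i" for j using fun_cong[OF e, of j] that by simp
   have "\<And>j. j < l \<Longrightarrow> strip (D j) (D (Suc j))" and sD: "\<And>j. j < l \<Longrightarrow> int (sz n (D (Suc j))) - int (sz n (D j)) = al j"
    using D by (auto simp: bad_def chs_def chains_def)
   then have "strip c1 d" "strip d b1" using il ej[of i] ej[of "Suc (Suc i)"] unfolding c1_def b1_def d
    by (metis Suc_lessD n_not_Suc_n, metis n_not_Suc_n)
   moreover have "(\<lambda>r. max (d r) k) = \<rho>" using fun_cong[OF e, of "Suc i"] by (simp add: d \<rho>_def d1_def)
   moreover have "sz n d = sz n d1" using sD[of i] szs(1) il ej[of i] by (simp add: d c1_def)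
   ultimately show "d \<in> ?S (sz n d1)" by simp
  qed
 qed
 also have "card (?S (sz n d1)) \<le> card (?S s')"
  by (rule reflect_card[OF b1 viol nviol]) (use s' in simp)
 also have "card (?S s') \<le> card {D\<in>?B. ?\<pi> D = ?\<pi> D0}"
 proof (rule card_inj_on_le[where f = "\<lambda>d. D0(Suc i := d)"])
  show "finite {D\<in>?B. ?\<pi> D = ?\<pi> D0}" unfolding bad_def using finite_chs[OF b] by auto
  show "inj_on (\<lambda>d. D0(Suc i := d)) (?S s')"
   by (rule inj_onI) (metis fun_upd_same)
  show "(\<lambda>d. D0(Suc i := d)) ` ?S s' \<subseteq> {D\<in>?B. ?\<pi> D = ?\<pi> D0}"
  proof
   fix D assume "D \<in> (\<lambda>d. D0(Suc i := d)) ` ?S s'"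
   then obtain d where D: "D = D0(Suc i := d)" and d: "strip c1 d" "strip d b1" "(\<lambda>r. max (d r) k) = \<rho>" "sz n d = s'" by auto
   have Dj: "D j = D0 j" if "j \<noteq> Suc i" for j using that by (simp add: D)
   have Di: "D (Suc i) = d" by (simp add: D)
   have "strip (D j) (D (Suc j)) \<and> int (sz n (D (Suc j))) - int (sz n (D j)) = ?al j" if j: "j < l" for j
   proof -
    consider "j = i" | "j = Suc i" | "j \<noteq> i" "j \<noteq> Suc i" by blast
    then show ?thesis
    proof cases
     case 1 then show ?thesis using d s' szs by (simp add: D c1_def)
    next
     case 2 then show ?thesis using d s' szs by (simp add: D b1_def)
    next
     case 3 then show ?thesis using ch(3)[OF j] sz0[OF j] by (simp add: D)
    qed
   qed
   then have "D \<in> chs n c b l ?al" using ch(1,2) il by (auto simp: chs_def chains_def D)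
   moreover have tl: "tl_sz n k' (D j) = tl_sz n k' (D0 j)" if "k \<le> k'" for k' j
   proof (cases "j = Suc i")
    case True
    have "tl_sz n k' d = tl_sz n k' (\<lambda>r. max (d r) k)" by (rule tl_sz_max[OF that, symmetric])
    also have "\<dots> = tl_sz n k' d1" unfolding d(3) by (rule tl\<rho>[OF that])
    finally show ?thesis using True by (simp add: D d1_def)
   qed (simp add: D)
   have vi: "viol n l D k' j = viol n l D0 k' j" if "k \<le> k'" for k' j
    unfolding viol_def cn_def tl[OF that] ..
   ultimately have "D \<in> ?B" using v0 by (auto simp: bad_def vi)
   moreover have "?\<pi> D = ?\<pi> D0" using d(3) by (simp add: D \<rho>_def d1_def)
   ultimately show "D \<in> {D\<in>?B. ?\<pi> D = ?\<pi> D0}" by simp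
  qed
 qed
 finally show "card {D\<in>?A. ?\<pi> D = ?\<pi> D0} \<le> card {D\<in>?B. ?\<pi> D = ?\<pi> D0}" .
qed

lemma card_bad_swap:
 assumes "on {0<..n} b"
 shows "card (bad n c b l (al(i := al (Suc i) - 1, Suc i := al i + 1)) k i) = card (bad n c b l al k i)"
proof (rule antisym)
 let ?al = "al(i := al (Suc i) - 1, Suc i := al i + 1)"
 have "?al(i := ?al (Suc i) - 1, Suc i := ?al i + 1) = al" by auto
 then show "card (bad n c b l ?al k i) \<le> card (bad n c b l al k i)"
  using card_bad_le[OF assms, of c l ?al k i] by simp
qed (rule card_bad_le[OF assms])

lemma viol_less:
 assumes D: "D \<in> chains c b l" and b: "on {0<..n} b" and v: "viol n l D k i"
 shows "k < sz n b"
proof (rule ccontr)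
 assume a: "\<not> k < sz n b"
 have "tl_sz n k (D j) = 0" for j
  unfolding tl_sz_def
 proof (rule sum.neutral, rule ballI)
  fix r assume r: "r \<in> {1..n}"
  have "D j r \<le> b r" by (rule chains_le[OF D])
  also have "b r \<le> sz n b" unfolding sz_def by (rule member_le_sum) (use r in auto)
  finally show "int (D j r - k) = 0" using a by simp
 qed
 then show False using v by (simp add: viol_def cn_def)
qed

lemma card_chs_split:
 assumes b: "on {0<..n} b"
 shows "card (chs n c b l al) = card {D\<in>chs n c b l al. lattice n l D} +
  (\<Sum>(k, i)\<in>{..<sz n b} \<times> {..<l}. card (bad n c b l al k i))"
proof -
 let ?I = "{..<sz n b} \<times> {..<l}"
 let ?U = "\<Union>(k, i)\<in>?I. bad n c b l al k i"
 have fin: "finite (chs n c b l al)" by (rule finite_chs[OF b])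
 have "chs n c b l al = {D\<in>chs n c b l al. lattice n l D} \<union> ?U"
 proof (intro set_eqI iffI)
  fix D assume D: "D \<in> chs n c b l al"
  then have DC: "D \<in> chains c b l" by (simp add: chs_def)
  show "D \<in> {D\<in>chs n c b l al. lattice n l D} \<union> ?U"
  proof (cases "lattice n l D")
   case False
   let ?K = "{k. \<exists>i. viol n l D k i}"
   have K: "finite ?K" "?K \<noteq> {}"
    using viol_less[OF DC b] False by (auto simp: lattice_def intro: finite_subset[of _ "{..<sz n b}"])
   define k where "k = Max ?K"
   have k1: "\<exists>i. viol n l D k i" using Max_in[OF K] unfolding k_def by blast
   have k2: "\<not> viol n l D k' i'" if "k < k'" for k' i'
    using Max_ge[OF K(1), of k'] that unfolding k_def by fastforce
   define i where "i = (LEAST i. viol n l D k i)"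
   have i1: "viol n l D k i" unfolding i_def by (rule LeastI_ex[OF k1])
   have i2: "\<not> viol n l D k i'" if "i' < i" for i' using not_less_Least that unfolding i_def by blast
   have "(k, i) \<in> ?I" using viol_less[OF DC b i1] i1 by (simp add: viol_def)
   moreover have "D \<in> bad n c b l al k i" using D i1 i2 k2 by (simp add: bad_def)
   ultimately show ?thesis by blast
  qed (use D in simp)
 next
  fix D assume "D \<in> {D\<in>chs n c b l al. lattice n l D} \<union> ?U"
  then show "D \<in> chs n c b l al" by (auto simp: bad_def)
 qed
 then have "card (chs n c b l al) = card ({D\<in>chs n c b l al. lattice n l D} \<union> ?U)" by simp
 also have "\<dots> = card {D\<in>chs n c b l al. lattice n l D} + card ?U"
 proof (rule card_Un_disjoint)
  show "finite {D\<in>chs n c b l al. lattice n l D}" using fin by simp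
  show "finite ?U" using fin by (auto simp: bad_def)
  show "{D\<in>chs n c b l al. lattice n l D} \<inter> ?U = {}" by (auto simp: bad_def lattice_def)
 qed
 also have "card ?U = (\<Sum>(k, i)\<in>?I. card (bad n c b l al k i))"
  unfolding split_def
 proof (rule card_UN_disjoint)
  show "finite ?I" by simp
  show "\<forall>x\<in>?I. finite (bad n c b l al (fst x) (snd x))" using fin by (auto simp: bad_def)
  show "\<forall>x\<in>?I. \<forall>y\<in>?I. x \<noteq> y \<longrightarrow> bad n c b l al (fst x) (snd x) \<inter> bad n c b l al (fst y) (snd y) = {}"
  proof (intro ballI impI)
   fix x y :: "nat \<times> nat" assume ne: "x \<noteq> y"
   show "bad n c b l al (fst x) (snd x) \<inter> bad n c b l al (fst y) (snd y) = {}"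
   proof (rule ccontr)
    assume "bad n c b l al (fst x) (snd x) \<inter> bad n c b l al (fst y) (snd y) \<noteq> {}"
    then obtain D where D: "D \<in> bad n c b l al (fst x) (snd x)" "D \<in> bad n c b l al (fst y) (snd y)" by blast
    then have "fst x = fst y" unfolding bad_def by (metis (mono_tags, lifting) mem_Collect_eq nat_neq_iff)
    moreover from this D have "snd x = snd y" unfolding bad_def by (metis (mono_tags, lifting) mem_Collect_eq nat_neq_iff)
    ultimately show False using ne by (simp add: prod_eq_iff)
   qed
  qed
 qed
 finally show ?thesis .
qed

text \<open>Indices of the complete homogeneous factors in the Jacobi-Trudi term of the inverse of
  \<open>p\<close>. Composing \<open>p\<close> with the transposition of \<open>i\<close> and
  \<open>Suc i\<close> changes them exactly as in \<open>card_bad_le\<close>.\<close>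

definition dot :: "(nat \<Rightarrow> nat) \<Rightarrow> (nat \<Rightarrow> nat) \<Rightarrow> nat \<Rightarrow> int" where
 "dot lam p i = int (lam (p i)) - int (p i) + int i"

text \<open>Composing with the transposition of \<open>i\<close> and \<open>Suc i\<close> reverses
  the sign and preserves the number of bad chains, so the sum equals its own negative.\<close>

lemma sum_signed_bad_zero:
 assumes b: "on {0<..n} b" and il: "i < l"
 shows "(\<Sum>p | p permutes {0..<l}. sign p * int (card (bad n c b l (dot lam p) k i))) = 0" (is "?S = 0")
proof (cases "Suc i < l")
 case True
 let ?t = "Transposition.transpose i (Suc i)"
 let ?P = "{p. p permutes {0..<l}}"
 have t: "?t permutes {0..<l}" by (rule permutes_swap_id) (use True in auto)
 have dot: "dot lam (p \<circ> ?t) = (dot lam p)(i := dot lam p (Suc i) - 1, Suc i := dot lam p i + 1)" for p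
  by (auto simp: dot_def fun_eq_iff Transposition.transpose_def)
 have "?S = (\<Sum>p\<in>?P. sign (p \<circ> ?t) * int (card (bad n c b l (dot lam (p \<circ> ?t)) k i)))"
  by (rule sum.reindex_bij_witness[of _ "\<lambda>p. p \<circ> ?t" "\<lambda>p. p \<circ> ?t"])
   (use t in \<open>auto intro: permutes_compose simp: comp_assoc\<close>)
 also have "\<dots> = (\<Sum>p\<in>?P. - (sign p * int (card (bad n c b l (dot lam p) k i))))"
 proof (rule sum.cong[OF refl])
  fix p assume "p \<in> ?P"
  then have "permutation p" using permutes_imp_permutation[of "{0..<l}" p] by simp
  then have "sign (p \<circ> ?t) = - sign p"
   by (simp add: sign_compose permutation_swap_id sign_swap_id)
  then show "sign (p \<circ> ?t) * int (card (bad n c b l (dot lam (p \<circ> ?t)) k i)) = - (sign p * int (card (bad n c b l (dot lam p) k i)))"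
   unfolding dot card_bad_swap[OF b] by simp
 qed
 also have "\<dots> = - ?S" by (simp add: sum_negf)
 finally show ?thesis by simp
next
 case False
 then have "bad n c b l al k i = {}" for al by (auto simp: bad_def viol_def)
 then show ?thesis by simp
qed

text \<open>At \<open>k = 0\<close> the lattice condition makes the step sizes weakly decreasing. As
  \<open>lam i - i\<close> decreases strictly, \<open>p\<close> must be increasing and hence the
  identity.\<close>

lemma lattice_dot_id:
 assumes lam: "\<And>i. Suc i < l \<Longrightarrow> lam (Suc i) \<le> lam i" and p: "p permutes {0..<l}"
  and D: "D \<in> chs n c b l (dot lam p)" "lattice n l D"
 shows "p = id"
proof -
 have dec: "lam j + i < lam i + j" if "i < j" "j < l" for i j
  using that
 proof (induction j)
  case (Suc j) then show ?case using lam[of j] by (cases "i = j") auto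
 qed simp
 have inj: "p i \<noteq> p j" if "i \<noteq> j" for i j using permutes_inj[OF p] that by (auto dest: injD)
 have pl: "p i < l" if "i < l" for i using permutes_in_image[OF p, of i] that by simp
 have step: "p i < p (Suc i)" if "Suc i < l" for i
 proof -
  have "\<not> viol n l D 0 i" using D(2) by (simp add: lattice_def)
  then have "cn n D 0 (Suc i) \<le> cn n D 0 i" using that by (simp add: viol_def)
  moreover have "cn n D 0 j = dot lam p j" if "j < l" for j using D(1) that by (simp add: cn_def tl_sz_0 chs_def)
  ultimately have "dot lam p (Suc i) \<le> dot lam p i" using that by simp
  then have "int (lam (p (Suc i))) - int (p (Suc i)) < int (lam (p i)) - int (p i)" by (simp add: dot_def)
  then have "\<not> p (Suc i) < p i" using dec[of "p (Suc i)" "p i"] pl[of i] that by auto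
  then show ?thesis using inj[of i "Suc i"] by simp
 qed
 have ge: "i \<le> p i" if "i < l" for i
  using that
 proof (induction i)
  case (Suc i) then show ?case using step[of i] by simp
 qed simp
 have le: "p i \<le> i" if "i < l" for i
 proof -
  have "i \<le> l - 1" using that by simp
  then show ?thesis
  proof (induction i rule: inc_induct)
   case base then show ?case using pl[of "l - 1"] that by simp
  next
   case (step j)
   then have "Suc j < l" by linarith
   then show ?case using \<open>\<And>i. Suc i < l \<Longrightarrow> p i < p (Suc i)\<close>[of j] step by simp
  qed
 qed
 show ?thesis
 proof
  fix i show "p i = id i"
   using ge[of i] le[of i] permutes_not_in[OF p, of i] by (cases "i < l") auto
 qed
qed

lemma lattice_count:
 assumes b: "on {0<..n} b" and lam: "\<And>i. Suc i < l \<Longrightarrow> lam (Suc i) \<le> lam i"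
 shows "(\<Sum>p | p permutes {0..<l}. sign p * int (card (chs n c b l (dot lam p)))) =
  int (card {D\<in>chs n c b l (\<lambda>i. int (lam i)). lattice n l D})"
proof -
 let ?P = "{p. p permutes {0..<l}}"
 let ?I = "{..<sz n b} \<times> {..<l}"
 let ?L = "\<lambda>p. {D\<in>chs n c b l (dot lam p). lattice n l D}"
 have fP: "finite ?P" by (rule finite_permutations) simp
 have "(\<Sum>p\<in>?P. sign p * int (card (chs n c b l (dot lam p)))) =
   (\<Sum>p\<in>?P. sign p * int (card (?L p))) + (\<Sum>p\<in>?P. \<Sum>x\<in>?I. sign p * int (card (bad n c b l (dot lam p) (fst x) (snd x))))"
  unfolding card_chs_split[OF b] split_def by (simp add: distrib_left sum.distrib sum_distrib_left)
 also have "(\<Sum>p\<in>?P. \<Sum>x\<in>?I. sign p * int (card (bad n c b l (dot lam p) (fst x) (snd x)))) =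
   (\<Sum>x\<in>?I. \<Sum>p\<in>?P. sign p * int (card (bad n c b l (dot lam p) (fst x) (snd x))))" by (rule sum.swap)
 also have "\<dots> = 0" by (rule sum.neutral) (use sum_signed_bad_zero[OF b] in auto)
 also have "(\<Sum>p\<in>?P. sign p * int (card (?L p))) = (\<Sum>p\<in>?P. if p = id then int (card (?L id)) else 0)"
 proof (rule sum.cong[OF refl])
  fix p assume p: "p \<in> ?P"
  show "sign p * int (card (?L p)) = (if p = id then int (card (?L id)) else 0)"
  proof (cases "p = id")
   case False
   then have "?L p = {}" using lattice_dot_id[of l lam p] lam p by blast
   then show ?thesis using False by (simp only: card.empty) simp
  qed (simp add: sign_id)
 qed
 also have "\<dots> = int (card (?L id))" using fP permutes_id by simp
 also have "dot lam id = (\<lambda>i. int (lam i))" by (simp add: dot_def fun_eq_iff)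
 finally show ?thesis by simp
qed

section \<open>The Jacobi-Trudi identity\<close>

text \<open>Leibniz expansion of the determinant of the \<open>l\<close> by \<open>l\<close> matrix
  \<open>f\<close>.\<close>

definition alt :: "nat \<Rightarrow> (nat \<Rightarrow> nat \<Rightarrow> Defs.poly) \<Rightarrow> Defs.poly" where
 "alt l f = (\<Sum>p | p permutes {0..<l}. of_int (sign p) * (\<Prod>i\<in>{0..<l}. f i (p i)))"

lemma poly_double_zero:
 fixes S :: Defs.poly assumes "S = - S" shows "S = 0"
proof (rule poly_mapping_eqI)
 fix k
 have "Poly_Mapping.lookup S k = Poly_Mapping.lookup (- S) k" using assms by simp
 then show "Poly_Mapping.lookup S k = Poly_Mapping.lookup 0 k" by (simp add: lookup_uminus)
qed

lemma alt_same_rows: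
 assumes i: "i < l" "i' < l" "i \<noteq> i'" and f: "f i = f i'"
 shows "alt l f = 0"
proof (rule poly_double_zero)
 let ?t = "Transposition.transpose i i'"
 let ?P = "{p. p permutes {0..<l}}"
 have t: "?t permutes {0..<l}" by (rule permutes_swap_id) (use i in auto)
 have "alt l f = (\<Sum>p\<in>?P. of_int (sign (p \<circ> ?t)) * (\<Prod>j\<in>{0..<l}. f j ((p \<circ> ?t) j)))"
  unfolding alt_def
  by (rule sum.reindex_bij_witness[of _ "\<lambda>p. p \<circ> ?t" "\<lambda>p. p \<circ> ?t"])
   (use t in \<open>auto intro: permutes_compose simp: comp_assoc\<close>)
 also have "\<dots> = (\<Sum>p\<in>?P. - (of_int (sign p) * (\<Prod>j\<in>{0..<l}. f j (p j))))"
 proof (rule sum.cong[OF refl])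
  fix p assume "p \<in> ?P"
  then have "permutation p" using permutes_imp_permutation[of "{0..<l}" p] by simp
  then have s: "sign (p \<circ> ?t) = - sign p" using i by (simp add: sign_compose permutation_swap_id sign_swap_id)
  have "(\<Prod>j\<in>{0..<l}. f j ((p \<circ> ?t) j)) = (\<Prod>j\<in>{0..<l}. f (?t j) (p (?t j)))"
   by (rule prod.cong) (use f in \<open>auto simp: Transposition.transpose_def\<close>)
  also have "\<dots> = (\<Prod>j\<in>{0..<l}. f j (p j))"
   using prod.permute[OF t, of "\<lambda>j. f j (p j)"] by (simp add: comp_def)
  finally show "of_int (sign (p \<circ> ?t)) * (\<Prod>j\<in>{0..<l}. f j ((p \<circ> ?t) j)) = - (of_int (sign p) * (\<Prod>j\<in>{0..<l}. f j (p j)))"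
   unfolding s by simp
 qed
 finally show "alt l f = - alt l f" by (simp add: alt_def sum_negf)
qed

lemma alt_linear:
 assumes "i < l"
 shows "alt l (f(i := \<lambda>j. u j + y * v j)) = alt l (f(i := u)) + y * alt l (f(i := v))"
proof -
 have "(\<Prod>k\<in>{0..<l}. (f(i := w)) k (p k)) = w (p i) * (\<Prod>k\<in>{0..<l} - {i}. f k (p k))" for w p
 proof -
  have "(\<Prod>k\<in>{0..<l}. (f(i := w)) k (p k)) = (f(i := w)) i (p i) * (\<Prod>k\<in>{0..<l} - {i}. (f(i := w)) k (p k))"
   by (rule prod.remove) (use assms in auto)
  also have "(\<Prod>k\<in>{0..<l} - {i}. (f(i := w)) k (p k)) = (\<Prod>k\<in>{0..<l} - {i}. f k (p k))"
   by (rule prod.cong) auto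
  finally show ?thesis by simp
 qed
 then show ?thesis unfolding alt_def by (simp add: algebra_simps sum.distrib sum_distrib_left)
qed

lemma alt_row_op:
 assumes "i < l" "i' < l" "i \<noteq> i'"
 shows "alt l (f(i := \<lambda>j. f i j + y * f i' j)) = alt l f"
 using alt_linear[OF assms(1), of f "f i" y "f i'"] alt_same_rows[OF assms, of "f(i := f i')"] assms by simp

lemma alt_sum:
 assumes "\<And>i. i < l \<Longrightarrow> finite (A i)"
 shows "alt l (\<lambda>i j. \<Sum>t\<in>A i. g i t j) = (\<Sum>t\<in>PiE {0..<l} A. alt l (\<lambda>i j. g i (t i) j))"
proof -
 have "alt l (\<lambda>i j. \<Sum>t\<in>A i. g i t j) =
   (\<Sum>p | p permutes {0..<l}. of_int (sign p) * (\<Sum>t\<in>PiE {0..<l} A. \<Prod>i\<in>{0..<l}. g i (t i) (p i)))"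
  unfolding alt_def by (intro sum.cong refl arg_cong2[where f = times] prod_sum_PiE) (use assms in auto)
 also have "\<dots> = (\<Sum>t\<in>PiE {0..<l} A. alt l (\<lambda>i j. g i (t i) j))"
  unfolding alt_def sum_distrib_left by (rule sum.swap)
 finally show ?thesis .
qed

lemma alt_scale: "alt l (\<lambda>i j. y i * g i j) = (\<Prod>i\<in>{0..<l}. y i) * alt l g"
 unfolding alt_def by (simp add: prod.distrib sum_distrib_left mult_ac)

lemma hz_Suc: "hz (Suc n) k = hz n k + vX (Suc n) * hz (Suc n) (k - 1)"
proof -
 have i: "{0<..Suc n} = insert (Suc n) {0<..n}" "Suc n \<notin> {0<..n}" by auto
 consider "k < 0" | "k = 0" | "k > 0" by linarith
 then show ?thesis
 proof cases
  case 2 then show ?thesis using hp_insert[OF _ i(2), of 0] by (simp add: hz_def i(1))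
 next
  case 3
  then obtain j where k: "nat k = Suc j" "nat (k - 1) = j" by (cases "nat k") auto
  have "hp {0<..Suc n} (Suc j) = (\<Sum>t\<le>Suc j. vX (Suc n) ^ t * hp {0<..n} (Suc j - t))"
   unfolding i(1) by (rule hp_insert) (use i in auto)
  also have "\<dots> = hp {0<..n} (Suc j) + (\<Sum>t\<le>j. vX (Suc n) ^ Suc t * hp {0<..n} (Suc j - Suc t))"
   by (subst sum.atMost_Suc_shift) simp
  also have "(\<Sum>t\<le>j. vX (Suc n) ^ Suc t * hp {0<..n} (Suc j - Suc t)) = vX (Suc n) * (\<Sum>t\<le>j. vX (Suc n) ^ t * hp {0<..n} (j - t))"
   by (simp add: sum_distrib_left mult.assoc)
  also have "(\<Sum>t\<le>j. vX (Suc n) ^ t * hp {0<..n} (j - t)) = hp {0<..Suc n} j"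
   unfolding i(1) by (rule hp_insert[symmetric]) (use i in auto)
  finally show ?thesis using 3 k by (simp add: hz_def)
 qed (simp add: hz_def)
qed

lemma hz_Suc_steps: "hz (Suc n) k = (\<Sum>t<m. vX (Suc n) ^ t * hz n (k - int t)) + vX (Suc n) ^ m * hz (Suc n) (k - int m)"
proof (induction m)
 case (Suc m)
 have "hz (Suc n) (k - int m) = hz n (k - int m) + vX (Suc n) * hz (Suc n) (k - int (Suc m))"
  using hz_Suc[of n "k - int m"] by (simp add: algebra_simps)
 then show ?case using Suc by (simp add: algebra_simps)
qed simp

definition jt :: "nat \<Rightarrow> nat \<Rightarrow> (nat \<Rightarrow> nat) \<Rightarrow> Defs.poly" where
 "jt n l lam = alt l (\<lambda>i j. hz n (int (lam i) - int i + int j))"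

definition nxt :: "nat \<Rightarrow> (nat \<Rightarrow> nat) \<Rightarrow> nat \<Rightarrow> nat" where
 "nxt l lam i = (if Suc i < l then lam (Suc i) else 0)"

text \<open>Subtracting a multiple of the next row truncates the geometric expansion of each row,
 so that only the horizontal strips survive the multilinear expansion.\<close>

lemma jt_Suc:
 assumes lam: "\<And>i. Suc i < l \<Longrightarrow> lam (Suc i) \<le> lam i"
 shows "jt (Suc n) l lam = (\<Sum>t\<in>PiE {0..<l} (\<lambda>i. {..lam i - nxt l lam i}).
   vX (Suc n) ^ (\<Sum>i\<in>{0..<l}. t i) * jt n l (\<lambda>i. lam i - t i))"
proof -
 let ?x = "vX (Suc n)"
 let ?\<beta> = "\<lambda>i. int (lam i) - int i"
 let ?m = "\<lambda>i. Suc (lam i - nxt l lam i)"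
 let ?F = "\<lambda>i j. hz (Suc n) (?\<beta> i + int j)"
 let ?R = "\<lambda>i j. \<Sum>t<?m i. ?x ^ t * hz n (?\<beta> i + int j - int t)"
 \<comment> \<open>Rows before \<open>k\<close> are already truncated. The operation on row
   \<open>k\<close> uses row \<open>Suc k\<close>, which still has its original form.\<close>
 let ?G = "\<lambda>k i j. if i < k then ?R i j else ?F i j"
 have row: "?R k j = ?F k j + (if Suc k < l then (- (?x ^ ?m k)) * ?F (Suc k) j else 0)" if "k < l" "j < l" for k j
 proof (cases "Suc k < l")
  case True
  then have s: "?\<beta> k + int j - int (?m k) = ?\<beta> (Suc k) + int j" using lam[of k] by (simp add: nxt_def of_nat_diff)
  have "?F k j = ?R k j + ?x ^ ?m k * ?F (Suc k) j"
   using hz_Suc_steps[of n "?\<beta> k + int j" "?m k"] unfolding s .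
  then have "?R k j = ?F k j + (- (?x ^ ?m k)) * ?F (Suc k) j" by (simp only: mult_minus_left) (simp only: add.assoc right_minus add_0_right)
  then show ?thesis by (simp only: True if_True)
 next
  case False
  \<comment> \<open>In the last row the remainder has index \<open>j - l\<close>, so no further row
    is needed to remove it.\<close>
  then have "?\<beta> k + int j - int (?m k) < 0" using that by (simp add: nxt_def)
  then have "hz (Suc n) (?\<beta> k + int j - int (?m k)) = 0" by (simp add: hz_def)
  then have "?F k j = ?R k j"
   using hz_Suc_steps[of n "?\<beta> k + int j" "?m k"] by (simp only: mult_zero_right add_0_right)
  then show ?thesis by (simp only: False if_False add_0_right)
 qed
 have cong: "alt l f = alt l g" if "\<And>i j. i < l \<Longrightarrow> j < l \<Longrightarrow> f i j = g i j" for f g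
  unfolding alt_def
 proof (intro sum.cong refl arg_cong2[where f = times] prod.cong)
  fix p i assume "p \<in> {p. p permutes {0..<l}}" "i \<in> {0..<l}"
  then show "f i (p i) = g i (p i)" using that[of i "p i"] permutes_in_image[of p "{0..<l}" i] by simp
 qed
 have "alt l (?G k) = alt l ?F" if "k \<le> l" for k
  using that
 proof (induction k)
  case (Suc k)
  have "alt l (?G (Suc k)) = alt l (?G k)"
  proof (cases "Suc k < l")
   case True
   have "alt l (?G (Suc k)) = alt l ((?G k)(k := \<lambda>j. ?G k k j + (- (?x ^ ?m k)) * ?G k (Suc k) j))"
   proof (rule cong)
    fix i j assume "i < l" "j < l"
    then show "?G (Suc k) i j = ((?G k)(k := \<lambda>j. ?G k k j + (- (?x ^ ?m k)) * ?G k (Suc k) j)) i j"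
     using row[of k j] True by auto
   qed
   also have "\<dots> = alt l (?G k)" by (rule alt_row_op) (use True in auto)
   finally show ?thesis .
  next
   case False
   show ?thesis
   proof (rule cong)
    fix i j assume "i < l" "j < l"
    then show "?G (Suc k) i j = ?G k i j" using row[of k j] False Suc.prems
     by (cases "i = k") (simp_all add: less_Suc_eq del: sum.lessThan_Suc)
   qed
  qed
  then show ?case using Suc by simp
 qed simp
 from this[of l] have "jt (Suc n) l lam = alt l (?G l)" by (simp add: jt_def)
 also have "\<dots> = alt l (\<lambda>i j. \<Sum>t\<in>{..lam i - nxt l lam i}. ?x ^ t * hz n (?\<beta> i + int j - int t))"
  by (rule cong) (simp add: lessThan_Suc_atMost)
 also have "\<dots> = (\<Sum>t\<in>PiE {0..<l} (\<lambda>i. {..lam i - nxt l lam i}). alt l (\<lambda>i j. ?x ^ t i * hz n (?\<beta> i + int j - int (t i))))"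
  by (rule alt_sum) simp
 also have "\<dots> = (\<Sum>t\<in>PiE {0..<l} (\<lambda>i. {..lam i - nxt l lam i}). ?x ^ (\<Sum>i\<in>{0..<l}. t i) * jt n l (\<lambda>i. lam i - t i))"
 proof (rule sum.cong[OF refl])
  fix t assume t: "t \<in> PiE {0..<l} (\<lambda>i. {..lam i - nxt l lam i})"
  have "alt l (\<lambda>i j. ?x ^ t i * hz n (?\<beta> i + int j - int (t i))) = ?x ^ (\<Sum>i\<in>{0..<l}. t i) * alt l (\<lambda>i j. hz n (?\<beta> i + int j - int (t i)))"
   by (simp add: alt_scale power_sum)
  also have "alt l (\<lambda>i j. hz n (?\<beta> i + int j - int (t i))) = jt n l (\<lambda>i. lam i - t i)"
   unfolding jt_def
  proof (rule cong)
   fix i j assume "i < l"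
   then have "t i \<le> lam i" using t by (fastforce simp: PiE_def Pi_def)
   then show "hz n (?\<beta> i + int j - int (t i)) = hz n (int (lam i - t i) - int i + int j)"
    by (simp add: of_nat_diff algebra_simps)
  qed
  finally show "alt l (\<lambda>i j. ?x ^ t i * hz n (?\<beta> i + int j - int (t i))) = ?x ^ (\<Sum>i\<in>{0..<l}. t i) * jt n l (\<lambda>i. lam i - t i)" .
 qed
 finally show ?thesis .
qed

text \<open>With no variables, \<open>hz 0 k\<close> is the indicator of \<open>k = 0\<close>. For
  the zero partition only the identity term survives; otherwise all indices in row 0 are positive
  and every term vanishes.\<close>

lemma jt_0:
 assumes lam: "\<And>i. Suc i < l \<Longrightarrow> lam (Suc i) \<le> lam i"
 shows "jt 0 l lam = (if \<forall>i<l. lam i = 0 then 1 else 0)"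
proof -
 have h0: "hz 0 k = (if k = 0 then 1 else 0)" for k by (simp add: hz_def hp_empty)
 show ?thesis
 proof (cases "\<forall>i<l. lam i = 0")
  case True
  have "jt 0 l lam = (\<Sum>p | p permutes {0..<l}. if p = id then 1 else 0)"
   unfolding jt_def alt_def
  proof (rule sum.cong[OF refl])
   fix p assume "p \<in> {p. p permutes {0..<l}}"
   then have p: "p permutes {0..<l}" by simp
   show "of_int (sign p) * (\<Prod>i\<in>{0..<l}. hz 0 (int (lam i) - int i + int (p i))) = (if p = id then 1 else 0)"
   proof (cases "p = id")
    case False
    then obtain i where i: "p i \<noteq> i" by (auto simp: fun_eq_iff)
    then have "i \<in> {0..<l}" using permutes_not_in[OF p] by blast
    moreover have "hz 0 (int (lam i) - int i + int (p i)) = 0" using i True calculation by (simp add: h0)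
    ultimately have "(\<Prod>i\<in>{0..<l}. hz 0 (int (lam i) - int i + int (p i))) = 0" by (intro prod_zero) auto
    then show ?thesis using False by simp
   qed (use True in \<open>simp add: h0 sign_id\<close>)
  qed
  also have "\<dots> = 1" using finite_permutations[of "{0..<l}"] permutes_id by simp
  finally show ?thesis using True by simp
 next
  case False
  then obtain i where i: "i < l" "0 < lam i" by auto
  have "lam i \<le> lam 0" using i(1)
  proof (induction i)
   case (Suc i) then show ?case using lam[of i] by simp
  qed simp
  then have l0: "0 < lam 0" "0 < l" using i by auto
  have "(\<Prod>i\<in>{0..<l}. hz 0 (int (lam i) - int i + int (p i))) = 0" for p
   by (rule prod_zero) (use l0 in \<open>auto simp: h0 intro!: bexI[of _ 0]\<close>)
  then show ?thesis unfolding jt_def alt_def by (simp only: False if_False mult_zero_right sum.neutral_const)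
 qed
qed

text \<open>Partitions are kept as functions padded to a fixed number \<open>l\<close> of rows, so
  that removing a horizontal strip stays within the same format.\<close>

definition shp :: "nat \<Rightarrow> (nat \<Rightarrow> nat) \<Rightarrow> nat list" where
 "shp l lam = map lam [0..<l]"

lemma cells_shp: "(i, j) \<in> cells (shp l lam) \<longleftrightarrow> 1 \<le> i \<and> i \<le> l \<and> 1 \<le> j \<and> j \<le> lam (i - 1)"
 by (auto simp: cells_def shp_def)

lemma finite_cells: "finite (cells a)"
proof -
 have "cells a \<subseteq> Sigma {1..length a} (\<lambda>i. {1..a ! (i - 1)})" by (auto simp: cells_def)
 then show ?thesis by (rule finite_subset) simp
qed

lemma finite_ssyt: "finite (ssyt n lam)"
proof (rule finite_subset)
 show "ssyt n lam \<subseteq> {T. \<forall>p. (p \<in> cells lam \<longrightarrow> T p \<in> {..n}) \<and> (p \<notin> cells lam \<longrightarrow> T p = 0)}"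
  by (auto simp: ssyt_def)
 show "finite {T. \<forall>p. (p \<in> cells lam \<longrightarrow> T p \<in> {..n}) \<and> (p \<notin> cells lam \<longrightarrow> T p = 0)}"
  by (rule finite_set_of_finite_funs[OF finite_cells]) simp
qed

text \<open>The entries \<open>Suc n\<close> form a horizontal strip: they end their rows, and
  strict columns require the remaining part of row \<open>i\<close> to cover row
  \<open>Suc i\<close> of \<open>lam\<close>. This is the same index set as in
  \<open>jt_Suc\<close>.\<close>

lemma schur_Suc:
 assumes lam: "\<And>i. Suc i < l \<Longrightarrow> lam (Suc i) \<le> lam i"
 shows "schur (Suc n) (shp l lam) = (\<Sum>t\<in>PiE {0..<l} (\<lambda>i. {..lam i - nxt l lam i}).
   vX (Suc n) ^ (\<Sum>i\<in>{0..<l}. t i) * schur n (shp l (\<lambda>i. lam i - t i)))"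
proof -
 let ?PI = "PiE {0..<l} (\<lambda>i. {..lam i - nxt l lam i})"
 let ?C = "cells (shp l lam)"
 let ?mu = "\<lambda>(t::nat \<Rightarrow> nat) i. lam i - t i"
 let ?tt = "\<lambda>T::filling. restrict (\<lambda>i. card {j. T (Suc i, j) = Suc n}) {0..<l}"
 let ?f = "\<lambda>T. (?tt T, \<lambda>p. if T p = Suc n then 0 else T p)"
 let ?g = "\<lambda>(t::nat \<Rightarrow> nat, T::filling). (\<lambda>p. if p \<in> ?C \<and> T p = 0 then Suc n else T p)"
 let ?w = "\<lambda>(t, T). Poly_Mapping.single (Poly_Mapping.single (Suc n) (\<Sum>i\<in>{0..<l}. t i) + wt (cells (shp l (?mu t))) T) (1::int)"
 have tle: "t i \<le> lam i" "nxt l lam i \<le> lam i - t i" if "t \<in> ?PI" "i < l" for t i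
 proof -
  have "t i \<le> lam i - nxt l lam i" using that by (fastforce simp: PiE_def Pi_def)
  moreover have "nxt l lam i \<le> lam i" using lam[of i] by (simp add: nxt_def)
  ultimately show "t i \<le> lam i" "nxt l lam i \<le> lam i - t i" by auto
 qed
 have sub: "cells (shp l (?mu t)) \<subseteq> ?C" for t by (auto simp: cells_shp)
 have cardC: "card (?C - cells (shp l (?mu t))) = (\<Sum>i\<in>{0..<l}. t i)" if t: "t \<in> ?PI" for t
 proof -
  have "?C - cells (shp l (?mu t)) = Sigma {1..l} (\<lambda>i. {lam (i - 1) - t (i - 1)<..lam (i - 1)})"
   by (auto simp: cells_shp)
  then have "card (?C - cells (shp l (?mu t))) = (\<Sum>i\<in>{1..l}. lam (i - 1) - (lam (i - 1) - t (i - 1)))" by simp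
  also have "\<dots> = (\<Sum>i\<in>{0..<l}. t i)"
   by (rule sum.reindex_bij_witness[of _ Suc "\<lambda>i. i - 1"]) (use tle(1)[OF t] in auto)
  finally show ?thesis .
 qed
 have "schur (Suc n) (shp l lam) = sum ?w (Sigma ?PI (\<lambda>t. ssyt n (shp l (?mu t))))"
  unfolding schur_def
 proof (rule sum.reindex_bij_witness[where i = ?g and j = ?f])
  fix T assume T: "T \<in> ssyt (Suc n) (shp l lam)"
  have z: "T p = 0 \<longleftrightarrow> p \<notin> ?C" for p using T by (cases p) (auto simp: ssyt_def)
  have le: "T p \<le> Suc n" for p using T z[of p] by (cases "p \<in> ?C") (auto simp: ssyt_def)
  have row: "T (i, j) \<le> T (i, Suc j)" if "(i, Suc j) \<in> ?C" for i j
   using T that by (cases "(i, j) \<in> ?C") (auto simp: ssyt_def cells_shp)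
  have col: "T (i, j) < T (Suc i, j)" if "(i, j) \<in> ?C" "(Suc i, j) \<in> ?C" for i j
   using T that by (auto simp: ssyt_def)
  \<comment> \<open>\<open>thr_iff\<close> is about weakly decreasing rows. Complementing the
    entries in \<open>Suc (Suc n)\<close> reverses the order and turns entries at most
    \<open>n\<close> into entries greater than 1.\<close>
  define mu where "mu = (\<lambda>i. thr 1 (\<lambda>p. if T p = 0 then 0 else Suc (Suc n) - T p) (Suc i))"
  have mu: "p \<in> ?C \<and> T p \<le> n \<longleftrightarrow> p \<in> cells (shp l mu)" for p
  proof -
   obtain r j where p: "p = (r, j)" by force
   let ?T = "\<lambda>p. if T p = 0 then 0 else Suc (Suc n) - T p"
   have "1 < ?T (r, j) \<longleftrightarrow> 1 \<le> j \<and> j \<le> thr 1 ?T r"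
   proof (rule thr_iff)
    show "?T (r, Suc j) \<le> ?T (r, j)" if "1 \<le> j" for j
    proof (cases "(r, Suc j) \<in> ?C")
     case True
     then have "(r, j) \<in> ?C" using that by (auto simp: cells_shp)
     then show ?thesis using diff_le_mono2[OF row[OF True], of "Suc (Suc n)"] z by simp
    qed (use z in simp)
    show "?T (r, 0) = 0" using z[of "(r, 0)"] by (simp add: cells_shp)
    show "?T (r, Suc (lam (r - 1))) = 0" using z[of "(r, Suc (lam (r - 1)))"] by (simp add: cells_shp)
   qed
   moreover have "1 < ?T (r, j) \<longleftrightarrow> (r, j) \<in> ?C \<and> T (r, j) \<le> n" using z[of "(r, j)"] le[of "(r, j)"] by auto
   ultimately have e: "(r, j) \<in> ?C \<and> T (r, j) \<le> n \<longleftrightarrow> 1 \<le> j \<and> j \<le> thr 1 ?T r" by simp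
   show ?thesis
   proof (cases "1 \<le> r \<and> r \<le> l")
    case True
    then have "mu (r - 1) = thr 1 ?T r" by (simp add: mu_def)
    then show ?thesis using e True unfolding p by (simp add: cells_shp)
   next
    case False
    then show ?thesis unfolding p by (auto simp: cells_shp)
   qed
  qed
  have mule: "mu i \<le> lam i" if "i < l" for i
   using mu[of "(Suc i, mu i)"] that by (cases "mu i = 0") (auto simp: cells_shp)
  have tt: "?tt T i = lam i - mu i" if "i < l" for i
  proof -
   have "{j. T (Suc i, j) = Suc n} = {mu i<..lam i}"
   proof (rule set_eqI)
    fix j
    show "j \<in> {j. T (Suc i, j) = Suc n} \<longleftrightarrow> j \<in> {mu i<..lam i}"
     using mu[of "(Suc i, j)"] z[of "(Suc i, j)"] le[of "(Suc i, j)"] mule[OF that] that by (auto simp: cells_shp)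
   qed
   then show ?thesis using that by simp
  qed
  have nx: "nxt l lam i \<le> mu i" if "i < l" for i
  proof (cases "Suc i < l \<and> 0 < lam (Suc i)")
   case True
   have "(Suc i, lam (Suc i)) \<in> ?C" "(Suc (Suc i), lam (Suc i)) \<in> ?C" using True lam[of i] by (auto simp: cells_shp)
   then have "T (Suc i, lam (Suc i)) \<le> n" "(Suc i, lam (Suc i)) \<in> ?C"
    using col[of "Suc i" "lam (Suc i)"] le[of "(Suc (Suc i), lam (Suc i))"] by auto
   then show ?thesis using mu[of "(Suc i, lam (Suc i))"] True by (simp add: cells_shp nxt_def)
  qed (auto simp: nxt_def)
  have tP: "?tt T \<in> ?PI"
  proof (rule PiE_I)
   fix i assume "i \<in> {0..<l}"
   then show "?tt T i \<in> {..lam i - nxt l lam i}" using tt[of i] nx[of i] by (simp add: diff_le_mono2)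
  qed simp
  have muc: "cells (shp l (?mu (?tt T))) = cells (shp l mu)"
  proof (rule set_eqI)
   fix p :: "nat \<times> nat" obtain r j where p: "p = (r, j)" by force
   show "p \<in> cells (shp l (?mu (?tt T))) \<longleftrightarrow> p \<in> cells (shp l mu)"
    unfolding p cells_shp using tt[of "r - 1"] mule[of "r - 1"] by (cases "1 \<le> r \<and> r \<le> l") auto
  qed
  let ?T = "\<lambda>p. if T p = Suc n then 0 else T p"
  have "?T \<in> ssyt n (shp l mu)"
   unfolding ssyt_def mem_Collect_eq
  proof (intro conjI allI ballI impI)
   fix p
   show "?T p = 0" if "p \<notin> cells (shp l mu)" using mu[of p] z[of p] le[of p] that by auto
   show "1 \<le> ?T p" "?T p \<le> n" if "p \<in> cells (shp l mu)" using mu[of p] z[of p] that by auto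
  next
   fix i j assume a: "(i, j) \<in> cells (shp l mu) \<and> (i, j + 1) \<in> cells (shp l mu)"
   then show "?T (i, j) \<le> ?T (i, j + 1)" using row[of i j] mu[of "(i, j)"] mu[of "(i, j + 1)"] by auto
  next
   fix i j assume a: "(i, j) \<in> cells (shp l mu) \<and> (i + 1, j) \<in> cells (shp l mu)"
   then show "?T (i, j) < ?T (i + 1, j)" using col[of i j] mu[of "(i, j)"] mu[of "(i + 1, j)"] by auto
  qed
  then have "?T \<in> ssyt n (shp l (?mu (?tt T)))" using muc by (simp add: ssyt_def)
  then show "?f T \<in> Sigma ?PI (\<lambda>t. ssyt n (shp l (?mu t)))" using tP by simp
  have "p \<in> ?C" if "T p = Suc n" for p using z[of p] that by (metis nat.distinct(1))
  then show "?g (?f T) = T" using z by (auto simp: fun_eq_iff)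
  have "wt ?C T = Poly_Mapping.single (Suc n) (card (?C - cells (shp l (?mu (?tt T))))) + wt (cells (shp l (?mu (?tt T)))) ?T"
  proof (rule wt_split[OF finite_cells sub])
   show "T p = ?T p" if "p \<in> cells (shp l (?mu (?tt T)))" for p using that mu[of p] unfolding muc by auto
   show "T p = Suc n" if "p \<in> ?C - cells (shp l (?mu (?tt T)))" for p
    using that mu[of p] le[of p] unfolding muc by auto
  qed
  then show "?w (?f T) = Poly_Mapping.single (wt ?C T) 1" using cardC[OF tP] by simp
 next
  fix q assume "q \<in> Sigma ?PI (\<lambda>t. ssyt n (shp l (?mu t)))"
  then obtain t T where q: "q = (t, T)" and t: "t \<in> ?PI" and T: "T \<in> ssyt n (shp l (?mu t))" by auto
  let ?M = "cells (shp l (?mu t))"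
  have z: "T p = 0 \<longleftrightarrow> p \<notin> ?M" for p using T by (cases p) (auto simp: ssyt_def)
  have le: "T p \<le> n" for p using T z[of p] by (cases "p \<in> ?M") (auto simp: ssyt_def)
  let ?T = "\<lambda>p. if p \<in> ?C \<and> T p = 0 then Suc n else T p"
  have "?T \<in> ssyt (Suc n) (shp l lam)"
   unfolding ssyt_def mem_Collect_eq
  proof (intro conjI allI ballI impI)
   fix p
   show "?T p = 0" if "p \<notin> ?C" using that z[of p] sub[of t] by auto
   show "1 \<le> ?T p" "?T p \<le> Suc n" if "p \<in> ?C" using that le[of p] by auto
  next
   fix i j assume a: "(i, j) \<in> ?C \<and> (i, j + 1) \<in> ?C"
   show "?T (i, j) \<le> ?T (i, j + 1)"
   proof (cases "(i, j + 1) \<in> ?M")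
    case True
    then have "(i, j) \<in> ?M" using a by (auto simp: cells_shp)
    then show ?thesis using True T z[of "(i, j)"] z[of "(i, j + 1)"] by (auto simp: ssyt_def)
   next
    case False then show ?thesis using a z[of "(i, j + 1)"] le[of "(i, j)"] by auto
   qed
  next
   fix i j assume a: "(i, j) \<in> ?C \<and> (i + 1, j) \<in> ?C"
   then have i: "1 \<le> i" "i < l" "1 \<le> j" "j \<le> lam i" by (auto simp: cells_shp)
   have "nxt l lam (i - 1) \<le> ?mu t (i - 1)" using tle(2)[OF t, of "i - 1"] i by simp
   then have M: "(i, j) \<in> ?M" using i by (auto simp: cells_shp nxt_def)
   show "?T (i, j) < ?T (i + 1, j)"
   proof (cases "(i + 1, j) \<in> ?M")
    case True then show ?thesis using M T z[of "(i, j)"] z[of "(i + 1, j)"] by (auto simp: ssyt_def)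
   next
    case False then show ?thesis using M a z[of "(i + 1, j)"] z[of "(i, j)"] le[of "(i, j)"] by auto
   qed
  qed
  then show "?g q \<in> ssyt (Suc n) (shp l lam)" using q by simp
  have "card {j. ?T (Suc i, j) = Suc n} = t i" if i: "i < l" for i
  proof -
   have "{j. ?T (Suc i, j) = Suc n} = {lam i - t i<..lam i}"
   proof (rule set_eqI)
    fix j
    show "j \<in> {j. ?T (Suc i, j) = Suc n} \<longleftrightarrow> j \<in> {lam i - t i<..lam i}"
     using z[of "(Suc i, j)"] le[of "(Suc i, j)"] i by (auto simp: cells_shp)
   qed
   then show ?thesis using tle(1)[OF t i] by simp
  qed
  then have "?tt ?T = t" using t by (auto simp: fun_eq_iff PiE_def extensional_def)
  moreover have ne: "T p \<noteq> Suc n" for p using le[of p] by simp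
  then have "(\<lambda>p. if ?T p = Suc n then 0 else ?T p) = T" by (auto simp: fun_eq_iff)
  ultimately show "?f (?g q) = q" unfolding q prod.case by blast
 qed
 also have "\<dots> = (\<Sum>t\<in>?PI. \<Sum>T\<in>ssyt n (shp l (?mu t)). ?w (t, T))"
  unfolding prod.case
  by (rule sum.Sigma[symmetric]) (auto intro: finite_PiE finite_ssyt)
 also have "\<dots> = (\<Sum>t\<in>?PI. vX (Suc n) ^ (\<Sum>i\<in>{0..<l}. t i) * schur n (shp l (?mu t)))"
  by (rule sum.cong) (simp_all add: schur_def vX_power sum_distrib_left mult_single)
 finally show ?thesis .
qed

lemma schur_0: "schur 0 (shp l lam) = (if \<forall>i<l. lam i = 0 then 1 else 0)"
proof (cases "\<forall>i<l. lam i = 0")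
 case True
 then have "cells (shp l lam) = {}" by (auto simp: cells_shp)
 then have "ssyt 0 (shp l lam) = {\<lambda>_. 0}" by (auto simp: ssyt_def)
 then show ?thesis using True \<open>cells (shp l lam) = {}\<close> by (simp add: schur_def wt_def)
next
 case False
 then obtain i where "i < l" "0 < lam i" by auto
 then have "(Suc i, 1) \<in> cells (shp l lam)" by (simp add: cells_shp)
 then have "ssyt 0 (shp l lam) = {}" by (force simp: ssyt_def)
 then show ?thesis using False by (simp only: schur_def sum.empty) simp
qed

lemma jacobi_trudi:
 assumes "\<And>i. Suc i < l \<Longrightarrow> lam (Suc i) \<le> lam i"
 shows "schur n (shp l lam) = jt n l lam"
 using assms
proof (induction n arbitrary: lam)
 case 0 then show ?case by (simp add: schur_0 jt_0)
next
 case (Suc n)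
 have "schur n (shp l (\<lambda>i. lam i - t i)) = jt n l (\<lambda>i. lam i - t i)" if t: "t \<in> PiE {0..<l} (\<lambda>i. {..lam i - nxt l lam i})" for t
 proof (rule Suc.IH)
  fix i assume i: "Suc i < l"
  then have "t i \<le> lam i - lam (Suc i)" using PiE_mem[OF t, of i] by (simp add: nxt_def)
  then show "lam (Suc i) - t (Suc i) \<le> lam i - t i" using Suc.prems[OF i] by linarith
 qed
 note IH = this
 have "schur (Suc n) (shp l lam) = (\<Sum>t\<in>PiE {0..<l} (\<lambda>i. {..lam i - nxt l lam i}).
   vX (Suc n) ^ (\<Sum>i\<in>{0..<l}. t i) * schur n (shp l (\<lambda>i. lam i - t i)))"
  by (rule schur_Suc) (rule Suc.prems)
 also have "\<dots> = (\<Sum>t\<in>PiE {0..<l} (\<lambda>i. {..lam i - nxt l lam i}).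
   vX (Suc n) ^ (\<Sum>i\<in>{0..<l}. t i) * jt n l (\<lambda>i. lam i - t i))"
  by (rule sum.cong[OF refl]) (simp only: IH)
 also have "\<dots> = jt (Suc n) l lam" by (rule jt_Suc[symmetric]) (rule Suc.prems)
 finally show ?case .
qed

lemma atom_times_schur:
 assumes c: "on {0<..n} c" and lam: "\<And>i. Suc i < l \<Longrightarrow> lam (Suc i) \<le> lam i"
 shows "atom 0 c * schur n (shp l lam) =
  (\<Sum>b\<in>{b. on {0<..n} b \<and> sz n b = sz n c + (\<Sum>i<l. lam i)}.
   of_nat (card {D\<in>chs n c b l (\<lambda>i. int (lam i)). lattice n l D}) * atom 0 b)"
proof -
 let ?P = "{p. p permutes {0..<l}}"
 let ?B = "{b. on {0<..n} b \<and> sz n b = sz n c + (\<Sum>i<l. lam i)}"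
 have fP: "finite ?P" by (rule finite_permutations) simp
 have "atom 0 c * schur n (shp l lam) = atom 0 c * (\<Sum>p\<in>?P. of_int (sign p) * (\<Prod>i\<in>{0..<l}. hz n (int (lam i) - int i + int (p i))))"
  using jacobi_trudi[of l lam n] lam by (simp add: jt_def alt_def)
 also have "(\<Sum>p\<in>?P. of_int (sign p) * (\<Prod>i\<in>{0..<l}. hz n (int (lam i) - int i + int (p i)))) =
   (\<Sum>p\<in>?P. of_int (sign p) * (\<Prod>i<l. hz n (dot lam p i)))"
 \<comment> \<open>The determinant in \<open>jt\<close> permutes columns, \<open>dot\<close>
   permutes rows; inverting the permutation passes from one to the other and keeps the sign.\<close>
 proof (rule sum.reindex_bij_witness[of _ inv inv])
  fix p assume "p \<in> ?P"
  then have p: "p permutes {0..<l}" by simp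
  show "inv (inv p) = p" by (rule inv_inv_eq[OF permutes_bij[OF p]])
  show "inv p \<in> ?P" using permutes_inv[OF p] by simp
  have "sign (inv p) = sign p" by (rule sign_inverse) (rule permutes_imp_permutation[OF _ p], simp)
  moreover have "(\<Prod>i<l. hz n (dot lam (inv p) i)) = (\<Prod>i\<in>{0..<l}. hz n (int (lam i) - int i + int (p i)))"
  proof -
   have "(\<Prod>i\<in>{0..<l}. hz n (int (lam i) - int i + int (p i))) = (\<Prod>i\<in>{0..<l}. hz n (dot lam (inv p) (p i)))"
    by (rule prod.cong) (simp_all add: dot_def permutes_inverses[OF p])
   also have "\<dots> = (\<Prod>i\<in>{0..<l}. hz n (dot lam (inv p) i))"
    using prod.permute[OF p, of "\<lambda>i. hz n (dot lam (inv p) i)"] by (simp add: comp_def)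
   finally show ?thesis by (simp add: atLeast0LessThan)
  qed
  ultimately show "of_int (sign (inv p)) * (\<Prod>i<l. hz n (dot lam (inv p) i)) = of_int (sign p) * (\<Prod>i\<in>{0..<l}. hz n (int (lam i) - int i + int (p i)))"
   by simp
 qed (auto intro: permutes_inv simp: inv_inv_eq permutes_bij)
 also have "atom 0 c * (\<Sum>p\<in>?P. of_int (sign p) * (\<Prod>i<l. hz n (dot lam p i))) =
   (\<Sum>p\<in>?P. of_int (sign p) * (\<Sum>b\<in>?B. of_nat (card (chs n c b l (dot lam p))) * atom 0 b))"
  unfolding sum_distrib_left
 proof (rule sum.cong[OF refl])
  fix p assume "p \<in> ?P"
  then have p: "p permutes {0..<l}" by simp
  have "(\<Sum>i<l. dot lam p i) = (\<Sum>i\<in>{0..<l}. (int (lam (p i)) - int (p i))) + (\<Sum>i\<in>{0..<l}. int i)"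
   unfolding dot_def sum.distrib by (simp add: atLeast0LessThan)
  also have "(\<Sum>i\<in>{0..<l}. (int (lam (p i)) - int (p i))) = (\<Sum>i\<in>{0..<l}. int (lam i) - int i)"
   using sum.permute[OF p, of "\<lambda>i. int (lam i) - int i"] by (simp add: comp_def)
  also have "(\<Sum>i\<in>{0..<l}. int (lam i) - int i) + (\<Sum>i\<in>{0..<l}. int i) = int (\<Sum>i<l. lam i)"
   by (simp add: sum_subtractf atLeast0LessThan)
  finally have "{b. on {0<..n} b \<and> int (sz n b) = int (sz n c) + (\<Sum>i<l. dot lam p i)} = ?B"
   by (auto simp flip: of_nat_add of_nat_sum)
  then have "atom 0 c * (\<Prod>i<l. hz n (dot lam p i)) = (\<Sum>b\<in>?B. of_nat (card (chs n c b l (dot lam p))) * atom 0 b)"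
   using atom_times_hs[OF c, where l = l and al = "dot lam p"] by simp
  moreover have "atom 0 c * (of_int (sign p) * (\<Prod>i<l. hz n (dot lam p i))) = of_int (sign p) * (atom 0 c * (\<Prod>i<l. hz n (dot lam p i)))"
   by (rule mult.left_commute)
  ultimately show "atom 0 c * (of_int (sign p) * (\<Prod>i<l. hz n (dot lam p i))) =
    (\<Sum>b\<in>?B. of_int (sign p) * (of_nat (card (chs n c b l (dot lam p))) * atom 0 b))"
   by (simp only: sum_distrib_left)
 qed
 also have "\<dots> = (\<Sum>b\<in>?B. of_int (\<Sum>p\<in>?P. sign p * int (card (chs n c b l (dot lam p)))) * atom 0 b)"
  unfolding sum_distrib_left by (subst sum.swap) (simp add: sum_distrib_right mult.assoc)
 also have "\<dots> = (\<Sum>b\<in>?B. of_nat (card {D\<in>chs n c b l (\<lambda>i. int (lam i)). lattice n l D}) * atom 0 b)"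
 proof (rule sum.cong[OF refl])
  fix b assume b: "b \<in> ?B"
  have "(\<Sum>p\<in>?P. sign p * int (card (chs n c b l (dot lam p)))) = int (card {D\<in>chs n c b l (\<lambda>i. int (lam i)). lattice n l D})"
   by (rule lattice_count) (use b lam in auto)
  then show "of_int (\<Sum>p\<in>?P. sign p * int (card (chs n c b l (dot lam p)))) * atom 0 b =
    of_nat (card {D\<in>chs n c b l (\<lambda>i. int (lam i)). lattice n l D}) * atom 0 b" by simp
 qed
 finally show ?thesis .
qed

section \<open>Quasi-key tableaux and skyline fillings\<close>

definition fil :: "nat \<Rightarrow> (nat \<Rightarrow> nat) \<Rightarrow> filling \<Rightarrow> bool" where
 "fil n c T \<longleftrightarrow> on {0<..n} c \<and> (\<forall>r j. 0 < T (r, j) \<longleftrightarrow> 1 \<le> j \<and> j \<le> c r) \<and>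
   (\<forall>r j. 1 \<le> j \<longrightarrow> T (r, Suc j) \<le> T (r, j)) \<and>
   (\<forall>r s j. 0 < T (r, j) \<and> T (r, j) = T (s, j) \<longrightarrow> r = s)"

definition colset :: "filling \<Rightarrow> nat \<Rightarrow> nat set" where
 "colset T j = {T (r, j) | r. 0 < T (r, j)}"

text \<open>The order of the rows in which the quasi-key conditions become a single rule.\<close>

definition prior :: "(nat \<Rightarrow> nat) \<Rightarrow> nat \<Rightarrow> nat \<Rightarrow> bool" where
 "prior c r s \<longleftrightarrow> c s < c r \<or> c r = c s \<and> r < s"

text \<open>The bound \<open>k\<close> lets this rule be established from the last column leftwards,
  whereas \<open>srule\<close> is established from the first column rightwards.\<close>

definition qrule :: "nat \<Rightarrow> (nat \<Rightarrow> nat) \<Rightarrow> filling \<Rightarrow> bool" where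
 "qrule k c T \<longleftrightarrow> (\<forall>r s j. prior c r s \<and> k \<le> j \<and> 1 \<le> j \<and> j \<le> c s \<longrightarrow> T (r, j) < T (s, j) \<or> T (s, j) < T (r, Suc j))"

definition srule :: "nat \<Rightarrow> filling \<Rightarrow> bool" where
 "srule k T \<longleftrightarrow> (\<forall>r s j. r < s \<and> 1 \<le> j \<and> j < k \<and> 0 < T (s, Suc j) \<longrightarrow> T (r, j) < T (s, Suc j) \<or> T (s, Suc j) < T (r, Suc j))"

definition qa :: "nat \<Rightarrow> (nat \<Rightarrow> nat) \<Rightarrow> filling set" where
 "qa n c = {T. fil n c T \<and> (\<forall>r. 0 < c r \<longrightarrow> T (r, 1) = r) \<and> qrule 1 c T}"

definition cnt :: "filling \<Rightarrow> nat \<Rightarrow> nat \<Rightarrow> nat" where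
 "cnt T v j = card {r. 0 < T (r, j) \<and> T (r, 1) \<le> v}"

lemma fil_pos: "fil n c T \<Longrightarrow> 0 < T (r, j) \<longleftrightarrow> 1 \<le> j \<and> j \<le> c r"
 by (simp add: fil_def)

lemma fil_dec: "fil n c T \<Longrightarrow> 1 \<le> j \<Longrightarrow> T (r, Suc j) \<le> T (r, j)"
 by (simp add: fil_def)

lemma fil_dist: "fil n c T \<Longrightarrow> 0 < T (r, j) \<Longrightarrow> T (r, j) = T (s, j) \<Longrightarrow> r = s"
 unfolding fil_def by (elim conjE) blast

lemma fil_anti: assumes "fil n c T" "1 \<le> i" "i \<le> j" shows "T (r, j) \<le> T (r, i)"
 using assms(3)
proof (induction j rule: dec_induct)
 case (step j) then show ?case using fil_dec[OF assms(1), of j r] assms(2) by simp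
qed simp

lemma fil_on: "fil n c T \<Longrightarrow> on {0<..n} c"
 by (simp add: fil_def)

lemma fil_row: assumes "fil n c T" "0 < T (r, j)" shows "r \<in> {1..n}"
proof -
 have "c r \<noteq> 0" using fil_pos[OF assms(1), of r j] assms(2) by simp
 then have "r \<in> {0<..n}" using onD[OF fil_on[OF assms(1)], of r] by blast
 then show ?thesis by simp
qed

lemma finite_rows: assumes "fil n c T" shows "finite {r. 0 < T (r, j) \<and> P r}"
 by (rule finite_subset[of _ "{1..n}"]) (use fil_row[OF assms] in auto)

text \<open>Distinct entries in a column are a consequence of the triple rule: a repetition in
  column \<open>Suc i\<close> would contradict either alternative, because the lower row weakly
  decreases.\<close>

lemma ssaf_iff: assumes c: "on {0<..n} c"
 shows "T \<in> ssaf 0 c \<longleftrightarrow> fil n c T \<and> (\<forall>r. 0 < c r \<longrightarrow> T (r, 1) = r) \<and> (\<forall>k. srule k T)"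
proof
 assume T: "T \<in> ssaf 0 c"
 have pos: "0 < T (r, j) \<longleftrightarrow> 1 \<le> j \<and> j \<le> c r" for r j using T by (simp add: ssaf_def)
 have dec: "T (r, Suc j) \<le> T (r, j)" if "1 \<le> j" for r j using T that by (simp add: ssaf_def)
 have one: "T (r, 1) = r" if "0 < c r" for r using T that by (simp add: ssaf_def)
 have rl: "T (r, j) < T (s, Suc j) \<or> T (s, Suc j) < T (r, Suc j)" if "r < s" "1 \<le> j" "Suc j \<le> c s" for r s j
  using T that by (simp add: ssaf_def)
 have lt: "False" if "r < s" "0 < T (s, j)" "T (r, j) = T (s, j)" for r s j
 proof (cases "j = 1")
  case True
  then show False using one[of r] one[of s] pos[of r 1] pos[of s 1] that by auto
 next
  case False
  have "1 \<le> j" using that pos[of s j] by simp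
  with False obtain i where j: "j = Suc i" "1 \<le> i" by (cases j) auto
  then have "T (r, i) < T (s, j) \<or> T (s, j) < T (r, j)" using rl[of r s i] that pos[of s j] by simp
  then show False using dec[of i r] that j by simp
 qed
 have "r = s" if "0 < T (r, j)" "T (r, j) = T (s, j)" for r s j
  using lt[of r s j] lt[of s r j] that by (metis linorder_neqE_nat)
 then have "fil n c T" unfolding fil_def using c pos dec by blast
 moreover have "srule k T" for k unfolding srule_def using rl pos by blast
 ultimately show "fil n c T \<and> (\<forall>r. 0 < c r \<longrightarrow> T (r, 1) = r) \<and> (\<forall>k. srule k T)" using one by blast
next
 assume a: "fil n c T \<and> (\<forall>r. 0 < c r \<longrightarrow> T (r, 1) = r) \<and> (\<forall>k. srule k T)"
 then have f: "fil n c T" by blast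
 have s: "srule (Suc j) T" for j using a by blast
 show "T \<in> ssaf 0 c" unfolding ssaf_def mem_Collect_eq
 proof (intro conjI allI impI)
  show "0 < T (r, j) \<longleftrightarrow> 1 \<le> j \<and> j \<le> c r" for r j by (rule fil_pos[OF f])
  show "T (r, Suc j) \<le> T (r, j)" if "1 \<le> j" for r j by (rule fil_dec[OF f that])
  show "T (r, 1) = r" if "0 < c r" for r using a that by blast
  show "T (r, j) < T (s, Suc j) \<or> T (s, Suc j) < T (r, Suc j)" if "r < s \<and> 1 \<le> j \<and> Suc j \<le> c s" for r s j
   using s[of j] that fil_pos[OF f, of s "Suc j"] by (auto simp: srule_def)
 qed
qed

text \<open>Rows are paths through the columns. The number of paths that start at a value at most \<open>v\<close> and reach
 column \<open>j\<close> is bounded by any cut, and both rules make a suitable cut tight; hence the column sets determine the shape.\<close>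

primrec scut :: "filling \<Rightarrow> nat \<Rightarrow> nat \<Rightarrow> nat \<Rightarrow> nat \<Rightarrow> nat" where
 "scut T n v j 0 = 0"
| "scut T n v j (Suc k) = (LEAST x. scut T n v j k \<le> x \<and> (x = Suc n \<or> (\<exists>s>v. 0 < x \<and> T (s, j - k) = x)))"

text \<open>The rows of \<open>T\<close> above \<open>v\<close> define the cut: \<open>t i\<close>
  is the least entry not below \<open>t (Suc i)\<close> that such a row has in column
  \<open>i\<close>. A path of \<open>T'\<close> counted by \<open>cnt\<close> first reaches the cut
  at some entry; in \<open>T\<close> this entry lies in a row at most \<open>v\<close>, and the
  triple rule keeps that row above the cut up to column \<open>j\<close>. Distinct paths lead to
  distinct rows.\<close>

lemma cnt_le_ssaf:
 assumes T: "T \<in> ssaf 0 c" "on {0<..n} c" and T': "fil n c' T'" and cs: "\<And>i. colset T' i = colset T i" and j: "1 \<le> j"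
 shows "cnt T' v j \<le> cnt T v j"
proof -
 have f: "fil n c T" and one: "\<And>r. 0 < c r \<Longrightarrow> T (r, 1) = r" and sr: "\<And>k. srule k T"
  using T(1) unfolding ssaf_iff[OF T(2)] by auto
 have Tn: "T p \<le> n" for p
  using ssaf_le[OF T(1), of "fst p" "snd p"] fil_row[OF f, of "fst p" "snd p"] by (cases "T p = 0") (auto intro: le_trans)
 \<comment> \<open>\<open>scut\<close> grows from column \<open>j\<close> to the left, starting from
   the value 0 at column \<open>Suc j\<close>; \<open>t\<close> indexes it by columns. The value
   \<open>Suc n\<close> stands for no admissible entry.\<close>
 define t where "t = (\<lambda>i. scut T n v j (Suc j - i))"
 have bnd: "scut T n v j k \<le> Suc n" for k
 proof (induction k)
  case (Suc k) then show ?case by (simp add: Least_le)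
 qed simp
 have st: "t (Suc i) \<le> t i \<and> (t i = Suc n \<or> (\<exists>s>v. 0 < t i \<and> T (s, i) = t i))" if "i \<le> j" for i
 proof -
  have e: "t i = scut T n v j (Suc (j - i))" "t (Suc i) = scut T n v j (j - i)" using that by (simp_all add: t_def Suc_diff_le)
  let ?P = "\<lambda>x. scut T n v j (j - i) \<le> x \<and> (x = Suc n \<or> (\<exists>s>v. 0 < x \<and> T (s, j - (j - i)) = x))"
  have "?P (LEAST x. ?P x)" by (rule LeastI[of ?P "Suc n"]) (use bnd in simp)
  then show ?thesis unfolding e(1) scut.simps e(2) using that by simp
 qed
 have tle: "t i \<le> T (s, i)" if "i \<le> j" "v < s" "0 < T (s, i)" "t (Suc i) \<le> T (s, i)" for i s
 proof -
  have e: "t i = scut T n v j (Suc (j - i))" "t (Suc i) = scut T n v j (j - i)" using that by (simp_all add: t_def Suc_diff_le)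
  show ?thesis unfolding e(1) scut.simps by (rule Least_le) (use that e in auto)
 qed
 have t0: "t (Suc j) = 0" by (simp add: t_def)
 define I where "I = (\<lambda>r. LEAST i. 1 \<le> i \<and> t (Suc i) \<le> T' (r, i))"
 have I: "1 \<le> I r" "I r \<le> j" "t (Suc (I r)) \<le> T' (r, I r)" "T' (r, I r) < t (I r)" "0 < T' (r, I r)"
  if r: "0 < T' (r, j)" "T' (r, 1) \<le> v" for r
 proof -
  let ?P = "\<lambda>i. 1 \<le> i \<and> t (Suc i) \<le> T' (r, i)"
  have Pj: "?P j" using j t0 by simp
  have P: "?P (I r)" unfolding I_def by (rule LeastI[of ?P, OF Pj])
  show "1 \<le> I r" "t (Suc (I r)) \<le> T' (r, I r)" using P by auto
  show ij: "I r \<le> j" unfolding I_def by (rule Least_le[of ?P, OF Pj])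
  show pos: "0 < T' (r, I r)" using fil_anti[OF T', of "I r" j r] P ij r by simp
  show "T' (r, I r) < t (I r)"
  proof (cases "I r = 1")
   case True
   have "T' (r, 1) \<in> colset T' 1" using pos True unfolding colset_def by auto
   then have "T' (r, 1) \<in> colset T 1" by (simp only: cs)
   then have "T' (r, 1) \<le> n" using Tn by (auto simp: colset_def)
   moreover have "v < t 1 \<or> t 1 = Suc n"
   proof (cases "t 1 = Suc n")
    case False
    then obtain s where s: "v < s" "0 < t 1" "T (s, 1) = t 1" using st[of 1] j by auto
    then have "T (s, 1) = s" using one[of s] fil_pos[OF f, of s 1] by simp
    then show ?thesis using s by simp
   qed simp
   ultimately show ?thesis using True r(2) by auto
  next
   case False
   then obtain i where i: "I r = Suc i" "1 \<le> i" using P by (cases "I r") auto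
   then have "\<not> ?P i" using not_less_Least[of i ?P] unfolding I_def by simp
   then show ?thesis using i fil_dec[OF T', of i r] by simp
  qed
 qed
 define F where "F = (\<lambda>r. SOME \<rho>. T (\<rho>, I r) = T' (r, I r))"
 have F: "T (F r, I r) = T' (r, I r)" if r: "0 < T' (r, j)" "T' (r, 1) \<le> v" for r
 proof -
  have "T' (r, I r) \<in> colset T' (I r)" using I(5)[OF r] unfolding colset_def by blast
  then have "T' (r, I r) \<in> colset T (I r)" by (simp only: cs)
  then have "\<exists>\<rho>. T (\<rho>, I r) = T' (r, I r)" by (auto simp: colset_def)
  then show ?thesis unfolding F_def by (rule someI_ex)
 qed
 have low: "F r \<le> v" if r: "0 < T' (r, j)" "T' (r, 1) \<le> v" for r
  using tle[of "I r" "F r"] I[OF r] F[OF r] by fastforce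
 have keep: "0 < T (F r, i) \<and> t (Suc i) \<le> T (F r, i) \<and> (I r < i \<longrightarrow> t i < T (F r, i))"
  if r: "0 < T' (r, j)" "T' (r, 1) \<le> v" and i: "I r \<le> i" "i \<le> j" for r i
  using i
 proof (induction i rule: dec_induct)
  case base then show ?case using I[OF r] F[OF r] by simp
 next
  case (step i)
  then have IH: "t (Suc i) \<le> T (F r, i)" by simp
  then have "t (Suc i) \<noteq> Suc n" using Tn[of "(F r, i)"] by auto
  then obtain s where s: "v < s" "0 < t (Suc i)" "T (s, Suc i) = t (Suc i)" using st[of "Suc i"] step.prems by auto
  then have "F r < s" using low[OF r] by simp
  moreover have "1 \<le> i" using I(1)[OF r] step.hyps by simp
  ultimately have "T (F r, i) < T (s, Suc i) \<or> T (s, Suc i) < T (F r, Suc i)"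
   using sr[of "Suc i"] s unfolding srule_def by (metis lessI)
  then have "t (Suc i) < T (F r, Suc i)" using s IH by auto
  moreover have "t (Suc (Suc i)) \<le> t (Suc i)" using st[of "Suc i"] step.prems by simp
  ultimately show ?case by simp
 qed
 let ?A = "{r. 0 < T' (r, j) \<and> T' (r, 1) \<le> v}" and ?B = "{r. 0 < T (r, j) \<and> T (r, 1) \<le> v}"
 have "card ?A \<le> card ?B"
 proof (rule card_inj_on_le[of F])
  show "finite ?B" by (rule finite_rows[OF f])
  show "F ` ?A \<subseteq> ?B"
  proof
   fix x assume "x \<in> F ` ?A"
   then obtain r where x: "x = F r" and r: "0 < T' (r, j)" "T' (r, 1) \<le> v" by auto
   have p: "0 < T (x, j)" using keep[OF r, of j] I(2)[OF r] x by simp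
   then have "T (x, 1) = x" using one[of x] fil_pos[OF f, of x j] by simp
   then show "x \<in> ?B" using p low[OF r] x by simp
  qed
  \<comment> \<open>A row entered at an earlier column is strictly above the cut in every later one,
    but the second path enters at an entry below it.\<close>
  have less: False if r: "0 < T' (r, j)" "T' (r, 1) \<le> v" and s: "0 < T' (s, j)" "T' (s, 1) \<le> v" and e: "F r = F s" "I r < I s" for r s
  proof -
   have "t (I s) < T (F r, I s)" using keep[OF r, of "I s"] e(2) I(2)[OF s] by simp
   then show False using e(1) F[OF s] I(4)[OF s] by simp
  qed
  show "inj_on F ?A"
  proof (rule inj_onI)
   fix r s assume "r \<in> ?A" "s \<in> ?A" and e: "F r = F s"
   then have r: "0 < T' (r, j)" "T' (r, 1) \<le> v" and s: "0 < T' (s, j)" "T' (s, 1) \<le> v" by auto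
   have "I r = I s" using less[OF r s e] less[OF s r e[symmetric]] by (metis linorder_neqE_nat)
   then have "T' (r, I r) = T' (s, I r)" using F[OF r] F[OF s] e by simp
   then show "r = s" using fil_dist[OF T' I(5)[OF r]] by blast
  qed
 qed
 then show ?thesis by (simp add: cnt_def)
qed

primrec qcut :: "filling \<Rightarrow> (nat \<Rightarrow> nat) \<Rightarrow> nat \<Rightarrow> nat \<Rightarrow> nat \<Rightarrow> nat" where
 "qcut T c v j 0 = v"
| "qcut T c v j (Suc i) = (GREATEST x. x \<le> qcut T c v j i \<and> (x = 0 \<or> (\<exists>s. c s < j \<and> T (s, Suc i) = x)))"

text \<open>Dually, the cut is built from the rows of \<open>T'\<close> too short to reach column
  \<open>j\<close>. The entry at which a path of \<open>T\<close> first exceeds the cut lies in a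
  long row of \<open>T'\<close>, and the rule carries this row back to column 1 below the cut, hence
  to a first entry at most \<open>v\<close>.\<close>

lemma cnt_le_qrule:
 assumes T': "fil n c' T'" "qrule 1 c' T'" and T: "fil n c T" and cs: "\<And>i. colset T' i = colset T i" and j: "1 \<le> j"
 shows "cnt T v j \<le> cnt T' v j"
proof -
 define u where "u = qcut T' c' v j"
 have u0: "u 0 = v" by (simp add: u_def)
 have st: "u (Suc i) \<le> u i \<and> (u (Suc i) = 0 \<or> (\<exists>s. c' s < j \<and> T' (s, Suc i) = u (Suc i)))" for i
 proof -
  let ?P = "\<lambda>x. x \<le> u i \<and> (x = 0 \<or> (\<exists>s. c' s < j \<and> T' (s, Suc i) = x))"
  have "?P (GREATEST x. ?P x)" by (rule GreatestI_nat[of ?P 0 "u i"]) auto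
  then show ?thesis by (simp add: u_def)
 qed
 have le: "T' (s, Suc i) \<le> u (Suc i)" if "c' s < j" "T' (s, Suc i) \<le> u i" for s i
 proof -
  let ?P = "\<lambda>x. x \<le> u i \<and> (x = 0 \<or> (\<exists>s. c' s < j \<and> T' (s, Suc i) = x))"
  have "T' (s, Suc i) \<le> (GREATEST x. ?P x)" by (rule Greatest_le_nat[of ?P _ "u i"]) (use that in auto)
  then show ?thesis by (simp add: u_def)
 qed
 have uj: "u j = 0"
 proof -
  obtain i where i: "j = Suc i" using j by (cases j) auto
  have "T' (s, j) = 0" if "c' s < j" for s using fil_pos[OF T'(1), of s j] that by simp
  then show ?thesis using st[of i] i by auto
 qed
 define I where "I = (\<lambda>r. LEAST i. 1 \<le> i \<and> u i < T (r, i))"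
 have I: "1 \<le> I r" "I r \<le> j" "u (I r) < T (r, I r)" "T (r, I r) \<le> u (I r - 1)"
  if r: "0 < T (r, j)" "T (r, 1) \<le> v" for r
 proof -
  let ?P = "\<lambda>i. 1 \<le> i \<and> u i < T (r, i)"
  have Pj: "?P j" using j uj r by simp
  have P: "?P (I r)" unfolding I_def by (rule LeastI[of ?P, OF Pj])
  show "1 \<le> I r" "u (I r) < T (r, I r)" using P by auto
  show "I r \<le> j" unfolding I_def by (rule Least_le[of ?P, OF Pj])
  show "T (r, I r) \<le> u (I r - 1)"
  proof (cases "I r = 1")
   case True then show ?thesis using r u0 by simp
  next
   case False
   then obtain i where i: "I r = Suc i" "1 \<le> i" using P by (cases "I r") auto
   then have "\<not> ?P i" using not_less_Least[of i ?P] unfolding I_def by simp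
   then show ?thesis using i fil_dec[OF T, of i r] by simp
  qed
 qed
 define F where "F = (\<lambda>r. SOME \<rho>. T' (\<rho>, I r) = T (r, I r))"
 have F: "T' (F r, I r) = T (r, I r)" if r: "0 < T (r, j)" "T (r, 1) \<le> v" for r
 proof -
  have "0 < T (r, I r)" using I(3)[OF r] by simp
  then have "T (r, I r) \<in> colset T (I r)" unfolding colset_def by blast
  then have "T (r, I r) \<in> colset T' (I r)" by (simp only: cs)
  then have "\<exists>\<rho>. T' (\<rho>, I r) = T (r, I r)" by (auto simp: colset_def)
  then show ?thesis unfolding F_def by (rule someI_ex)
 qed
 have long: "j \<le> c' (F r)" if r: "0 < T (r, j)" "T (r, 1) \<le> v" for r
 proof (rule ccontr)
  assume "\<not> j \<le> c' (F r)"
  then have "T' (F r, Suc (I r - 1)) \<le> u (Suc (I r - 1))" using le[of "F r" "I r - 1"] I[OF r] F[OF r] by simp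
  then show False using I[OF r] F[OF r] by simp
 qed
 have keep: "T' (F r, i) \<le> u (i - 1) \<and> (i < I r \<longrightarrow> T' (F r, i) < u i)"
  if r: "0 < T (r, j)" "T (r, 1) \<le> v" and i: "i \<le> I r" "1 \<le> i" for r i
  using i
 proof (induction i rule: inc_induct)
  case base then show ?case using I[OF r] F[OF r] by simp
 next
  case (step i)
  then have IH: "T' (F r, Suc i) \<le> u i" by simp
  have "Suc i \<le> c' (F r)" using long[OF r] I(2)[OF r] step.hyps by simp
  then have "0 < T' (F r, Suc i)" using fil_pos[OF T'(1)] by simp
  then have ui: "0 < u i" using IH by simp
  obtain i' where i': "i = Suc i'" using step.prems by (cases i) auto
  obtain s where s: "c' s < j" "T' (s, i) = u i" using st[of i'] ui i' by auto
  have pr: "prior c' (F r) s" using long[OF r] s(1) by (simp add: prior_def)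
  moreover have "i \<le> c' s" using fil_pos[OF T'(1), of s i] s(2) ui by simp
  ultimately have "T' (F r, i) < T' (s, i) \<or> T' (s, i) < T' (F r, Suc i)"
   using T'(2) step.prems unfolding qrule_def by blast
  then have "T' (F r, i) < u i" using s IH by auto
  moreover have "u i \<le> u (i - 1)" using st[of i'] i' by simp
  ultimately show ?case by simp
 qed
 let ?A = "{r. 0 < T (r, j) \<and> T (r, 1) \<le> v}" and ?B = "{r. 0 < T' (r, j) \<and> T' (r, 1) \<le> v}"
 have "card ?A \<le> card ?B"
 proof (rule card_inj_on_le[of F])
  show "finite ?B" by (rule finite_rows[OF T'(1)])
  show "F ` ?A \<subseteq> ?B"
  proof
   fix x assume "x \<in> F ` ?A"
   then obtain r where x: "x = F r" and r: "0 < T (r, j)" "T (r, 1) \<le> v" by auto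
   have "0 < T' (x, j)" using fil_pos[OF T'(1), of x j] long[OF r] j x by simp
   moreover have "T' (x, 1) \<le> v" using keep[OF r, of 1] I(1)[OF r] u0 x by simp
   ultimately show "x \<in> ?B" by simp
  qed
  have less: False if r: "0 < T (r, j)" "T (r, 1) \<le> v" and s: "0 < T (s, j)" "T (s, 1) \<le> v" and e: "F r = F s" "I r < I s" for r s
   using keep[OF s, of "I r"] e I[OF r] F[OF r] by simp
  show "inj_on F ?A"
  proof (rule inj_onI)
   fix r s assume "r \<in> ?A" "s \<in> ?A" and e: "F r = F s"
   then have r: "0 < T (r, j)" "T (r, 1) \<le> v" and s: "0 < T (s, j)" "T (s, 1) \<le> v" by auto
   have eI: "I r = I s" using less[OF r s e] less[OF s r e[symmetric]] by (metis linorder_neqE_nat)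
   then have "T (r, I r) = T (s, I r)" using F[OF r] F[OF s] e by simp
   moreover have "0 < T (r, I r)" using I(3)[OF r] by simp
   ultimately show "r = s" using fil_dist[OF T] by blast
  qed
 qed
 then show ?thesis by (simp add: cnt_def)
qed

section \<open>Existence of rule-abiding fillings by exchanging parts of rows\<close>

lemma sum_transpose_less:
 fixes w f :: "nat \<Rightarrow> nat"
 assumes A: "finite A" "r \<in> A" "s \<in> A" and w: "w s < w r" "f s < f r"
 shows "(\<Sum>q\<in>A. w q * f (Transposition.transpose r s q)) < (\<Sum>q\<in>A. w q * f q)"
proof -
 have rs: "r \<noteq> s" using w by auto
 have split: "sum g A = g r + (g s + sum g (A - {r} - {s}))" for g :: "nat \<Rightarrow> nat"
  using A rs by (simp add: sum.remove[of A r] sum.remove[of "A - {r}" s])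
 obtain d e where de: "w r = w s + d" "0 < d" "f r = f s + e" "0 < e"
  using w by (metis less_imp_add_positive)
 have "sum (\<lambda>q. w q * f (Transposition.transpose r s q)) (A - {r} - {s}) = sum (\<lambda>q. w q * f q) (A - {r} - {s})"
  by (rule sum.cong) (auto simp: Transposition.transpose_def)
 moreover have "w r * f s + w s * f r < w r * f r + w s * f s"
  using de by (simp add: algebra_simps)
 ultimately show ?thesis using rs by (subst (1 2) split) (simp add: Transposition.transpose_def)
qed

lemma colset_transpose:
 assumes "\<And>q. T' (q, j) = T (Transposition.transpose r s q, j)"
 shows "colset T' j = colset T j"
proof (rule set_eqI)
 fix p
 have "p \<in> colset T' j \<longleftrightarrow> 0 < p \<and> (\<exists>q. T (Transposition.transpose r s q, j) = p)" by (auto simp: colset_def assms)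
 also have "(\<exists>q. T (Transposition.transpose r s q, j) = p) \<longleftrightarrow> (\<exists>q. T (q, j) = p)"
  by (metis transpose_involutory)
 also have "0 < p \<and> (\<exists>q. T (q, j) = p) \<longleftrightarrow> p \<in> colset T j" by (auto simp: colset_def)
 finally show "p \<in> colset T' j \<longleftrightarrow> p \<in> colset T j" .
qed

text \<open>At a violation, T(r,k+1) < T(s,k+1) \<le> T(r,k), so the tails of the two rows can be
  exchanged from column \<open>Suc k\<close> on. The larger entry moves to the lower row, which
  decreases the weighted sum; the sets of column entries and all columns up to \<open>k\<close> stay
  as they are.\<close>

lemma srule_improve:
 assumes T: "fil n c T" "srule k T" and k: "1 \<le> k" and n: "\<not> srule (Suc k) T"
 shows "\<exists>c' T'. fil n c' T' \<and> (\<forall>j. colset T' j = colset T j) \<and> (\<forall>r. T' (r, 1) = T (r, 1)) \<and> srule k T' \<and>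
  (\<Sum>r\<in>{1..n}. r * T' (r, Suc k)) < (\<Sum>r\<in>{1..n}. r * T (r, Suc k))"
proof -
 obtain r s j where v: "r < s" "1 \<le> j" "j < Suc k" "0 < T (s, Suc j)" "\<not> (T (r, j) < T (s, Suc j) \<or> T (s, Suc j) < T (r, Suc j))"
  using n unfolding srule_def by blast
 then have jk: "j = k" using T(2) unfolding srule_def by (metis less_antisym)
 have lt: "T (r, Suc k) < T (s, Suc k)" using v fil_dist[OF T(1), of s "Suc k" r] unfolding jk by force
 have rk: "T (s, Suc k) \<le> T (r, k)" using v jk by simp
 have cr: "k \<le> c r" "Suc k \<le> c s" using fil_pos[OF T(1), of r k] fil_pos[OF T(1), of s "Suc k"] v rk jk by auto
 define \<tau> where "\<tau> = Transposition.transpose s r"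
 define T' where "T' = (\<lambda>(q, j). T (if Suc k \<le> j then \<tau> q else q, j))"
 have hi: "T' (q, j) = T (\<tau> q, j)" if "Suc k \<le> j" for q j using that by (simp add: T'_def)
 have lo: "T' (q, j) = T (q, j)" if "j \<le> k" for q j using that by (simp add: T'_def)
 have \<tau>: "\<tau> r = s" "\<tau> s = r" "\<And>q. q \<noteq> r \<Longrightarrow> q \<noteq> s \<Longrightarrow> \<tau> q = q" using v by (auto simp: \<tau>_def Transposition.transpose_def)
 have "fil n (c \<circ> \<tau>) T'" unfolding fil_def
 proof (intro conjI allI impI)
  have rs: "r \<in> {0<..n}" "s \<in> {0<..n}"
   using fil_row[OF T(1), of r k] fil_row[OF T(1), of s "Suc k"] v rk jk by auto
  have "q \<in> {0<..n}" if q: "0 < c (\<tau> q)" for q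
   using onD[OF fil_on[OF T(1)], of q] rs q \<tau>(3)[of q] by (cases "q = r"; cases "q = s") auto
  then show "on {0<..n} (c \<circ> \<tau>)" unfolding on_def comp_def by (meson gr0I)
  show "0 < T' (q, j) \<longleftrightarrow> 1 \<le> j \<and> j \<le> (c \<circ> \<tau>) q" for q j
  proof (cases "Suc k \<le> j")
   case True then show ?thesis using hi fil_pos[OF T(1), of "\<tau> q" j] by simp
  next
   case False
   then have "j \<le> c q \<longleftrightarrow> j \<le> c (\<tau> q)" using \<tau> cr by (cases "q = r"; cases "q = s") auto
   then show ?thesis using False lo fil_pos[OF T(1), of q j] by simp
  qed
  show "T' (q, Suc j) \<le> T' (q, j)" if j: "1 \<le> j" for q j
  proof (cases "j = k")
   case True
   have "T (\<tau> q, Suc k) \<le> T (q, k)"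
    using \<tau> rk lt fil_dec[OF T(1) k, of s] fil_dec[OF T(1) k, of q] by (cases "q = r"; cases "q = s") auto
   then show ?thesis using True hi lo by simp
  next
   case False
   then show ?thesis using hi[of j] hi[of "Suc j"] lo[of j] lo[of "Suc j"] fil_dec[OF T(1) j]
    by (cases "Suc k \<le> j") auto
  qed
  show "q = q'" if "0 < T' (q, j) \<and> T' (q, j) = T' (q', j)" for q q' j
  proof (cases "Suc k \<le> j")
   case True
   then have "\<tau> q = \<tau> q'" using that hi fil_dist[OF T(1)] by metis
   then show ?thesis unfolding \<tau>_def by (metis transpose_involutory)
  next
   case False then show ?thesis using that lo fil_dist[OF T(1)] by (metis not_less_eq_eq)
  qed
 qed
 moreover have "colset T' j = colset T j" for j
 proof (cases "Suc k \<le> j")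
  case True show ?thesis by (rule colset_transpose[of _ _ _ s r]) (use hi[OF True] in \<open>simp add: \<tau>_def\<close>)
 next
  case False then show ?thesis using lo by (simp add: colset_def)
 qed
 moreover have "T' (q, 1) = T (q, 1)" for q using lo k by simp
 moreover have "srule k T'" unfolding srule_def
 proof (intro allI impI)
  fix r s j assume a: "r < s \<and> 1 \<le> j \<and> j < k \<and> 0 < T' (s, Suc j)"
  then have e: "T' (r, j) = T (r, j)" "T' (r, Suc j) = T (r, Suc j)" "T' (s, Suc j) = T (s, Suc j)" using lo by auto
  have "0 < T (s, Suc j)" using a e(3) by simp
  then show "T' (r, j) < T' (s, Suc j) \<or> T' (s, Suc j) < T' (r, Suc j)" unfolding e using T(2) a unfolding srule_def by blast
 qed
 moreover have "(\<Sum>r\<in>{1..n}. r * T' (r, Suc k)) < (\<Sum>r\<in>{1..n}. r * T (r, Suc k))"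
  unfolding hi[OF order_refl] \<tau>_def
  by (rule sum_transpose_less[of _ _ _ "\<lambda>r. r" "\<lambda>r. T (r, Suc k)"])
   (use fil_row[OF T(1), of s "Suc k"] fil_row[OF T(1), of r k] lt rk v(1) in simp_all)
 ultimately show ?thesis by blast
qed

lemma srule_exists:
 assumes T0: "fil n c0 T0"
 shows "\<exists>c T. fil n c T \<and> (\<forall>j. colset T j = colset T0 j) \<and> (\<forall>r. T (r, 1) = T0 (r, 1)) \<and> srule k T"
proof (induction k)
 case 0 show ?case using T0 by (auto simp: srule_def)
next
 case (Suc k)
 let ?P = "\<lambda>k T. (\<exists>c. fil n c T) \<and> (\<forall>j. colset T j = colset T0 j) \<and> (\<forall>r. T (r, 1) = T0 (r, 1)) \<and> srule k T"
 let ?m = "\<lambda>T. \<Sum>r\<in>{1..n}. r * T (r, Suc k)"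
 obtain T1 where "?P k T1" using Suc.IH by blast
 then obtain T where T: "?P k T" and min: "\<And>T'. ?P k T' \<Longrightarrow> ?m T \<le> ?m T'"
  using ex_has_least_nat[of "?P k" T1 ?m] by blast
 have "srule (Suc k) T"
 proof (rule ccontr)
  assume n: "\<not> srule (Suc k) T"
  then have "1 \<le> k" by (cases k) (auto simp: srule_def)
  moreover obtain c where "fil n c T" using T by blast
  ultimately obtain c' T' where T': "fil n c' T'" "\<forall>j. colset T' j = colset T j" "\<forall>r. T' (r, 1) = T (r, 1)" "srule k T'"
   "?m T' < ?m T" using srule_improve[of n c T k] T n by blast
  then have "?P k T'" using T by metis
  then show False using min T'(5) by fastforce
 qed
 then show ?case using T by blast
qed

lemma fil_bound: assumes "fil n c T" obtains N where "\<And>r. c r \<le> N"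
proof
 fix r
 show "c r \<le> (\<Sum>r\<in>{1..n}. c r)"
 proof (cases "r \<in> {1..n}")
  case True then show ?thesis by (simp add: member_le_sum)
 next
  case False
  then have "r \<notin> {0<..n}" by auto
  then have "c r = 0" using onD[OF fil_on[OF assms], of r] by blast
  then show ?thesis by simp
 qed
qed

lemma srule_exists_all:
 assumes T0: "fil n c0 T0"
 shows "\<exists>c T. fil n c T \<and> (\<forall>j. colset T j = colset T0 j) \<and> (\<forall>r. T (r, 1) = T0 (r, 1)) \<and> (\<forall>k. srule k T)"
proof -
 obtain N where N: "\<And>r. c0 r \<le> N" using fil_bound[OF T0] by blast
 obtain c T where T: "fil n c T" "\<forall>j. colset T j = colset T0 j" "\<forall>r. T (r, 1) = T0 (r, 1)" "srule (Suc N) T"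
  using srule_exists[OF T0] by blast
 have z: "T (s, j) = 0" if "N < j" for s j
 proof -
  have "colset T0 j = {}" using fil_pos[OF T0, of _ j] N that by (auto simp: colset_def) (meson leD le_trans)
  then have "colset T j = {}" using T(2) by simp
  then show ?thesis by (auto simp: colset_def)
 qed
 have "srule k T" for k unfolding srule_def
 proof (intro allI impI)
  fix r s j assume a: "r < s \<and> 1 \<le> j \<and> j < k \<and> 0 < T (s, Suc j)"
  then have "\<not> N < Suc j" using z[of "Suc j" s] by auto
  then have "j < Suc N" by simp
  then show "T (r, j) < T (s, Suc j) \<or> T (s, Suc j) < T (r, Suc j)" using T(4) a unfolding srule_def by blast
 qed
 then show ?thesis using T by blast
qed

text \<open>Here the heads up to column \<open>k\<close> are exchanged, so the shape stays the same.
  The weight \<open>c r * Suc n + (n - r)\<close> encodes the order \<open>prior\<close> as a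
  number: rows with priority weigh more.\<close>

lemma qrule_improve:
 assumes T: "fil n c T" "qrule (Suc k) c T" and k: "1 \<le> k" and n: "\<not> qrule k c T"
 shows "\<exists>T'. fil n c T' \<and> (\<forall>j. colset T' j = colset T j) \<and> qrule (Suc k) c T' \<and>
  (\<Sum>r\<in>{1..n}. (c r * Suc n + (n - r)) * T' (r, k)) < (\<Sum>r\<in>{1..n}. (c r * Suc n + (n - r)) * T (r, k))"
proof -
 obtain r s j where v: "prior c r s" "k \<le> j" "1 \<le> j" "j \<le> c s" "\<not> (T (r, j) < T (s, j) \<or> T (s, j) < T (r, Suc j))"
  using n unfolding qrule_def by blast
 have jk: "j = k"
 proof (rule ccontr)
  assume "j \<noteq> k"
  then have "Suc k \<le> j" using v by simp
  then show False using T(2) v unfolding qrule_def by blast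
 qed
 have crs: "c s \<le> c r" "k \<le> c s" and rs: "r \<noteq> s" using v jk by (auto simp: prior_def)
 have ps: "0 < T (s, k)" "0 < T (r, k)" using fil_pos[OF T(1)] crs k by auto
 have lt: "T (s, k) < T (r, k)" using v(5) fil_dist[OF T(1) ps(1), of r] rs jk by force
 have rk: "T (r, Suc k) \<le> T (s, k)" using v jk by simp
 define \<tau> where "\<tau> = Transposition.transpose r s"
 define T' where "T' = (\<lambda>(q, j). T (if j \<le> k then \<tau> q else q, j))"
 have lo: "T' (q, j) = T (\<tau> q, j)" if "j \<le> k" for q j using that by (simp add: T'_def)
 have hi: "T' (q, j) = T (q, j)" if "Suc k \<le> j" for q j using that by (simp add: T'_def)
 have \<tau>: "\<tau> r = s" "\<tau> s = r" "\<And>q. q \<noteq> r \<Longrightarrow> q \<noteq> s \<Longrightarrow> \<tau> q = q" by (auto simp: \<tau>_def Transposition.transpose_def)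
 have "fil n c T'" unfolding fil_def
 proof (intro conjI allI impI)
  show "on {0<..n} c" by (rule fil_on[OF T(1)])
  show "0 < T' (q, j) \<longleftrightarrow> 1 \<le> j \<and> j \<le> c q" for q j
  proof (cases "j \<le> k")
   case True
   then have "j \<le> c q \<longleftrightarrow> j \<le> c (\<tau> q)" using \<tau> crs by (cases "q = r"; cases "q = s") auto
   then show ?thesis using True lo fil_pos[OF T(1), of "\<tau> q" j] by simp
  next
   case False then show ?thesis using hi fil_pos[OF T(1), of q j] by simp
  qed
  show "T' (q, Suc j) \<le> T' (q, j)" if j: "1 \<le> j" for q j
  proof (cases "j = k")
   case True
   have "T (q, Suc k) \<le> T (\<tau> q, k)"
    using \<tau> rk lt fil_dec[OF T(1) k, of s] fil_dec[OF T(1) k, of q] by (cases "q = r"; cases "q = s") auto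
   then show ?thesis using True hi lo by simp
  next
   case False
   then show ?thesis using hi[of j] hi[of "Suc j"] lo[of j] lo[of "Suc j"] fil_dec[OF T(1) j]
    by (cases "Suc k \<le> j") auto
  qed
  show "q = q'" if "0 < T' (q, j) \<and> T' (q, j) = T' (q', j)" for q q' j
  proof (cases "j \<le> k")
   case True
   then have "\<tau> q = \<tau> q'" using that lo fil_dist[OF T(1)] by metis
   then show ?thesis unfolding \<tau>_def by (metis transpose_involutory)
  next
   case False then show ?thesis using that hi fil_dist[OF T(1)] by (metis not_less_eq_eq)
  qed
 qed
 moreover have "colset T' j = colset T j" for j
 proof (cases "j \<le> k")
  case True show ?thesis by (rule colset_transpose[of _ _ _ r s]) (use lo[OF True] in \<open>simp add: \<tau>_def\<close>)
 next
  case False then show ?thesis using hi by (simp add: colset_def)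
 qed
 moreover have "qrule (Suc k) c T'" using T(2) hi unfolding qrule_def by simp
 moreover have "c s * Suc n + (n - s) < c r * Suc n + (n - r)"
 proof (cases "c s < c r")
  case True
  then have "c s * Suc n + Suc n \<le> c r * Suc n" by (metis add.commute less_eq_Suc_le mult_Suc mult_le_mono1)
  then show ?thesis by linarith
 next
  case False
  then show ?thesis using v(1) fil_row[OF T(1) ps(1)] by (auto simp: prior_def)
 qed
 then have "(\<Sum>r\<in>{1..n}. (c r * Suc n + (n - r)) * T' (r, k)) < (\<Sum>r\<in>{1..n}. (c r * Suc n + (n - r)) * T (r, k))"
  unfolding lo[OF order_refl] \<tau>_def
  by (intro sum_transpose_less[of _ _ _ "\<lambda>r. c r * Suc n + (n - r)" "\<lambda>r. T (r, k)"])
   (use fil_row[OF T(1) ps(1)] fil_row[OF T(1) ps(2)] lt in auto)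
 ultimately show ?thesis by blast
qed

lemma qrule_exists:
 assumes T0: "fil n c T0"
 shows "\<exists>T. fil n c T \<and> (\<forall>j. colset T j = colset T0 j) \<and> qrule 1 c T"
proof -
 obtain N where N: "\<And>r. c r \<le> N" using fil_bound[OF T0] by blast
 let ?P = "\<lambda>k T. fil n c T \<and> (\<forall>j. colset T j = colset T0 j) \<and> qrule k c T"
 have "\<exists>T. ?P k T" if "1 \<le> k" "k \<le> Suc N" for k
  using that(2,1)
 proof (induction k rule: inc_induct)
  case base
  have "qrule (Suc N) c T0" using N unfolding qrule_def by (meson not_less_eq_eq order_trans)
  then show ?case using T0 by blast
 next
  case (step k)
  let ?m = "\<lambda>T. \<Sum>r\<in>{1..n}. (c r * Suc n + (n - r)) * T (r, k)"
  obtain T1 where "?P (Suc k) T1" using step by auto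
  then obtain T where T: "?P (Suc k) T" and min: "\<And>T'. ?P (Suc k) T' \<Longrightarrow> ?m T \<le> ?m T'"
   using ex_has_least_nat[of "?P (Suc k)" T1 ?m] by blast
  have "qrule k c T"
  proof (rule ccontr)
   assume n: "\<not> qrule k c T"
   then obtain T' where T': "fil n c T'" "\<forall>j. colset T' j = colset T j" "qrule (Suc k) c T'" "?m T' < ?m T"
    using qrule_improve[of n c T k] T step.prems by blast
   then have "?P (Suc k) T'" using T by metis
   then show False using min T'(4) by fastforce
  qed
  then show ?case using T by blast
 qed
 then show ?thesis by simp
qed

section \<open>Uniqueness of a filling with given column sets\<close>

lemma colset_iff: "p \<in> colset T j \<longleftrightarrow> 0 < p \<and> (\<exists>r. T (r, j) = p)"
 by (auto simp: colset_def)

text \<open>Well-founded descent on misplaced entries: each entry lying in different rows of the two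
  columns yields another misplaced entry that precedes it for \<open>R\<close>.\<close>

lemma column_eqI:
 assumes cs: "colset T j = colset T' j"
  and step: "\<And>p r s. 0 < p \<Longrightarrow> T (r, j) = p \<Longrightarrow> T' (s, j) = p \<Longrightarrow> r \<noteq> s \<Longrightarrow>
   \<exists>p' q. 0 < p' \<and> (T (q, j) = p') \<noteq> (T' (q, j) = p') \<and> R p' p" and R: "wfP R"
 shows "T (r, j) = T' (r, j)"
proof (rule ccontr)
 assume n: "T (r, j) \<noteq> T' (r, j)"
 have none: "\<not> (0 < p \<and> (\<exists>q. (T (q, j) = p) \<noteq> (T' (q, j) = p)))" for p
  using R
 proof (induction p rule: wfp_induct_rule)
  case (less p)
  show ?case
  proof
   assume a: "0 < p \<and> (\<exists>q. (T (q, j) = p) \<noteq> (T' (q, j) = p))"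
   then have "p \<in> colset T j" "p \<in> colset T' j" using cs unfolding set_eq_iff colset_iff by blast+
   then obtain r s where rs: "T (r, j) = p" "T' (s, j) = p" by (auto simp: colset_iff)
   show False
   proof (cases "\<exists>r s. T (r, j) = p \<and> T' (s, j) = p \<and> r \<noteq> s")
    case True then show False using step less a by blast
   next
    case False then show False using a rs by blast
   qed
  qed
 qed
 then show False using n none[of "T (r, j)"] none[of "T' (r, j)"] by (metis gr0I)
qed

text \<open>Columns are compared from left to right. In a column, a misplaced entry produces a
  larger misplaced one, and the bound \<open>B\<close> on all entries ends this ascent.\<close>

lemma srule_unique:
 assumes T: "fil n c T" "\<And>k. srule k T" and T': "fil n c' T'" "\<And>k. srule k T'"
  and one: "\<And>r. T (r, 1) = T' (r, 1)" and cs: "\<And>j. colset T j = colset T' j"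
 shows "T = T'"
proof -
 have aux: "\<exists>p' q. 0 < p' \<and> (U (q, Suc j) = p') \<noteq> (U' (q, Suc j) = p') \<and> p < p'"
  if U: "fil n d U" and U': "\<And>k. srule k U'" and e: "\<And>r. U (r, j) = U' (r, j)" and j: "1 \<le> j"
   and p: "0 < p" "U (r, Suc j) = p" "U' (s, Suc j) = p" "r < s" for U U' d p r s j
 proof -
  have "U' (r, j) < U' (s, Suc j) \<or> U' (s, Suc j) < U' (r, Suc j)"
   using U'[of "Suc j"] p j unfolding srule_def by (metis lessI)
  moreover have "p \<le> U' (r, j)" using fil_dec[OF U j, of r] e p by metis
  ultimately show ?thesis using p by (intro exI[of _ "U' (r, Suc j)"] exI[of _ r]) auto
 qed
 have eq: "\<forall>r. T (r, Suc j) = T' (r, Suc j)" for j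
 proof (induction j)
  case 0 show ?case using one by simp
 next
  case (Suc j)
  obtain B where B: "\<And>p. T p < B" "\<And>p. T' p < B"
  proof -
   have f: "\<exists>B. \<forall>p. U p < B" if U: "fil n d U" for U d
   proof -
    have "U p \<le> (\<Sum>r\<in>{1..n}. U (r, 1))" for p
    proof (cases "U p = 0")
     case False
     obtain r j where p: "p = (r, j)" by (cases p)
     have "1 \<le> j" using fil_pos[OF U, of r j] False p by simp
     then have "U p \<le> U (r, 1)" using fil_anti[OF U, of 1 j r] p by simp
     also have "\<dots> \<le> (\<Sum>r\<in>{1..n}. U (r, 1))"
      using fil_row[OF U, of r j] False p by (intro member_le_sum[of r "{1..n}" "\<lambda>r. U (r, 1)"]) auto
     finally show ?thesis .
    qed simp
    then show ?thesis by (meson le_imp_less_Suc)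
   qed
   obtain B1 B2 where "\<forall>p. T p < B1" "\<forall>p. T' p < B2" using f[OF T(1)] f[OF T'(1)] by blast
   then have "T p < max B1 B2" "T' p < max B1 B2" for p by (auto simp: less_max_iff_disj simp del: split_paired_All)
   then show ?thesis by (rule that)
  qed
  show ?case
  proof (intro allI, rule column_eqI[where R = "\<lambda>p' p. p < p' \<and> p' < B", OF cs])
   have "wfP (\<lambda>p' p. B - p' < B - p)" by (simp add: wfp_if_convertible_to_nat)
   then show "wfP (\<lambda>p' p. p < p' \<and> p' < B)" by (rule wfp_subset) auto
  next
   fix p r s assume p: "0 < p" "T (r, Suc (Suc j)) = p" "T' (s, Suc (Suc j)) = p" "r \<noteq> s"
   have "\<exists>p' q. 0 < p' \<and> (T (q, Suc (Suc j)) = p') \<noteq> (T' (q, Suc (Suc j)) = p') \<and> p < p'"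
   proof (cases "r < s")
    case True
    show ?thesis by (rule aux[OF T(1) T'(2) _ _ p(1,2,3) True]) (use Suc in auto)
   next
    case False
    then have sr: "s < r" using p by simp
    have "\<exists>p' q. 0 < p' \<and> (T' (q, Suc (Suc j)) = p') \<noteq> (T (q, Suc (Suc j)) = p') \<and> p < p'"
     by (rule aux[OF T'(1) T(2) _ _ p(1,3,2) sr]) (use Suc in auto)
    then show ?thesis by metis
   qed
   then show "\<exists>p' q. 0 < p' \<and> (T (q, Suc (Suc j)) = p') \<noteq> (T' (q, Suc (Suc j)) = p') \<and> p < p' \<and> p' < B"
    using B by metis
  qed
 qed
 show ?thesis
 proof
  fix p :: "nat \<times> nat"
  obtain r j where p: "p = (r, j)" by (cases p)
  show "T p = T' p"
  proof (cases j)
   case 0 then show ?thesis using p fil_pos[OF T(1), of r 0] fil_pos[OF T'(1), of r 0] by simp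
  next
   case (Suc i) then show ?thesis using eq p by simp
  qed
 qed
qed

text \<open>Columns are compared from right to left, and a misplaced entry produces a smaller
  one.\<close>

lemma qrule_unique:
 assumes T: "fil n c T" "qrule 1 c T" and T': "fil n c T'" "qrule 1 c T'" and cs: "\<And>j. colset T j = colset T' j"
 shows "T = T'"
proof -
 have aux: "\<exists>p' q. 0 < p' \<and> (U (q, j) = p') \<noteq> (U' (q, j) = p') \<and> p' < p"
  if U: "fil n c U" and U': "fil n c U'" "qrule 1 c U'" and e: "\<And>r. U (r, Suc j) = U' (r, Suc j)" and j: "1 \<le> j"
   and p: "0 < p" "U (r, j) = p" "U' (s, j) = p" "prior c r s" for U U' p r s j
 proof -
  have js: "j \<le> c s" using fil_pos[OF U'(1), of s j] p by simp
  then have "U' (r, j) < U' (s, j) \<or> U' (s, j) < U' (r, Suc j)"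
   using U'(2) p j unfolding qrule_def by blast
  moreover have "U' (r, Suc j) \<le> p" using fil_dec[OF U j, of r] e p by metis
  moreover have "0 < U' (r, j)" using fil_pos[OF U'(1), of r j] js j p(4) by (auto simp: prior_def)
  ultimately show ?thesis using p by (intro exI[of _ "U' (r, j)"] exI[of _ r]) auto
 qed
 obtain N where N: "\<And>r. c r \<le> N" using fil_bound[OF T(1)] by blast
 have big: "T (r, j) = 0 \<and> T' (r, j) = 0" if "N < j \<or> j = 0" for r j
  using fil_pos[OF T(1), of r j] fil_pos[OF T'(1), of r j] N[of r] that by auto
 have eq: "\<forall>r. T (r, j) = T' (r, j)" if "1 \<le> j" "j \<le> Suc N" for j
  using that(2,1)
 proof (induction j rule: inc_induct)
  case base show ?case using big by simp
 next
  case (step j)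
  then have IH: "T (r, Suc j) = T' (r, Suc j)" for r by simp
  show ?case
  proof (intro allI, rule column_eqI[where R = "(<)", OF cs])
   fix p r s assume p: "0 < p" "T (r, j) = p" "T' (s, j) = p" "r \<noteq> s"
   show "\<exists>p' q. 0 < p' \<and> (T (q, j) = p') \<noteq> (T' (q, j) = p') \<and> p' < p"
   proof (cases "prior c r s")
    case True
    show ?thesis by (rule aux[OF T(1) T' IH step.prems p(1,2,3) True])
   next
    case False
    then have sr: "prior c s r" using p(4) by (auto simp: prior_def)
    have "\<exists>p' q. 0 < p' \<and> (T' (q, j) = p') \<noteq> (T (q, j) = p') \<and> p' < p"
     by (rule aux[OF T'(1) T IH[symmetric] step.prems p(1,3,2) sr])
    then show ?thesis by metis
   qed
  qed (rule wfp_on_less)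
 qed
 show ?thesis
 proof
  fix p :: "nat \<times> nat"
  obtain r j where p: "p = (r, j)" by (cases p)
  show "T p = T' p"
  proof (cases "1 \<le> j \<and> j \<le> N")
   case True then show ?thesis using eq[of j] p by simp
  next
   case False
   then have "N < j \<or> j = 0" by auto
   then show ?thesis using big[of j r] p by simp
  qed
 qed
qed

lemma cnt_one:
 assumes "fil n c T" "\<And>r. 0 < c r \<Longrightarrow> T (r, 1) = r" "1 \<le> j"
 shows "cnt T v j = card {r. j \<le> c r \<and> r \<le> v}"
proof -
 have "0 < T (r, j) \<and> T (r, 1) \<le> v \<longleftrightarrow> j \<le> c r \<and> r \<le> v" for r
  using fil_pos[OF assms(1), of r j] assms(2)[of r] assms(3) by auto
 then show ?thesis by (simp add: cnt_def)
qed

lemma shape_eqI: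
 assumes c: "on {0<..n} c" and c': "on {0<..n} c'"
  and e: "\<And>v j. 1 \<le> j \<Longrightarrow> card {r. j \<le> c r \<and> r \<le> v} = card {r. j \<le> c' r \<and> r \<le> v}"
 shows "c = c'"
proof
 fix r
 have step: "card {r. P r \<and> r \<le> Suc v} = card {r. P r \<and> r \<le> v} + (if P (Suc v) then 1 else 0)" for P and v :: nat
 proof -
  have f: "finite {r. P r \<and> r \<le> v}" by simp
  have "{r. P r \<and> r \<le> Suc v} = (if P (Suc v) then insert (Suc v) {r. P r \<and> r \<le> v} else {r. P r \<and> r \<le> v})"
   by (auto simp: le_Suc_eq)
  then show ?thesis using f by simp
 qed
 show "c r = c' r"
 proof (cases r)
  case 0
  have "c 0 = 0" "c' 0 = 0" using onD[OF c, of 0] onD[OF c', of 0] by (metis gr0I greaterThanAtMost_iff less_irrefl)+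
  then show ?thesis using 0 by simp
 next
  case (Suc v)
  have "j \<le> c r \<longleftrightarrow> j \<le> c' r" if "1 \<le> j" for j
   using e[OF that, of "Suc v"] e[OF that, of v] step[of "\<lambda>r. j \<le> c r" v] step[of "\<lambda>r. j \<le> c' r" v] Suc
   by (auto split: if_splits)
  from this[of "c r"] this[of "c' r"] show ?thesis by (cases "c r = 0"; cases "c' r = 0") auto
 qed
qed

text \<open>The counts identify the set of values of \<open>f\<close> with \<open>R\<close>, and
  there is only one increasing bijection of a finite set onto itself.\<close>

lemma strict_mono_count_id:
 fixes f :: "nat \<Rightarrow> nat"
 assumes R: "finite R" and f: "\<And>r s. r \<in> R \<Longrightarrow> s \<in> R \<Longrightarrow> r < s \<Longrightarrow> f r < f s"
  and e: "\<And>v. card {r\<in>R. f r \<le> v} = card {r\<in>R. r \<le> v}" and r: "r \<in> R"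
 shows "f r = r"
proof -
 have "f q \<le> f r \<longleftrightarrow> q \<le> r" if "q \<in> R" for q
  using f[OF that r] f[OF r that] by (metis leD leI linorder_neqE_nat order_refl less_imp_le)
 then have "{q\<in>R. f q \<le> f r} = {q\<in>R. q \<le> r}" by blast
 then have 1: "card {q\<in>R. f q \<le> f r} = card {q\<in>R. q \<le> r}" by simp
 show ?thesis
 proof (rule linorder_cases[of "f r" r])
  assume l: "f r < r"
  then have "{q\<in>R. q \<le> f r} \<subset> {q\<in>R. q \<le> r}" using r by force
  then have "card {q\<in>R. q \<le> f r} < card {q\<in>R. q \<le> r}" using R by (intro psubset_card_mono) auto
  then show ?thesis using 1 e[of "f r"] by simp
 next
  assume l: "r < f r"
  then have "{q\<in>R. f q \<le> r} \<subset> {q\<in>R. f q \<le> f r}" using r by force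
  then have "card {q\<in>R. f q \<le> r} < card {q\<in>R. f q \<le> f r}" using R by (intro psubset_card_mono) auto
  then show ?thesis using 1 e[of r] by simp
 qed
qed

text \<open>In the last column the row with priority has no further entry, which leaves only the
  first alternative. Walking left, the second alternative is excluded by the inequality known in the
  next column and the weak decrease of row \<open>s\<close>.\<close>

lemma qrule_equal_rows:
 assumes T: "fil n c T" "qrule 1 c T" and rs: "r < s" "c r = c s" "1 \<le> c s"
 shows "T (r, 1) < T (s, 1)"
proof -
 have pr: "prior c r s" using rs by (simp add: prior_def)
 have q: "T (r, j) < T (s, j) \<or> T (s, j) < T (r, Suc j)" if "1 \<le> j" "j \<le> c s" for j
  using T(2) pr that unfolding qrule_def by blast
 have "1 \<le> j \<longrightarrow> T (r, j) < T (s, j)" if "j \<le> c s" for j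
  using that
 proof (induction j rule: inc_induct)
  case base
  have "T (r, Suc (c s)) = 0" using fil_pos[OF T(1), of r "Suc (c s)"] rs by simp
  then show ?case using q[of "c s"] by auto
 next
  case (step j)
  then show ?case using q[of j] fil_dec[OF T(1), of j s] by fastforce
 qed
 then show ?thesis using rs by blast
qed

text \<open>\<open>qrule_exists\<close> keeps the shape but not the first column. The two counting
  inequalities give equality, so rows of each length have the right set of first entries, and
  \<open>qrule_equal_rows\<close> puts them in the right order.\<close>

lemma qa_of_ssaf:
 assumes c: "on {0<..n} c" and T: "T \<in> ssaf 0 c"
 shows "\<exists>T'\<in>qa n c. \<forall>j. colset T' j = colset T j"
proof -
 have f: "fil n c T" and one: "\<And>r. 0 < c r \<Longrightarrow> T (r, 1) = r" using T unfolding ssaf_iff[OF c] by auto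
 obtain T' where T': "fil n c T'" "qrule 1 c T'" and cs: "\<And>j. colset T' j = colset T j"
  using qrule_exists[OF f] by blast
 have ce: "cnt T' v j = cnt T v j" if "1 \<le> j" for v j
  by (rule antisym) (rule cnt_le_ssaf[OF T c T'(1) cs that], rule cnt_le_qrule[OF T' f cs that])
 have fin: "finite {r. j \<le> c r \<and> P r}" if "1 \<le> j" for j P
 proof (rule finite_subset[OF _ finite_rows[OF f, of 1 P]])
  show "{r. j \<le> c r \<and> P r} \<subseteq> {r. 0 < T (r, 1) \<and> P r}"
  proof
   fix r assume "r \<in> {r. j \<le> c r \<and> P r}"
   then show "r \<in> {r. 0 < T (r, 1) \<and> P r}" using fil_pos[OF f, of r 1] that by simp
  qed
 qed
 have id: "T' (r, 1) = r" if r: "0 < c r" for r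
 proof (rule strict_mono_count_id[where R = "{q. c q = c r}"])
  show "finite {q. c q = c r}" by (rule finite_subset[OF _ fin[of "c r" "\<lambda>_. True"]]) (use r in auto)
  show "T' (q, 1) < T' (s, 1)" if "q \<in> {q. c q = c r}" "s \<in> {q. c q = c r}" "q < s" for q s
   by (rule qrule_equal_rows[OF T']) (use that r in auto)
  show "card {q \<in> {q. c q = c r}. T' (q, 1) \<le> v} = card {q \<in> {q. c q = c r}. q \<le> v}" for v
  proof -
   have sp: "card {q \<in> {q. c q = c r}. P q} = card {q. c r \<le> c q \<and> P q} - card {q. Suc (c r) \<le> c q \<and> P q}" for P
   proof -
    have "{q \<in> {q. c q = c r}. P q} = {q. c r \<le> c q \<and> P q} - {q. Suc (c r) \<le> c q \<and> P q}" by auto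
    also have "card \<dots> = card {q. c r \<le> c q \<and> P q} - card {q. Suc (c r) \<le> c q \<and> P q}"
     by (rule card_Diff_subset) (use fin[of "Suc (c r)" P] in auto)
    finally show ?thesis .
   qed
   have ct: "cnt T' v j = card {q. j \<le> c q \<and> T' (q, 1) \<le> v}" if "1 \<le> j" for j
    unfolding cnt_def using fil_pos[OF T'(1), of _ j] that by simp
   have "card {q. j \<le> c q \<and> T' (q, 1) \<le> v} = card {q. j \<le> c q \<and> q \<le> v}" if "1 \<le> j" for j
    using ct[OF that] ce[OF that, of v] cnt_one[OF f one that, of v] by simp
   then show ?thesis unfolding sp using r by simp
  qed
 qed (use r in simp)
 then have "T' \<in> qa n c" using T' by (simp add: qa_def)
 then show ?thesis using cs by blast
qed

text \<open>In this direction the first column is preserved and the shape may change; the equal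
  counts recover the shape.\<close>

lemma ssaf_of_qa:
 assumes T: "T \<in> qa n c"
 shows "\<exists>T'\<in>ssaf 0 c. \<forall>j. colset T' j = colset T j"
proof -
 have f: "fil n c T" and one: "\<And>r. 0 < c r \<Longrightarrow> T (r, 1) = r" and q: "qrule 1 c T"
  using T unfolding qa_def by auto
 obtain c' T' where T': "fil n c' T'" "\<forall>j. colset T' j = colset T j" "\<forall>r. T' (r, 1) = T (r, 1)" "\<forall>k. srule k T'"
  using srule_exists_all[OF f] by blast
 have c': "on {0<..n} c'" by (rule fil_on[OF T'(1)])
 have one': "T' (r, 1) = r" if "0 < c' r" for r
 proof -
  have "0 < T (r, 1)" using fil_pos[OF T'(1), of r 1] that T'(3) by simp
  then show ?thesis using one[of r] fil_pos[OF f, of r 1] T'(3) by simp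
 qed
 then have s: "T' \<in> ssaf 0 c'" unfolding ssaf_iff[OF c'] using T' by blast
 have "cnt T v j = cnt T' v j" if "1 \<le> j" for v j
  by (rule antisym) (rule cnt_le_ssaf[OF s c' f _ that], use T'(2) in simp, rule cnt_le_qrule[OF f q T'(1) _ that], use T'(2) in simp)
 then have "card {r. j \<le> c r \<and> r \<le> v} = card {r. j \<le> c' r \<and> r \<le> v}" if "1 \<le> j" for v j
  using cnt_one[OF f one that, of v] cnt_one[OF T'(1) one' that, of v] that by simp
 then have "c = c'" by (rule shape_eqI[OF fil_on[OF f] c'])
 then show ?thesis using s T'(2) by blast
qed

lemma wt_colset:
 assumes f: "fil n c T"
 shows "wt (dg c) T = (\<Sum>x\<in>{(j, p). p \<in> colset T j}. Poly_Mapping.single (snd x) 1)"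
proof -
 let ?h = "\<lambda>(r, j). (j, T (r, j))"
 have pos: "(r, j) \<in> dg c \<longleftrightarrow> 0 < T (r, j)" for r j using fil_pos[OF f, of r j] by (simp add: dg_def)
 have "inj_on ?h (dg c)"
 proof (rule inj_onI)
  fix x y assume a: "x \<in> dg c" "y \<in> dg c" "?h x = ?h y"
  obtain r j s k where xy: "x = (r, j)" "y = (s, k)" by (cases x, cases y)
  have "0 < T (r, j)" "T (r, j) = T (s, j)" "j = k" using a pos xy by auto
  then show "x = y" using fil_dist[OF f, of r j s] xy by simp
 qed
 moreover have "?h ` dg c = {(j, p). p \<in> colset T j}"
 proof (rule set_eqI)
  fix x :: "nat \<times> nat"
  obtain j p where x: "x = (j, p)" by (cases x)
  have "x \<in> ?h ` dg c \<longleftrightarrow> (\<exists>r. (r, j) \<in> dg c \<and> T (r, j) = p)" unfolding x image_iff by force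
  then show "x \<in> ?h ` dg c \<longleftrightarrow> x \<in> {(j, p). p \<in> colset T j}" unfolding x using pos by (auto simp: colset_iff)
 qed
 ultimately show ?thesis unfolding wt_def
  by (intro sum.reindex_cong[of ?h "dg c", symmetric]) auto
qed

lemma colset_image_eq:
 assumes c: "on {0<..n} c"
 shows "colset ` ssaf 0 c = colset ` qa n c"
proof
 show "colset ` ssaf 0 c \<subseteq> colset ` qa n c"
 proof
  fix K assume "K \<in> colset ` ssaf 0 c"
  then obtain T where T: "T \<in> ssaf 0 c" "K = colset T" by blast
  obtain T' where "T' \<in> qa n c" "\<forall>j. colset T' j = colset T j" using qa_of_ssaf[OF c T(1)] by blast
  then show "K \<in> colset ` qa n c" using T(2) by (metis ext imageI)
 qed
 show "colset ` qa n c \<subseteq> colset ` ssaf 0 c"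
 proof
  fix K assume "K \<in> colset ` qa n c"
  then obtain T where T: "T \<in> qa n c" "K = colset T" by blast
  obtain T' where "T' \<in> ssaf 0 c" "\<forall>j. colset T' j = colset T j" using ssaf_of_qa[OF T(1)] by blast
  then show "K \<in> colset ` ssaf 0 c" using T(2) by (metis ext imageI)
 qed
qed

lemma inj_on_colset_qa: "inj_on colset (qa n c)"
 by (rule inj_onI, rule qrule_unique) (auto simp: qa_def)

lemma finite_qa: assumes c: "on {0<..n} c" shows "finite (qa n c)"
 by (rule finite_imageD[OF _ inj_on_colset_qa]) (use finite_ssaf[OF c] in \<open>simp flip: colset_image_eq[OF c]\<close>)

lemma atom_eq_qa:
 assumes c: "on {0<..n} c"
 shows "atom 0 c = (\<Sum>T\<in>qa n c. Poly_Mapping.single (wt (dg c) T) 1)"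
proof -
 let ?g = "\<lambda>K. Poly_Mapping.single (\<Sum>x\<in>{(j, p). p \<in> K j}. Poly_Mapping.single (snd x) 1) 1 :: Defs.poly"
 have i1: "inj_on colset (ssaf 0 c)"
 proof (rule inj_onI)
  fix T T' assume a: "T \<in> ssaf 0 c" "T' \<in> ssaf 0 c" "colset T = colset T'"
  have 1: "fil n c T" "\<And>r. 0 < c r \<Longrightarrow> T (r, 1) = r" "\<And>k. srule k T"
   and 2: "fil n c T'" "\<And>r. 0 < c r \<Longrightarrow> T' (r, 1) = r" "\<And>k. srule k T'"
   using a unfolding ssaf_iff[OF c] by auto
  have "T (r, 1) = T' (r, 1)" for r
   using 1(2)[of r] 2(2)[of r] fil_pos[OF 1(1), of r 1] fil_pos[OF 2(1), of r 1] by (cases "0 < c r") auto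
  then show "T = T'" by (rule srule_unique[OF 1(1,3) 2(1,3)]) (use a in simp)
 qed
 have "atom 0 c = (\<Sum>T\<in>ssaf 0 c. ?g (colset T))"
  unfolding atom_def by (rule sum.cong) (auto simp: wt_colset ssaf_iff[OF c])
 also have "\<dots> = sum ?g (colset ` ssaf 0 c)" using sum.reindex[OF i1, of ?g] by (simp add: comp_def)
 also have "\<dots> = (\<Sum>T\<in>qa n c. ?g (colset T))" unfolding colset_image_eq[OF c] using sum.reindex[OF inj_on_colset_qa, of ?g] by (simp add: comp_def)
 also have "\<dots> = (\<Sum>T\<in>qa n c. Poly_Mapping.single (wt (dg c) T) 1)"
  by (rule sum.cong) (auto simp: wt_colset qa_def)
 finally show ?thesis .
qed

section \<open>Skew skyline tableaux as lattice chains\<close>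

text \<open>The triple conditions reduced to one condition per pair of rows and column. For weakly
  decreasing rows a longer or equally long lower row leaves the plain column comparison; a longer
  higher row adds the alternative through its next column. The order of the stars is absorbed in the
  comparisons with \<open>c\<close>.\<close>

definition slrs :: "(nat \<Rightarrow> nat) \<Rightarrow> (nat \<Rightarrow> nat) \<Rightarrow> filling \<Rightarrow> bool" where
 "slrs b c L \<longleftrightarrow> (\<forall>r. c r \<le> b r) \<and> (\<forall>r j. 0 < L (r, j) \<longleftrightarrow> c r < j \<and> j \<le> b r) \<and>
   (\<forall>r j. c r < j \<longrightarrow> L (r, Suc j) \<le> L (r, j)) \<and>
   (\<forall>r s j. r < s \<and> 1 \<le> j \<and> j \<le> b r \<and> j \<le> b s \<longrightarrow> j \<le> c r \<or> c s < j \<and> L (s, j) < L (r, j) \<or>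
    b r < b s \<and> c r < j \<and> (Suc j \<le> c s \<or> L (r, j) < L (s, Suc j)))"

definition vcnt :: "filling \<Rightarrow> nat \<Rightarrow> nat \<Rightarrow> nat" where
 "vcnt L k v = card {p. k < snd p \<and> L p = v}"

text \<open>The lattice condition for prefixes of the column word that consist of whole columns;
  \<open>contre_lattice_iff\<close> extends it to all prefixes.\<close>

definition clat :: "nat \<Rightarrow> filling \<Rightarrow> bool" where
 "clat l L \<longleftrightarrow> (\<forall>k v. 1 \<le> v \<and> v < l \<longrightarrow> vcnt L k v \<le> vcnt L k (Suc v))"

definition lrf :: "nat \<Rightarrow> (nat \<Rightarrow> nat) \<Rightarrow> (nat \<Rightarrow> nat) \<Rightarrow> (nat \<Rightarrow> nat) \<Rightarrow> filling \<Rightarrow> bool" where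
 "lrf l lam b c L \<longleftrightarrow> slrs b c L \<and> (\<forall>p. L p \<le> l) \<and> (\<forall>v. 1 \<le> v \<and> v \<le> l \<longrightarrow> vcnt L 0 v = lam (l - v)) \<and> clat l L"

text \<open>\<open>D i r\<close> is the last column of row \<open>r\<close> whose entry exceeds \<open>l - i\<close>; stars exceed everything.\<close>

definition lvl :: "nat \<Rightarrow> (nat \<Rightarrow> nat) \<Rightarrow> filling \<Rightarrow> (nat \<Rightarrow> nat \<Rightarrow> nat) \<Rightarrow> bool" where
 "lvl l c L D \<longleftrightarrow> (\<forall>p. L p \<le> l) \<and> (\<forall>r j. j \<le> c r \<longrightarrow> L (r, j) = 0) \<and>
   (\<forall>r j i. j \<le> D i r \<longleftrightarrow> j \<le> c r \<or> l - i < L (r, j))"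

lemma lvlD:
 assumes "lvl l c L D"
 shows "L p \<le> l" "j \<le> c r \<Longrightarrow> L (r, j) = 0" "j \<le> D i r \<longleftrightarrow> j \<le> c r \<or> l - i < L (r, j)"
 using assms by (simp_all add: lvl_def del: split_paired_All)

lemma lvl_mono: assumes "lvl l c L D" "i \<le> i'" shows "D i r \<le> D i' r"
 using lvlD(3)[OF assms(1), of "D i r" i r] lvlD(3)[OF assms(1), of "D i r" i' r] assms(2) by auto

lemma slrsD:
 assumes "slrs b c L"
 shows "c r \<le> b r" "0 < L (r, j) \<longleftrightarrow> c r < j \<and> j \<le> b r" "c r < j \<Longrightarrow> L (r, Suc j) \<le> L (r, j)"
  "r < s \<Longrightarrow> 1 \<le> j \<Longrightarrow> j \<le> b r \<Longrightarrow> j \<le> b s \<Longrightarrow> j \<le> c r \<or> c s < j \<and> L (s, j) < L (r, j) \<or>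
    b r < b s \<and> c r < j \<and> (Suc j \<le> c s \<or> L (r, j) < L (s, Suc j))"
 using assms unfolding slrs_def by blast+

text \<open>If the strip condition failed for \<open>r < s\<close>, each cell that row
  \<open>r\<close> gains would force row \<open>s\<close>, at the previous level, one column further
  to the right, until \<open>s\<close> passes the end of row \<open>r\<close>.\<close>

lemma lvl_chain:
 assumes R: "lvl l c L D" and S: "slrs b c L"
 shows "D \<in> chains c b l"
proof -
 have D0: "D 0 = c"
 proof
  fix r
  have "j \<le> D 0 r \<longleftrightarrow> j \<le> c r" for j using lvlD(3)[OF R, of j 0 r] lvlD(1)[OF R, of "(r, j)"] by simp
  from this[of "D 0 r"] this[of "c r"] show "D 0 r = c r" by simp
 qed
 have Dl: "D i = b" if "l \<le> i" for i
 proof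
  fix r
  have "j \<le> D i r \<longleftrightarrow> j \<le> b r" for j
   using lvlD(3)[OF R, of j i r] slrsD(2)[OF S, of r j] slrsD(1)[OF S, of r] that by auto
  from this[of "D i r"] this[of "b r"] show "D i r = b r" by simp
 qed
 have "strip (D i) (D (Suc i))" if il: "i < l" for i unfolding strip_def
 proof (intro conjI allI impI)
  show "D i r \<le> D (Suc i) r" for r by (rule lvl_mono[OF R]) simp
  fix r s :: nat assume rs: "r < s"
  show "D (Suc i) s \<le> D i r \<or> D (Suc i) r < D i s \<or> D (Suc i) r = D i r"
  proof (rule ccontr)
   assume n: "\<not> ?thesis"
   then have n1: "D i r < D (Suc i) s" and n2: "D i r < D (Suc i) r"
    using lvl_mono[OF R, of i "Suc i" r] by auto
   have "Suc j \<le> D i s" if "D i r < j" "j \<le> D (Suc i) r" "j \<le> D (Suc i) s" for j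
   proof -
    have jc: "\<not> j \<le> c r" and L: "L (r, j) = l - i"
     using lvlD(3)[OF R, of j i r] lvlD(3)[OF R, of j "Suc i" r] that il by auto
    have jb: "j \<le> b r" "j \<le> b s" using that Dl[of l] lvl_mono[OF R, of "Suc i" l] il by (metis Suc_leI le_refl le_trans)+
    have s: "j \<le> c s \<or> l - i \<le> L (s, j)" using lvlD(3)[OF R, of j "Suc i" s] that il by auto
    have "Suc j \<le> c s \<or> L (r, j) < L (s, Suc j)" using slrsD(4)[OF S rs _ jb] s jc L that by auto
    then show ?thesis using lvlD(3)[OF R, of "Suc j" i s] L by auto
   qed
   note up = this
   have "j \<le> D i s" if "D i r < j" "j \<le> Suc (D (Suc i) r)" for j
    using that
   proof (induction j)
    case (Suc j)
    show ?case
    proof (cases "D i r < j")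
     case True
     then have "j \<le> D i s" using Suc by simp
     then show ?thesis using up[OF True] Suc lvl_mono[OF R, of i "Suc i" s] by simp
    next
     case False
     then have "j = D i r" using Suc by simp
     then show ?thesis using up[of "Suc j"] n1 n2 by simp
    qed
   qed simp
   then have "Suc (D (Suc i) r) \<le> D i s" using n2 by simp
   then show False using n by simp
  qed
 qed
 then show ?thesis using D0 Dl by (simp add: chains_def)
qed

lemma chain_slrs:
 assumes R: "lvl l c L D" and D: "D \<in> chains c b l"
 shows "slrs b c L"
 unfolding slrs_def
proof (intro conjI allI impI)
 have D0: "D 0 = c" and Dl: "D i = b" if "l \<le> i" for i using D that by (auto simp: chains_def)
 have st: "strip (D i) (D (Suc i))" if "i < l" for i using D that by (auto simp: chains_def)
 have b: "b = D l" using Dl by simp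
 show "c r \<le> b r" for r using lvl_mono[OF R, of 0 l r] D0[OF le_refl] b by simp
 show "0 < L (r, j) \<longleftrightarrow> c r < j \<and> j \<le> b r" for r j
  using lvlD(2)[OF R, of j r] lvlD(3)[OF R, of j l r] unfolding b by (cases "j \<le> c r") auto
 show "L (r, Suc j) \<le> L (r, j)" if j: "c r < j" for r j
 proof (rule ccontr)
  assume n: "\<not> L (r, Suc j) \<le> L (r, j)"
  have "l - (l - L (r, j)) = L (r, j)" using lvlD(1)[OF R, of "(r, j)"] by simp
  then have "Suc j \<le> D (l - L (r, j)) r" using lvlD(3)[OF R, of "Suc j" "l - L (r, j)" r] n by simp
  then have "j \<le> D (l - L (r, j)) r" by simp
  then show False using lvlD(3)[OF R, of j "l - L (r, j)" r] j \<open>l - (l - L (r, j)) = L (r, j)\<close> by simp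
 qed
 fix r s j assume a: "r < s \<and> 1 \<le> j \<and> j \<le> b r \<and> j \<le> b s"
 show "j \<le> c r \<or> c s < j \<and> L (s, j) < L (r, j) \<or> b r < b s \<and> c r < j \<and> (Suc j \<le> c s \<or> L (r, j) < L (s, Suc j))"
 proof (cases "j \<le> c r")
  case False
  define v where "v = L (r, j)"
  have v: "0 < v" "v \<le> l" using lvlD(3)[OF R, of j l r] a False lvlD(1)[OF R] by (auto simp: v_def b)
  define i where "i = l - v"
  have il: "i < l" "l - i = v" "l - Suc i = v - 1" using v by (auto simp: i_def)
  have lo: "D i r < j" using lvlD(3)[OF R, of j i r] False il by (auto simp: v_def)
  have hi: "j \<le> D (Suc i) r" using lvlD(3)[OF R, of j "Suc i" r] v il by (simp add: v_def)
  have "D (Suc i) s \<le> D i r \<or> D (Suc i) r < D i s" using st[OF il(1)] a lo hi unfolding strip_def by fastforce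
  then show ?thesis
  proof
   assume "D (Suc i) s \<le> D i r"
   then have "\<not> j \<le> D (Suc i) s" using lo by simp
   then have "\<not> j \<le> c s" "L (s, j) < v" using lvlD(3)[OF R, of j "Suc i" s] il v by auto
   then show ?thesis by (simp add: v_def)
  next
   assume g: "D (Suc i) r < D i s"
   \<comment> \<open>Otherwise, going down from level \<open>l\<close>, each strip condition keeps
     row \<open>s\<close> no longer than row \<open>r\<close> at all levels after the current step,
     contradicting \<open>g\<close>.\<close>
   have "b r < b s"
   proof (rule ccontr)
    assume n: "\<not> b r < b s"
    have "i' \<le> l \<longrightarrow> D i' s \<le> D i' r" if "Suc i \<le> i'" "i' \<le> l" for i'
     using that(2,1)
    proof (induction i' rule: inc_induct)
     case base then show ?case using n b by simp
    next
     case (step i')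
     then have IH: "D (Suc i') s \<le> D (Suc i') r" by simp
     have "D i' s \<le> D (Suc i') s" by (rule lvl_mono[OF R]) simp
     moreover have "D (Suc i') s \<le> D i' r \<or> D (Suc i') r < D i' s \<or> D (Suc i') r = D i' r"
      using st[of i'] step a unfolding strip_def by blast
     ultimately show ?case using IH by linarith
    qed
    then have "D (Suc i) s \<le> D (Suc i) r" using il by simp
    then show False using g lvl_mono[OF R, of i "Suc i" s] by simp
   qed
   moreover have "Suc j \<le> D i s" using g hi by simp
   then have "Suc j \<le> c s \<or> v < L (s, Suc j)" using lvlD(3)[OF R, of "Suc j" i s] il by simp
   ultimately show ?thesis using False by (simp add: v_def)
  qed
 qed simp
qed

lemma lvl_vcnt:
 assumes R: "lvl l c L D" and o: "on {0<..n} (D (Suc i))" and il: "i < l"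
 shows "int (vcnt L k (l - i)) = cn n D k i"
proof -
 have le: "D i r \<le> D (Suc i) r" for r by (rule lvl_mono[OF R]) simp
 have iff: "L (r, j) = l - i \<longleftrightarrow> D i r < j \<and> j \<le> D (Suc i) r" for r j
  using lvlD(2)[OF R, of j r] lvlD(3)[OF R, of j i r] lvlD(3)[OF R, of j "Suc i" r] il by (cases "j \<le> c r") auto
 let ?C = "\<lambda>r. {max k (D i r)<..D (Suc i) r}"
 have "{p. k < snd p \<and> L p = l - i} = (SIGMA r:{1..n}. ?C r)"
 proof (rule set_eqI)
  fix p :: "nat \<times> nat"
  obtain r j where p: "p = (r, j)" by (cases p)
  have "r \<in> {1..n}" if "D i r < j" "j \<le> D (Suc i) r"
   using onD[OF o, of r] that by auto
  then show "p \<in> {p. k < snd p \<and> L p = l - i} \<longleftrightarrow> p \<in> (SIGMA r:{1..n}. ?C r)" unfolding p using iff[of r j] by auto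
 qed
 then have "vcnt L k (l - i) = (\<Sum>r\<in>{1..n}. D (Suc i) r - max k (D i r))" by (simp add: vcnt_def)
 then have "int (vcnt L k (l - i)) = (\<Sum>r\<in>{1..n}. int (D (Suc i) r - max k (D i r)))" by simp
 also have "\<dots> = (\<Sum>r\<in>{1..n}. int (D (Suc i) r - k) - int (D i r - k))"
 proof (rule sum.cong)
  fix r assume "r \<in> {1..n}"
  show "int (D (Suc i) r - max k (D i r)) = int (D (Suc i) r - k) - int (D i r - k)"
   using le[of r] by (simp add: max_def)
 qed simp
 also have "\<dots> = cn n D k i" unfolding cn_def tl_sz_def by (simp add: sum_subtractf)
 finally show ?thesis .
qed

lemma lvl_iff:
 assumes R: "lvl l c L D" and b: "on {0<..n} b"
 shows "lrf l lam b c L \<longleftrightarrow> D \<in> chs n c b l (\<lambda>i. int (lam i)) \<and> lattice n l D"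
proof -
 have ch: "slrs b c L \<longleftrightarrow> D \<in> chains c b l" using lvl_chain[OF R] chain_slrs[OF R] by blast
 have "(\<forall>v. 1 \<le> v \<and> v \<le> l \<longrightarrow> vcnt L 0 v = lam (l - v)) \<longleftrightarrow> (\<forall>i<l. int (sz n (D (Suc i))) - int (sz n (D i)) = int (lam i))" (is ?A)
  and "clat l L \<longleftrightarrow> lattice n l D" (is ?B) if D: "D \<in> chains c b l"
 proof -
  have o: "on {0<..n} (D i)" for i
   using b chains_le[OF D, of i] unfolding on_def by (metis le_zero_eq)
  have v: "int (vcnt L k (l - i)) = cn n D k i" if "i < l" for i k by (rule lvl_vcnt[OF R o that])
  have all: "(\<forall>v. 1 \<le> v \<and> v \<le> l \<longrightarrow> P v (l - v)) \<longleftrightarrow> (\<forall>i<l. P (l - i) i)" for P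
  proof
   assume a: "\<forall>v. 1 \<le> v \<and> v \<le> l \<longrightarrow> P v (l - v)"
   show "\<forall>i<l. P (l - i) i"
   proof (intro allI impI)
    fix i assume "i < l" then show "P (l - i) i" using a[rule_format, of "l - i"] by simp
   qed
  next
   assume a: "\<forall>i<l. P (l - i) i"
   show "\<forall>v. 1 \<le> v \<and> v \<le> l \<longrightarrow> P v (l - v)"
   proof (intro allI impI)
    fix v assume "1 \<le> v \<and> v \<le> l" then show "P v (l - v)" using a[rule_format, of "l - v"] by simp
   qed
  qed
  have "(\<forall>v. 1 \<le> v \<and> v \<le> l \<longrightarrow> vcnt L 0 v = lam (l - v)) \<longleftrightarrow> (\<forall>i<l. vcnt L 0 (l - i) = lam i)" by (rule all)
  also have "\<dots> \<longleftrightarrow> (\<forall>i<l. int (vcnt L 0 (l - i)) = int (lam i))" by simp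
  also have "\<dots> \<longleftrightarrow> (\<forall>i<l. int (sz n (D (Suc i))) - int (sz n (D i)) = int (lam i))"
   using v by (simp add: cn_def tl_sz_0)
  finally show ?A .
  have "clat l L \<longleftrightarrow> (\<forall>k v. 1 \<le> v \<and> v \<le> l \<longrightarrow> v < l \<longrightarrow> vcnt L k v \<le> vcnt L k (Suc v))"
   unfolding clat_def by (meson less_imp_le)
  also have "\<dots> \<longleftrightarrow> (\<forall>k. \<forall>i<l. l - i < l \<longrightarrow> vcnt L k (l - i) \<le> vcnt L k (Suc (l - i)))"
   using all[of "\<lambda>v _. v < l \<longrightarrow> vcnt L k v \<le> vcnt L k (Suc v)" for k] by (simp only:)
  also have "\<dots> \<longleftrightarrow> (\<forall>k i. Suc i < l \<longrightarrow> vcnt L k (l - Suc i) \<le> vcnt L k (l - i))"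
  proof (intro iffI allI impI)
   fix k i assume a: "\<forall>k. \<forall>i<l. l - i < l \<longrightarrow> vcnt L k (l - i) \<le> vcnt L k (Suc (l - i))" and i: "Suc i < l"
   then show "vcnt L k (l - Suc i) \<le> vcnt L k (l - i)" using a[rule_format, of "Suc i"] by (simp add: Suc_diff_Suc)
  next
   fix k i assume a: "\<forall>k i. Suc i < l \<longrightarrow> vcnt L k (l - Suc i) \<le> vcnt L k (l - i)" and i: "i < l" "l - i < l"
   then obtain i' where "i = Suc i'" by (cases i) auto
   then show "vcnt L k (l - i) \<le> vcnt L k (Suc (l - i))" using a[rule_format, of i'] i by (simp add: Suc_diff_Suc)
  qed
  also have "\<dots> \<longleftrightarrow> (\<forall>k i. Suc i < l \<longrightarrow> cn n D k (Suc i) \<le> cn n D k i)"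
   using v by (metis Suc_lessD of_nat_le_iff)
  also have "\<dots> \<longleftrightarrow> lattice n l D" unfolding lattice_def viol_def by (meson leD leI)
  finally show ?B .
 qed
 then show ?thesis using ch lvlD(1)[OF R] unfolding lrf_def chs_def mem_Collect_eq by blast
qed

lemma le_Greatest_iff:
 fixes P :: "nat \<Rightarrow> bool"
 assumes "P 0" "\<And>j. P (Suc j) \<Longrightarrow> P j" "\<And>j. P j \<Longrightarrow> j \<le> B"
 shows "j \<le> (GREATEST j. P j) \<longleftrightarrow> P j"
proof
 have G: "P (GREATEST j. P j)" by (rule GreatestI_nat[of P 0 B]) (use assms in auto)
 assume "j \<le> (GREATEST j. P j)"
 then show "P j" by (induction j rule: inc_induct) (use G assms in auto)
next
 assume "P j" then show "j \<le> (GREATEST j. P j)" by (rule Greatest_le_nat) (rule assms(3))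
qed

definition lvl_of :: "nat \<Rightarrow> (nat \<Rightarrow> nat) \<Rightarrow> filling \<Rightarrow> nat \<Rightarrow> nat \<Rightarrow> nat" where
 "lvl_of l c L i r = (GREATEST j. j \<le> c r \<or> l - i < L (r, j))"

text \<open>A cell added at step \<open>i\<close> carries the letter \<open>l - i\<close>, which is
  the number of levels from \<open>Suc i\<close> to \<open>l\<close>, that is, of levels containing
  the cell.\<close>

definition fill_of :: "nat \<Rightarrow> (nat \<Rightarrow> nat) \<Rightarrow> (nat \<Rightarrow> nat \<Rightarrow> nat) \<Rightarrow> filling" where
 "fill_of l c D = (\<lambda>(r, j). if c r < j then card {i. i \<le> l \<and> j \<le> D i r} else 0)"

lemma lvl_lvl_of:
 assumes L: "lrf l lam b c L"
 shows "lvl l c L (lvl_of l c L)"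
proof -
 have S: "slrs b c L" and l: "\<And>p. L p \<le> l" using L by (auto simp: lrf_def)
 have "j \<le> lvl_of l c L i r \<longleftrightarrow> j \<le> c r \<or> l - i < L (r, j)" for i r j
  unfolding lvl_of_def
 proof (rule le_Greatest_iff[where P = "\<lambda>j. j \<le> c r \<or> l - i < L (r, j)" and B = "b r"])
  show "j \<le> c r \<or> l - i < L (r, j)" if "Suc j \<le> c r \<or> l - i < L (r, Suc j)" for j
   using slrsD(3)[OF S, of r j] that by (cases "c r < j") auto
  show "j \<le> b r" if "j \<le> c r \<or> l - i < L (r, j)" for j
   using slrsD(1,2)[OF S, of r] that by (metis gr_zeroI le_trans not_less_zero)
 qed simp
 moreover have "L (r, j) = 0" if "j \<le> c r" for r j using slrsD(2)[OF S, of r j] that by simp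
 ultimately show ?thesis using l by (simp add: lvl_def)
qed

lemma lvl_fill_of:
 assumes D: "D \<in> chains c b l"
 shows "lvl l c (fill_of l c D) D"
proof -
 have D0: "D 0 = c" and Dl: "\<And>i. l \<le> i \<Longrightarrow> D i = b" using D by (auto simp: chains_def)
 have mono: "D i r \<le> D i' r" if "i \<le> i'" for i i' r
  using that
 proof (induction i' rule: dec_induct)
  case (step i')
  have "D i' r \<le> D (Suc i') r"
  proof (cases "i' < l")
   case True then show ?thesis using D by (simp add: chains_def strip_def)
  next
   case False then show ?thesis using Dl by simp
  qed
  then show ?case using step by simp
 qed simp
 have up: "l - i < card U \<longleftrightarrow> i \<in> U" if U: "U \<subseteq> {..l}" "\<And>i i'. i \<in> U \<Longrightarrow> i \<le> i' \<Longrightarrow> i' \<le> l \<Longrightarrow> i' \<in> U" and i: "i \<le> l" for U i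
 proof
  have f: "finite U" using U(1) finite_subset by blast
  show "l - i < card U" if "i \<in> U"
  proof -
   have "{i..l} \<subseteq> U" using U(2) that by auto
   then have "card {i..l} \<le> card U" by (rule card_mono[OF f])
   then show ?thesis using i by simp
  qed
  show "i \<in> U" if c: "l - i < card U"
  proof (rule ccontr)
   assume n: "i \<notin> U"
   have "x \<in> {i<..l}" if "x \<in> U" for x
   proof -
    have "\<not> x \<le> i" using U(2)[OF that, of i] n i by blast
    then show ?thesis using U(1) that by auto
   qed
   then have "U \<subseteq> {i<..l}" by blast
   then have "card U \<le> card {i<..l}" by (intro card_mono) auto
   then show False using c by simp
  qed
 qed
 have "j \<le> D i r \<longleftrightarrow> j \<le> c r \<or> l - i < fill_of l c D (r, j)" for r j i
 proof (cases "j \<le> c r")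
  case True
  then show ?thesis using mono[of 0 i r] D0 by simp
 next
  case False
  have u: "l - min i l < card {i. i \<le> l \<and> j \<le> D i r} \<longleftrightarrow> min i l \<in> {i. i \<le> l \<and> j \<le> D i r}"
  proof (rule up)
   show "i' \<in> {i. i \<le> l \<and> j \<le> D i r}" if "i \<in> {i. i \<le> l \<and> j \<le> D i r}" "i \<le> i'" "i' \<le> l" for i i'
    using mono[OF that(2), of r] that by auto
  qed auto
  moreover have "D (min i l) r = D i r" using Dl[of i] Dl[of l] by (simp add: min_def)
  moreover have "l - min i l = l - i" by simp
  ultimately show ?thesis using False by (simp add: fill_of_def)
 qed
 moreover have "fill_of l c D p \<le> l" for p
 proof (cases p)
  case (Pair r j)
  have "card {i. i \<le> l \<and> j \<le> D i r} \<le> l" if "c r < j"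
  proof -
   have "{i. i \<le> l \<and> j \<le> D i r} \<subseteq> {0<..l}"
   proof
    fix i assume "i \<in> {i. i \<le> l \<and> j \<le> D i r}"
    then show "i \<in> {0<..l}" using D0 that by (cases i) auto
   qed
   then have "card {i. i \<le> l \<and> j \<le> D i r} \<le> card {0<..l}" by (intro card_mono) auto
   then show ?thesis by simp
  qed
  then show ?thesis using Pair by (simp add: fill_of_def)
 qed
 ultimately show ?thesis unfolding lvl_def by (simp add: fill_of_def)
qed

lemma lvl_unique_D: assumes "lvl l c L D" "lvl l c L D'" shows "D = D'"
proof (intro ext)
 fix i r
 have "j \<le> D i r \<longleftrightarrow> j \<le> D' i r" for j using lvlD(3)[OF assms(1)] lvlD(3)[OF assms(2)] by simp
 from this[of "D i r"] this[of "D' i r"] show "D i r = D' i r" by simp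
qed

lemma lvl_unique_L: assumes R: "lvl l c L D" "lvl l c L' D" shows "L = L'"
proof
 fix p :: "nat \<times> nat"
 obtain r j where p: "p = (r, j)" by (cases p)
 show "L p = L' p"
 proof (cases "j \<le> c r")
  case True then show ?thesis using lvlD(2)[OF R(1)] lvlD(2)[OF R(2)] p by simp
 next
  case False
  have e: "l - i < L (r, j) \<longleftrightarrow> l - i < L' (r, j)" for i
   using lvlD(3)[OF R(1), of j i r] lvlD(3)[OF R(2), of j i r] False by simp
  show ?thesis using e[of "l - L (r, j)"] e[of "l - L' (r, j)"] lvlD(1)[OF R(1), of p] lvlD(1)[OF R(2), of p] p by simp
 qed
qed

lemma bij_lrf:
 assumes b: "on {0<..n} b"
 shows "bij_betw (lvl_of l c) {L. lrf l lam b c L} {D\<in>chs n c b l (\<lambda>i. int (lam i)). lattice n l D}"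
proof (rule bij_betw_byWitness[where f' = "fill_of l c"])
 let ?A = "{L. lrf l lam b c L}" and ?B = "{D\<in>chs n c b l (\<lambda>i. int (lam i)). lattice n l D}"
 have f: "lvl_of l c L \<in> ?B" if "L \<in> ?A" for L
  using lvl_iff[OF lvl_lvl_of b] that by blast
 have g: "lvl l c (fill_of l c D) D" if "D \<in> ?B" for D
  using lvl_fill_of that by (auto simp: chs_def)
 have g2: "fill_of l c D \<in> ?A" if "D \<in> ?B" for D
  using lvl_iff[OF g[OF that] b] that by blast
 show "lvl_of l c ` ?A \<subseteq> ?B" using f by blast
 show "fill_of l c ` ?B \<subseteq> ?A" using g2 by blast
 show "\<forall>L\<in>?A. fill_of l c (lvl_of l c L) = L"
 proof
  fix L assume L: "L \<in> ?A"
  then have "lvl l c L (lvl_of l c L)" using lvl_lvl_of by blast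
  then show "fill_of l c (lvl_of l c L) = L" using g[OF f[OF L]] lvl_unique_L by blast
 qed
 show "\<forall>D\<in>?B. lvl_of l c (fill_of l c D) = D"
 proof
  fix D assume D: "D \<in> ?B"
  have "lrf l lam b c (fill_of l c D)" using g2[OF D] by simp
  then have "lvl l c (fill_of l c D) (lvl_of l c (fill_of l c D))" by (rule lvl_lvl_of)
  then show "lvl_of l c (fill_of l c D) = D" using g[OF D] lvl_unique_D by blast
 qed
qed

lemma finite_lrf: assumes b: "on {0<..n} b" shows "finite {L. lrf l lam b c L}"
proof -
 have "finite {D\<in>chs n c b l (\<lambda>i. int (lam i)). lattice n l D}" by (rule finite_subset[OF _ finite_chs[OF b]]) blast
 then show ?thesis using bij_betw_finite[OF bij_lrf[OF b, where l = l and c = c and lam = lam]] by simp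
qed

section \<open>Tableaux on lists translated to shapes as functions\<close>

definition cf :: "nat list \<Rightarrow> nat \<Rightarrow> nat" where
 "cf b r = (if 1 \<le> r \<and> r \<le> length b then b ! (r - 1) else 0)"

lemma cf_on: "on {0<..length b} (cf b)"
 by (auto simp: on_def cf_def)

lemma cf_range: "0 < cf b r \<Longrightarrow> 1 \<le> r \<and> r \<le> length b"
 by (auto simp: cf_def split: if_splits)

lemma cf_nth: "i < length b \<Longrightarrow> cf b (Suc i) = b ! i"
 by (simp add: cf_def)

lemma isstar_cf: "1 \<le> r \<Longrightarrow> r \<le> length c \<Longrightarrow> isstar c (r, j) \<longleftrightarrow> j \<le> cf c r"
 by (auto simp: isstar_def cf_def)

lemma numcell_cf: "length c = length b \<Longrightarrow> numcell b c (r, j) \<longleftrightarrow> cf c r < j \<and> j \<le> cf b r"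
 by (auto simp: numcell_def present_def isstar_def cf_def)

lemma present_cf: "present b (r, j) \<longleftrightarrow> 1 \<le> r \<and> r \<le> length b \<and> j \<le> cf b r"
 by (auto simp: present_def cf_def)

lemma lt_cell_down:
 "1 \<le> r \<Longrightarrow> r < s \<Longrightarrow> s \<le> length c \<Longrightarrow> lt_cell c L (s, j) (r, j') \<longleftrightarrow> j' \<le> cf c r \<or> cf c s < j \<and> L (s, j) < L (r, j')"
 by (auto simp: lt_cell_def isstar_cf)

lemma lt_cell_up:
 "1 \<le> r \<Longrightarrow> r < s \<Longrightarrow> s \<le> length c \<Longrightarrow> lt_cell c L (r, j) (s, j') \<longleftrightarrow> cf c r < j \<and> (j' \<le> cf c s \<or> L (r, j) < L (s, j'))"
 by (auto simp: lt_cell_def isstar_cf)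

lemma le_cell_row:
 "1 \<le> r \<Longrightarrow> r \<le> length c \<Longrightarrow> le_cell c L (r, Suc j) (r, j) \<longleftrightarrow> j \<le> cf c r \<or> L (r, Suc j) \<le> L (r, j)"
 by (auto simp: le_cell_def isstar_cf)

lemma is_lrs_imp_slrs:
 assumes len: "length c = length b" and I: "is_lrs b c L"
 shows "slrs (cf b) (cf c) L"
proof -
 have zero: "L p = 0" if "\<not> numcell b c p" for p using I that by (simp add: is_lrs_def del: split_paired_All)
 have pos: "1 \<le> L p" if "numcell b c p" for p using I that by (simp add: is_lrs_def del: split_paired_All)
 have row: "le_cell c L (i, j + 1) (i, j)" if "present b (i, j + 1)" for i j
  using I that unfolding is_lrs_def by blast
 have ta: "inv_triple c L (r, j) (r, j + 1) (s, j + 1)"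
  if "r < s" "b ! (s - 1) \<le> b ! (r - 1)" "present b (r, j)" "present b (r, j + 1)" "present b (s, j + 1)" for r s j
  using I that unfolding is_lrs_def by blast
 have tb: "inv_triple c L (s, j) (s, j + 1) (r, j)"
  if "r < s" "b ! (r - 1) < b ! (s - 1)" "present b (s, j)" "present b (s, j + 1)" "present b (r, j)" for r s j
  using I that unfolding is_lrs_def by blast
 have p: "0 < L (r, j) \<longleftrightarrow> cf c r < j \<and> j \<le> cf b r" for r j
  unfolding numcell_cf[OF len, symmetric] using pos[of "(r, j)"] zero[of "(r, j)"] by (cases "numcell b c (r, j)") auto
 have dec: "L (r, Suc j) \<le> L (r, j)" if j: "cf c r < j" for r j
 proof (cases "Suc j \<le> cf b r")
  case True
  then have rr: "1 \<le> r" "r \<le> length b" using cf_range[of b r] by auto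
  then have "le_cell c L (r, Suc j) (r, j)" using row[of r j] True by (simp add: present_cf)
  then show ?thesis using le_cell_row[of r c L j] rr len j by auto
 next
  case False then show ?thesis using p[of r "Suc j"] by simp
 qed
 show ?thesis unfolding slrs_def
 proof (intro conjI allI impI)
  show "cf c r \<le> cf b r" for r
  proof (cases "1 \<le> r \<and> r \<le> length b")
   case True
   then have "c ! (r - 1) \<le> b ! (r - 1)" using I unfolding is_lrs_def by (metis One_nat_def Suc_le_D diff_Suc_1 less_eq_Suc_le)
   then show ?thesis using True len by (simp add: cf_def)
  next
   case False
   then have "cf c r = 0" unfolding cf_def len by auto
   then show ?thesis by simp
  qed
  show "0 < L (r, j) \<longleftrightarrow> cf c r < j \<and> j \<le> cf b r" for r j by (rule p)
  show "L (r, Suc j) \<le> L (r, j)" if "cf c r < j" for r j by (rule dec[OF that])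
  fix r s j assume a: "r < s \<and> 1 \<le> j \<and> j \<le> cf b r \<and> j \<le> cf b s"
  then have rr: "1 \<le> r" "r \<le> length b" "1 \<le> s" "s \<le> length b" "r < s" using cf_range[of b r] cf_range[of b s] by auto
  then have bb: "b ! (r - 1) = cf b r" "b ! (s - 1) = cf b s" by (simp_all add: cf_def)
  note down = lt_cell_down[of r s c L] and up = lt_cell_up[of r s c L]
  show "j \<le> cf c r \<or> cf c s < j \<and> L (s, j) < L (r, j) \<or>
    cf b r < cf b s \<and> cf c r < j \<and> (Suc j \<le> cf c s \<or> L (r, j) < L (s, Suc j))"
  proof (cases "cf b r < cf b s")
   case True
   have "inv_triple c L (s, j) (s, j + 1) (r, j)" by (rule tb) (use True bb a rr in \<open>auto simp: present_cf\<close>)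
   then have "lt_cell c L (s, j) (r, j) \<or> lt_cell c L (r, j) (s, Suc j)" by (auto simp: inv_triple_def)
   then show ?thesis using down up rr len True by auto
  next
   case False
   \<comment> \<open>A single triple leaves an alternative comparing column \<open>j\<close> with
     column \<open>Suc j\<close>. The column comparison already known in column \<open>j\<close> and
     the weak decrease of row \<open>s\<close> exclude it; at the basement it cannot occur because
     the star in row \<open>r\<close> exceeds every entry.\<close>
   have "1 \<le> j \<longrightarrow> j \<le> cf b s \<longrightarrow> j \<le> cf c r \<or> cf c s < j \<and> L (s, j) < L (r, j)" for j
   proof (induction j)
    case (Suc j)
    show ?case
    proof (intro impI)
     assume j: "Suc j \<le> cf b s"
     have "inv_triple c L (r, j) (r, j + 1) (s, j + 1)" by (rule ta) (use j False bb rr in \<open>auto simp: present_cf\<close>)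
     then have "lt_cell c L (r, j) (s, Suc j) \<or> lt_cell c L (s, Suc j) (r, Suc j)" by (auto simp: inv_triple_def)
     then show "Suc j \<le> cf c r \<or> cf c s < Suc j \<and> L (s, Suc j) < L (r, Suc j)"
     proof
      assume "lt_cell c L (r, j) (s, Suc j)"
      then have u: "cf c r < j" "Suc j \<le> cf c s \<or> L (r, j) < L (s, Suc j)" using up[of j "Suc j"] rr len by auto
      then have "cf c s < j" "L (s, j) < L (r, j)" using Suc.IH j by auto
      then show ?thesis using u dec[of s j] by simp
     next
      assume "lt_cell c L (s, Suc j) (r, Suc j)"
      then show ?thesis using down[of "Suc j" "Suc j"] rr len by simp
     qed
    qed
   qed simp
   then show ?thesis using a by blast
  qed
 qed
qed

lemma slrs_imp_is_lrs:
 assumes len: "length c = length b" and S: "slrs (cf b) (cf c) L" and w: "contre_lattice (colword b c L)"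
 shows "is_lrs b c L"
proof -
 have num: "numcell b c (r, j) \<longleftrightarrow> 0 < L (r, j)" for r j using numcell_cf[OF len] slrsD(2)[OF S] by simp
 have row: "le_cell c L (r, Suc j) (r, j)" if "1 \<le> r" "r \<le> length b" for r j
  using le_cell_row[of r c L j] that len slrsD(3)[OF S, of r j] by (cases "j \<le> cf c r") auto
 have ne: "L (r, j) \<noteq> L (s, j)" if rs: "r < s" "0 < L (r, j)" "0 < L (s, j)" for r s j
  using slrsD(4)[OF S rs(1), of j] slrsD(2)[OF S, of r j] slrsD(2)[OF S, of s j] slrsD(3)[OF S, of s j] rs by fastforce
 show ?thesis unfolding is_lrs_def
 proof (intro conjI allI impI)
  show "c ! i \<le> b ! i" if "i < length b" for i using slrsD(1)[OF S, of "Suc i"] that len by (simp add: cf_nth)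
  show "L p = 0" if "\<not> numcell b c p" for p using num that by (cases p) auto
  show "1 \<le> L p" if "numcell b c p" for p using num that by (cases p) (simp add: Suc_le_eq)
  show "le_cell c L (i, j + 1) (i, j)" if "present b (i, j + 1)" for i j
   using row[of i j] that by (simp add: present_cf)
  show "L (i, j) \<noteq> L (k, j)" if a: "numcell b c (i, j) \<and> numcell b c (k, j) \<and> i \<noteq> k" for i k j
   using ne[of i k j] ne[of k i j] a unfolding num by (metis linorder_neqE_nat)
  fix r s j
  show "inv_triple c L (r, j) (r, j + 1) (s, j + 1)"
   if a: "r < s \<and> b ! (s - 1) \<le> b ! (r - 1) \<and> present b (r, j) \<and> present b (r, j + 1) \<and> present b (s, j + 1)"
  proof -
   have rr: "1 \<le> r" "r < s" "s \<le> length b" "Suc j \<le> cf b r" "Suc j \<le> cf b s" using a by (auto simp: present_cf)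
   have "cf b s \<le> cf b r" using a rr by (simp add: cf_def)
   then have "Suc j \<le> cf c r \<or> cf c s < Suc j \<and> L (s, Suc j) < L (r, Suc j)" using slrsD(4)[OF S rr(2) _ rr(4,5)] by auto
   then have "lt_cell c L (s, Suc j) (r, Suc j)" using lt_cell_down[of r s c L] rr len by simp
   then show ?thesis using row[of r j] rr by (simp add: inv_triple_def)
  qed
  show "inv_triple c L (s, j) (s, j + 1) (r, j)"
   if a: "r < s \<and> b ! (r - 1) < b ! (s - 1) \<and> present b (s, j) \<and> present b (s, j + 1) \<and> present b (r, j)"
  proof -
   have rr: "1 \<le> r" "r < s" "s \<le> length b" "j \<le> cf b s" "j \<le> cf b r" using a by (auto simp: present_cf)
   have "lt_cell c L (s, j) (r, j) \<or> lt_cell c L (r, j) (s, Suc j)"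
   proof (cases "j = 0")
    case True then show ?thesis using lt_cell_down[of r s c L] rr len by simp
   next
    case False
    then show ?thesis using slrsD(4)[OF S rr(2) _ rr(5,4)] lt_cell_down[of r s c L] lt_cell_up[of r s c L] rr len by auto
   qed
   then show ?thesis using row[of s j] rr by (auto simp: inv_triple_def)
  qed
 qed (use len w in auto)
qed

lemma finite_entries:
 assumes S: "slrs b c L" and b: "on {0<..n} b"
 shows "finite {p. 0 < L p}"
proof (rule finite_subset)
 show "{p. 0 < L p} \<subseteq> (SIGMA r:{1..n}. {..b r})"
 proof
  fix p assume p: "p \<in> {p. 0 < L p}"
  obtain r j where e: "p = (r, j)" by (cases p)
  have "c r < j" "j \<le> b r" using slrsD(2)[OF S, of r j] p e by auto
  then show "p \<in> (SIGMA r:{1..n}. {..b r})" using onD[OF b, of r] e by auto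
 qed
qed simp

lemma content_iff:
 assumes len: "length c = length b" and S: "slrs (cf b) (cf c) L"
 shows "content (b, c, L) = lamstar lam \<longleftrightarrow>
  (\<forall>p. L p \<le> length lam) \<and> (\<forall>v. 1 \<le> v \<and> v \<le> length lam \<longrightarrow> vcnt L 0 v = lam ! (length lam - v))"
proof -
 let ?l = "length lam"
 have fin: "finite {p. 0 < L p}" by (rule finite_entries[OF S cf_on])
 have num: "{p. numcell b c p} = {p. 0 < L p}" using numcell_cf[OF len] slrsD(2)[OF S] by auto
 have cc: "count (content (b, c, L)) v = (if v = 0 then 0 else vcnt L 0 v)" for v
 proof -
  have "count (content (b, c, L)) v = card (L -` {v} \<inter> {p. 0 < L p})"
   unfolding content_def prod.case num count_image_mset using fin by simp
  also have "L -` {v} \<inter> {p. 0 < L p} = (if v = 0 then {} else {p. 0 < snd p \<and> L p = v})"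
  proof (rule set_eqI)
   fix p :: "nat \<times> nat"
   obtain r j where e: "p = (r, j)" by (cases p)
   show "p \<in> L -` {v} \<inter> {p. 0 < L p} \<longleftrightarrow> p \<in> (if v = 0 then {} else {p. 0 < snd p \<and> L p = v})"
    using slrsD(2)[OF S, of r j] e by auto
  qed
  finally show ?thesis by (simp add: vcnt_def)
 qed
 have cl: "count (lamstar lam) v = (if 1 \<le> v \<and> v \<le> ?l then lam ! (?l - v) else 0)" for v
 proof -
  have "count (lamstar lam) v = (\<Sum>j\<in>{1..?l}. if j = v then lam ! (?l - v) else 0)"
   unfolding lamstar_def count_sum by (rule sum.cong) auto
  then show ?thesis by simp
 qed
 have L: "(\<forall>p. L p \<le> ?l) \<longleftrightarrow> (\<forall>v>?l. vcnt L 0 v = 0)"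
 proof
  assume "\<forall>p. L p \<le> ?l"
  then have "{p. 0 < snd p \<and> L p = v} = {}" if "?l < v" for v using that by (metis (mono_tags, lifting) empty_Collect_eq leD)
  then show "\<forall>v>?l. vcnt L 0 v = 0" unfolding vcnt_def by (metis card.empty)
 next
  assume z: "\<forall>v>?l. vcnt L 0 v = 0"
  show "\<forall>p. L p \<le> ?l"
  proof (rule ccontr)
   assume "\<not> ?thesis"
   then obtain p where p: "?l < L p" by (meson not_le)
   have "finite {q. 0 < snd q \<and> L q = L p}" by (rule finite_subset[OF _ fin]) (use p in auto)
   moreover have "0 < snd p" using slrsD(2)[OF S, of "fst p" "snd p"] p by simp
   ultimately have "0 < vcnt L 0 (L p)" unfolding vcnt_def card_gt_0_iff by blast
   then show False using z p by simp
  qed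
 qed
 have "content (b, c, L) = lamstar lam \<longleftrightarrow> (\<forall>v. count (content (b, c, L)) v = count (lamstar lam) v)"
  by (rule multiset_eq_iff)
 also have "\<dots> \<longleftrightarrow> (\<forall>v>?l. vcnt L 0 v = 0) \<and> (\<forall>v. 1 \<le> v \<and> v \<le> ?l \<longrightarrow> vcnt L 0 v = lam ! (?l - v))"
  unfolding cc cl
 proof (intro iffI conjI allI impI)
  fix v assume a: "\<forall>v. (if v = 0 then 0 else vcnt L 0 v) = (if 1 \<le> v \<and> v \<le> ?l then lam ! (?l - v) else 0)"
  show "vcnt L 0 v = 0" if "?l < v" using a[rule_format, of v] that by simp
  show "vcnt L 0 v = lam ! (?l - v)" if "1 \<le> v \<and> v \<le> ?l" using a[rule_format, of v] that by simp
 next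
  fix v assume a: "(\<forall>v>?l. vcnt L 0 v = 0) \<and> (\<forall>v. 1 \<le> v \<and> v \<le> ?l \<longrightarrow> vcnt L 0 v = lam ! (?l - v))"
  show "(if v = 0 then 0 else vcnt L 0 v) = (if 1 \<le> v \<and> v \<le> ?l then lam ! (?l - v) else 0)"
   using a by (cases "v = 0"; cases "v \<le> ?l") (auto simp: not_le)
 qed
 finally show ?thesis using L by simp
qed

section \<open>The reading word and the lattice condition\<close>

lemma entries_column_unique:
 assumes S: "slrs b c L" and e: "0 < L (r, j)" "L (r, j) = L (s, j)"
 shows "r = s"
proof -
 have "False" if "r < s" "0 < L (r, j)" "L (r, j) = L (s, j)" for r s
  using slrsD(4)[OF S that(1), of j] slrsD(2)[OF S, of r j] slrsD(2)[OF S, of s j] slrsD(3)[OF S, of s j] that by fastforce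
 then show ?thesis using e by (metis linorder_neqE_nat)
qed

lemma vcnt_step:
 assumes S: "slrs b c L" and b: "on {0<..n} b" and v: "1 \<le> v"
 shows "vcnt L k v = (if \<exists>r. L (r, Suc k) = v then 1 else 0) + vcnt L (Suc k) v"
proof -
 have fin: "finite {p. Suc k < snd p \<and> L p = v}" by (rule finite_subset[OF _ finite_entries[OF S b]]) (use v in auto)
 show ?thesis
 proof (cases "\<exists>r. L (r, Suc k) = v")
  case True
  then obtain r where r: "L (r, Suc k) = v" by blast
  have "{p. k < snd p \<and> L p = v} = insert (r, Suc k) {p. Suc k < snd p \<and> L p = v}"
  proof (rule set_eqI)
   fix p :: "nat \<times> nat"
   obtain s j where p: "p = (s, j)" by (cases p)
   have "s = r" if "j = Suc k" "L (s, j) = v" using entries_column_unique[OF S, of s "Suc k" r] that r v by simp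
   then show "p \<in> {p. k < snd p \<and> L p = v} \<longleftrightarrow> p \<in> insert (r, Suc k) {p. Suc k < snd p \<and> L p = v}"
    unfolding p using r by (cases "j = Suc k") auto
  qed
  then show ?thesis using fin True by (simp add: vcnt_def)
 next
  case False
  have "{p. k < snd p \<and> L p = v} = {p. Suc k < snd p \<and> L p = v}"
  proof (rule set_eqI)
   fix p :: "nat \<times> nat"
   obtain s j where p: "p = (s, j)" by (cases p)
   show "p \<in> {p. k < snd p \<and> L p = v} \<longleftrightarrow> p \<in> {p. Suc k < snd p \<and> L p = v}"
    unfolding p using False by (cases "j = Suc k") auto
  qed
  then show ?thesis using False by (simp add: vcnt_def)
 qed
qed

text \<open>If \<open>v\<close> lies below \<open>Suc v\<close> in column \<open>k\<close>, the pair
  condition puts another \<open>Suc v\<close> next in row \<open>s\<close>. The equality of counts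
  then produces a \<open>v\<close> in that column too and persists there. This \<open>v\<close>
  cannot lie above row \<open>s\<close>, by the pair condition with row \<open>r\<close>, so the
  configuration repeats one column to the right, and row \<open>s\<close> is finite.\<close>

lemma no_bad_column:
 assumes S: "slrs b c L" and b: "on {0<..n} b" and cl: "clat l L" and v: "1 \<le> v" "v < l"
  and rs: "r < s" "L (r, k) = v" "L (s, k) = Suc v" "vcnt L k v = vcnt L k (Suc v)"
 shows False
 using rs
proof (induction "b s - k" arbitrary: k r rule: less_induct)
 case less
 have r: "c r < k" "k \<le> b r" and s: "c s < k" "k \<le> b s"
  using slrsD(2)[OF S, of r k] slrsD(2)[OF S, of s k] less.prems v by auto
 have "L (r, k) < L (s, Suc k)" using slrsD(4)[OF S less.prems(1), of k] r s less.prems by auto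
 then have s1: "L (s, Suc k) = Suc v" using slrsD(3)[OF S s(1)] less.prems by simp
 have s2: "Suc k \<le> b s" using slrsD(2)[OF S, of s "Suc k"] s1 by simp
 have le: "vcnt L (Suc k) v \<le> vcnt L (Suc k) (Suc v)" using cl v by (simp add: clat_def)
 have st: "vcnt L k v = (if \<exists>r. L (r, Suc k) = v then 1 else 0) + vcnt L (Suc k) v"
  "vcnt L k (Suc v) = 1 + vcnt L (Suc k) (Suc v)"
  using vcnt_step[OF S b, of v k] vcnt_step[OF S b, of "Suc v" k] v s1 by auto
 then have ex: "\<exists>t. L (t, Suc k) = v" using le less.prems(4) by (cases "\<exists>t. L (t, Suc k) = v") auto
 then have eq: "vcnt L (Suc k) v = vcnt L (Suc k) (Suc v)" using st less.prems(4) by simp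
 obtain t where t: "L (t, Suc k) = v" using ex by blast
 have tk: "c t < Suc k" "Suc k \<le> b t" using slrsD(2)[OF S, of t "Suc k"] t v by auto
 show False
 proof (cases "t < s")
  case True
  show False by (rule less.hyps[OF _ True t s1 eq]) (use s2 in simp)
 next
  case False
  then have rt: "r < t" using less.prems(1) by simp
  show False using slrsD(4)[OF S rt, of k] r tk less.prems(2) t slrsD(3)[OF S, of t k] by (cases "c t < k") auto
 qed
qed

lemma count_list_map_distinct: "distinct xs \<Longrightarrow> count_list (map f xs) v = card {x\<in>set xs. f x = v}"
proof (induction xs)
 case (Cons x xs)
 have "{y\<in>set (x # xs). f y = v} = (if f x = v then insert x {y\<in>set xs. f y = v} else {y\<in>set xs. f y = v})" by auto
 then show ?case using Cons by simp
qed simp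

lemma take_concat_prefix:
 "\<exists>i m'. i \<le> length xss \<and> take m (concat xss) = concat (take i xss) @ (if i < length xss then take m' (xss ! i) else [])"
proof (induction xss arbitrary: m)
 case (Cons xs xss)
 show ?case
 proof (cases "m \<le> length xs")
  case True
  then show ?thesis by (intro exI[of _ 0] exI[of _ m]) simp
 next
  case False
  obtain i m' where i: "i \<le> length xss" "take (m - length xs) (concat xss) = concat (take i xss) @ (if i < length xss then take m' (xss ! i) else [])"
   using Cons.IH by blast
  then show ?thesis using False by (intro exI[of _ "Suc i"] exI[of _ m']) simp
 qed
qed simp

abbreviation column_rows :: "nat list \<Rightarrow> nat list \<Rightarrow> nat \<Rightarrow> nat list" where
 "column_rows b c j \<equiv> filter (\<lambda>i. numcell b c (i, j)) [1..<length b + 1]"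

lemma colword_eq: "colword b c L = concat (map (\<lambda>j. map (\<lambda>i. L (i, j)) (column_rows b c j)) (rev [1..<sum_list b + 1]))"
 by (simp add: colword_def)

lemma cf_le_sum: "cf b r \<le> sum_list b"
 by (auto simp: cf_def intro: member_le_sum_list)

lemma count_column:
 assumes len: "length c = length b" and S: "slrs (cf b) (cf c) L" and v: "1 \<le> v"
 shows "count_list (map (\<lambda>i. L (i, j)) (column_rows b c j)) v = (if \<exists>r. L (r, j) = v then 1 else 0)"
proof -
 have "{i\<in>set (column_rows b c j). L (i, j) = v} = {i. L (i, j) = v}"
 proof (rule set_eqI)
  fix i
  have "1 \<le> i \<and> i \<le> length b \<and> numcell b c (i, j)" if "L (i, j) = v"
   using slrsD(2)[OF S, of i j] that v numcell_cf[OF len, of i j] cf_range[of b i] by auto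
  then show "i \<in> {i\<in>set (column_rows b c j). L (i, j) = v} \<longleftrightarrow> i \<in> {i. L (i, j) = v}" by auto
 qed
 moreover have "card {i. L (i, j) = v} = (if \<exists>r. L (r, j) = v then 1 else 0)"
 proof (cases "\<exists>r. L (r, j) = v")
  case True
  then obtain r where r: "L (r, j) = v" by blast
  have "s = r" if "L (s, j) = v" for s using entries_column_unique[OF S, of s j r] that r v by simp
  then have "{i. L (i, j) = v} = {r}" using r by blast
  then show ?thesis using True by simp
 qed simp
 ultimately show ?thesis by (subst count_list_map_distinct) simp_all
qed

lemma count_columns:
 assumes len: "length c = length b" and S: "slrs (cf b) (cf c) L" and v: "1 \<le> v" and k: "k \<le> sum_list b"
 shows "count_list (concat (map (\<lambda>j. map (\<lambda>i. L (i, j)) (column_rows b c j)) (rev [Suc k..<sum_list b + 1]))) v = vcnt L k v"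
 using k
proof (induction k rule: inc_induct)
 case base
 have "{p. sum_list b < snd p \<and> L p = v} = {}"
 proof (rule equals0I)
  fix p assume p: "p \<in> {p. sum_list b < snd p \<and> L p = v}"
  then show False using slrsD(2)[OF S, of "fst p" "snd p"] cf_le_sum[of b "fst p"] v by auto
 qed
 then have "vcnt L (sum_list b) v = 0" unfolding vcnt_def by (metis card.empty)
 then show ?case by simp
next
 case (step k)
 have "[Suc k..<sum_list b + 1] = Suc k # [Suc (Suc k)..<sum_list b + 1]" using step.hyps by (simp add: upt_conv_Cons)
 then have "count_list (concat (map (\<lambda>j. map (\<lambda>i. L (i, j)) (column_rows b c j)) (rev [Suc k..<sum_list b + 1]))) v =
   vcnt L (Suc k) v + count_list (map (\<lambda>i. L (i, Suc k)) (column_rows b c (Suc k))) v"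
  using step.IH by simp
 then show ?case using count_column[OF len S v, of "Suc k"] vcnt_step[OF S cf_on v, of k] by simp
qed

text \<open>A prefix consists of whole columns and the lower part of one more column, in which a
  letter occurs at most once. The condition can fail only if this part contains \<open>v\<close> but
  not \<open>Suc v\<close> while the preceding counts are equal; then \<open>v\<close> lies below
  \<open>Suc v\<close>, which \<open>no_bad_column\<close> excludes. By \<open>pos\<close> all
  letters occur, so \<open>l\<close> is the largest letter of the word.\<close>

lemma contre_lattice_iff:
 assumes len: "length c = length b" and S: "slrs (cf b) (cf c) L" and l: "\<And>p. L p \<le> l"
  and pos: "\<And>v. 1 \<le> v \<Longrightarrow> v \<le> l \<Longrightarrow> 0 < vcnt L 0 v"
 shows "contre_lattice (colword b c L) \<longleftrightarrow> clat l L"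
proof -
 let ?N = "sum_list b" and ?w = "colword b c L"
 let ?C = "\<lambda>j. map (\<lambda>i. L (i, j)) (column_rows b c j)"
 let ?X = "map ?C (rev [1..<?N + 1])"
 have w: "?w = concat ?X" by (rule colword_eq)
 have tk: "take i ?X = map ?C (rev [Suc (?N - i)..<?N + 1])" if "i \<le> ?N" for i
 proof -
  have "take i (rev [1..<?N + 1]) = rev (drop (?N - i) [1..<?N + 1])" using that by (simp add: take_rev)
  then show ?thesis by (simp add: take_map drop_upt)
 qed
 have cnt: "count_list (concat (take i ?X)) v = vcnt L (?N - i) v" if "i \<le> ?N" "1 \<le> v" for i v
  unfolding tk[OF that(1)] by (rule count_columns[OF len S that(2)]) simp
 have setw: "v \<in> set ?w \<longleftrightarrow> 0 < vcnt L 0 v" if v: "1 \<le> v" for v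
 proof -
  have "take ?N ?X = ?X" by simp
  then have "count_list ?w v = vcnt L (?N - ?N) v" using cnt[OF order_refl v] unfolding w by (simp only:)
  then have "count_list ?w v = vcnt L 0 v" by simp
  then show ?thesis using count_list_0_iff[of ?w v] by (metis gr0I less_irrefl)
 qed
 have k: "(if ?w = [] then 0 else Max (set ?w)) = l"
 proof (cases "l = 0")
  case True
  have "?w = []"
  proof (rule ccontr)
   assume "?w \<noteq> []"
   then have "hd ?w \<in> set ?w" by (rule hd_in_set)
   then obtain i j where ij: "numcell b c (i, j)" unfolding w by fastforce
   have "0 < L (i, j)" using slrsD(2)[OF S, of i j] numcell_cf[OF len, of i j] ij by blast
   then show False using l[of "(i, j)"] True by simp
  qed
  then show ?thesis using True by simp
 next
  case False
  then have "l \<in> set ?w" using setw[of l] pos[of l] by simp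
  moreover have "x \<le> l" if x: "x \<in> set ?w" for x
  proof -
   obtain i j where "x = L (i, j)" using x unfolding w by fastforce
   then show ?thesis using l by simp
  qed
  ultimately have "Max (set ?w) = l" by (intro Max_eqI) auto
  then show ?thesis using \<open>l \<in> set ?w\<close> by auto
 qed
 have "contre_lattice ?w \<longleftrightarrow> (\<forall>m\<le>length ?w. \<forall>v. 1 \<le> v \<and> v < l \<longrightarrow> count_list (take m ?w) v \<le> count_list (take m ?w) (Suc v))"
  unfolding contre_lattice_def k Let_def by (simp add: Suc_le_eq)
 also have "\<dots> \<longleftrightarrow> clat l L"
 proof
  assume a: "\<forall>m\<le>length ?w. \<forall>v. 1 \<le> v \<and> v < l \<longrightarrow> count_list (take m ?w) v \<le> count_list (take m ?w) (Suc v)"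
  show "clat l L" unfolding clat_def
  proof (intro allI impI)
   fix k v assume v: "1 \<le> v \<and> v < l"
   show "vcnt L k v \<le> vcnt L k (Suc v)"
   proof (cases "k \<le> ?N")
    case True
    define P Q where "P = concat (take (?N - k) ?X)" and "Q = concat (drop (?N - k) ?X)"
    have wp: "?w = P @ Q" unfolding w P_def Q_def concat_append[symmetric] append_take_drop_id ..
    have P: "take (length P) ?w = P" "length P \<le> length ?w" unfolding wp by simp_all
    have "count_list P v \<le> count_list P (Suc v)" using a[rule_format, OF P(2) v] unfolding P(1) .
    then show ?thesis using cnt[of "?N - k" v] cnt[of "?N - k" "Suc v"] True v unfolding P_def by simp
   next
    case False
    have "{p. k < snd p \<and> L p = v} = {}"
    proof (rule equals0I)
     fix p assume p: "p \<in> {p. k < snd p \<and> L p = v}"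
     then show False using slrsD(2)[OF S, of "fst p" "snd p"] cf_le_sum[of b "fst p"] v False by auto
    qed
    then have "vcnt L k v = 0" unfolding vcnt_def by (metis card.empty)
    then show ?thesis by simp
   qed
  qed
 next
  assume cl: "clat l L"
  show "\<forall>m\<le>length ?w. \<forall>v. 1 \<le> v \<and> v < l \<longrightarrow> count_list (take m ?w) v \<le> count_list (take m ?w) (Suc v)"
  proof (intro allI impI)
   fix m v assume v: "1 \<le> v \<and> v < l"
   obtain i m' where i: "i \<le> length ?X" "take m ?w = concat (take i ?X) @ (if i < length ?X then take m' (?X ! i) else [])"
    using take_concat_prefix[of ?X m] unfolding w by (elim exE conjE)
   have lX: "length ?X = ?N" unfolding length_map length_rev length_upt by simp
   have iN: "i \<le> ?N" using i(1) unfolding lX .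
   define k where "k = ?N - i"
   have le: "vcnt L k v \<le> vcnt L k (Suc v)" using cl v by (simp add: clat_def)
   show "count_list (take m ?w) v \<le> count_list (take m ?w) (Suc v)"
   proof (cases "i < ?N")
    case False
    then have tw: "take m ?w = concat (take i ?X)" using i(2) unfolding lX by (simp only: if_False append_Nil2)
    show ?thesis using le cnt[OF iN, of v] cnt[OF iN, of "Suc v"] v unfolding tw k_def by (simp only: simp_thms)
   next
    case True
    then obtain k' where k': "k = Suc k'" unfolding k_def by (metis Suc_diff_Suc)
    have len_rev: "length (rev [1..<?N + 1]) = ?N" unfolding length_rev length_upt by simp
    have "rev [1..<?N + 1] ! i = k"
     using True by (subst rev_nth) (simp_all add: k_def nth_upt del: upt_Suc)
    then have Xi: "?X ! i = ?C k" using nth_map[of i "rev [1..<?N + 1]" ?C] True unfolding len_rev by (simp only:)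
    have tw: "take m ?w = concat (take i ?X) @ take m' (?C k)"
     using i(2) True unfolding lX Xi by (simp only: if_True)
    define R where "R = take m' (column_rows b c k)"
    have p: "count_list (take m ?w) u = vcnt L k u + card {r\<in>set R. L (r, k) = u}" if "1 \<le> u" for u
    proof -
     have "count_list (take m ?w) u = vcnt L k u + count_list (take m' (?C k)) u"
      unfolding tw count_list_append cnt[OF iN that] k_def ..
     moreover have "count_list (take m' (?C k)) u = card {r\<in>set R. L (r, k) = u}"
      unfolding take_map R_def by (rule count_list_map_distinct) (intro distinct_take distinct_filter distinct_upt)
     ultimately show ?thesis by simp
    qed
    have one: "card {r\<in>set R. L (r, k) = u} \<le> 1" if "1 \<le> u" for u
    proof -
     have "x = y" if "x \<in> {r\<in>set R. L (r, k) = u}" "y \<in> {r\<in>set R. L (r, k) = u}" for x y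
      using entries_column_unique[OF S, of x k y] that \<open>1 \<le> u\<close> by simp
     moreover have f: "finite {r\<in>set R. L (r, k) = u}" by simp
     ultimately show ?thesis unfolding One_nat_def card_le_Suc0_iff_eq[OF f] by blast
    qed
    show ?thesis
    proof (rule ccontr)
     assume n: "\<not> ?thesis"
     have vv: "1 \<le> v" "1 \<le> Suc v" using v by auto
     have x1: "card {r\<in>set R. L (r, k) = v} = 1" and x0: "card {r\<in>set R. L (r, k) = Suc v} = 0"
      and eq: "vcnt L k v = vcnt L k (Suc v)"
      using n p[OF vv(1)] p[OF vv(2)] le one[OF vv(1)] by linarith+
     obtain r where "{r\<in>set R. L (r, k) = v} = {r}" using x1 by (rule card_1_singletonE)
     then have r: "r \<in> set R" "L (r, k) = v" by auto
     have none: "r \<notin> set R" if "L (r, k) = Suc v" for r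
      using x0 that by (auto simp: card_eq_0_iff)
     have "vcnt L k' v \<le> vcnt L k' (Suc v)" using cl v by (simp add: clat_def)
     moreover have "\<exists>s. L (s, k) = v" using r(2) by blast
     note vcnt_step[OF S cf_on vv(1), of k', folded k', unfolded if_P[OF this]]
     moreover have "vcnt L k' (Suc v) = 0 + vcnt L k (Suc v)" if n: "\<not> (\<exists>s. L (s, k) = Suc v)"
      using vcnt_step[OF S cf_on vv(2), of k', folded k'] unfolding if_not_P[OF n] .
     ultimately have "\<exists>s. L (s, k) = Suc v" using eq by (cases "\<exists>s. L (s, k) = Suc v") auto
     then obtain s where s: "L (s, k) = Suc v" by blast
     have sr: "s \<in> set (column_rows b c k)"
      using slrsD(2)[OF S, of s k] s numcell_cf[OF len, of s k] cf_range[of b s] by (auto simp del: upt_Suc)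
     have "r < s"
     proof -
      have so: "sorted_wrt (<) (column_rows b c k)" by (rule sorted_wrt_filter[OF sorted_wrt_upt])
      have "s \<in> set (drop m' (column_rows b c k))" using sr none[OF s] unfolding R_def
       by (metis Un_iff append_take_drop_id set_append)
      moreover have "sorted_wrt (<) (take m' (column_rows b c k) @ drop m' (column_rows b c k))" using so by simp
      ultimately show ?thesis using r(1) unfolding sorted_wrt_append R_def by blast
     qed
     then show False using no_bad_column[OF S cf_on cl _ _ _ r(2) s eq] v by simp
    qed
   qed
  qed
 qed
 finally show ?thesis .
qed

lemma is_lrs_iff:
 assumes len: "length c = length b" and lam: "is_partition lam"
 shows "is_lrs b c L \<and> content (b, c, L) = lamstar lam \<longleftrightarrow> lrf (length lam) (\<lambda>i. lam ! i) (cf b) (cf c) L"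
proof -
 have pos: "0 < lam ! (length lam - v)" if "1 \<le> v" "v \<le> length lam" for v
  using lam that unfolding is_partition_def by (metis diff_less le_zero_eq less_le_trans not_gr_zero not_one_le_zero nth_mem zero_less_one)
 have con: "contre_lattice (colword b c L) \<longleftrightarrow> clat (length lam) L"
  if "slrs (cf b) (cf c) L" "content (b, c, L) = lamstar lam"
  using content_iff[OF len that(1), of lam] that pos by (intro contre_lattice_iff[OF len that(1)]) auto
 have a: "is_lrs b c L \<longleftrightarrow> slrs (cf b) (cf c) L \<and> contre_lattice (colword b c L)"
 proof
  assume i: "is_lrs b c L"
  then have "contre_lattice (colword b c L)" by (simp add: is_lrs_def)
  then show "slrs (cf b) (cf c) L \<and> contre_lattice (colword b c L)" using is_lrs_imp_slrs[OF len i] by blast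
 next
  assume "slrs (cf b) (cf c) L \<and> contre_lattice (colword b c L)"
  then show "is_lrs b c L" using slrs_imp_is_lrs[OF len] by blast
 qed
 show ?thesis
 proof (cases "slrs (cf b) (cf c) L")
  case True
  show ?thesis using a con[OF True] content_iff[OF len True, of lam] True unfolding lrf_def by blast
 next
  case False then show ?thesis using a by (simp add: lrf_def)
 qed
qed

section \<open>Relocating rows\<close>

text \<open>Only the values of \<open>f\<close> on nonempty rows carry information; uniqueness and
  equality of relocations are therefore stated there.\<close>

definition reloc :: "(nat \<Rightarrow> nat) \<Rightarrow> (nat \<Rightarrow> nat) \<Rightarrow> (nat \<Rightarrow> nat) \<Rightarrow> bool" where
 "reloc f a c \<longleftrightarrow> (\<forall>r s. 0 < a r \<and> 0 < a s \<and> r < s \<longrightarrow> f r < f s) \<and> (\<forall>r. 0 < a r \<longrightarrow> c (f r) = a r) \<and>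
   (\<forall>q. 0 < c q \<longrightarrow> (\<exists>r. 0 < a r \<and> f r = q))"

text \<open>By \<open>down_cf\<close> these are the shapes that dominate \<open>a\<close> and have
  the same flattening.\<close>

definition down :: "nat \<Rightarrow> (nat \<Rightarrow> nat) \<Rightarrow> (nat \<Rightarrow> nat) set" where
 "down n a = {c. on {0<..n} c \<and> (\<exists>f. reloc f a c \<and> (\<forall>r. 0 < a r \<longrightarrow> f r \<le> r))}"

text \<open>\<open>a\<close> is the outer shape and \<open>c\<close> an inner one on the relocated
  rows. A row of the inner shape may be empty where the outer one is not, so both are transported by
  the relocation of the outer shape.\<close>

definition pull :: "(nat \<Rightarrow> nat) \<Rightarrow> (nat \<Rightarrow> nat) \<Rightarrow> (nat \<Rightarrow> nat) \<Rightarrow> nat \<Rightarrow> nat" where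
 "pull f a c r = (if 0 < a r then c (f r) else 0)"

definition pull_fill :: "(nat \<Rightarrow> nat) \<Rightarrow> (nat \<Rightarrow> nat) \<Rightarrow> filling \<Rightarrow> filling" where
 "pull_fill f a T = (\<lambda>(r, j). if 0 < a r then T (f r, j) else 0)"

lemma relocD:
 assumes "reloc f a c"
 shows "0 < a r \<Longrightarrow> 0 < a s \<Longrightarrow> r < s \<Longrightarrow> f r < f s" "0 < a r \<Longrightarrow> c (f r) = a r" "0 < c q \<Longrightarrow> \<exists>r. 0 < a r \<and> f r = q"
 using assms unfolding reloc_def by blast+

lemma relocI:
 assumes "\<And>r s. 0 < a r \<Longrightarrow> 0 < a s \<Longrightarrow> r < s \<Longrightarrow> f r < f s" "\<And>r. 0 < a r \<Longrightarrow> c (f r) = a r" "\<And>q. 0 < c q \<Longrightarrow> \<exists>r. 0 < a r \<and> f r = q"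
 shows "reloc f a c"
 using assms unfolding reloc_def by blast

lemma reloc_inj: assumes "reloc f a c" "0 < a r" "0 < a s" "f r = f s" shows "r = s"
 using relocD(1)[OF assms(1), of r s] relocD(1)[OF assms(1), of s r] assms(2-4) by (metis less_irrefl linorder_neqE_nat)

lemma reloc_less: assumes "reloc f a c" "0 < a r" "0 < a s" "f r < f s" shows "r < s"
 using relocD(1)[OF assms(1), of s r] assms(2-4) by (metis less_asym linorder_neqE_nat less_irrefl)

lemma reloc_unique:
 assumes f: "reloc f a c" and g: "reloc g a c" and r: "0 < a r"
 shows "f r = g r"
 using r
proof (induction r rule: less_induct)
 case (less r)
 have aux: "\<not> h r < k r" if h: "reloc h a c" and k: "reloc k a c" and IH: "\<And>u. u < r \<Longrightarrow> 0 < a u \<Longrightarrow> h u = k u" for h k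
 proof
  assume lt: "h r < k r"
  have "0 < c (h r)" using relocD(2)[OF h less.prems] less.prems by simp
  then obtain u where u: "0 < a u" "k u = h r" using relocD(3)[OF k] by blast
  have "u < r" using reloc_less[OF k u(1) less.prems] u lt by simp
  then have "h u = h r" using IH u by simp
  then show False using reloc_inj[OF h u(1) less.prems] \<open>u < r\<close> by simp
 qed
 show ?case using aux[OF f g] aux[OF g f] less.IH by (metis linorder_neqE_nat)
qed

lemma reloc_fun_eq:
 assumes f: "reloc f a c" and g: "reloc g a d" and e: "\<And>r. 0 < a r \<Longrightarrow> f r = g r"
 shows "c = d"
proof
 fix q
 have aux: "c q = d q" if "reloc f a c" "reloc g a d" "\<And>r. 0 < a r \<Longrightarrow> f r = g r" "0 < c q" for f g c d
  using relocD(3)[OF that(1,4)] relocD(2)[OF that(1)] relocD(2)[OF that(2)] that(3) by metis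
 show "c q = d q" using aux[OF f g e] aux[OF g f e[symmetric]] by (metis gr0I)
qed

lemma reloc_inverse:
 assumes f: "reloc f a c"
 obtains g where "reloc g c a" "\<And>r. 0 < a r \<Longrightarrow> g (f r) = r" "\<And>q. 0 < c q \<Longrightarrow> 0 < a (g q) \<and> f (g q) = q"
proof -
 define g where "g = (\<lambda>q. SOME r. 0 < a r \<and> f r = q)"
 have g1: "0 < a (g q) \<and> f (g q) = q" if "0 < c q" for q
  unfolding g_def by (rule someI_ex) (rule relocD(3)[OF f that])
 have g2: "g (f r) = r" if r: "0 < a r" for r
 proof -
  have "0 < c (f r)" using relocD(2)[OF f r] r by simp
  then show ?thesis using g1 reloc_inj[OF f _ r] by blast
 qed
 have "reloc g c a"
 proof (rule relocI)
  show "g r < g s" if "0 < c r" "0 < c s" "r < s" for r s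
   using g1[OF that(1)] g1[OF that(2)] reloc_less[OF f] that(3) by metis
  show "a (g r) = c r" if "0 < c r" for r using g1[OF that] relocD(2)[OF f] by metis
  show "\<exists>r. 0 < c r \<and> g r = q" if "0 < a q" for q using g2[OF that] relocD(2)[OF f that] that by metis
 qed
 then show ?thesis using g1 g2 that by blast
qed

lemma reloc_comp: assumes f: "reloc f a c" and g: "reloc g c d" shows "reloc (g \<circ> f) a d"
proof (rule relocI)
 have p: "0 < c (f r)" if "0 < a r" for r using relocD(2)[OF f that] that by simp
 show "(g \<circ> f) r < (g \<circ> f) s" if "0 < a r" "0 < a s" "r < s" for r s
  using relocD(1)[OF g p[OF that(1)] p[OF that(2)]] relocD(1)[OF f that] by simp
 show "d ((g \<circ> f) r) = a r" if "0 < a r" for r using relocD(2)[OF g p[OF that]] relocD(2)[OF f that] by simp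
 show "\<exists>r. 0 < a r \<and> (g \<circ> f) r = q" if q: "0 < d q" for q
 proof -
  obtain u where u: "0 < c u" "g u = q" using relocD(3)[OF g q] by blast
  obtain r where "0 < a r" "f r = u" using relocD(3)[OF f u(1)] by blast
  then show ?thesis using u by auto
 qed
qed

lemma down_iff: "c \<in> down n a \<longleftrightarrow> on {0<..n} c \<and> (\<exists>g. reloc g c a \<and> (\<forall>q. 0 < c q \<longrightarrow> q \<le> g q))"
proof
 assume "c \<in> down n a"
 then obtain f where o: "on {0<..n} c" and f: "reloc f a c" "\<forall>r. 0 < a r \<longrightarrow> f r \<le> r" by (auto simp: down_def)
 obtain g where g: "reloc g c a" "\<And>q. 0 < c q \<Longrightarrow> 0 < a (g q) \<and> f (g q) = q" using reloc_inverse[OF f(1)] by blast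
 then have "\<forall>q. 0 < c q \<longrightarrow> q \<le> g q" using f(2) by metis
 then show "on {0<..n} c \<and> (\<exists>g. reloc g c a \<and> (\<forall>q. 0 < c q \<longrightarrow> q \<le> g q))" using g o by blast
next
 assume "on {0<..n} c \<and> (\<exists>g. reloc g c a \<and> (\<forall>q. 0 < c q \<longrightarrow> q \<le> g q))"
 then obtain g where o: "on {0<..n} c" and g: "reloc g c a" "\<forall>q. 0 < c q \<longrightarrow> q \<le> g q" by blast
 obtain f where f: "reloc f a c" "\<And>q. 0 < a q \<Longrightarrow> 0 < c (f q) \<and> g (f q) = q" using reloc_inverse[OF g(1)] by blast
 then have "\<forall>r. 0 < a r \<longrightarrow> f r \<le> r" using g(2) by metis
 then show "c \<in> down n a" using f o by (auto simp: down_def)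
qed

text \<open>All shapes of a class are compared on one index set, the rows of \<open>c'\<close>:
  \<open>p\<close> is the current position of a row and \<open>x\<close> its position in
  \<open>a\<close>, the upper limit for \<open>p\<close>.\<close>

lemma down_relocated:
 assumes p: "reloc p c' c" and x: "reloc x c' a" and o: "on {0<..n} c"
 shows "c \<in> down n a \<longleftrightarrow> (\<forall>u. 0 < c' u \<longrightarrow> p u \<le> x u)"
proof -
 obtain q where q: "reloc q c c'" "\<And>r. 0 < c' r \<Longrightarrow> q (p r) = r" "\<And>s. 0 < c s \<Longrightarrow> 0 < c' (q s) \<and> p (q s) = s"
  using reloc_inverse[OF p] by blast
 have xq: "reloc (x \<circ> q) c a" by (rule reloc_comp[OF q(1) x])
 show ?thesis
 proof
  assume "c \<in> down n a"
  then obtain g where g: "reloc g c a" "\<forall>s. 0 < c s \<longrightarrow> s \<le> g s" unfolding down_iff by blast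
  show "\<forall>u. 0 < c' u \<longrightarrow> p u \<le> x u"
  proof (intro allI impI)
   fix u assume u: "0 < c' u"
   then have c: "0 < c (p u)" using relocD(2)[OF p u] by simp
   then have "g (p u) = (x \<circ> q) (p u)" by (rule reloc_unique[OF g(1) xq])
   then show "p u \<le> x u" using g(2) c q(2)[OF u] by (metis comp_apply)
  qed
 next
  assume a: "\<forall>u. 0 < c' u \<longrightarrow> p u \<le> x u"
  have "s \<le> (x \<circ> q) s" if "0 < c s" for s using q(3)[OF that] a by (metis comp_apply)
  then show "c \<in> down n a" unfolding down_iff using o xq by blast
 qed
qed

lemma pull_reloc:
 assumes p: "reloc p b' b" and le: "\<And>r. c r \<le> b r"
 shows "reloc p (pull p b' c) c"
proof (rule relocI)
 show "p r < p s" if "0 < pull p b' c r" "0 < pull p b' c s" "r < s" for r s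
  using relocD(1)[OF p _ _ that(3)] that(1,2) by (auto simp: pull_def split: if_splits)
 show "c (p r) = pull p b' c r" if "0 < pull p b' c r" for r using that by (auto simp: pull_def split: if_splits)
 show "\<exists>r. 0 < pull p b' c r \<and> p r = q" if q: "0 < c q" for q
 proof -
  have "0 < b q" using le[of q] q by simp
  then obtain r where "0 < b' r" "p r = q" using relocD(3)[OF p] by blast
  then show ?thesis using q by (auto simp: pull_def)
 qed
qed

lemma pull_pull:
 assumes p: "reloc p b' b" and q: "\<And>s. 0 < b s \<Longrightarrow> 0 < b' (q s) \<and> p (q s) = s" and le: "\<And>r. c r \<le> b r"
 shows "pull q b (pull p b' c) = c"
proof
 fix s show "pull q b (pull p b' c) s = c s" using q[of s] le[of s] by (auto simp: pull_def)
qed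

lemma pull_fill_pull_fill:
 assumes q: "\<And>s. 0 < b s \<Longrightarrow> 0 < b' (q s) \<and> p (q s) = s" and z: "\<And>r j. b r = 0 \<Longrightarrow> L (r, j) = 0"
 shows "pull_fill q b (pull_fill p b' L) = L"
proof
 fix x :: "nat \<times> nat"
 obtain s j where x: "x = (s, j)" by (cases x)
 show "pull_fill q b (pull_fill p b' L) x = L x" using q[of s] z[of s j] x by (auto simp: pull_fill_def)
qed

lemma slrs_zero: "slrs b c L \<Longrightarrow> b r = 0 \<Longrightarrow> L (r, j) = 0"
 using slrsD(2)[of b c L r j] by (cases "L (r, j) = 0") auto

text \<open>The conditions compare only nonempty rows and depend only on their lengths and their
  relative order; the columns of the entries do not change.\<close>

lemma lrf_pull:
 assumes p: "reloc p b' b" and L: "lrf l lam b c L"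
 shows "lrf l lam b' (pull p b' c) (pull_fill p b' L)"
proof -
 let ?c = "pull p b' c" and ?L = "pull_fill p b' L"
 have S: "slrs b c L" and l: "\<And>p. L p \<le> l" and cn: "\<And>v. 1 \<le> v \<Longrightarrow> v \<le> l \<Longrightarrow> vcnt L 0 v = lam (l - v)" and cl: "clat l L"
  using L by (auto simp: lrf_def)
 have b: "b (p r) = b' r" if "0 < b' r" for r by (rule relocD(2)[OF p that])
 have e: "?c r = c (p r)" "?L (r, j) = L (p r, j)" if "0 < b' r" for r j using that by (auto simp: pull_def pull_fill_def)
 have z: "?c r = 0" "?L (r, j) = 0" if "b' r = 0" for r j using that by (auto simp: pull_def pull_fill_def)
 have "slrs b' ?c ?L" unfolding slrs_def
 proof (intro conjI allI impI)
  show "?c r \<le> b' r" for r using slrsD(1)[OF S, of "p r"] b[of r] by (auto simp: pull_def)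
  show "0 < ?L (r, j) \<longleftrightarrow> ?c r < j \<and> j \<le> b' r" for r j
  proof (cases "0 < b' r")
   case True then show ?thesis using e b slrsD(2)[OF S, of "p r" j] by simp
  next
   case False then show ?thesis using z(1)[of r] z(2)[of r j] by auto
  qed
  show "?L (r, Suc j) \<le> ?L (r, j)" if "?c r < j" for r j
  proof (cases "0 < b' r")
   case True then show ?thesis using e slrsD(3)[OF S, of "p r" j] that by simp
  next
   case False then show ?thesis using z(2)[of r "Suc j"] by simp
  qed
  fix r s j assume a: "r < s \<and> 1 \<le> j \<and> j \<le> b' r \<and> j \<le> b' s"
  then have rs: "0 < b' r" "0 < b' s" by auto
  then have "p r < p s" using relocD(1)[OF p] a by blast
  then show "j \<le> ?c r \<or> ?c s < j \<and> ?L (s, j) < ?L (r, j) \<or> b' r < b' s \<and> ?c r < j \<and> (Suc j \<le> ?c s \<or> ?L (r, j) < ?L (s, Suc j))"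
   using slrsD(4)[OF S, of "p r" "p s" j] a unfolding e[OF rs(1)] e[OF rs(2)] b[OF rs(1)] b[OF rs(2)] by blast
 qed
 moreover have "?L x \<le> l" for x using l by (cases x) (simp add: pull_fill_def)
 moreover have v: "vcnt ?L k v = vcnt L k v" if "1 \<le> v" for k v
 proof -
  let ?h = "\<lambda>(r, j). (p r, j)"
  let ?A = "{x. k < snd x \<and> ?L x = v}" and ?B = "{x. k < snd x \<and> L x = v}"
  have pos: "0 < b' r" if "?L (r, j) = v" for r j using that \<open>1 \<le> v\<close> z(2)[of r j] by (cases "b' r = 0") auto
  have "bij_betw ?h ?A ?B"
  proof (rule bij_betw_imageI)
   show "inj_on ?h ?A"
   proof (rule inj_onI)
    fix x y assume a: "x \<in> ?A" "y \<in> ?A" "?h x = ?h y"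
    obtain r j s i where xy: "x = (r, j)" "y = (s, i)" by (cases x, cases y)
    then show "x = y" using reloc_inj[OF p, of r s] pos[of r j] pos[of s i] a by simp
   qed
   show "?h ` ?A = ?B"
   proof
    show "?h ` ?A \<subseteq> ?B"
    proof
     fix y assume "y \<in> ?h ` ?A"
     then obtain r j where y: "y = (p r, j)" "k < j" "?L (r, j) = v" by auto
     then show "y \<in> ?B" using e(2)[OF pos[OF y(3)], of j] by simp
    qed
    show "?B \<subseteq> ?h ` ?A"
    proof
     fix y assume y: "y \<in> ?B"
     obtain s j where ys: "y = (s, j)" by (cases y)
     have "0 < b s" using slrs_zero[OF S, of s j] y ys \<open>1 \<le> v\<close> by (cases "b s = 0") auto
     then obtain r where r: "0 < b' r" "p r = s" using relocD(3)[OF p] by blast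
     then have "(r, j) \<in> ?A" using e(2)[of r j] y ys by simp
     then show "y \<in> ?h ` ?A" using ys r by (metis (mono_tags, lifting) case_prod_conv image_eqI)
    qed
   qed
  qed
  then show ?thesis unfolding vcnt_def by (rule bij_betw_same_card)
 qed
 moreover have "clat l ?L" using cl v unfolding clat_def by simp
 ultimately show ?thesis using cn unfolding lrf_def by simp
qed

lemma card_lrf_pull:
 assumes p: "reloc p b' b" and le: "\<And>r. c r \<le> b r"
 shows "card {L. lrf l lam b c L} = card {L. lrf l lam b' (pull p b' c) L}"
proof -
 obtain q where q: "reloc q b b'" "\<And>r. 0 < b' r \<Longrightarrow> q (p r) = r" "\<And>s. 0 < b s \<Longrightarrow> 0 < b' (q s) \<and> p (q s) = s"
  using reloc_inverse[OF p] by blast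
 have q2: "0 < b (p s) \<and> q (p s) = s" if "0 < b' s" for s using q(2)[OF that] relocD(2)[OF p that] that by simp
 have pp: "pull q b (pull p b' c) = c" by (rule pull_pull[OF p q(3) le])
 have zero: "L (r, j) = 0" if "lrf l lam d e L" "d r = 0" for d e L r j
  using slrs_zero[of d e L r j] that by (auto simp: lrf_def)
 have "bij_betw (pull_fill p b') {L. lrf l lam b c L} {L. lrf l lam b' (pull p b' c) L}"
 proof (rule bij_betw_byWitness[where f' = "pull_fill q b"])
  show "\<forall>L\<in>{L. lrf l lam b c L}. pull_fill q b (pull_fill p b' L) = L"
  proof
   fix L assume "L \<in> {L. lrf l lam b c L}"
   then have h: "L (r, j) = 0" if "b r = 0" for r j using zero that by blast
   show "pull_fill q b (pull_fill p b' L) = L" by (rule pull_fill_pull_fill) (erule q(3), erule h)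
  qed
  show "\<forall>L\<in>{L. lrf l lam b' (pull p b' c) L}. pull_fill p b' (pull_fill q b L) = L"
  proof
   fix L assume "L \<in> {L. lrf l lam b' (pull p b' c) L}"
   then have h: "L (r, j) = 0" if "b' r = 0" for r j using zero that by blast
   show "pull_fill p b' (pull_fill q b L) = L" by (rule pull_fill_pull_fill) (erule q2, erule h)
  qed
  show "pull_fill p b' ` {L. lrf l lam b c L} \<subseteq> {L. lrf l lam b' (pull p b' c) L}" using lrf_pull[OF p] by blast
  show "pull_fill q b ` {L. lrf l lam b' (pull p b' c) L} \<subseteq> {L. lrf l lam b c L}"
   using lrf_pull[OF q(1), of l lam "pull p b' c"] unfolding pp by blast
 qed
 then show ?thesis by (rule bij_betw_same_card)
qed

section \<open>Highest-weight representatives\<close>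

definition swp :: "nat \<Rightarrow> (nat \<Rightarrow> nat) \<Rightarrow> nat \<Rightarrow> nat" where
 "swp i c r = (if r = i then c (Suc i) else if r = Suc i then c i else c r)"

text \<open>Only the inner shape is tested. Moving a row into an empty row above it keeps the
  filling valid, so a swap can fail only by leaving \<open>down n a\<close>; see
  \<open>swap_rows_LRS\<close>.\<close>

definition high :: "nat \<Rightarrow> (nat \<Rightarrow> nat) \<Rightarrow> (nat \<Rightarrow> nat) \<Rightarrow> (nat \<Rightarrow> nat) \<Rightarrow> bool" where
 "high n a b c \<longleftrightarrow> (\<forall>i. 1 \<le> i \<and> Suc i \<le> n \<and> 0 < b i \<and> b (Suc i) = 0 \<longrightarrow> swp i c \<notin> down n a)"

lemma reloc_swp:
 assumes p: "reloc p b' b" and u: "0 < b' u" and z: "b (Suc (p u)) = 0"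
 shows "reloc (p(u := Suc (p u))) b' (swp (p u) b)"
proof -
 have ne: "p s \<noteq> Suc (p u)" if "0 < b' s" for s using relocD(2)[OF p that] z that by (metis less_irrefl)
 have ne2: "p s \<noteq> p u" if "0 < b' s" "s \<noteq> u" for s using reloc_inj[OF p that(1) u] that(2) by blast
 show ?thesis
 proof (rule relocI)
  show "(p(u := Suc (p u))) r < (p(u := Suc (p u))) s" if rs: "0 < b' r" "0 < b' s" "r < s" for r s
   using relocD(1)[OF p rs] ne[OF rs(2)] rs(3) by auto
  show "swp (p u) b ((p(u := Suc (p u))) r) = b' r" if r: "0 < b' r" for r
   using relocD(2)[OF p r] ne[OF r] ne2[OF r] by (auto simp: swp_def)
  show "\<exists>r. 0 < b' r \<and> (p(u := Suc (p u))) r = q" if q: "0 < swp (p u) b q" for q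
  proof (cases "q = Suc (p u)")
   case True then show ?thesis using u by auto
  next
   case False
   then have "q \<noteq> p u" "0 < b q" using q z by (auto simp: swp_def split: if_splits)
   then obtain r where "0 < b' r" "p r = q" using relocD(3)[OF p] by blast
   then show ?thesis using \<open>q \<noteq> p u\<close> by auto
  qed
 qed
qed

lemma pull_swp:
 assumes p: "reloc p b' b" and u: "0 < b' u" and z: "b (Suc (p u)) = 0"
 shows "pull (p(u := Suc (p u))) b' (swp (p u) c) = pull p b' c"
proof
 fix r
 have "p r \<noteq> Suc (p u)" if "0 < b' r" using relocD(2)[OF p that] z that by (metis less_irrefl)
 moreover have "p r \<noteq> p u" if "0 < b' r" "r \<noteq> u" using reloc_inj[OF p that(1) u] that(2) by blast
 ultimately show "pull (p(u := Suc (p u))) b' (swp (p u) c) r = pull p b' c r" by (auto simp: pull_def swp_def)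
qed

lemma on_swp: "on {0<..n} c \<Longrightarrow> 1 \<le> i \<Longrightarrow> Suc i \<le> n \<Longrightarrow> on {0<..n} (swp i c)"
 by (auto simp: on_def swp_def)

lemma swp_le: "(\<And>r. c r \<le> b r) \<Longrightarrow> swp i c r \<le> swp i b r"
 by (simp add: swp_def)

lemma reloc_ge_1: assumes "reloc p b' b" "on {0<..n} b" "0 < b' u" shows "1 \<le> p u \<and> p u \<le> n"
proof -
 have "0 < b (p u)" using relocD(2)[OF assms(1,3)] assms(3) by simp
 then have "p u \<in> {0<..n}" using onD[OF assms(2), of "p u"] by blast
 then show ?thesis by auto
qed

text \<open>Rephrases highest weight as local maximality of the position map \<open>p\<close> under
  the limit \<open>x\<close>, the form in which uniqueness and existence are proved.\<close>

lemma high_reloc: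
 assumes p: "reloc p b' b" and x: "reloc x (pull p b' c) a" and o: "on {0<..n} b" and le: "\<And>r. c r \<le> b r"
 shows "high n a b c \<longleftrightarrow> (\<forall>u. 0 < b' u \<and> Suc (p u) \<le> n \<and> b (Suc (p u)) = 0 \<longrightarrow>
  \<not> (\<forall>v. 0 < pull p b' c v \<longrightarrow> (p(u := Suc (p u))) v \<le> x v))"
proof -
 have oc: "on {0<..n} c" using o le unfolding on_def by (metis le_zero_eq)
 have key: "swp (p u) c \<in> down n a \<longleftrightarrow> (\<forall>v. 0 < pull p b' c v \<longrightarrow> (p(u := Suc (p u))) v \<le> x v)"
  if u: "0 < b' u" "Suc (p u) \<le> n" "b (Suc (p u)) = 0" for u
 proof -
  have "reloc (p(u := Suc (p u))) (pull (p(u := Suc (p u))) b' (swp (p u) c)) (swp (p u) c)"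
   by (rule pull_reloc[OF reloc_swp[OF p u(1,3)]]) (rule swp_le[OF le])
  then have "reloc (p(u := Suc (p u))) (pull p b' c) (swp (p u) c)" unfolding pull_swp[OF p u(1,3)] .
  moreover have "on {0<..n} (swp (p u) c)" by (rule on_swp[OF oc _ u(2)]) (use reloc_ge_1[OF p o u(1)] in simp)
  ultimately show ?thesis using x by (intro down_relocated)
 qed
 show ?thesis
 proof
  assume h: "high n a b c"
  show "\<forall>u. 0 < b' u \<and> Suc (p u) \<le> n \<and> b (Suc (p u)) = 0 \<longrightarrow> \<not> (\<forall>v. 0 < pull p b' c v \<longrightarrow> (p(u := Suc (p u))) v \<le> x v)"
  proof (intro allI impI)
   fix u assume u: "0 < b' u \<and> Suc (p u) \<le> n \<and> b (Suc (p u)) = 0"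
   then have "1 \<le> p u" "0 < b (p u)" using reloc_ge_1[OF p o, of u] relocD(2)[OF p, of u] by auto
   then have "swp (p u) c \<notin> down n a" using h u unfolding high_def by blast
   then show "\<not> (\<forall>v. 0 < pull p b' c v \<longrightarrow> (p(u := Suc (p u))) v \<le> x v)" using key u by blast
  qed
 next
  assume r: "\<forall>u. 0 < b' u \<and> Suc (p u) \<le> n \<and> b (Suc (p u)) = 0 \<longrightarrow> \<not> (\<forall>v. 0 < pull p b' c v \<longrightarrow> (p(u := Suc (p u))) v \<le> x v)"
  show "high n a b c" unfolding high_def
  proof (intro allI impI)
   fix i assume i: "1 \<le> i \<and> Suc i \<le> n \<and> 0 < b i \<and> b (Suc i) = 0"
   then obtain u where u: "0 < b' u" "p u = i" using relocD(3)[OF p, of i] by blast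
   then show "swp i c \<notin> down n a" using key[of u] r[rule_format, of u] i by blast
  qed
 qed
qed

text \<open>At the highest row \<open>u\<close> where the two position maps differ, the one placing
  \<open>u\<close> lower has an empty row directly above, since all later rows agree with the other
  map. Raising \<open>u\<close> by one stays within the limit, because the other map already
  respects it at a higher position; this contradicts local maximality.\<close>

lemma high_unique:
 assumes p: "reloc p b' b" "on {0<..n} b" "\<And>r. c r \<le> b r" "high n a b c"
  and q: "reloc q b' d" "on {0<..n} d" "\<And>r. e r \<le> d r" "e \<in> down n a" and c: "c \<in> down n a"
  and eq: "pull p b' c = pull q b' e" and u: "0 < b' u" and above: "\<And>v. u < v \<Longrightarrow> 0 < b' v \<Longrightarrow> p v = q v"
 shows "\<not> p u < q u"
proof
 assume lt: "p u < q u"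
 have oc: "on {0<..n} c" and oe: "on {0<..n} e" using c q(4) by (auto simp: down_def)
 have pc: "reloc p (pull p b' c) c" by (rule pull_reloc[OF p(1,3)])
 have qe: "reloc q (pull p b' c) e" unfolding eq by (rule pull_reloc[OF q(1,3)])
 obtain g where g: "reloc g c a" using c unfolding down_iff by blast
 have x: "reloc (g \<circ> p) (pull p b' c) a" by (rule reloc_comp[OF pc g])
 have cx: "p v \<le> (g \<circ> p) v" if "0 < pull p b' c v" for v using down_relocated[OF pc x oc] c that by blast
 have ex: "q v \<le> (g \<circ> p) v" if "0 < pull p b' c v" for v using down_relocated[OF qe x oe] q(4) that by blast
 have "b (Suc (p u)) = 0"
 proof (rule ccontr)
  assume "b (Suc (p u)) \<noteq> 0"
  then obtain v where v: "0 < b' v" "p v = Suc (p u)" using relocD(3)[OF p(1)] by blast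
  then have uv: "u < v" using reloc_less[OF p(1) u v(1)] by simp
  then have "q u < q v" using relocD(1)[OF q(1) u v(1)] by simp
  then show False using above[OF uv v(1)] v lt by simp
 qed
 moreover have "Suc (p u) \<le> n" using lt reloc_ge_1[OF q(1,2) u] by simp
 ultimately have "\<not> (\<forall>v. 0 < pull p b' c v \<longrightarrow> (p(u := Suc (p u))) v \<le> (g \<circ> p) v)"
  using p(4) u unfolding high_reloc[OF p(1) x p(2,3)] by blast
 then obtain v where v: "0 < pull p b' c v" "\<not> (p(u := Suc (p u))) v \<le> (g \<circ> p) v" by blast
 show False
 proof (cases "v = u")
  case True then show False using v ex[OF v(1)] lt by simp
 next
  case False then show False using v cx[OF v(1)] by simp
 qed
qed

text \<open>The opposite of \<open>pull\<close>: here the position map comes first and the shapes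
  are read off from it.\<close>

definition push :: "(nat \<Rightarrow> nat) \<Rightarrow> (nat \<Rightarrow> nat) \<Rightarrow> (nat \<Rightarrow> nat) \<Rightarrow> nat \<Rightarrow> nat" where
 "push p b f q = (if \<exists>r. 0 < b r \<and> p r = q then f (SOME r. 0 < b r \<and> p r = q) else 0)"

lemma push_at:
 assumes m: "\<And>r s. 0 < b r \<Longrightarrow> 0 < b s \<Longrightarrow> r < s \<Longrightarrow> p r < p s" and r: "0 < b r"
 shows "push p b f (p r) = f r"
proof -
 let ?s = "SOME s. 0 < b s \<and> p s = p r"
 have "0 < b ?s \<and> p ?s = p r" by (rule someI[where x = r]) (use r in simp)
 then have "?s = r" using m[of ?s r] m[of r ?s] r by (metis less_irrefl linorder_neqE_nat)
 moreover have "\<exists>s. 0 < b s \<and> p s = p r" using r by blast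
 ultimately show ?thesis unfolding push_def by (simp only: if_True)
qed

lemma push_off: "\<not> (\<exists>r. 0 < b r \<and> p r = q) \<Longrightarrow> push p b f q = 0"
 unfolding push_def by (simp only: if_False)

lemma push_reloc:
 assumes m: "\<And>r s. 0 < b r \<Longrightarrow> 0 < b s \<Longrightarrow> r < s \<Longrightarrow> p r < p s"
 shows "reloc p b (push p b b)"
proof (rule relocI)
 show "p r < p s" if "0 < b r" "0 < b s" "r < s" for r s by (rule m[OF that])
 show "push p b b (p r) = b r" if "0 < b r" for r by (rule push_at) (rule m, assumption+, rule that)
 show "\<exists>r. 0 < b r \<and> p r = q" if "0 < push p b b q" for q using that push_off[of b p q b] by (metis less_irrefl)
qed

text \<open>Among the order-preserving maps that raise rows within the limits, one with the largest
  total position is locally maximal.\<close>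

lemma high_exists:
 assumes b': "on {0<..n} b'" and c': "c' \<in> down n a" and le: "\<And>r. c' r \<le> b' r"
 shows "\<exists>p b c. reloc p b' b \<and> on {0<..n} b \<and> b' \<in> down n b \<and> c \<in> down n a \<and> (\<forall>r. c r \<le> b r) \<and> high n a b c \<and> pull p b' c = c'"
proof -
 obtain x where x: "reloc x c' a" "\<forall>q. 0 < c' q \<longrightarrow> q \<le> x q" using c' unfolding down_iff by blast
 let ?P = "\<lambda>p. (\<forall>r s. 0 < b' r \<and> 0 < b' s \<and> r < s \<longrightarrow> p r < p s) \<and> (\<forall>u. 0 < b' u \<longrightarrow> u \<le> p u \<and> p u \<le> n) \<and> (\<forall>u. 0 < c' u \<longrightarrow> p u \<le> x u)"
 let ?S = "{u\<in>{1..n}. 0 < b' u}"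
 have b'r: "u \<in> {1..n}" if "0 < b' u" for u using onD[OF b', of u] that by auto
 have "?P id" using x(2) b'r by auto
 moreover have "\<forall>p. ?P p \<longrightarrow> sum p ?S < Suc (n * n)"
 proof (intro allI impI)
  fix p assume P: "?P p"
  have "sum p ?S \<le> (\<Sum>u\<in>?S. n)" by (rule sum_mono) (use P in auto)
  also have "\<dots> \<le> (\<Sum>u\<in>{1..n}. n)" by (rule sum_mono2) auto
  finally show "sum p ?S < Suc (n * n)" by simp
 qed
 ultimately obtain p where P: "?P p" and max: "\<forall>q. ?P q \<longrightarrow> sum q ?S \<le> sum p ?S"
  using ex_has_greatest_nat[of ?P id "\<lambda>p. sum p ?S" "Suc (n * n)"] by blast
 have m: "p r < p s" if "0 < b' r" "0 < b' s" "r < s" for r s using P that by blast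
 define b where "b = push p b' b'"
 define c where "c = push p b' c'"
 have pb: "reloc p b' b" unfolding b_def by (rule push_reloc[OF m])
 have le2: "c r \<le> b r" for r
 proof (cases "\<exists>u. 0 < b' u \<and> p u = r")
  case True
  then show ?thesis unfolding b_def c_def push_def using le by (simp only: if_True)
 next
  case False then show ?thesis unfolding c_def by (simp add: push_off)
 qed
 have pull: "pull p b' c = c'"
 proof
  fix r
  show "pull p b' c r = c' r" using push_at[where b = b' and p = p and r = r and f = c'] m le[of r] by (auto simp: pull_def c_def)
 qed
 have ob: "on {0<..n} b" unfolding on_def
 proof (intro allI impI)
  fix q assume q: "q \<notin> {0<..n}"
  have "q \<in> {0<..n}" if u: "0 < b' u" "p u = q" for u
  proof -
   have "u \<le> p u \<and> p u \<le> n" using P u(1) by blast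
   then show ?thesis using b'r[OF u(1)] u(2) by auto
  qed
  then show "b q = 0" unfolding b_def using q by (intro push_off) blast
 qed
 then have oc: "on {0<..n} c" using le2 unfolding on_def by (metis le_zero_eq)
 have pc: "reloc p c' c" using pull_reloc[OF pb le2] unfolding pull .
 have cd: "c \<in> down n a" using down_relocated[OF pc x(1) oc] P by blast
 have bd: "b' \<in> down n b" unfolding down_iff using b' pb P by blast
 have "high n a b c" unfolding high_reloc[where c = c, OF pb x(1)[folded pull] ob le2]
 proof (intro allI impI notI)
  fix u assume u: "0 < b' u \<and> Suc (p u) \<le> n \<and> b (Suc (p u)) = 0"
   and all: "\<forall>v. 0 < pull p b' c v \<longrightarrow> (p(u := Suc (p u))) v \<le> x v"
  let ?q = "p(u := Suc (p u))"
  have rq: "reloc ?q b' (swp (p u) b)" using reloc_swp[OF pb] u by blast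
  have "?P ?q"
  proof (intro conjI allI impI)
   show "?q r < ?q s" if "0 < b' r \<and> 0 < b' s \<and> r < s" for r s using relocD(1)[OF rq] that by blast
   show "v \<le> ?q v" if "0 < b' v" for v using P that by (auto simp: le_SucI)
   show "?q v \<le> n" if "0 < b' v" for v using P u that by auto
   show "?q v \<le> x v" if "0 < c' v" for v using all that unfolding pull by blast
  qed
  then have "sum ?q ?S \<le> sum p ?S" using max by blast
  moreover have "sum p ?S < sum ?q ?S" by (rule sum_strict_mono_ex1) (use u b'r[of u] in auto)
  ultimately show False by simp
 qed
 then show ?thesis using pb ob bd cd le2 pull by blast
qed

text \<open>For a fixed outer shape \<open>b'\<close>, raising rows takes each inner shape to
  exactly one highest-weight pair, and \<open>inv\<close> says that the summand is constant along
  the way. This regroups a sum over inner shapes by highest-weight pairs.\<close>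

lemma sum_high:
 fixes N :: "(nat \<Rightarrow> nat) \<Rightarrow> (nat \<Rightarrow> nat) \<Rightarrow> nat"
 assumes b': "on {0<..n} b'"
  and inv: "\<And>p b c. reloc p b' b \<Longrightarrow> (\<And>r. c r \<le> b r) \<Longrightarrow> N b c = N b' (pull p b' c)"
 shows "(\<Sum>c | c \<in> down n a \<and> (\<forall>r. c r \<le> b' r). N b' c) =
  (\<Sum>x | on {0<..n} (fst x) \<and> b' \<in> down n (fst x) \<and> snd x \<in> down n a \<and> (\<forall>r. snd x r \<le> fst x r) \<and> high n a (fst x) (snd x). N (fst x) (snd x))"
  (is "sum _ ?Y = sum _ ?X")
proof -
 define \<psi> where "\<psi> = (\<lambda>b. SOME p. reloc p b' b)"
 have \<psi>: "reloc (\<psi> b) b' b" if "b' \<in> down n b" for b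
 proof -
  have "\<exists>p. reloc p b' b" using that unfolding down_iff by blast
  then show ?thesis unfolding \<psi>_def by (rule someI_ex)
 qed
 let ?h = "\<lambda>x. pull (\<psi> (fst x)) b' (snd x)"
 have bij: "bij_betw ?h ?X ?Y"
 proof (rule bij_betw_imageI)
  show "inj_on ?h ?X"
  proof (rule inj_onI)
   fix x y assume x: "x \<in> ?X" and y: "y \<in> ?X" and e: "?h x = ?h y"
   obtain b c d e where xy: "x = (b, c)" "y = (d, e)" by (cases x, cases y)
   have X: "on {0<..n} b" "b' \<in> down n b" "c \<in> down n a" "\<And>r. c r \<le> b r" "high n a b c"
    and Y: "on {0<..n} d" "b' \<in> down n d" "e \<in> down n a" "\<And>r. e r \<le> d r" "high n a d e" using x y xy by auto
   have p: "reloc (\<psi> b) b' b" and q: "reloc (\<psi> d) b' d" using \<psi> X Y by auto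
   have eq: "pull (\<psi> b) b' c = pull (\<psi> d) b' e" using e xy by simp
   have same: "\<psi> b u = \<psi> d u" if "0 < b' u" for u
   proof (rule ccontr)
    assume n: "\<psi> b u \<noteq> \<psi> d u"
    let ?D = "{u. 0 < b' u \<and> \<psi> b u \<noteq> \<psi> d u}"
    have f: "finite ?D" by (rule finite_subset[of _ "{0<..n}"]) (use onD[OF b'] in auto)
    have ne: "?D \<noteq> {}" using n that by blast
    let ?u = "Max ?D"
    have u: "0 < b' ?u" "\<psi> b ?u \<noteq> \<psi> d ?u" using Max_in[OF f ne] by auto
    have ab: "\<psi> b v = \<psi> d v" if "?u < v" "0 < b' v" for v
    proof (rule ccontr)
     assume "\<psi> b v \<noteq> \<psi> d v"
     then have "v \<le> ?u" using that Max_ge[OF f, of v] by blast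
     then show False using that by simp
    qed
    have "\<not> \<psi> b ?u < \<psi> d ?u" by (rule high_unique[OF p X(1,4,5) q Y(1,4,3) X(3) eq u(1) ab])
    moreover have "\<not> \<psi> d ?u < \<psi> b ?u" by (rule high_unique[OF q Y(1,4,5) p X(1,4,3) Y(3) eq[symmetric] u(1) ab[symmetric]])
    ultimately show False using u(2) by simp
   qed
   have "b = d" by (rule reloc_fun_eq[OF p q same])
   moreover have "c = e"
   proof (rule reloc_fun_eq[OF pull_reloc[OF p X(4)]])
    show "reloc (\<psi> d) (pull (\<psi> b) b' c) e" unfolding eq by (rule pull_reloc[OF q Y(4)])
    show "\<psi> b r = \<psi> d r" if "0 < pull (\<psi> b) b' c r" for r using same[of r] that by (auto simp: pull_def split: if_splits)
   qed
   ultimately show "x = y" using xy by simp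
  qed
  show "?h ` ?X = ?Y"
  proof
   show "?h ` ?X \<subseteq> ?Y"
   proof
    fix z assume "z \<in> ?h ` ?X"
    then obtain b c where z: "z = pull (\<psi> b) b' c" and X: "on {0<..n} b" "b' \<in> down n b" "c \<in> down n a" "\<And>r. c r \<le> b r"
     by auto
    obtain g where g: "reloc g b' b" "\<And>q. 0 < b' q \<Longrightarrow> q \<le> g q" using X(2) unfolding down_iff by blast
    have p: "reloc (\<psi> b) b' b" by (rule \<psi>[OF X(2)])
    have up: "q \<le> \<psi> b q" if "0 < b' q" for q using g(2)[OF that] reloc_unique[OF g(1) p that] by simp
    have le: "z r \<le> b' r" for r unfolding z pull_def using X(4)[of "\<psi> b r"] relocD(2)[OF p, of r] by (cases "0 < b' r") auto
    have pz: "reloc (\<psi> b) z c" unfolding z by (rule pull_reloc[OF p X(4)])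
    obtain x where x: "reloc x c a" "\<And>q. 0 < c q \<Longrightarrow> q \<le> x q" using X(3) unfolding down_iff by blast
    have "reloc (x \<circ> \<psi> b) z a" by (rule reloc_comp[OF pz x(1)])
    moreover have "q \<le> (x \<circ> \<psi> b) q" if q: "0 < z q" for q
    proof -
     have "q \<le> \<psi> b q" using up[of q] le[of q] q by simp
     also have "\<dots> \<le> x (\<psi> b q)" by (rule x(2)) (use relocD(2)[OF pz q] q in simp)
     finally show ?thesis by simp
    qed
    moreover have "on {0<..n} z" using b' le unfolding on_def by (metis le_zero_eq)
    ultimately have "z \<in> down n a" unfolding down_iff by blast
    then show "z \<in> ?Y" using le by simp
   qed
   show "?Y \<subseteq> ?h ` ?X"
   proof
    fix c' assume "c' \<in> ?Y"
    then have c': "c' \<in> down n a" "\<And>r. c' r \<le> b' r" by auto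
    obtain p b c where H: "reloc p b' b" "on {0<..n} b" "b' \<in> down n b" "c \<in> down n a" "\<forall>r. c r \<le> b r" "high n a b c" "pull p b' c = c'"
     using high_exists[OF b' c'] by blast
    have "\<psi> b r = p r" if "0 < b' r" for r by (rule reloc_unique[OF \<psi>[OF H(3)] H(1) that])
    then have "pull (\<psi> b) b' c = pull p b' c" by (auto simp: pull_def)
    then have "c' = ?h (b, c)" using H(7) by simp
    moreover have "(b, c) \<in> ?X" using H by simp
    ultimately show "c' \<in> ?h ` ?X" by (rule image_eqI)
   qed
  qed
 qed
 have "sum (N b') ?Y = (\<Sum>x\<in>?X. N b' (?h x))" by (rule sum.reindex_bij_betw[OF bij, symmetric])
 also have "\<dots> = (\<Sum>x\<in>?X. N (fst x) (snd x))"
 proof (rule sum.cong)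
  fix x assume "x \<in> ?X"
  then have "b' \<in> down n (fst x)" "\<And>r. snd x r \<le> fst x r" by auto
  then show "N b' (?h x) = N (fst x) (snd x)" using inv[OF \<psi>, of "fst x" "snd x"] by simp
 qed simp
 finally show ?thesis .
qed

section \<open>Dominance in terms of relocations\<close>

lemma sum_reloc:
 assumes f: "reloc f a c" and a: "on {0<..n} a" and c: "on {0<..n} c"
 shows "(\<Sum>q\<in>{1..i}. c q) = (\<Sum>r | 0 < a r \<and> f r \<le> i. a r)"
proof -
 let ?R = "{r. 0 < a r \<and> f r \<le> i}"
 have im: "{q\<in>{1..i}. 0 < c q} = f ` ?R"
 proof (rule set_eqI)
  fix q
  show "q \<in> {q\<in>{1..i}. 0 < c q} \<longleftrightarrow> q \<in> f ` ?R"
  proof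
   assume q: "q \<in> {q\<in>{1..i}. 0 < c q}"
   then obtain r where "0 < a r" "f r = q" using relocD(3)[OF f, of q] by auto
   then show "q \<in> f ` ?R" using q by auto
  next
   assume "q \<in> f ` ?R"
   then obtain r where r: "0 < a r" "f r \<le> i" "q = f r" by auto
   then show "q \<in> {q\<in>{1..i}. 0 < c q}" using relocD(2)[OF f r(1)] reloc_ge_1[OF f c r(1)] by simp
  qed
 qed
 have "(\<Sum>q\<in>{1..i}. c q) = sum c {q\<in>{1..i}. 0 < c q}" by (rule sum.mono_neutral_right) auto
 also have "\<dots> = sum (c \<circ> f) ?R" unfolding im
  by (rule sum.reindex) (use reloc_inj[OF f] in \<open>auto simp: inj_on_def\<close>)
 also have "\<dots> = sum a ?R" by (rule sum.cong) (use relocD(2)[OF f] in auto)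
 finally show ?thesis .
qed

lemma sz_reloc:
 assumes f: "reloc f a c" and a: "on {0<..n} a" and c: "on {0<..n} c"
 shows "sz n c = sz n a"
proof -
 have "sz n c = (\<Sum>r | 0 < a r \<and> f r \<le> n. a r)" unfolding sz_def by (rule sum_reloc[OF f a c])
 also have "{r. 0 < a r \<and> f r \<le> n} = {r. 0 < a r}" using reloc_ge_1[OF f c] by blast
 also have "sum a {r. 0 < a r} = sz n a" unfolding sz_def
  by (rule sum.mono_neutral_left) (use onD[OF a] in \<open>auto simp: Suc_le_eq\<close>)
 finally show ?thesis .
qed

lemma finite_supp: assumes "on {0<..n} a" shows "finite {r. 0 < a r \<and> P r}"
 by (rule finite_subset[of _ "{0<..n}"]) (use onD[OF assms] in auto)

text \<open>If some row moved up, so that \<open>f r > r\<close>, the rows now at height at most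
  \<open>r\<close> form a proper subset of those originally there, and the partial sum at
  \<open>r\<close> is too small.\<close>

lemma dominance_reloc:
 assumes f: "reloc f a c" and a: "on {0<..n} a" and c: "on {0<..n} c"
 shows "(\<forall>i. (\<Sum>q\<in>{1..i}. a q) \<le> (\<Sum>q\<in>{1..i}. c q)) \<longleftrightarrow> (\<forall>r. 0 < a r \<longrightarrow> f r \<le> r)"
proof -
 have id: "reloc id a a" by (rule relocI) auto
 have A: "(\<Sum>q\<in>{1..i}. a q) = (\<Sum>r | 0 < a r \<and> r \<le> i. a r)" for i using sum_reloc[OF id a a, of i] by simp
 show ?thesis unfolding sum_reloc[OF f a c] A
 proof
  assume d: "\<forall>i. (\<Sum>r | 0 < a r \<and> r \<le> i. a r) \<le> (\<Sum>r | 0 < a r \<and> f r \<le> i. a r)"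
  show "\<forall>r. 0 < a r \<longrightarrow> f r \<le> r"
  proof (intro allI impI, rule ccontr)
   fix r assume r: "0 < a r" "\<not> f r \<le> r"
   have "{s. 0 < a s \<and> f s \<le> r} \<subset> {s. 0 < a s \<and> s \<le> r}"
   proof
    show "{s. 0 < a s \<and> f s \<le> r} \<subseteq> {s. 0 < a s \<and> s \<le> r}"
    proof
     fix s assume s: "s \<in> {s. 0 < a s \<and> f s \<le> r}"
     then have "f s < f r" using r by simp
     then have "s < r" using reloc_less[OF f] s r by blast
     then show "s \<in> {s. 0 < a s \<and> s \<le> r}" using s by simp
    qed
    show "{s. 0 < a s \<and> f s \<le> r} \<noteq> {s. 0 < a s \<and> s \<le> r}" using r by blast
   qed
   then have "(\<Sum>s | 0 < a s \<and> f s \<le> r. a s) < (\<Sum>s | 0 < a s \<and> s \<le> r. a s)"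
    using finite_supp[OF a, of "\<lambda>s. s \<le> r"] r by (intro sum_strict_mono2[of _ _ r]) auto
   then show False using d[rule_format, of r] by simp
  qed
 next
  assume d: "\<forall>r. 0 < a r \<longrightarrow> f r \<le> r"
  show "\<forall>i. (\<Sum>r | 0 < a r \<and> r \<le> i. a r) \<le> (\<Sum>r | 0 < a r \<and> f r \<le> i. a r)"
   by (intro allI sum_mono2 finite_supp[OF a]) (use d in \<open>auto intro: le_trans\<close>)
 qed
qed

section \<open>Quasi-key polynomials as sums of atoms\<close>

lemma fil_pull:
 assumes p: "reloc p a c" and f: "fil n c T" and a: "on {0<..n} a"
 shows "fil n a (pull_fill p a T)"
 unfolding fil_def
proof (intro conjI allI impI)
 show "on {0<..n} a" by (rule a)
 show "0 < pull_fill p a T (r, j) \<longleftrightarrow> 1 \<le> j \<and> j \<le> a r" for r j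
  using fil_pos[OF f, of "p r" j] relocD(2)[OF p, of r] by (cases "0 < a r") (auto simp: pull_fill_def)
 show "pull_fill p a T (r, Suc j) \<le> pull_fill p a T (r, j)" if "1 \<le> j" for r j
  using fil_dec[OF f that] by (simp add: pull_fill_def)
 show "r = s" if e: "0 < pull_fill p a T (r, j) \<and> pull_fill p a T (r, j) = pull_fill p a T (s, j)" for r s j
 proof -
  have rs: "0 < a r" "0 < a s" using e by (auto simp: pull_fill_def split: if_splits)
  then have "0 < T (p r, j)" "T (p r, j) = T (p s, j)" using e by (auto simp: pull_fill_def)
  then have "p r = p s" by (rule fil_dist[OF f])
  then show ?thesis by (rule reloc_inj[OF p rs])
 qed
qed

lemma qrule_pull:
 assumes p: "reloc p a c" and q: "qrule 1 c T"
 shows "qrule 1 a (pull_fill p a T)"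
 unfolding qrule_def
proof (intro allI impI)
 fix r s j assume h: "prior a r s \<and> 1 \<le> j \<and> 1 \<le> j \<and> j \<le> a s"
 then have rs: "0 < a r" "0 < a s" by (auto simp: prior_def)
 have e: "c (p r) = a r" "c (p s) = a s" using relocD(2)[OF p] rs by auto
 have "prior c (p r) (p s)" using h relocD(1)[OF p rs] unfolding prior_def e by auto
 then have "T (p r, j) < T (p s, j) \<or> T (p s, j) < T (p r, Suc j)" using q h e unfolding qrule_def by simp
 then show "pull_fill p a T (r, j) < pull_fill p a T (s, j) \<or> pull_fill p a T (s, j) < pull_fill p a T (r, Suc j)"
  using rs by (simp add: pull_fill_def)
qed

lemma colset_pull:
 assumes p: "reloc p a c" and f: "fil n c T"
 shows "colset (pull_fill p a T) = colset T"
proof (intro ext set_eqI)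
 fix j v
 show "v \<in> colset (pull_fill p a T) j \<longleftrightarrow> v \<in> colset T j"
 proof
  assume "v \<in> colset (pull_fill p a T) j"
  then show "v \<in> colset T j" unfolding colset_iff pull_fill_def by (auto split: if_splits)
 next
  assume "v \<in> colset T j"
  then obtain q where v: "0 < v" "T (q, j) = v" unfolding colset_iff by blast
  then have "0 < c q" using fil_pos[OF f, of q j] by simp
  then obtain r where "0 < a r" "p r = q" using relocD(3)[OF p] by blast
  then have "pull_fill p a T (r, j) = v" using v by (simp add: pull_fill_def)
  then show "v \<in> colset (pull_fill p a T) j" using v unfolding colset_iff by blast
 qed
qed

lemma cells_dg: "cells a = dg (cf a)"
 by (auto simp: cells_def dg_def cf_def split: if_splits)

text \<open>The two inequalities between rows in the definition of quasi-key tableaux are the two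
  cases of \<open>qrule\<close>: priority for the lower row, or for a strictly longer higher
  row.\<close>

lemma qkt_iff:
 "T \<in> qkt a \<longleftrightarrow> fil (length a) (cf a) T \<and> (\<forall>r. 0 < cf a r \<longrightarrow> T (r, 1) \<le> r) \<and>
  (\<forall>r s. 0 < cf a r \<and> 0 < cf a s \<and> r < s \<longrightarrow> T (r, 1) < T (s, 1)) \<and> qrule 1 (cf a) T"
  (is "_ \<longleftrightarrow> ?F \<and> ?B \<and> ?I \<and> ?Q")
proof -
 let ?c = "cf a"
 have cell: "(r, j) \<in> cells a \<longleftrightarrow> 1 \<le> j \<and> j \<le> ?c r" for r j unfolding cells_dg dg_def by simp
 have rng: "?c r = a ! (r - 1)" if "0 < ?c r" for r using cf_range[OF that] by (simp add: cf_def)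
 show ?thesis
 proof
  assume T: "T \<in> qkt a"
  have zero: "T p = 0" if "p \<notin> cells a" for p using T that by (simp add: qkt_def del: split_paired_All)
  have pos: "1 \<le> T p" if "p \<in> cells a" for p using T that by (simp add: qkt_def del: split_paired_All)
  have "\<forall>i j. (i, j) \<in> cells a \<and> (i, j + 1) \<in> cells a \<longrightarrow> T (i, j + 1) \<le> T (i, j)"
   using T unfolding qkt_def mem_Collect_eq by (elim conjE)
  then have dec: "T (i, j + 1) \<le> T (i, j)" if "(i, j) \<in> cells a" "(i, j + 1) \<in> cells a" for i j using that by blast
  have "\<forall>i j. (i, j) \<in> cells a \<longrightarrow> T (i, j) \<le> i" using T unfolding qkt_def mem_Collect_eq by (elim conjE)
  then have le: "T (i, j) \<le> i" if "(i, j) \<in> cells a" for i j using that by blast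
  have "\<forall>i k j. (i, j) \<in> cells a \<and> (k, j) \<in> cells a \<and> i \<noteq> k \<longrightarrow> T (i, j) \<noteq> T (k, j)"
   using T unfolding qkt_def mem_Collect_eq by (elim conjE)
  then have ne: "T (i, j) \<noteq> T (k, j)" if "(i, j) \<in> cells a" "(k, j) \<in> cells a" "i \<noteq> k" for i k j using that by blast
  have "\<forall>i k. (i, 1) \<in> cells a \<and> (k, 1) \<in> cells a \<and> i < k \<longrightarrow> T (i, 1) < T (k, 1)"
   using T unfolding qkt_def mem_Collect_eq by (elim conjE)
  then have inc: "T (i, 1) < T (k, 1)" if "(i, 1) \<in> cells a" "(k, 1) \<in> cells a" "i < k" for i k using that by blast
  have "\<forall>r s j. r < s \<and> (r, j) \<in> cells a \<and> (s, j) \<in> cells a \<and> T (s, j) < T (r, j) \<longrightarrow>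
    (r, j + 1) \<in> cells a \<and> T (s, j) < T (r, j + 1)"
   using T unfolding qkt_def mem_Collect_eq by (elim conjE)
  then have q1: "T (s, j) < T (r, j + 1)" if "r < s" "(r, j) \<in> cells a" "(s, j) \<in> cells a" "T (s, j) < T (r, j)" for r s j
   using that by blast
  have "\<forall>r s j. r < s \<and> a ! (r - 1) < a ! (s - 1) \<and> (r, j) \<in> cells a \<and> (s, j + 1) \<in> cells a \<longrightarrow> T (r, j) < T (s, j + 1)"
   using T unfolding qkt_def mem_Collect_eq by (elim conjE)
  then have q2: "T (r, j) < T (s, j + 1)" if "r < s" "a ! (r - 1) < a ! (s - 1)" "(r, j) \<in> cells a" "(s, j + 1) \<in> cells a" for r s j
   using that by blast
  have p: "0 < T (r, j) \<longleftrightarrow> 1 \<le> j \<and> j \<le> ?c r" for r j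
   unfolding cell[symmetric] using pos[of "(r, j)"] zero[of "(r, j)"] by (cases "(r, j) \<in> cells a") auto
  have ?F unfolding fil_def
  proof (intro conjI allI impI)
   show "on {0<..length a} ?c" by (rule cf_on)
   show "0 < T (r, j) \<longleftrightarrow> 1 \<le> j \<and> j \<le> ?c r" for r j by (rule p)
   show "T (r, Suc j) \<le> T (r, j)" if j: "1 \<le> j" for r j
   proof (cases "Suc j \<le> ?c r")
    case True then show ?thesis using dec[of r j] j by (simp add: cell)
   next
    case False then show ?thesis using p[of r "Suc j"] by simp
   qed
   show "r = s" if e: "0 < T (r, j) \<and> T (r, j) = T (s, j)" for r s j
    using ne[of r j s] e p[of r j] p[of s j] by (auto simp: cell)
  qed
  moreover have ?B using le by (simp add: cell)
  moreover have ?I using inc by (simp add: cell)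
  moreover have ?Q unfolding qrule_def
  proof (intro allI impI)
   fix u v j assume h: "prior ?c u v \<and> 1 \<le> j \<and> 1 \<le> j \<and> j \<le> ?c v"
   then have uv: "0 < ?c u" "0 < ?c v" "j \<le> ?c u" "u \<noteq> v" by (auto simp: prior_def)
   show "T (u, j) < T (v, j) \<or> T (v, j) < T (u, Suc j)"
   proof (cases "u < v")
    case True
    then show ?thesis using q1[of u v j] ne[of u j v] h uv by (fastforce simp: cell)
   next
    case False
    then have "?c v < ?c u" "v < u" using h uv by (auto simp: prior_def)
    then show ?thesis using q2[of v u j] h rng[OF uv(1)] rng[OF uv(2)] by (simp add: cell)
   qed
  qed
  ultimately show "?F \<and> ?B \<and> ?I \<and> ?Q" by blast
 next
  assume A: "?F \<and> ?B \<and> ?I \<and> ?Q"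
  then have f: ?F and B: "\<And>r. 0 < ?c r \<Longrightarrow> T (r, 1) \<le> r" and I: "\<And>r s. 0 < ?c r \<Longrightarrow> 0 < ?c s \<Longrightarrow> r < s \<Longrightarrow> T (r, 1) < T (s, 1)"
   and Q: ?Q by simp_all
  have q: "T (u, j) < T (v, j) \<or> T (v, j) < T (u, Suc j)" if "prior ?c u v" "1 \<le> j" "j \<le> ?c v" for u v j
   using Q that unfolding qrule_def by blast
  \<comment> \<open>The first column increases, so the first alternative of \<open>qrule\<close>
    fails there; the weak decrease of the lower row makes it fail in every later column as
    well.\<close>
  have lw: "T (r, j) < T (s, Suc j)" if rs: "r < s" "?c r < ?c s" "1 \<le> j" "j \<le> ?c r" for r s j
   using rs(3,4)
  proof (induction j rule: dec_induct)
   case base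
   then show ?case using q[of s r 1] I[of r s] rs by (auto simp: prior_def)
  next
   case (step j)
   then have "T (r, Suc j) < T (s, Suc j)" using fil_dec[OF f, of j r] by fastforce
   then show ?case using q[of s r "Suc j"] step rs by (auto simp: prior_def)
  qed
  show "T \<in> qkt a" unfolding qkt_def mem_Collect_eq
  proof (intro conjI allI impI ballI)
   show "T p = 0" if "p \<notin> cells a" for p using that fil_pos[OF f] by (cases p) (auto simp: cell)
   show "1 \<le> T p" if "p \<in> cells a" for p using that fil_pos[OF f] by (cases p) (auto simp: cell Suc_le_eq)
   show "T (i, j + 1) \<le> T (i, j)" if "(i, j) \<in> cells a \<and> (i, j + 1) \<in> cells a" for i j
    using fil_dec[OF f, of j i] that by (simp add: cell)
   show "T (i, j) \<le> i" if "(i, j) \<in> cells a" for i j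
    using fil_anti[OF f, of 1 j i] B[of i] that by (simp add: cell)
   show "T (i, j) \<noteq> T (k, j)" if "(i, j) \<in> cells a \<and> (k, j) \<in> cells a \<and> i \<noteq> k" for i k j
    using fil_dist[OF f, of i j k] fil_pos[OF f, of i j] that by (auto simp: cell)
   show "T (i, 1) < T (k, 1)" if "(i, 1) \<in> cells a \<and> (k, 1) \<in> cells a \<and> i < k" for i k
    using I[of i k] that by (simp add: cell)
  next
   fix r s j assume h: "r < s \<and> (r, j) \<in> cells a \<and> (s, j) \<in> cells a \<and> T (s, j) < T (r, j)"
   then have c: "1 \<le> j" "j \<le> ?c r" "j \<le> ?c s" by (auto simp: cell)
   have "\<not> ?c r < ?c s"
   proof
    assume "?c r < ?c s"
    then have "T (r, j) < T (s, Suc j)" using lw[of r s j] h c by simp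
    then show False using fil_dec[OF f c(1), of s] h by simp
   qed
   then have "prior ?c r s" using h by (auto simp: prior_def)
   then have "T (s, j) < T (r, Suc j)" using q[of r s j] h c by auto
   moreover from this have "0 < T (r, Suc j)" by simp
   then have "Suc j \<le> ?c r" using fil_pos[OF f, of r "Suc j"] by simp
   ultimately show "(r, j + 1) \<in> cells a" "T (s, j) < T (r, j + 1)" by (auto simp: cell)
  next
   fix r s j assume h: "r < s \<and> a ! (r - 1) < a ! (s - 1) \<and> (r, j) \<in> cells a \<and> (s, j + 1) \<in> cells a"
   then have c: "1 \<le> j" "j \<le> ?c r" "Suc j \<le> ?c s" by (auto simp: cell)
   then have "?c r < ?c s" using h rng[of r] rng[of s] by simp
   then show "T (r, j) < T (s, j + 1)" using lw[of r s j] h c by simp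
  qed
 qed
qed

lemma finite_down: assumes a: "on {0<..n} a" shows "finite (down n a)"
proof (rule finite_subset[OF _ finite_on_sz[of 0 n "sz n a"]])
 show "down n a \<subseteq> {c. on {0<..n} c \<and> sz n c \<le> sz n a}"
 proof
  fix c assume "c \<in> down n a"
  then obtain f where "on {0<..n} c" "reloc f a c" by (auto simp: down_def)
  then show "c \<in> {c. on {0<..n} c \<and> sz n c \<le> sz n a}" using sz_reloc[OF _ a] by fastforce
 qed
qed

lemma qpoly_eq_sum_atoms: "qpoly a = (\<Sum>c\<in>down (length a) (cf a). atom 0 c)"
proof -
 let ?n = "length a" and ?a = "cf a"
 have oa: "on {0<..?n} ?a" by (rule cf_on)
 define \<phi> where "\<phi> = (\<lambda>c. SOME p. reloc p ?a c)"
 have \<phi>: "reloc (\<phi> c) ?a c \<and> (\<forall>r. 0 < ?a r \<longrightarrow> \<phi> c r \<le> r) \<and> on {0<..?n} c" if c: "c \<in> down ?n ?a" for c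
 proof -
  obtain f where f: "reloc f ?a c" "\<And>r. 0 < ?a r \<Longrightarrow> f r \<le> r" using c by (auto simp: down_def)
  have "reloc (\<phi> c) ?a c" unfolding \<phi>_def by (rule someI[of "\<lambda>p. reloc p ?a c", OF f(1)])
  moreover have "\<phi> c r \<le> r" if "0 < ?a r" for r using reloc_unique[OF calculation f(1) that] f(2)[OF that] by simp
  ultimately show ?thesis using c by (auto simp: down_def)
 qed
 let ?h = "\<lambda>x. pull_fill (\<phi> (fst x)) ?a (snd x)"
 let ?X = "Sigma (down ?n ?a) (qa ?n)"
 have one: "?h (c, T) (r, 1) = \<phi> c r" if c: "c \<in> down ?n ?a" and T: "T \<in> qa ?n c" and r: "0 < ?a r" for c T r
 proof -
  have "0 < c (\<phi> c r)" using relocD(2)[of "\<phi> c" ?a c r] \<phi>[OF c] r by simp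
  then have "T (\<phi> c r, 1) = \<phi> c r" using T by (simp add: qa_def)
  then show ?thesis using r by (simp add: pull_fill_def)
 qed
 have bij: "bij_betw ?h ?X (qkt a)"
 proof (rule bij_betw_imageI)
  show "inj_on ?h ?X"
  proof (rule inj_onI)
   fix x y assume x: "x \<in> ?X" and y: "y \<in> ?X" and e: "?h x = ?h y"
   obtain c T d U where xy: "x = (c, T)" "y = (d, U)" by (cases x, cases y)
   have c: "c \<in> down ?n ?a" "T \<in> qa ?n c" and d: "d \<in> down ?n ?a" "U \<in> qa ?n d" using x y xy by auto
   have same: "\<phi> c r = \<phi> d r" if "0 < ?a r" for r using one[OF c that] one[OF d that] e xy by simp
   have cd: "c = d" using reloc_fun_eq[of "\<phi> c" ?a c "\<phi> d" d] \<phi>[OF c(1)] \<phi>[OF d(1)] same by blast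
   have "T (q, j) = U (q, j)" for q j
   proof (cases "0 < c q")
    case True
    then obtain r where r: "0 < ?a r" "\<phi> c r = q" using relocD(3)[of "\<phi> c" ?a c q] \<phi>[OF c(1)] by blast
    have "?h x (r, j) = ?h y (r, j)" using e by simp
    then show ?thesis using r xy cd by (simp add: pull_fill_def)
   next
    case False
    then show ?thesis using c(2) d(2) cd fil_pos[of ?n c T q j] fil_pos[of ?n c U q j] by (auto simp: qa_def)
   qed
   then have "T = U" by (intro ext) (metis surj_pair)
   then show "x = y" using xy cd by simp
  qed
  show "?h ` ?X = qkt a"
  proof
   show "?h ` ?X \<subseteq> qkt a"
   proof
    fix V assume "V \<in> ?h ` ?X"
    then obtain c T where V: "V = ?h (c, T)" and c: "c \<in> down ?n ?a" and T: "T \<in> qa ?n c" by auto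
    have p: "reloc (\<phi> c) ?a c" using \<phi>[OF c] by blast
    show "V \<in> qkt a" unfolding qkt_iff
    proof (intro conjI allI impI)
     show "fil ?n ?a V" unfolding V fst_conv snd_conv by (rule fil_pull[OF p _ oa]) (use T in \<open>simp add: qa_def\<close>)
     show "qrule 1 ?a V" unfolding V fst_conv snd_conv by (rule qrule_pull[OF p]) (use T in \<open>simp add: qa_def\<close>)
     show "V (r, 1) \<le> r" if "0 < ?a r" for r unfolding V one[OF c T that] using \<phi>[OF c] that by blast
     show "V (r, 1) < V (s, 1)" if "0 < ?a r \<and> 0 < ?a s \<and> r < s" for r s
      using relocD(1)[OF p, of r s] one[OF c T, of r] one[OF c T, of s] that unfolding V by simp
    qed
   qed
   show "qkt a \<subseteq> ?h ` ?X"
   proof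
    fix V assume "V \<in> qkt a"
    then have f: "fil ?n ?a V" and B: "\<And>r. 0 < ?a r \<Longrightarrow> V (r, 1) \<le> r"
     and I: "\<And>r s. 0 < ?a r \<Longrightarrow> 0 < ?a s \<Longrightarrow> r < s \<Longrightarrow> V (r, 1) < V (s, 1)" and Q: "qrule 1 ?a V"
     unfolding qkt_iff by blast+
    \<comment> \<open>Each row goes to the row named by its first entry; the bound on entries says
      that rows only move down.\<close>
    define p where "p = (\<lambda>r. V (r, 1))"
    define c where "c = push p ?a ?a"
    have p: "reloc p ?a c" unfolding c_def by (rule push_reloc) (unfold p_def, rule I)
    have oc: "on {0<..?n} c" unfolding on_def
    proof (intro allI impI)
     fix q assume q: "q \<notin> {0<..?n}"
     have "q \<in> {0<..?n}" if r: "0 < ?a r" "p r = q" for r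
     proof -
      have "0 < V (r, 1)" using fil_pos[OF f, of r 1] r by simp
      then show ?thesis using B[OF r(1)] r cf_range[OF r(1)] by (auto simp: p_def)
     qed
     then show "c q = 0" using q unfolding c_def by (intro push_off) blast
    qed
    have c: "c \<in> down ?n ?a" unfolding down_def using oc p B by (auto simp: p_def)
    obtain g where g: "reloc g c ?a" "\<And>r. 0 < ?a r \<Longrightarrow> g (p r) = r" "\<And>q. 0 < c q \<Longrightarrow> 0 < ?a (g q) \<and> p (g q) = q"
     using reloc_inverse[OF p] by blast
    define T where "T = pull_fill g c V"
    have T: "T \<in> qa ?n c" unfolding qa_def mem_Collect_eq
    proof (intro conjI allI impI)
     show "fil ?n c T" unfolding T_def by (rule fil_pull[OF g(1) f oc])
     show "qrule 1 c T" unfolding T_def by (rule qrule_pull[OF g(1) Q])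
     show "T (q, 1) = q" if "0 < c q" for q using g(3)[OF that] that by (simp add: T_def pull_fill_def p_def)
    qed
    have "?h (c, T) = V"
    proof
     fix x :: "nat \<times> nat"
     obtain r j where x: "x = (r, j)" by (cases x)
     show "?h (c, T) x = V x"
     proof (cases "0 < ?a r")
      case True
      have "\<phi> c r = p r" using reloc_unique[of "\<phi> c" ?a c p r] \<phi>[OF c] p True by blast
      moreover have "0 < c (p r)" using relocD(2)[OF p True] True by simp
      ultimately show ?thesis using True x g(2)[OF True] by (simp add: pull_fill_def T_def)
     next
      case False
      then show ?thesis using fil_pos[OF f, of r j] x by (auto simp: pull_fill_def)
     qed
    qed
    then show "V \<in> ?h ` ?X" using c T by (intro image_eqI[of _ _ "(c, T)"]) auto
   qed
  qed
 qed
 have w: "wt (cells a) (?h x) = wt (dg (fst x)) (snd x)" if x: "x \<in> ?X" for x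
 proof -
  obtain c T where xc: "x = (c, T)" by (cases x)
  have c: "c \<in> down ?n ?a" "T \<in> qa ?n c" using x xc by auto
  have f: "fil ?n c T" using c by (simp add: qa_def)
  have p: "reloc (\<phi> c) ?a c" using \<phi>[OF c(1)] by blast
  have "wt (dg ?a) (?h x) = wt (dg c) T"
   unfolding xc fst_conv snd_conv wt_colset[OF fil_pull[OF p f oa]] wt_colset[OF f] colset_pull[OF p f] ..
  then show ?thesis by (simp add: cells_dg xc)
 qed
 have "qpoly a = (\<Sum>x\<in>?X. Poly_Mapping.single (wt (cells a) (?h x)) 1)"
  unfolding qpoly_def by (rule sum.reindex_bij_betw[OF bij, symmetric])
 also have "\<dots> = (\<Sum>x\<in>?X. Poly_Mapping.single (wt (dg (fst x)) (snd x)) 1)"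
  by (rule sum.cong) (simp_all add: w)
 also have "\<dots> = (\<Sum>c\<in>down ?n ?a. \<Sum>T\<in>qa ?n c. Poly_Mapping.single (wt (dg c) T) 1)"
  using finite_down[OF oa] finite_qa \<phi> by (subst sum.Sigma) (auto simp: case_prod_beta)
 also have "\<dots> = (\<Sum>c\<in>down ?n ?a. atom 0 c)"
 proof (rule sum.cong)
  fix c assume "c \<in> down ?n ?a"
  then have "on {0<..?n} c" using \<phi> by blast
  then show "(\<Sum>T\<in>qa ?n c. Poly_Mapping.single (wt (dg c) T) 1) = atom 0 c" by (rule atom_eq_qa[symmetric])
 qed simp
 finally show ?thesis .
qed

section \<open>Highest-weight tableaux and the product rule\<close>

definition posl :: "nat list \<Rightarrow> nat list" where
 "posl a = filter (\<lambda>r. 0 < cf a r) [1..<Suc (length a)]"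

lemma set_posl: "set (posl a) = {r. 0 < cf a r}"
proof (rule set_eqI)
 fix r show "r \<in> set (posl a) \<longleftrightarrow> r \<in> {r. 0 < cf a r}"
  using cf_range[of a r] by (auto simp: posl_def simp del: upt_Suc)
qed

lemma sorted_posl: "sorted_wrt (<) (posl a)"
 unfolding posl_def by (rule sorted_wrt_filter[OF sorted_wrt_upt])

lemma flat_posl: "flat a = map (cf a) (posl a)"
proof -
 have "a = map (cf a) [1..<Suc (length a)]"
  by (rule nth_equalityI) (simp_all add: cf_def nth_upt del: upt_Suc)
 then have "flat a = filter (\<lambda>x. x \<noteq> 0) (map (cf a) [1..<Suc (length a)])" unfolding flat_def by (rule arg_cong)
 then show ?thesis unfolding posl_def by (simp add: filter_map comp_def del: upt_Suc)
qed

lemma flat_eq_iff: "flat c = flat a \<longleftrightarrow> (\<exists>f. reloc f (cf a) (cf c))"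
proof
 assume e: "flat c = flat a"
 let ?P = "posl a" and ?Q = "posl c"
 let ?k = "length ?P"
 have m: "map (cf c) ?Q = map (cf a) ?P" using e by (simp add: flat_posl)
 then have k: "length ?Q = ?k" by (metis length_map)
 have v: "cf c (?Q ! i) = cf a (?P ! i)" if "i < ?k" for i using m k that by (metis nth_map)
 have mono: "?P ! i < ?P ! j" "?Q ! i < ?Q ! j" if "i < j" "j < ?k" for i j
  using sorted_wrt_nth_less[OF sorted_posl] that k by auto
 define f where "f = (\<lambda>r. ?Q ! (SOME i. i < ?k \<and> ?P ! i = r))"
 have f: "f (?P ! i) = ?Q ! i" if i: "i < ?k" for i
 proof -
  let ?s = "SOME i'. i' < ?k \<and> ?P ! i' = ?P ! i"
  have s: "?s < ?k \<and> ?P ! ?s = ?P ! i" by (rule someI[where x = i]) (use i in simp)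
  then have "?s = i" using mono(1)[of ?s i] mono(1)[of i ?s] i by (metis less_irrefl linorder_neqE_nat)
  then show ?thesis by (simp add: f_def)
 qed
 have idx: "\<exists>i<?k. ?P ! i = r" if "0 < cf a r" for r using that set_posl[of a] by (metis in_set_conv_nth mem_Collect_eq)
 have "reloc f (cf a) (cf c)"
 proof (rule relocI)
  fix r s assume rs: "0 < cf a r" "0 < cf a s" "r < s"
  obtain i j where ij: "i < ?k" "?P ! i = r" "j < ?k" "?P ! j = s" using idx[OF rs(1)] idx[OF rs(2)] by blast
  have "i < j" using mono(1)[of j i] ij rs(3) by (metis less_asym linorder_neqE_nat less_irrefl)
  then show "f r < f s" using mono(2)[of i j] f ij by metis
 next
  fix r assume "0 < cf a r"
  then obtain i where "i < ?k" "?P ! i = r" using idx by blast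
  then show "cf c (f r) = cf a r" using f v by metis
 next
  fix q assume "0 < cf c q"
  then obtain i where i: "i < ?k" "?Q ! i = q" using set_posl[of c] k by (metis in_set_conv_nth mem_Collect_eq)
  have "0 < cf a (?P ! i)" using set_posl[of a] i(1) nth_mem by blast
  then show "\<exists>r. 0 < cf a r \<and> f r = q" using f[OF i(1)] i(2) by blast
 qed
 then show "\<exists>f. reloc f (cf a) (cf c)" by blast
next
 assume "\<exists>f. reloc f (cf a) (cf c)"
 then obtain f where f: "reloc f (cf a) (cf c)" by blast
 have "sorted_wrt (\<lambda>x y. f x < f y) (posl a)"
  by (rule sorted_wrt_mono_rel[OF _ sorted_posl]) (use relocD(1)[OF f] set_posl[of a] in blast)
 then have s: "sorted_wrt (<) (map f (posl a))" by (simp add: sorted_wrt_map)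
 have "set (map f (posl a)) = set (posl c)"
 proof -
  have "f ` {r. 0 < cf a r} = {r. 0 < cf c r}"
  proof
   show "f ` {r. 0 < cf a r} \<subseteq> {r. 0 < cf c r}" using relocD(2)[OF f] by auto
   show "{r. 0 < cf c r} \<subseteq> f ` {r. 0 < cf a r}" using relocD(3)[OF f] by blast
  qed
  then show ?thesis by (simp add: set_posl)
 qed
 then have "posl c = map f (posl a)" using strict_sorted_equal[OF s sorted_posl] by metis
 then show "flat c = flat a" unfolding flat_posl using relocD(2)[OF f] set_posl[of a] by simp
qed

lemma sum_take_cf: "sum_list (take i a) = (\<Sum>q\<in>{1..i}. cf a q)"
proof (induction i)
 case (Suc i)
 then show ?case by (cases "i < length a") (simp_all add: take_Suc_conv_app_nth cf_def)
qed simp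

lemma down_cf:
 assumes len: "length c = length a"
 shows "dominates c a \<and> flat c = flat a \<longleftrightarrow> cf c \<in> down (length a) (cf a)"
proof -
 have o: "on {0<..length a} (cf a)" "on {0<..length a} (cf c)" using cf_on[of a] cf_on[of c] len by auto
 have d: "dominates c a \<longleftrightarrow> (\<forall>r. 0 < cf a r \<longrightarrow> f r \<le> r)" if "reloc f (cf a) (cf c)" for f
  unfolding dominates_def sum_take_cf by (rule dominance_reloc[OF that o])
 show ?thesis unfolding flat_eq_iff down_def mem_Collect_eq using d o(2) by blast
qed

lemma cf_swap:
 assumes "1 \<le> i" "Suc i \<le> length b"
 shows "cf (b[i - 1 := b ! i, i := b ! (i - 1)]) = swp i (cf b)"
proof
 fix r
 show "cf (b[i - 1 := b ! i, i := b ! (i - 1)]) r = swp i (cf b) r"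
  using assms by (cases i) (auto simp: cf_def swp_def nth_list_update)
qed

lemma reloc_swp_back:
 assumes z: "b (Suc i) = 0"
 shows "reloc (id(Suc i := i)) (swp i b) b"
proof (rule relocI)
 have pos: "r \<noteq> i" if "0 < swp i b r" for r using that z by (auto simp: swp_def)
 show "(id(Suc i := i)) r < (id(Suc i := i)) s" if "0 < swp i b r" "0 < swp i b s" "r < s" for r s
  using pos[OF that(1)] pos[OF that(2)] that(3) by (auto simp: less_Suc_eq)
 show "b ((id(Suc i := i)) r) = swp i b r" if "0 < swp i b r" for r using pos[OF that] by (auto simp: swp_def)
 show "\<exists>r. 0 < swp i b r \<and> (id(Suc i := i)) r = q" if "0 < b q" for q
 proof (cases "q = i")
  case True then show ?thesis using that by (intro exI[of _ "Suc i"]) (simp add: swp_def)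
 next
  case False
  then have "q \<noteq> Suc i" using that z by auto
  then show ?thesis using False that by (intro exI[of _ q]) (simp add: swp_def)
 qed
qed

text \<open>The swapped filling is again a Littlewood-Richardson filling by \<open>lrf_pull\<close>,
  so membership is decided by the inner shape alone.\<close>

lemma swap_rows_LRS:
 assumes len: "length b = length a" "length c = length a" and lam: "is_partition lam"
  and L: "lrf (length lam) (\<lambda>i. lam ! i) (cf b) (cf c) L"
  and i: "1 \<le> i" "Suc i \<le> length a" "cf b (Suc i) = 0"
 shows "swap_rows i (b, c, L) \<in> (\<Union>d. LRS a d) \<longleftrightarrow> swp i (cf c) \<in> down (length a) (cf a)"
proof -
 define b2 where "b2 = b[i - 1 := b ! i, i := b ! (i - 1)]"
 define c2 where "c2 = c[i - 1 := c ! i, i := c ! (i - 1)]"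
 define L2 where "L2 = (\<lambda>(k, j). if k = i + 1 then L (i, j) else if k = i then 0 else L (k, j))"
 have sw: "swap_rows i (b, c, L) = (b2, c2, L2)" unfolding swap_rows_def prod.case b2_def c2_def L2_def ..
 have cb: "cf b2 = swp i (cf b)" and cc: "cf c2 = swp i (cf c)" unfolding b2_def c2_def
  by (rule cf_swap[OF i(1)], use i len in simp)+
 have len2: "length b2 = length a" "length c2 = length a" using len by (simp_all add: b2_def c2_def)
 have S: "slrs (cf b) (cf c) L" using L by (simp add: lrf_def)
 have le: "cf c r \<le> cf b r" for r by (rule slrsD(1)[OF S])
 have pc: "pull (id(Suc i := i)) (swp i (cf b)) (cf c) = swp i (cf c)"
 proof
  fix r
  show "pull (id(Suc i := i)) (swp i (cf b)) (cf c) r = swp i (cf c) r"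
   using le[of r] le[of i] le[of "Suc i"] i(3) by (auto simp: pull_def swp_def)
 qed
 have pL: "pull_fill (id(Suc i := i)) (swp i (cf b)) L = L2"
 proof
  fix x :: "nat \<times> nat"
  obtain r j where x: "x = (r, j)" by (cases x)
  show "pull_fill (id(Suc i := i)) (swp i (cf b)) L x = L2 x"
   using slrs_zero[OF S, of r j] slrs_zero[OF S, of i j] i(3) unfolding x pull_fill_def L2_def swp_def by auto
 qed
 have "lrf (length lam) (\<lambda>i. lam ! i) (cf b2) (cf c2) L2"
  using lrf_pull[OF reloc_swp_back[of "cf b" i, OF i(3)] L] unfolding pc pL cb cc .
 then have "is_lrs b2 c2 L2" using is_lrs_iff[of c2 b2 lam L2] len2 lam by simp
 then show ?thesis unfolding sw LRS_def using down_cf[OF len2(2)] len2 cc by auto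
qed

definition of_fun :: "nat \<Rightarrow> (nat \<Rightarrow> nat) \<Rightarrow> nat list" where
 "of_fun n c = map c [1..<Suc n]"

lemma length_of_fun: "length (of_fun n c) = n"
 unfolding of_fun_def length_map length_upt by simp

lemma cf_of_fun: assumes c: "on {0<..n} c" shows "cf (of_fun n c) = c"
proof
 fix r
 have "c r = 0" if "\<not> (1 \<le> r \<and> r \<le> n)"
 proof -
  have "r \<notin> {0<..n}" using that by auto
  then show ?thesis using c unfolding on_def by blast
 qed
 then show "cf (of_fun n c) r = c r" unfolding cf_def length_of_fun
  by (auto simp: of_fun_def nth_upt simp del: upt_Suc)
qed

lemma of_fun_cf: "length b = n \<Longrightarrow> of_fun n (cf b) = b"
 by (rule nth_equalityI) (simp_all add: of_fun_def nth_upt cf_def del: upt_Suc)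

lemma lrcoeff_eq:
 assumes len: "length b = length a" and lam: "is_partition lam"
 shows "lrcoeff a lam b = (\<Sum>c | c \<in> down (length a) (cf a) \<and> (\<forall>r. c r \<le> cf b r) \<and> high (length a) (cf a) (cf b) c.
   card {L. lrf (length lam) (\<lambda>i. lam ! i) (cf b) c L})" (is "_ = (\<Sum>c\<in>?C. card (?F c))")
proof -
 let ?n = "length a"
 let ?H = "{x \<in> HLRS a b. content x = lamstar lam}"
 let ?g = "\<lambda>y. (b, of_fun ?n (fst y), snd y)"
 have mem: "(b', c, L) \<in> ?H \<longleftrightarrow> b' = b \<and> length c = ?n \<and> cf c \<in> ?C \<and> L \<in> ?F (cf c)" for b' c L
 proof (cases "b' = b \<and> length c = ?n \<and> lrf (length lam) (\<lambda>i. lam ! i) (cf b) (cf c) L")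
  case False
  have "\<not> ((b', c, L) \<in> ?H)"
  proof
   assume "(b', c, L) \<in> ?H"
   then have "b' = b" "length c = ?n" "is_lrs b c L" "content (b', c, L) = lamstar lam" by (auto simp: HLRS_def LRS_def)
   then show False using False is_lrs_iff[of c b lam L] len lam by simp
  qed
  then show ?thesis using False by auto
 next
  case True
  then have lc: "length c = ?n" and L: "lrf (length lam) (\<lambda>i. lam ! i) (cf b) (cf c) L" and bb: "b' = b" by auto
  have I: "is_lrs b c L" "content (b, c, L) = lamstar lam" using is_lrs_iff[of c b lam L] L lc len lam by simp_all
  have le: "cf c r \<le> cf b r" for r using L slrsD(1) by (auto simp: lrf_def)
  define W where "W = (\<lambda>i. swap_rows i (b, c, L) \<in> (\<Union>d. LRS a d))"
  have hw: "(\<forall>i. 1 \<le> i \<and> i + 1 \<le> ?n \<and> 0 < b ! (i - 1) \<and> b ! i = 0 \<longrightarrow> \<not> W i) \<longleftrightarrow>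
    high ?n (cf a) (cf b) (cf c)" (is "?l = _")
  proof -
   have e: "0 < b ! (i - 1) \<and> b ! i = 0 \<longleftrightarrow> 0 < cf b i \<and> cf b (Suc i) = 0" if "1 \<le> i" "Suc i \<le> ?n" for i
    using that len by (simp add: cf_def)
   have s: "W i \<longleftrightarrow> swp i (cf c) \<in> down ?n (cf a)"
    if "1 \<le> i" "Suc i \<le> ?n" "cf b (Suc i) = 0" for i
    unfolding W_def by (rule swap_rows_LRS[OF len lc lam L that])
   show ?thesis
   proof
    assume l: ?l
    show "high ?n (cf a) (cf b) (cf c)" unfolding high_def
    proof (intro allI impI)
     fix i assume i: "1 \<le> i \<and> Suc i \<le> ?n \<and> 0 < cf b i \<and> cf b (Suc i) = 0"
     then have "\<not> W i" using l[rule_format, of i] e[of i] by simp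
     then show "swp i (cf c) \<notin> down ?n (cf a)" using s[of i] i by simp
    qed
   next
    assume h: "high ?n (cf a) (cf b) (cf c)"
    show ?l
    proof (intro allI impI)
     fix i assume i: "1 \<le> i \<and> i + 1 \<le> ?n \<and> 0 < b ! (i - 1) \<and> b ! i = 0"
     then have j: "1 \<le> i" "Suc i \<le> ?n" "0 < cf b i" "cf b (Suc i) = 0" using e[of i] by auto
     then have "swp i (cf c) \<notin> down ?n (cf a)" using h unfolding high_def by blast
     then show "\<not> W i" using s[OF j(1,2,4)] by blast
    qed
   qed
  qed
  have "(b, c, L) \<in> LRS a b \<longleftrightarrow> dominates c a \<and> flat c = flat a" using I lc by (simp add: LRS_def)
  then have "(b', c, L) \<in> ?H \<longleftrightarrow> (dominates c a \<and> flat c = flat a) \<and> high ?n (cf a) (cf b) (cf c)"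
   using I(2) unfolding HLRS_def bb mem_Collect_eq fst_conv hw[unfolded W_def] by blast
  then show ?thesis using down_cf[OF lc] bb lc L le by blast
 qed
 have on: "on {0<..?n} c" if "c \<in> ?C" for c using that by (simp add: down_def)
 have "?H = ?g ` Sigma ?C ?F"
 proof (rule set_eqI)
  fix x :: lrs
  obtain b' c L where x: "x = (b', c, L)" by (cases x)
  show "x \<in> ?H \<longleftrightarrow> x \<in> ?g ` Sigma ?C ?F"
  proof
   assume "x \<in> ?H"
   then have h: "b' = b" "length c = ?n" "cf c \<in> ?C" "L \<in> ?F (cf c)" using mem[of b' c L] x by auto
   then have "x = ?g (cf c, L)" using x by (simp add: of_fun_cf)
   moreover have "(cf c, L) \<in> Sigma ?C ?F" using h by blast
   ultimately show "x \<in> ?g ` Sigma ?C ?F" by (rule image_eqI)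
  next
   assume "x \<in> ?g ` Sigma ?C ?F"
   then obtain d M where d: "x = (b, of_fun ?n d, M)" "d \<in> ?C" "M \<in> ?F d" by auto
   then show "x \<in> ?H" using mem[of b "of_fun ?n d" M] cf_of_fun[OF on[OF d(2)]] by (simp add: length_of_fun)
  qed
 qed
 moreover have "inj_on ?g (Sigma ?C ?F)"
 proof (rule inj_onI)
  fix x y assume a: "x \<in> Sigma ?C ?F" "y \<in> Sigma ?C ?F" "?g x = ?g y"
  obtain d M e N where xy: "x = (d, M)" "y = (e, N)" by (cases x, cases y)
  have "d \<in> ?C" "e \<in> ?C" using a xy by auto
  then have "cf (of_fun ?n d) = d" "cf (of_fun ?n e) = e" using cf_of_fun[OF on] by blast+
  moreover have "of_fun ?n d = of_fun ?n e" "M = N" using a(3) unfolding xy by simp_all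
  ultimately show "x = y" unfolding xy by (metis (no_types))
 qed
 ultimately have "lrcoeff a lam b = card (Sigma ?C ?F)" unfolding lrcoeff_def by (simp only: card_image)
 also have "\<dots> = (\<Sum>c\<in>?C. card (?F c))"
 proof (rule card_SigmaI)
  show "finite ?C" by (rule finite_subset[OF _ finite_down[OF cf_on[of a]]]) blast
  show "\<forall>c\<in>?C. finite (?F c)" using finite_lrf[OF cf_on[of b]] by blast
 qed
 finally show ?thesis .
qed

lemma sz_cf: "length b = n \<Longrightarrow> sz n (cf b) = sum_list b"
 using sum_take_cf[of n b] by (simp add: sz_def)

text \<open>The range of \<open>b\<close> is fixed by degree: a tableau of shape b/c has
  \<open>sum_list b - sum_list c\<close> integer entries, \<open>sum_list c\<close> equals
  \<open>sum_list a\<close>, and its content has \<open>sum_list lam\<close> elements. For all other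
  \<open>b\<close> the coefficient is zero.\<close>

theorem theorem3p11:
  fixes a lam :: "nat list"
  assumes "is_partition lam"
  shows "qpoly a * schur (length a) lam =
    (\<Sum>b \<in> {b. length b = length a \<and> sum_list b = sum_list a + sum_list lam}.
        of_nat (lrcoeff a lam b) * qpoly b)"
proof -
 let ?n = "length a" and ?l = "length lam" and ?D = "down (length a) (cf a)"
 let ?S = "sum_list a + sum_list lam"
 define B where "B = {b. on {0<..?n} b \<and> sz ?n b = ?S}"
 define N where "N = (\<lambda>b c. card {L. lrf ?l (\<lambda>i. lam ! i) b c L})"
 define C where "C = (\<lambda>b. {c. c \<in> ?D \<and> (\<forall>r. c r \<le> b r) \<and> high ?n (cf a) b c})"
 define M where "M = (\<lambda>b. \<Sum>c\<in>C b. N b c)"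
 have finB: "finite B" by (rule finite_subset[OF _ finite_on_sz[of 0 ?n ?S]]) (auto simp: B_def)
 have finD: "finite ?D" by (rule finite_down[OF cf_on])
 have lam: "shp ?l (\<lambda>i. lam ! i) = lam" by (rule nth_equalityI) (simp_all add: shp_def)
 have slam: "(\<Sum>i<?l. lam ! i) = sum_list lam" by (simp add: sum_list_sum_nth atLeast0LessThan)
 have dec: "lam ! j \<le> lam ! i" if "i \<le> j" "j < ?l" for i j
  using assms that sorted_wrt_nth_less[of "(\<ge>)" lam i j] unfolding is_partition_def by (cases "i = j") auto
 have szd: "sz ?n b' = sz ?n b" if "on {0<..?n} b" "b' \<in> down ?n b" for b b'
  using that sz_reloc[of _ b b' ?n] by (auto simp: down_def)
 have one: "atom 0 c * schur ?n lam = (\<Sum>b\<in>B. of_nat (N b c) * atom 0 b)" if c: "c \<in> ?D" for c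
 proof -
  have oc: "on {0<..?n} c" using c by (simp add: down_def)
  have "sz ?n c = sum_list a" using szd[OF cf_on c] by (simp add: sz_cf)
  then have "atom 0 c * schur ?n lam = (\<Sum>b\<in>B. of_nat (card {D\<in>chs ?n c b ?l (\<lambda>i. int (lam ! i)). lattice ?n ?l D}) * atom 0 b)"
   using atom_times_schur[of ?n c ?l "\<lambda>i. lam ! i"] oc dec unfolding lam slam B_def by simp
  also have "\<dots> = (\<Sum>b\<in>B. of_nat (N b c) * atom 0 b)"
  proof (rule sum.cong)
   fix b assume "b \<in> B"
   then have "N b c = card {D\<in>chs ?n c b ?l (\<lambda>i. int (lam ! i)). lattice ?n ?l D}"
    unfolding N_def by (intro bij_betw_same_card[OF bij_lrf]) (simp add: B_def)
   then show "of_nat (card {D\<in>chs ?n c b ?l (\<lambda>i. int (lam ! i)). lattice ?n ?l D}) * atom 0 b = of_nat (N b c) * atom 0 b"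
    by simp
  qed simp
  finally show ?thesis .
 qed
 \<comment> \<open>The coefficient of the atom of \<open>b'\<close> counts fillings over all inner
   shapes. Regrouped by highest-weight representatives, it becomes a sum over the shapes
   \<open>b\<close> for which \<open>atom 0 b'\<close> occurs in the quasi-key polynomial.\<close>
 have row: "(\<Sum>c\<in>?D. N b' c) = (\<Sum>b | b \<in> B \<and> b' \<in> down ?n b. M b)" if b': "b' \<in> B" for b'
 proof -
  have ob: "on {0<..?n} b'" using b' by (simp add: B_def)
  let ?X = "{x. on {0<..?n} (fst x) \<and> b' \<in> down ?n (fst x) \<and> snd x \<in> ?D \<and> (\<forall>r. snd x r \<le> fst x r) \<and> high ?n (cf a) (fst x) (snd x)}"
  have "(\<Sum>c\<in>?D. N b' c) = (\<Sum>c | c \<in> ?D \<and> (\<forall>r. c r \<le> b' r). N b' c)"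
  proof (rule sum.mono_neutral_right[OF finD])
   show "\<forall>c\<in>?D - {c. c \<in> ?D \<and> (\<forall>r. c r \<le> b' r)}. N b' c = 0"
   proof
    fix c assume "c \<in> ?D - {c. c \<in> ?D \<and> (\<forall>r. c r \<le> b' r)}"
    then have "{L. lrf ?l (\<lambda>i. lam ! i) b' c L} = {}" using slrsD(1) unfolding lrf_def by blast
    then show "N b' c = 0" unfolding N_def by (metis card.empty)
   qed
  qed blast
  also have "\<dots> = (\<Sum>x\<in>?X. N (fst x) (snd x))"
   by (rule sum_high[OF ob]) (unfold N_def, rule card_lrf_pull)
  also have "?X = Sigma {b. b \<in> B \<and> b' \<in> down ?n b} C"
  proof (rule set_eqI)
   fix x :: "(nat \<Rightarrow> nat) \<times> (nat \<Rightarrow> nat)"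
   obtain b c where x: "x = (b, c)" by (cases x)
   have "sz ?n b = ?S" if "on {0<..?n} b" "b' \<in> down ?n b" using szd[OF that] b' by (simp add: B_def)
   then show "x \<in> ?X \<longleftrightarrow> x \<in> Sigma {b. b \<in> B \<and> b' \<in> down ?n b} C" unfolding x by (auto simp: B_def C_def)
  qed
  also have "(\<Sum>x\<in>Sigma {b. b \<in> B \<and> b' \<in> down ?n b} C. N (fst x) (snd x)) = (\<Sum>b | b \<in> B \<and> b' \<in> down ?n b. M b)"
  proof -
   have "finite (C b)" for b by (rule finite_subset[OF _ finD]) (auto simp: C_def)
   then show ?thesis unfolding M_def using finB by (subst sum.Sigma) (auto simp: case_prod_beta)
  qed
  finally show ?thesis .
 qed
 have "qpoly a * schur ?n lam = (\<Sum>c\<in>?D. \<Sum>b'\<in>B. of_nat (N b' c) * atom 0 b')"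
  unfolding qpoly_eq_sum_atoms sum_distrib_right by (rule sum.cong) (simp_all add: one)
 also have "\<dots> = (\<Sum>b'\<in>B. \<Sum>c\<in>?D. of_nat (N b' c) * atom 0 b')" by (rule sum.swap)
 also have "\<dots> = (\<Sum>b'\<in>B. \<Sum>b | b \<in> B \<and> b' \<in> down ?n b. of_nat (M b) * atom 0 b')"
 proof (rule sum.cong)
  fix b' assume b': "b' \<in> B"
  show "(\<Sum>c\<in>?D. of_nat (N b' c) * atom 0 b') = (\<Sum>b | b \<in> B \<and> b' \<in> down ?n b. of_nat (M b) * atom 0 b')"
   unfolding sum_distrib_right[symmetric] of_nat_sum[symmetric] row[OF b'] ..
 qed simp
 also have "\<dots> = (\<Sum>b\<in>B. \<Sum>b' | b' \<in> B \<and> b' \<in> down ?n b. of_nat (M b) * atom 0 b')"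
  by (rule sum.swap_restrict[OF finB finB])
 also have "\<dots> = (\<Sum>b\<in>B. of_nat (M b) * (\<Sum>b'\<in>down ?n b. atom 0 b'))"
 proof (rule sum.cong)
  fix b assume b: "b \<in> B"
  have "b' \<in> B" if "b' \<in> down ?n b" for b'
   using szd[of b b'] that b by (simp add: B_def down_def)
  then have "{b'. b' \<in> B \<and> b' \<in> down ?n b} = down ?n b" by blast
  then show "(\<Sum>b' | b' \<in> B \<and> b' \<in> down ?n b. of_nat (M b) * atom 0 b') = of_nat (M b) * (\<Sum>b'\<in>down ?n b. atom 0 b')"
   by (simp add: sum_distrib_left)
 qed simp
 also have "\<dots> = (\<Sum>b \<in> {b. length b = ?n \<and> sum_list b = ?S}. of_nat (M (cf b)) * (\<Sum>b'\<in>down ?n (cf b). atom 0 b'))"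
 proof (rule sum.reindex_bij_betw[symmetric])
  show "bij_betw cf {b. length b = ?n \<and> sum_list b = ?S} B"
  proof (rule bij_betw_byWitness[where f' = "of_fun ?n"])
   show "\<forall>b\<in>{b. length b = ?n \<and> sum_list b = ?S}. of_fun ?n (cf b) = b" by (simp add: of_fun_cf)
   show "\<forall>b\<in>B. cf (of_fun ?n b) = b" by (simp add: B_def cf_of_fun)
   show "cf ` {b. length b = ?n \<and> sum_list b = ?S} \<subseteq> B"
   proof
    fix b assume "b \<in> cf ` {b. length b = ?n \<and> sum_list b = ?S}"
    then obtain d where "b = cf d" "length d = ?n" "sum_list d = ?S" by blast
    then show "b \<in> B" using cf_on[of d] sz_cf[of d ?n] by (simp add: B_def)
   qed
   show "of_fun ?n ` B \<subseteq> {b. length b = ?n \<and> sum_list b = ?S}"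
   proof
    fix d assume "d \<in> of_fun ?n ` B"
    then obtain b where b: "d = of_fun ?n b" "on {0<..?n} b" "sz ?n b = ?S" by (auto simp: B_def)
    then show "d \<in> {b. length b = ?n \<and> sum_list b = ?S}"
     using sz_cf[OF length_of_fun, of ?n b] cf_of_fun[OF b(2)] length_of_fun by simp
   qed
  qed
 qed
 also have "\<dots> = (\<Sum>b \<in> {b. length b = ?n \<and> sum_list b = ?S}. of_nat (lrcoeff a lam b) * qpoly b)"
 proof (rule sum.cong)
  fix b assume "b \<in> {b. length b = ?n \<and> sum_list b = ?S}"
  then have len: "length b = ?n" by simp
  have "lrcoeff a lam b = M (cf b)" unfolding M_def N_def C_def by (rule lrcoeff_eq[OF len assms])
  then show "of_nat (M (cf b)) * (\<Sum>b'\<in>down ?n (cf b). atom 0 b') = of_nat (lrcoeff a lam b) * qpoly b"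
   using len by (simp add: qpoly_eq_sum_atoms)
 qed simp
 finally show ?thesis .
qed

end
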